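(* Consider the parameterized map $u\mapsto Cu+F(u,\alpha)$ on $\mathbb{R}^{N}$, $N=(m+1)nl$, with parameter $\alpha\in\mathbb{R}^p$, where the Taylor expansion of $F$ at $(0,0)$ starts with terms of degree $2$ in $(u,\alpha)$. Let $P$ be the invariant subspace of $C$ associated with a nonempty finite set $\Lambda$ of eigenvalues of $C$, $\dim P=c$. For the decomposition $\mathbb{R}^{N}=\mathbb{R}^c\oplus\mathbb{R}^{N-c}$ write $u=\Phi_c x+\Phi_{su}y$ with $x\in\mathbb{R}^c$, $y\in\mathbb{R}^{N-c}$, where $\Phi_c$ and $\Phi_{su}$ are formed by the generalized eigenvectors of $C$ associated with $\Lambda$ and $\sigma(C)\setminus\Lambda$, respectively. If the nonresonance conditions relative to $\Lambda$ are satisfied, then there exists a formal change of variables $(\bar x,\bar y)\mapsto(x,y)$ of the form $$x=\bar x+p(\bar x,\alpha),\qquad y=\bar y+h(\bar x,\alpha),$$ such that the map is equivalent to the following map in $\mathbb{R}^c\times\mathbb{R}^{N-c}$: $$\bar x\mapsto J\bar x+\sum_{j\ge 2}\frac{1}{j!}g_j^1(\bar x,\bar y,\alpha),\qquad \bar y\mapsto C_Q\bar y+\sum_{j\ge 2}\frac{1}{j!}g_j^2(\bar x,\bar y,\alpha),$$ where $g_j=(g_j^1,g_j^2)$ is computed by $g_j=\bar f_j-M_jU_j$, with $g_j^2(\bar x,0,\alpha)=0$ for all $j\ge 2$, and this map is in normal form relative to $P$. Moreover, if there exists a locally invariant manifold for the map $u\mapsto Cu+F(u,\alpha)$ tangent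 to $P$ at zero, then it satisfies $\bar y=0$, and the map on it is given by the $c$-dimensional map $$\bar x\mapsto J\bar x+\sum_{j\ge 2}\frac{1}{j!}g_j^1(\bar x,0,\alpha),$$ which is in normal form for maps.
   Context: Here $n,m,l\in\mathbb{Z}_+$, $C$ is a real $N\times N$ matrix and $F$ is smooth in $(u,\alpha)$. (The original map is $u\mapsto C(\alpha)u+F(u,\alpha)$ with $F(0,0)=0$, $\partial F/\partial u(0,0)=0$; one sets $C=C(0)$ and absorbs $(C(\alpha)-C(0))u$ into $F$. All objects may also depend on the fixed parameter $\varepsilon=1/m$, which is suppressed.) All power series and changes of variables are understood formally; $\alpha$ is treated as an additional variable that is mapped to itself. Let $c$ be the number of eigenvalues of $C$ in $\Lambda$, counted with multiplicity, and let $Q$ be the invariant subspace of $C$ associated with $\sigma(C)\setminus\Lambda$. (In the paper's setting $\Lambda=\{\lambda\in\sigma(C):|\lambda|=1\}$.) The columns of $\Phi_c$ are a basis of $P$ and the columns of $\Phi_{su}$ a basis of $Q$; $\Psi_c,\Psi_{su}$ are the dual bases (rows), so that $\Psi_c\Phi_c=I_c$, $\Psi_{su}\Phi_{su}=I_{N-c}$, $\Psi_c\Phi_{su}=0$, $\Psi_{su}\Phi_c=0$. The matrices $J$ and $C_Q$ are defined by $C\Phi_c=\Phi_cJ$, $C\Phi_{su}=\Phi_{su}C_Q$; their spectra are $\Lambda$ and $\sigma(C)\setminus\Lambda$. Nonresonance conditions relative to $\Lambda$: let $\bar\lambda=(\lambda_1,\dots,\lambda_{c+p})$ list the $c$ eigenvalues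 of $C$ in $\Lambda$ (with multiplicity) together with $p$ copies of $1$ (the eigenvalues coming from the parameter); then $\bar\lambda^q\neq\mu$ for all $\mu\in\sigma(C)\setminus\Lambda$ and all $q\in\mathbb{N}_0^{c+p}$ with $|q|\ge 2$. In coordinates the map is $x\mapsto Jx+\sum_{j\ge2}\frac1{j!}f_j^1(x,y,\alpha)$, $y\mapsto C_Qy+\sum_{j\ge2}\frac1{j!}f_j^2(x,y,\alpha)$, where $F=\sum_{j\ge2}\frac1{j!}F_j$ with $F_j$ homogeneous of degree $j$ in $(u,\alpha)$, $f_j^1=\Psi_cF_j(\Phi_cx+\Phi_{su}y,\alpha)$, $f_j^2=\Psi_{su}F_j(\Phi_cx+\Phi_{su}y,\alpha)$. For a normed space $X$, $V_j^{c+p}(X)$ is the space of homogeneous polynomials of degree $j$ in the $c+p$ real variables $(x,\alpha)$ with coefficients in $X$. Define $M_j(p,h)=(M_j^1p,M_j^2h)$ on $V_j^{c+p}(\mathbb{R}^c)\times V_j^{c+p}(\mathbb{R}^{N-c})$ by $$(M_j^1p)(x,\alpha)=p(Jx,\alpha)-Jp(x,\alpha),\qquad (M_j^2h)(x,\alpha)=h(Jx,\alpha)-C_Qh(x,\alpha).$$ For $i=1,2$ choose complements $\mathrm{Im}(M_j^i)^c$ of $\mathrm{Im}(M_j^i)$ and $\ker(M_j^i)^c$ of $\ker(M_j^i)$. Let $P_{I,j}=(P_{I,j}^1,P_{I,j}^2)$ be the projection onto $\mathrm{Im}(M_j^1)\times\mathrm{Im}(M_j^2)$ and $P_{K,j}$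 the projection onto $\ker(M_j^1)^c\times\ker(M_j^2)^c$ associated with these decompositions; $M_j^{-1}$ denotes the right inverse of $M_j$ with range in $\ker(M_j^1)^c\times\ker(M_j^2)^c$, i.e. $M_j^{-1}\circ P_{I,j}\circ M_j=P_{K,j}$. The normal form is computed recursively: at step $j\ge2$ one performs the change $(x,y)=(\hat x,\hat y)+\frac1{j!}U_j(\hat x,\alpha)$ with $U_j=(U_j^1,U_j^2)\in V_j^{c+p}(\mathbb{R}^c)\times V_j^{c+p}(\mathbb{R}^{N-c})$. Denoting by $\bar f_j=(\bar f_j^1,\bar f_j^2)$ the terms of order $j$ in $(x,y,\alpha)$ obtained after the steps $2,\dots,j-1$, the new terms of order $j$ are $g_j=\bar f_j-M_jU_j$, that is, $g_j^1(x,y,\alpha)=\bar f_j^1(x,y,\alpha)-[U_j^1(Jx,\alpha)-JU_j^1(x,\alpha)]$ and $g_j^2(x,y,\alpha)=\bar f_j^2(x,y,\alpha)-[U_j^2(Jx,\alpha)-C_QU_j^2(x,\alpha)]$. The map is in normal form relative to $P$ (and to the chosen projections) when $U_j(x,\alpha)=M_j^{-1}P_{I,j}\bar f_j(x,0,\alpha)$, so that $g_j(x,0,\alpha)=(I-P_{I,j})\bar f_j(x,0,\alpha)$, for all $j\ge2$. *)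

theory Defs
  imports
    "HOL-Analysis.Function_Topology"
    "HOL-Analysis.Derivative"
    "HOL-Library.Poly_Mapping"
    "HOL-Library.Multiset"
    "HOL-Library.Extended_Nat"
    "Jordan_Normal_Form.Spectral_Radius"
begin

text \<open>
  Vectors and matrices have explicit natural-number dimensions, so that the cases
  N - c = 0 and p = 0 are covered. The coordinates of a point are always listed in the order
  parameter first: (alpha, u), (alpha, x) or (alpha, x, y).
\<close>


subsection \<open>Polynomials in several variables\<close>

type_synonym mpoly = "(nat \<Rightarrow>\<^sub>0 nat) \<Rightarrow>\<^sub>0 real"

definition Const :: "real \<Rightarrow> mpoly" where
  "Const r = Poly_Mapping.single 0 r"

definition Var :: "nat \<Rightarrow> mpoly" where
  "Var i = Poly_Mapping.single (Poly_Mapping.single i 1) 1"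

definition mon_degree :: "(nat \<Rightarrow>\<^sub>0 nat) \<Rightarrow> nat" where
  "mon_degree m = (\<Sum>i\<in>Poly_Mapping.keys m. Poly_Mapping.lookup m i)"

definition hom_part :: "nat \<Rightarrow> mpoly \<Rightarrow> mpoly" where
  "hom_part j f = (\<Sum>m\<in>{m \<in> Poly_Mapping.keys f. mon_degree m = j}. Poly_Mapping.single m (Poly_Mapping.lookup f m))"

definition msubst :: "(nat \<Rightarrow> mpoly) \<Rightarrow> mpoly \<Rightarrow> mpoly" where
  "msubst \<sigma> f = (\<Sum>m\<in>Poly_Mapping.keys f. Const (Poly_Mapping.lookup f m) * (\<Prod>i\<in>Poly_Mapping.keys m. \<sigma> i ^ Poly_Mapping.lookup m i))"

text \<open>\<open>hom_polys d j n\<close> is the space \<open>V\<^sub>j\<^sup>d(\<real>\<^sup>n)\<close>; for d = p + c the variables are (alpha, x).\<close>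

definition hom_polys :: "nat \<Rightarrow> nat \<Rightarrow> nat \<Rightarrow> mpoly vec set" where
  "hom_polys d j n = {h \<in> carrier_vec n.
     \<forall>i<n. \<forall>m\<in>Poly_Mapping.keys (h $ i). mon_degree m = j \<and> Poly_Mapping.keys m \<subseteq> {..<d}}"

definition is_complement :: "mpoly vec set \<Rightarrow> mpoly vec set \<Rightarrow> nat \<Rightarrow> mpoly vec set \<Rightarrow> bool" where
  "is_complement S A n B \<longleftrightarrow>
     B \<subseteq> S \<and> 0\<^sub>v n \<in> B \<and>
     (\<forall>v\<in>B. \<forall>w\<in>B. v + w \<in> B) \<and> (\<forall>v\<in>B. \<forall>r. Const r \<cdot>\<^sub>v v \<in> B) \<and>
     A \<inter> B = {0\<^sub>v n} \<and> (\<forall>s\<in>S. \<exists>a\<in>A. \<exists>b\<in>B. s = a + b)"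

definition block_vars :: "nat \<Rightarrow> nat \<Rightarrow> mpoly vec" where
  "block_vars k n = vec n (\<lambda>i. Var (k + i))"

abbreviation x_vars :: "nat \<Rightarrow> nat \<Rightarrow> mpoly vec" where
  "x_vars p c \<equiv> block_vars p c"

abbreviation y_vars :: "nat \<Rightarrow> nat \<Rightarrow> nat \<Rightarrow> mpoly vec" where
  "y_vars p c q \<equiv> block_vars (p + c) q"

text \<open>Replace the block of variables starting at number p by the components of e.\<close>

definition subst_block :: "nat \<Rightarrow> mpoly vec \<Rightarrow> mpoly \<Rightarrow> mpoly" where
  "subst_block p e = msubst (\<lambda>v. if p \<le> v \<and> v < p + dim_vec e then e $ (v - p) else Var v)"

text \<open>The restriction f(x,0,alpha).\<close>

definition at_y0 :: "nat \<Rightarrow> nat \<Rightarrow> mpoly vec \<Rightarrow> mpoly vec" where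
  "at_y0 p c = map_vec (msubst (\<lambda>v. if v < p + c then Var v else 0))"


subsection \<open>Formal maps\<close>

text \<open>
  A formal power series map fixing the origin is the sequence of its homogeneous parts. A map with
  n components acts on the block of n variables following alpha, and alpha is mapped to itself.
\<close>

type_synonym formal_map = "nat \<Rightarrow> mpoly vec"

definition is_formal_map :: "nat \<Rightarrow> nat \<Rightarrow> formal_map \<Rightarrow> bool" where
  "is_formal_map d n f \<longleftrightarrow> f 0 = 0\<^sub>v n \<and> (\<forall>j. f j \<in> hom_polys d j n)"

text \<open>
  The composition f(g(.,alpha),alpha). Since g has no constant term, only the parts of order at
  most j of f and g contribute to order j.
\<close>

definition fcomp :: "nat \<Rightarrow> formal_map \<Rightarrow> formal_map \<Rightarrow> formal_map" where
  "fcomp p f g j = vec (dim_vec (f j)) (\<lambda>l. \<Sum>i\<le>j.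
     hom_part j (subst_block p (vec (dim_vec (g j)) (\<lambda>s. \<Sum>k\<le>j. g k $ s)) (f i $ l)))"

definition agree_upto :: "enat \<Rightarrow> formal_map \<Rightarrow> formal_map \<Rightarrow> bool" where
  "agree_upto r f g \<longleftrightarrow> (\<forall>k. enat k \<le> r \<longrightarrow> f k = g k)"

text \<open>The change of variables \<open>\<Theta>\<close> transforms the map f into the map g, up to order r.\<close>

definition conjugated :: "enat \<Rightarrow> nat \<Rightarrow> formal_map \<Rightarrow> formal_map \<Rightarrow> formal_map \<Rightarrow> bool" where
  "conjugated r p \<Theta> f g \<longleftrightarrow> agree_upto r (fcomp p f \<Theta>) (fcomp p \<Theta> g)"

text \<open>The map \<open>z \<mapsto> L z + (\<Sum>j\<ge>2. f\<^sub>j / j!)\<close>, with the linear part given as a vector of linear forms.\<close>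

definition map_series :: "mpoly vec \<Rightarrow> (nat \<Rightarrow> mpoly vec) \<Rightarrow> formal_map" where
  "map_series L f k =
     (if k = 0 then 0\<^sub>v (dim_vec L) else if k = 1 then L else Const (1 / fact k) \<cdot>\<^sub>v f k)"

definition lin_part :: "nat \<Rightarrow> nat \<Rightarrow> nat \<Rightarrow> real mat \<Rightarrow> real mat \<Rightarrow> mpoly vec" where
  "lin_part p c q J CQ =
     (map_mat Const J *\<^sub>v x_vars p c) @\<^sub>v (map_mat Const CQ *\<^sub>v y_vars p c q)"

text \<open>The identity plus a formal map e starting at order 2.\<close>

definition near_id :: "nat \<Rightarrow> nat \<Rightarrow> formal_map \<Rightarrow> formal_map" where
  "near_id p n e k =
     (if k = 0 then 0\<^sub>v n else if k = 1 then block_vars p n else e k)"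

text \<open>The change of variables \<open>z = z' + U\<^sub>j(x',alpha) / j!\<close> of step j.\<close>

definition nf_step :: "nat \<Rightarrow> nat \<Rightarrow> (nat \<Rightarrow> mpoly vec) \<Rightarrow> nat \<Rightarrow> formal_map" where
  "nf_step p n U j =
     near_id p n (\<lambda>k. if k = j then Const (1 / fact j) \<cdot>\<^sub>v U j else 0\<^sub>v n)"

text \<open>The composite of the steps 2, ..., j.\<close>

fun nf_steps :: "nat \<Rightarrow> nat \<Rightarrow> (nat \<Rightarrow> mpoly vec) \<Rightarrow> nat \<Rightarrow> formal_map" where
  "nf_steps p n U 0 = near_id p n (\<lambda>_. 0\<^sub>v n)"
| "nf_steps p n U (Suc j) =
     (if j = 0 then near_id p n (\<lambda>_. 0\<^sub>v n) else fcomp p (nf_steps p n U j) (nf_step p n U (Suc j)))"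


subsection \<open>Normal forms\<close>

text \<open>
  \<open>M_op p J A\<close> sends h to h(Jx,alpha) - A h(x,alpha): it is \<open>M\<^sub>j\<^sup>1\<close> for A = J and \<open>M\<^sub>j\<^sup>2\<close>
  for \<open>A = C\<^sub>Q\<close>.
\<close>

definition M_op :: "nat \<Rightarrow> real mat \<Rightarrow> real mat \<Rightarrow> mpoly vec \<Rightarrow> mpoly vec" where
  "M_op p J A h =
     map_vec (subst_block p (map_mat Const J *\<^sub>v x_vars p (dim_row J))) h - map_mat Const A *\<^sub>v h"

definition M_im :: "nat \<Rightarrow> real mat \<Rightarrow> real mat \<Rightarrow> nat \<Rightarrow> mpoly vec set" where
  "M_im p J A j = M_op p J A ` hom_polys (p + dim_row J) j (dim_row A)"

definition M_ker :: "nat \<Rightarrow> real mat \<Rightarrow> real mat \<Rightarrow> nat \<Rightarrow> mpoly vec set" where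
  "M_ker p J A j = {h \<in> hom_polys (p + dim_row J) j (dim_row A). M_op p J A h = 0\<^sub>v (dim_row A)}"

definition im_proj ::
    "nat \<Rightarrow> real mat \<Rightarrow> real mat \<Rightarrow> nat \<Rightarrow> mpoly vec set \<Rightarrow> mpoly vec \<Rightarrow> mpoly vec" where
  "im_proj p J A j ImC h = (THE a. a \<in> M_im p J A j \<and> h - a \<in> ImC)"

definition right_inv ::
    "nat \<Rightarrow> real mat \<Rightarrow> real mat \<Rightarrow> mpoly vec set \<Rightarrow> mpoly vec \<Rightarrow> mpoly vec" where
  "right_inv p J A KerC w = (THE h. h \<in> KerC \<and> M_op p J A h = w)"

definition M_pair ::
    "nat \<Rightarrow> nat \<Rightarrow> nat \<Rightarrow> real mat \<Rightarrow> real mat \<Rightarrow> mpoly vec \<Rightarrow> mpoly vec" where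
  "M_pair p c q J CQ h = M_op p J J (vec_first h c) @\<^sub>v M_op p J CQ (vec_last h q)"

definition P_I :: "nat \<Rightarrow> nat \<Rightarrow> nat \<Rightarrow> real mat \<Rightarrow> real mat \<Rightarrow> nat
    \<Rightarrow> mpoly vec set \<Rightarrow> mpoly vec set \<Rightarrow> mpoly vec \<Rightarrow> mpoly vec" where
  "P_I p c q J CQ j ImC1 ImC2 h =
     im_proj p J J j ImC1 (vec_first h c) @\<^sub>v im_proj p J CQ j ImC2 (vec_last h q)"

definition M_inv :: "nat \<Rightarrow> nat \<Rightarrow> nat \<Rightarrow> real mat \<Rightarrow> real mat
    \<Rightarrow> mpoly vec set \<Rightarrow> mpoly vec set \<Rightarrow> mpoly vec \<Rightarrow> mpoly vec" where
  "M_inv p c q J CQ KerC1 KerC2 w =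
     right_inv p J J KerC1 (vec_first w c) @\<^sub>v right_inv p J CQ KerC2 (vec_last w q)"

text \<open>
  The recursive computation of the normal form of the map T in the variables (x,y), carried out up
  to order r: \<open>G (j - 1)\<close> is the map obtained after the steps 2, ..., j - 1, so that \<open>G j\<close> is
  conjugated to it by step j, and \<open>fbar j / j!\<close> is its part of order j. The map with terms
  \<open>g j\<close> is then in normal form relative to the invariant subspace y = 0 of the linear part. The
  case q = 0 (no y variables) is the normal form for maps in the variables x alone.
\<close>

definition normal_form :: "enat \<Rightarrow> nat \<Rightarrow> nat \<Rightarrow> nat \<Rightarrow> real mat \<Rightarrow> real mat
    \<Rightarrow> (nat \<Rightarrow> mpoly vec set) \<Rightarrow> (nat \<Rightarrow> mpoly vec set)
    \<Rightarrow> (nat \<Rightarrow> mpoly vec set) \<Rightarrow> (nat \<Rightarrow> mpoly vec set)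
    \<Rightarrow> formal_map \<Rightarrow> (nat \<Rightarrow> mpoly vec) \<Rightarrow> (nat \<Rightarrow> mpoly vec) \<Rightarrow> (nat \<Rightarrow> mpoly vec) \<Rightarrow> bool" where
  "normal_form r p c q J CQ ImC1 KerC1 ImC2 KerC2 T U fbar g \<longleftrightarrow>
     (\<exists>G. G 1 = T \<and>
       (\<forall>j. 2 \<le> j \<and> enat j \<le> r \<longrightarrow>
          U j \<in> hom_polys (p + c) j (c + q) \<and>
          is_formal_map (p + c + q) (c + q) (G j) \<and>
          conjugated r p (nf_step p (c + q) U j) (G (j - 1)) (G j) \<and>
          fbar j = Const (fact j) \<cdot>\<^sub>v G (j - 1) j \<and>
          g j = fbar j - M_pair p c q J CQ (U j) \<and>
          U j = M_inv p c q J CQ (KerC1 j) (KerC2 j)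
                  (P_I p c q J CQ j (ImC1 j) (ImC2 j) (at_y0 p c (fbar j))) \<and>
          at_y0 p c (g j) = at_y0 p c (fbar j)
                  - P_I p c q J CQ j (ImC1 j) (ImC2 j) (at_y0 p c (fbar j))))"


subsection \<open>Spectral data\<close>

abbreviation cmat :: "real mat \<Rightarrow> complex mat" where
  "cmat \<equiv> map_mat complex_of_real"

text \<open>The real vectors that are sums of generalized eigenvectors for eigenvalues in S.\<close>

definition inv_subspace :: "nat \<Rightarrow> real mat \<Rightarrow> complex set \<Rightarrow> real vec set" where
  "inv_subspace N C S = {u \<in> carrier_vec N. \<exists>v.
     (\<forall>\<kappa>\<in>S. v \<kappa> \<in> carrier_vec N \<and> ((cmat C - \<kappa> \<cdot>\<^sub>m 1\<^sub>m N) ^\<^sub>m N) *\<^sub>v v \<kappa> = 0\<^sub>v N) \<and>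
     (\<forall>i<N. complex_of_real (u $ i) = (\<Sum>\<kappa>\<in>S. v \<kappa> $ i))}"

definition cols_basis :: "nat \<Rightarrow> real mat \<Rightarrow> real vec set \<Rightarrow> bool" where
  "cols_basis N \<Phi> S \<longleftrightarrow> distinct (cols \<Phi>) \<and>
     \<not> LinearCombinations.module.lin_dep class_ring (module_vec TYPE(real) N) (set (cols \<Phi>)) \<and>
     LinearCombinations.module.span class_ring (module_vec TYPE(real) N) (set (cols \<Phi>)) = S"

abbreviation alg_mult :: "real mat \<Rightarrow> complex \<Rightarrow> nat" where
  "alg_mult C \<kappa> \<equiv> order \<kappa> (char_poly (cmat C))"

text \<open>The list \<open>ls\<close> consists of the eigenvalues in \<open>\<Lambda>\<close> with multiplicity and p copies of 1.\<close>

definition nonresonant :: "real mat \<Rightarrow> complex set \<Rightarrow> nat \<Rightarrow> bool" where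
  "nonresonant C \<Lambda> p \<longleftrightarrow> (\<forall>ls (k :: nat list) \<mu>.
     mset ls = (\<Sum>\<kappa>\<in>\<Lambda>. replicate_mset (alg_mult C \<kappa>) \<kappa>) + replicate_mset p 1 \<longrightarrow>
     \<mu> \<in> spectrum (cmat C) - \<Lambda> \<longrightarrow> length k = length ls \<longrightarrow> sum_list k \<ge> 2 \<longrightarrow>
     (\<Prod>i<length ls. ls ! i ^ k ! i) \<noteq> \<mu>)"


subsection \<open>Differentiable functions and their Taylor series\<close>

definition pdiff :: "nat \<Rightarrow> nat \<Rightarrow> (real vec \<Rightarrow> real) \<Rightarrow> real vec \<Rightarrow> real" where
  "pdiff d i f z = deriv (\<lambda>t. f (z + t \<cdot>\<^sub>v unit_vec d i)) 0"

text \<open>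
  Points of \<open>\<real>\<^sup>d\<close> carry the topology of the product space \<open>nat \<Rightarrow> real\<close> through \<open>vec d\<close>, which
  only reads the first d coordinates.
\<close>

primrec C_nat_on :: "nat \<Rightarrow> real vec set \<Rightarrow> nat \<Rightarrow> (real vec \<Rightarrow> real) \<Rightarrow> bool" where
  "C_nat_on d S 0 f \<longleftrightarrow> continuous_on {a. vec d a \<in> S} (\<lambda>a. f (vec d a))"
| "C_nat_on d S (Suc k) f \<longleftrightarrow> continuous_on {a. vec d a \<in> S} (\<lambda>a. f (vec d a)) \<and>
     (\<forall>i<d. (\<forall>z\<in>S. (\<lambda>t. f (z + t \<cdot>\<^sub>v unit_vec d i)) field_differentiable (at 0)) \<and>
        C_nat_on d S k (pdiff d i f))"

text \<open>Class \<open>C\<^sup>r\<close> on an open subset S of \<open>\<real>\<^sup>d\<close>, for maps into \<open>\<real>\<^sup>n\<close>.\<close>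

definition C_on :: "nat \<Rightarrow> nat \<Rightarrow> real vec set \<Rightarrow> enat \<Rightarrow> (real vec \<Rightarrow> real vec) \<Rightarrow> bool" where
  "C_on d n S r f \<longleftrightarrow> (\<forall>z\<in>S. f z \<in> carrier_vec n) \<and>
     (\<forall>i<n. \<forall>k. enat k \<le> r \<longrightarrow> C_nat_on d S k (\<lambda>z. f z $ i))"

text \<open>
  The j-th differential of f at 0 on the diagonal, \<open>z \<mapsto> D\<^sup>jf(0)(z,...,z)\<close>, as a polynomial; thus
  the j-th Taylor term is this divided by j!.
\<close>

definition diff_form :: "nat \<Rightarrow> nat \<Rightarrow> (real vec \<Rightarrow> real vec) \<Rightarrow> nat \<Rightarrow> mpoly vec" where
  "diff_form d n f j = vec n (\<lambda>l. \<Sum>is\<in>{is. length is = j \<and> set is \<subseteq> {..<d}}.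
     Const (foldr (pdiff d) is (\<lambda>z. f z $ l) (0\<^sub>v d)) * prod_list (map Var is))"

definition taylor :: "nat \<Rightarrow> nat \<Rightarrow> (real vec \<Rightarrow> real vec) \<Rightarrow> formal_map" where
  "taylor d n f j = Const (1 / fact j) \<cdot>\<^sub>v diff_form d n f j"

text \<open>F as a function of the concatenated variable (alpha, u).\<close>

definition joint :: "nat \<Rightarrow> nat \<Rightarrow> (real vec \<Rightarrow> real vec \<Rightarrow> real vec) \<Rightarrow> real vec \<Rightarrow> real vec" where
  "joint p N F z = F (vec_last z N) (vec_first z p)"

text \<open>
  The terms \<open>f\<^sub>j = (\<Psi>\<^sub>c F\<^sub>j(\<Phi>\<^sub>c x + \<Phi>\<^sub>s\<^sub>u y, alpha), \<Psi>\<^sub>s\<^sub>u F\<^sub>j(\<Phi>\<^sub>c x + \<Phi>\<^sub>s\<^sub>u y, alpha))\<close>.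
\<close>

definition coord_terms :: "nat \<Rightarrow> nat \<Rightarrow> nat \<Rightarrow> real mat \<Rightarrow> real mat \<Rightarrow> real mat \<Rightarrow> real mat
    \<Rightarrow> (real vec \<Rightarrow> real vec \<Rightarrow> real vec) \<Rightarrow> nat \<Rightarrow> mpoly vec" where
  "coord_terms p c N \<Phi>c \<Phi>su \<Psi>c \<Psi>su F j =
     (let Fj = map_vec (subst_block p (map_mat Const \<Phi>c *\<^sub>v x_vars p c
                                       + map_mat Const \<Phi>su *\<^sub>v y_vars p c (N - c)))
                 (diff_form (p + N) N (joint p N F) j)
      in (map_mat Const \<Psi>c *\<^sub>v Fj) @\<^sub>v (map_mat Const \<Psi>su *\<^sub>v Fj))"


subsection \<open>Locally invariant manifolds\<close>

definition box0 :: "nat \<Rightarrow> real \<Rightarrow> real vec set" where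
  "box0 d \<epsilon> = {z \<in> carrier_vec d. \<forall>i<d. \<bar>z $ i\<bar> < \<epsilon>}"

text \<open>A set W of pairs (u, alpha) is locally invariant for \<open>u \<mapsto> T u alpha\<close> near (0,0).\<close>

definition locally_invariant ::
    "nat \<Rightarrow> nat \<Rightarrow> (real vec \<Rightarrow> real vec \<Rightarrow> real vec) \<Rightarrow> (real vec \<times> real vec) set \<Rightarrow> bool" where
  "locally_invariant N p T W \<longleftrightarrow> (\<exists>\<rho>>0. \<forall>\<alpha>\<in>box0 p \<rho>. \<forall>u\<in>box0 N \<rho>.
     (u, \<alpha>) \<in> W \<and> T u \<alpha> \<in> box0 N \<rho> \<longrightarrow> (T u \<alpha>, \<alpha>) \<in> W)"

text \<open>
  Near (0,0), W is the graph \<open>u = \<Phi>\<^sub>c x + \<Phi>\<^sub>s\<^sub>u w(x,alpha)\<close> of a \<open>C\<^sup>r\<close> function w vanishing at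
  (0,0) and with \<open>\<partial>w/\<partial>x(0,0) = 0\<close>; i.e. W is a \<open>C\<^sup>r\<close> manifold whose slice alpha = 0 is tangent at
  zero to the column space of \<open>\<Phi>\<^sub>c\<close>.
\<close>

definition tangent_manifold :: "enat \<Rightarrow> nat \<Rightarrow> nat \<Rightarrow> nat \<Rightarrow> real mat \<Rightarrow> real mat
    \<Rightarrow> (real vec \<times> real vec) set \<Rightarrow> (real vec \<Rightarrow> real vec) \<Rightarrow> bool" where
  "tangent_manifold r N p c \<Phi>c \<Phi>su W w \<longleftrightarrow>
     w (0\<^sub>v (p + c)) = 0\<^sub>v (N - c) \<and>
     (\<forall>l<N - c. \<forall>i<c. pdiff (p + c) (p + i) (\<lambda>z. w z $ l) (0\<^sub>v (p + c)) = 0) \<and>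
     (\<exists>\<delta>>0. C_on (p + c) (N - c) (box0 (p + c) \<delta>) r w \<and>
       (\<exists>\<rho>>0. \<forall>\<alpha>\<in>box0 p \<rho>. \<forall>u\<in>box0 N \<rho>.
          (u, \<alpha>) \<in> W \<longleftrightarrow>
          (\<exists>x\<in>carrier_vec c. \<alpha> @\<^sub>v x \<in> box0 (p + c) \<delta> \<and>
             u = \<Phi>c *\<^sub>v x + \<Phi>su *\<^sub>v w (\<alpha> @\<^sub>v x))))"

text \<open>
  In the coordinates \<open>x = x' + P(x',alpha)\<close>, \<open>y = y' + H(x',alpha)\<close> the formal graph y = w(x,alpha)
  is \<open>y' = w(x' + P(x',alpha),alpha) - H(x',alpha)\<close>. It satisfies y' = 0 up to order r if the right
  hand side vanishes up to that order.
\<close>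

definition graph_is_y0 :: "enat \<Rightarrow> nat \<Rightarrow> nat \<Rightarrow> formal_map \<Rightarrow> formal_map \<Rightarrow> formal_map \<Rightarrow> bool" where
  "graph_is_y0 r p c w P H \<longleftrightarrow> agree_upto r (fcomp p w (near_id p c P)) H"

text \<open>The x-component of the map \<open>u \<mapsto> T u alpha\<close> on this graph, as a function of (alpha, x).\<close>

definition map_on_graph :: "nat \<Rightarrow> nat \<Rightarrow> real mat \<Rightarrow> real mat \<Rightarrow> real mat
    \<Rightarrow> (real vec \<Rightarrow> real vec \<Rightarrow> real vec) \<Rightarrow> (real vec \<Rightarrow> real vec) \<Rightarrow> real vec \<Rightarrow> real vec" where
  "map_on_graph p c \<Phi>c \<Phi>su \<Psi>c T w z =
     \<Psi>c *\<^sub>v T (\<Phi>c *\<^sub>v vec_last z c + \<Phi>su *\<^sub>v w z) (vec_first z p)"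

end

theory Submission
  imports Defs "HOL-Library.Landau_Symbols"
begin

text \<open>
  The generalized eigenvectors of the operator \<open>h \<mapsto> h(J x, alpha)\<close> on polynomials of degree j are
  products of j generalized eigenvectors of J and of the identity on the parameters, so its
  eigenvalues are products of j elements of \<open>\<Lambda> \<union> {1}\<close>. By nonresonance these differ from the
  eigenvalues of \<open>C\<^sub>Q\<close>; as \<open>h \<mapsto> h(J x, alpha)\<close> and \<open>h \<mapsto> C\<^sub>Q h\<close> commute, their difference
  \<open>M\<^sub>j\<^sup>2\<close> is bijective. Hence every step removes \<open>g\<^sub>j\<^sup>2(x,0,alpha)\<close>. The order j part of the composed
  change of variables is fixed from step j on, which gives the formal limit.

  For an invariant graph, the formal series \<open>\<omega>\<close> of y over x in the new variables satisfies an
  invariance equation whose lowest order part \<open>\<omega>\<^sub>k\<close> lies in the kernel of \<open>M\<^sub>k\<^sup>2\<close>, since the new map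
  leaves y = 0 invariant; by induction \<open>\<omega>\<close> vanishes. For k = 1 tangency leaves only the variables
  alpha, on which the kernel is trivial because 1 is not an eigenvalue of \<open>C\<^sub>Q\<close> when p > 0. The
  invariance equation itself is obtained from the functional one by comparing Taylor polynomials along
  rays \<open>t \<mapsto> t a\<close>, which requires only \<open>C\<^sup>r\<close>.
\<close>

text \<open>The operators are treated without matrices or dimension counts: polynomials become
  complex functions of the evaluation point, and "sum of generalized eigenvectors" is replaced by
  "annihilated by a finite product of factors T - \<sigma>", a property that passes through sums,
  products and intertwining maps.

  Substitution exists only for polynomials, so identities between series are proved for truncations
  modulo terms of order above k. The analytic input fits this scheme, because two polynomials that
  approximate one function along all rays agree modulo that order.

  Two obstacles shape the end. The operator M_j^1 is not invertible, so a fresh normalization of the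
  reduced map need not give the terms g_j^1(x,0,alpha); its steps have to be the x-parts of the
  original steps, which make sense on their own since every step depends on (x,alpha) alone. And the
  series of a manifold of class C^r carries information only up to order r, whereas a step is a
  conjugation to all orders; the reduced map is therefore transformed exactly and compared with the
  restricted normal form up to order r.\<close>

unbundle no vec_syntax

abbreviation keys where "keys \<equiv> Poly_Mapping.keys"
abbreviation lookup where "lookup \<equiv> Poly_Mapping.lookup"
abbreviation single where "single \<equiv> Poly_Mapping.single"

subsection \<open>Substitution and evaluation\<close>

definition mon :: "(nat \<Rightarrow> 'a::comm_ring_1) \<Rightarrow> (nat \<Rightarrow>\<^sub>0 nat) \<Rightarrow> 'a" where
  "mon \<sigma> m = (\<Prod>i\<in>keys m. \<sigma> i ^ lookup m i)"

text \<open>The value ring and the embedding c of the coefficients are parameters, so that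
  evaluation at a real point (\<open>peval\<close>) and substitution of polynomials
  (\<open>msubst\<close>) share one calculus.\<close>

definition gsubst :: "(real \<Rightarrow> 'a::comm_ring_1) \<Rightarrow> (nat \<Rightarrow> 'a) \<Rightarrow> mpoly \<Rightarrow> 'a" where
  "gsubst c \<sigma> f = (\<Sum>m\<in>keys f. c (lookup f m) * mon \<sigma> m)"

definition ring_map :: "(real \<Rightarrow> 'a::comm_ring_1) \<Rightarrow> bool" where
  "ring_map c \<longleftrightarrow> c 0 = 0 \<and> c 1 = 1 \<and> (\<forall>a b. c (a + b) = c a + c b) \<and> (\<forall>a b. c (a * b) = c a * c b)"

abbreviation peval :: "(nat \<Rightarrow> real) \<Rightarrow> mpoly \<Rightarrow> real" where
  "peval \<equiv> gsubst (\<lambda>r. r)"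

lemma sum_single: "f = (\<Sum>m\<in>keys f. single m (lookup f m))"
proof (rule poly_mapping_eqI)
  fix k
  show "lookup f k = lookup (\<Sum>m\<in>keys f. single m (lookup f m)) k"
    by (cases "k \<in> keys f")
      (auto simp: lookup_sum lookup_single when_def in_keys_iff sum.delta')
qed

lemma mon_superset:
  assumes "finite A" "keys m \<subseteq> A"
  shows "mon \<sigma> m = (\<Prod>i\<in>A. \<sigma> i ^ lookup m i)"
  unfolding mon_def by (rule prod.mono_neutral_left) (use assms in \<open>auto simp: in_keys_iff\<close>)

lemma mon_zero [simp]: "mon \<sigma> 0 = 1"
  by (simp add: mon_def)

lemma mon_add: "mon \<sigma> (m + n) = mon \<sigma> m * mon \<sigma> n"
proof -
  let ?A = "keys m \<union> keys n"
  have "mon \<sigma> (m + n) = (\<Prod>i\<in>?A. \<sigma> i ^ lookup (m + n) i)"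
    by (rule mon_superset) (auto simp: keys_add)
  also have "\<dots> = (\<Prod>i\<in>?A. \<sigma> i ^ lookup m i) * (\<Prod>i\<in>?A. \<sigma> i ^ lookup n i)"
    by (simp add: lookup_add power_add prod.distrib)
  also have "\<dots> = mon \<sigma> m * mon \<sigma> n"
    using mon_superset[of ?A m \<sigma>] mon_superset[of ?A n \<sigma>] by simp
  finally show ?thesis .
qed

lemma mon_single: "mon \<sigma> (single i k) = \<sigma> i ^ k"
  by (cases "k = 0") (auto simp: mon_def)

lemma ring_mapD:
  assumes "ring_map c"
  shows "c 0 = 0" "c 1 = 1" "c (a + b) = c a + c b" "c (a * b) = c a * c b"
  using assms by (auto simp: ring_map_def)

lemma ring_map_id [simp]: "ring_map (\<lambda>r. r)"
  by (simp add: ring_map_def)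

lemma ring_map_Const [simp]: "ring_map Const"
  by (simp add: ring_map_def Const_def single_add mult_single)

lemma Const_0 [simp]: "Const 0 = 0" and Const_1 [simp]: "Const 1 = 1"
  by (simp_all add: Const_def)

lemma Const_add: "Const (a + b) = Const a + Const b"
  and Const_mult: "Const (a * b) = Const a * Const b"
  and Const_minus: "Const (- a) = - Const a"
  by (simp_all add: Const_def single_add mult_single single_uminus)

lemma Const_sum: "Const (sum g A) = (\<Sum>x\<in>A. Const (g x))"
  by (induction A rule: infinite_finite_induct) (auto simp: Const_add)

lemma gsubst_superset:
  assumes "ring_map c" "finite A" "keys f \<subseteq> A"
  shows "gsubst c \<sigma> f = (\<Sum>m\<in>A. c (lookup f m) * mon \<sigma> m)"
  unfolding gsubst_def by (rule sum.mono_neutral_left) (use assms in \<open>auto simp: in_keys_iff ring_mapD\<close>)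

lemma gsubst_add:
  assumes "ring_map c"
  shows "gsubst c \<sigma> (f + g) = gsubst c \<sigma> f + gsubst c \<sigma> g"
proof -
  let ?A = "keys f \<union> keys g"
  have "gsubst c \<sigma> (f + g) = (\<Sum>m\<in>?A. c (lookup (f + g) m) * mon \<sigma> m)"
    by (rule gsubst_superset) (auto simp: keys_add assms)
  then show ?thesis
    using gsubst_superset[OF assms, of ?A f \<sigma>] gsubst_superset[OF assms, of ?A g \<sigma>]
    by (simp add: lookup_add ring_mapD[OF assms] algebra_simps sum.distrib)
qed

lemma gsubst_zero [simp]: "gsubst c \<sigma> 0 = 0"
  by (simp add: gsubst_def)

lemma gsubst_single:
  assumes "ring_map c"
  shows "gsubst c \<sigma> (single m r) = c r * mon \<sigma> m"
  by (cases "r = 0") (auto simp: gsubst_def ring_mapD[OF assms])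

lemma gsubst_sum:
  assumes "ring_map c"
  shows "gsubst c \<sigma> (sum g A) = (\<Sum>x\<in>A. gsubst c \<sigma> (g x))"
  by (induction A rule: infinite_finite_induct) (auto simp: gsubst_add[OF assms])

lemma gsubst_mult:
  assumes "ring_map c"
  shows "gsubst c \<sigma> (f * g) = gsubst c \<sigma> f * gsubst c \<sigma> g"
proof -
  have "f * g = (\<Sum>m\<in>keys f. \<Sum>n\<in>keys g. single (m + n) (lookup f m * lookup g n))"
    by (subst (1) sum_single[of f], subst (1) sum_single[of g])
      (simp add: sum_product mult_single)
  then have "gsubst c \<sigma> (f * g) =
      (\<Sum>m\<in>keys f. \<Sum>n\<in>keys g. c (lookup f m * lookup g n) * mon \<sigma> (m + n))"
    by (simp add: gsubst_sum[OF assms] gsubst_single[OF assms])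
  also have "\<dots> = gsubst c \<sigma> f * gsubst c \<sigma> g"
    by (simp add: gsubst_def sum_product mon_add ring_mapD[OF assms] algebra_simps)
  finally show ?thesis .
qed

lemma gsubst_one: "ring_map c \<Longrightarrow> gsubst c \<sigma> 1 = 1"
  by (simp flip: single_one add: gsubst_single ring_mapD)

lemma gsubst_Const: "ring_map c \<Longrightarrow> gsubst c \<sigma> (Const r) = c r"
  by (simp add: Const_def gsubst_single)

lemma gsubst_Var: "ring_map c \<Longrightarrow> gsubst c \<sigma> (Var i) = \<sigma> i"
  by (simp add: Var_def gsubst_single mon_single ring_mapD)

lemma gsubst_uminus: "ring_map c \<Longrightarrow> gsubst c \<sigma> (- f) = - gsubst c \<sigma> f"
  using gsubst_add[of c \<sigma> f "- f"] by (simp add: minus_unique)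

lemma gsubst_diff: "ring_map c \<Longrightarrow> gsubst c \<sigma> (f - g) = gsubst c \<sigma> f - gsubst c \<sigma> g"
  using gsubst_add[of c \<sigma> f "- g"] by (simp add: gsubst_uminus)

lemma gsubst_power: "ring_map c \<Longrightarrow> gsubst c \<sigma> (f ^ k) = gsubst c \<sigma> f ^ k"
  by (induction k) (auto simp: gsubst_one gsubst_mult)

lemma gsubst_prod: "ring_map c \<Longrightarrow> gsubst c \<sigma> (prod g A) = (\<Prod>x\<in>A. gsubst c \<sigma> (g x))"
  by (induction A rule: infinite_finite_induct) (auto simp: gsubst_mult gsubst_one)

lemmas gsubst_simps = gsubst_add gsubst_mult gsubst_one gsubst_Const gsubst_Var gsubst_uminus
  gsubst_diff gsubst_power gsubst_sum gsubst_prod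

lemma msubst_eq_gsubst: "msubst = gsubst Const"
  by (intro ext) (simp add: msubst_def gsubst_def mon_def)

lemmas peval_simps [simp] = gsubst_simps[OF ring_map_id]
lemmas msubst_simps [simp] = gsubst_simps[OF ring_map_Const, folded msubst_eq_gsubst]

lemma msubst_zero [simp]: "msubst \<sigma> 0 = 0"
  by (simp add: msubst_eq_gsubst)

section \<open>Polynomials as expressions in the variables\<close>

lemma prod_Var: "single m 1 = mon Var m"
proof -
  have 1: "single (sum g A) (1::real) = (\<Prod>i\<in>A. single (g i) 1)"
    for g :: "nat \<Rightarrow> (nat \<Rightarrow>\<^sub>0 nat)" and A
  proof (induction A rule: infinite_finite_induct)
    case (insert x F)
    then show ?case using mult_single[of "g x" "1::real" "sum g F" 1] by simp
  qed auto
  have 2: "single (single i k) (1::real) = Var i ^ k" for i k :: nat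
  proof (induction k)
    case (Suc k)
    then show ?case
      using mult_single[of "single i 1" "1::real" "single i k" 1] by (simp add: Var_def flip: single_add)
  qed simp
  show ?thesis
    by (subst sum_single[of m]) (simp only: 1 2 mon_def)
qed

lemma mpoly_expand: "f = (\<Sum>m\<in>keys f. Const (lookup f m) * mon Var m)"
proof -
  have "single m r = Const r * mon Var m" for m r
    by (simp add: prod_Var[symmetric] Const_def mult_single)
  then show ?thesis using sum_single[of f] by simp
qed

text \<open>Reduces composition laws of substitution to constants and variables, and later an
  asymptotic estimate for \<open>peval\<close> to sums and products.\<close>

lemma mpoly_induct [case_names Const Var add mult]:
  assumes "\<And>r. P (Const r)" and "\<And>i. P (Var i)"
    and add: "\<And>f g. P f \<Longrightarrow> P g \<Longrightarrow> P (f + g)" and mult: "\<And>f g. P f \<Longrightarrow> P g \<Longrightarrow> P (f * g)"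
  shows "P f"
proof -
  have P0: "P 0" and P1: "P 1"
    using assms(1)[of 0] assms(1)[of 1] by auto
  have pow: "P (g ^ k)" if "P g" for g k
    by (induction k) (auto simp: P1 mult that)
  have "P (mon Var m)" for m
  proof -
    have "P (\<Prod>i\<in>A. Var i ^ lookup m i)" for A
      by (induction A rule: infinite_finite_induct) (auto simp: P1 mult assms(2) pow)
    then show ?thesis by (simp add: mon_def)
  qed
  then have "P (\<Sum>m\<in>A. Const (lookup f m) * mon Var m)" for A
    by (induction A rule: infinite_finite_induct) (auto simp: P0 add mult assms(1))
  then show ?thesis using mpoly_expand[of f] by metis
qed

lemma gsubst_msubst:
  assumes "ring_map c"
  shows "gsubst c \<tau> (msubst \<sigma> f) = gsubst c (\<lambda>v. gsubst c \<tau> (\<sigma> v)) f"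
  by (induction f rule: mpoly_induct) (auto simp: gsubst_simps[OF assms])

lemmas peval_msubst = gsubst_msubst[OF ring_map_id]
lemmas msubst_msubst = gsubst_msubst[OF ring_map_Const, folded msubst_eq_gsubst]

lemma msubst_Var [simp]: "msubst Var f = f"
  by (induction f rule: mpoly_induct) auto

lemma mon_cong: "(\<And>v. v \<in> keys m \<Longrightarrow> \<sigma> v = \<tau> v) \<Longrightarrow> mon \<sigma> m = mon \<tau> m"
  by (simp add: mon_def)

lemma gsubst_cong:
  assumes "\<And>m v. m \<in> keys f \<Longrightarrow> v \<in> keys m \<Longrightarrow> \<sigma> v = \<tau> v"
  shows "gsubst c \<sigma> f = gsubst c \<tau> f"
proof -
  have "mon \<sigma> m = mon \<tau> m" if "m \<in> keys f" for m
    using that assms by (intro mon_cong)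
  then show ?thesis by (simp add: gsubst_def)
qed

lemmas msubst_cong = gsubst_cong[of _ _ _ Const, folded msubst_eq_gsubst]

text \<open>Distinct monomials are distinct characters of the multiplicative monoid of points, so they
  are linearly independent by the argument of Dedekind.\<close>

lemma peval_eq_0_imp:
  assumes "\<And>a. peval a f = 0"
  shows "f = 0"
proof -
  have char: "mon (\<lambda>i. a i * b i) m = mon a m * mon b m" for a b :: "nat \<Rightarrow> real" and m
    by (simp add: mon_def power_mult_distrib prod.distrib)
  \<comment> \<open>Take 2 in a coordinate where the exponents differ and 1 elsewhere: the monomials
    become distinct powers of 2.\<close>
  have sep: "\<exists>a::nat \<Rightarrow> real. mon a m \<noteq> mon a n" if "m \<noteq> n" for m n
  proof -
    from that obtain i where i: "lookup m i \<noteq> lookup n i"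
      by (metis poly_mapping_eqI)
    have "mon (\<lambda>j. if j = i then 2 else 1 :: real) k = 2 ^ lookup k i" for k
    proof -
      have "mon (\<lambda>j. if j = i then 2 else 1 :: real) k = (\<Prod>j\<in>insert i (keys k). (if j = i then 2 else 1) ^ lookup k j)"
        by (rule mon_superset) auto
      also have "\<dots> = (\<Prod>j\<in>insert i (keys k). if j = i then 2 ^ lookup k i else 1)"
        by (rule prod.cong) auto
      also have "\<dots> = 2 ^ lookup k i" by (subst prod.delta) auto
      finally show ?thesis .
    qed
    then have "mon (\<lambda>j. if j = i then 2 else 1 :: real) m \<noteq> mon (\<lambda>j. if j = i then 2 else 1) n"
      using i by simp
    then show ?thesis by blast
  qed
  have indep: "\<forall>m\<in>K. c m = 0"
    if "finite K" "\<And>a. (\<Sum>m\<in>K. c m * mon a m) = 0" for K and c :: "_ \<Rightarrow> real"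
    using that
  proof (induction K arbitrary: c rule: finite_induct)
    case (insert m0 K)
    \<comment> \<open>Replacing b by its pointwise product with a multiplies each summand by
      \<open>mon a m\<close>; subtracting \<open>mon a m0\<close> times the original relation
      removes m0.\<close>
    have *: "\<forall>m\<in>K. c m * (mon a m - mon a m0) = 0" for a
    proof (rule insert.IH)
      fix b
      have "c m0 * mon b m0 + (\<Sum>m\<in>K. c m * mon b m) = 0"
        using insert.prems[of b] insert.hyps by simp
      moreover have "c m0 * (mon a m0 * mon b m0) + (\<Sum>m\<in>K. c m * (mon a m * mon b m)) = 0"
        using insert.prems[of "\<lambda>i. a i * b i"] insert.hyps by (simp add: char)
      ultimately have "(\<Sum>m\<in>K. c m * (mon a m * mon b m)) = - (c m0 * (mon a m0 * mon b m0))"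
        and "(\<Sum>m\<in>K. c m * mon b m) = - (c m0 * mon b m0)"
        by linarith+
      then have "(\<Sum>m\<in>K. c m * (mon a m * mon b m)) = mon a m0 * (\<Sum>m\<in>K. c m * mon b m)"
        by simp
      then show "(\<Sum>m\<in>K. c m * (mon a m - mon a m0) * mon b m) = 0"
        by (simp add: algebra_simps sum_subtractf sum_distrib_left)
    qed
    have K: "\<forall>m\<in>K. c m = 0"
    proof
      fix m assume m: "m \<in> K"
      with insert.hyps have "m \<noteq> m0" by auto
      from sep[OF this] obtain a :: "nat \<Rightarrow> real" where "mon a m \<noteq> mon a m0" by blast
      with * m show "c m = 0" by fastforce
    qed
    have "mon (\<lambda>_. 1::real) m0 = 1" by (simp add: mon_def)
    then have "c m0 = 0" using insert.prems[of "\<lambda>_. 1"] insert.hyps K by simp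
    with K show ?case by simp
  qed simp
  have "\<forall>m\<in>keys f. lookup f m = 0"
    using assms by (intro indep) (simp_all add: gsubst_def)
  then have "lookup f m = 0" for m by (auto simp: in_keys_iff)
  then show ?thesis by (simp add: poly_mapping_eqI)
qed

lemma peval_inject: "(\<And>a. peval a f = peval a g) \<Longrightarrow> f = g"
  using peval_eq_0_imp[of "f - g"] by simp

subsection \<open>Order and homogeneous parts\<close>

definition ord_ge :: "nat \<Rightarrow> mpoly \<Rightarrow> bool" where
  "ord_ge k f \<longleftrightarrow> (\<forall>m\<in>keys f. k \<le> mon_degree m)"

definition homog :: "nat \<Rightarrow> mpoly \<Rightarrow> bool" where
  "homog k f \<longleftrightarrow> (\<forall>m\<in>keys f. mon_degree m = k)"

definition in_vars :: "nat \<Rightarrow> mpoly \<Rightarrow> bool" where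
  "in_vars d f \<longleftrightarrow> (\<forall>m\<in>keys f. keys m \<subseteq> {..<d})"

lemma mon_degree_superset: "finite A \<Longrightarrow> keys m \<subseteq> A \<Longrightarrow> mon_degree m = (\<Sum>i\<in>A. lookup m i)"
  unfolding mon_degree_def by (rule sum.mono_neutral_left) (auto simp: in_keys_iff)

lemma mon_degree_add: "mon_degree (m + n) = mon_degree m + mon_degree n"
proof -
  let ?A = "keys m \<union> keys n"
  have "mon_degree (m + n) = (\<Sum>i\<in>?A. lookup (m + n) i)"
    by (rule mon_degree_superset) (auto simp: keys_add)
  then show ?thesis
    using mon_degree_superset[of ?A m] mon_degree_superset[of ?A n]
    by (simp add: lookup_add sum.distrib)
qed

lemma mon_degree_0 [simp]: "mon_degree 0 = 0"
  by (simp add: mon_degree_def)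

lemma mon_degree_single [simp]: "mon_degree (single i k) = k"
  by (cases "k = 0") (auto simp: mon_degree_def)

lemma keys_add_mpolyE:
  assumes "m \<in> keys (f + g :: mpoly)"
  shows "m \<in> keys f \<or> m \<in> keys g"
  using assms keys_add[of f g] by auto

lemma keys_mult_mpolyE:
  assumes "m \<in> keys (f * g :: mpoly)"
  obtains a b where "a \<in> keys f" "b \<in> keys g" "m = a + b"
  using assms keys_mult[of f g] by auto

lemma keys_Const: "m \<in> keys (Const r) \<Longrightarrow> m = 0"
  by (auto simp: Const_def split: if_splits)

lemma keys_Var: "m \<in> keys (Var i) \<Longrightarrow> m = single i 1"
  by (auto simp: Var_def)

lemma ord_ge_zero [simp]: "ord_ge k 0"
  and ord_ge_0 [simp]: "ord_ge 0 f"
  and homog_zero [simp]: "homog k 0"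
  and in_vars_zero [simp]: "in_vars d 0"
  by (auto simp: ord_ge_def homog_def in_vars_def)

lemma ord_ge_mono: "ord_ge k f \<Longrightarrow> j \<le> k \<Longrightarrow> ord_ge j f"
  by (auto simp: ord_ge_def)

lemma in_vars_mono: "in_vars d f \<Longrightarrow> d \<le> e \<Longrightarrow> in_vars e f"
  by (fastforce simp: in_vars_def)

lemma ord_ge_homog: "homog k f \<Longrightarrow> ord_ge k f"
  by (auto simp: ord_ge_def homog_def)

lemma ord_ge_add: "ord_ge k f \<Longrightarrow> ord_ge k g \<Longrightarrow> ord_ge k (f + g)"
  and homog_add: "homog k f \<Longrightarrow> homog k g \<Longrightarrow> homog k (f + g)"
  and in_vars_add: "in_vars d f \<Longrightarrow> in_vars d g \<Longrightarrow> in_vars d (f + g)"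
  by (auto simp: ord_ge_def homog_def in_vars_def dest!: keys_add_mpolyE)

lemma ord_ge_uminus: "ord_ge k f \<Longrightarrow> ord_ge k (- f)"
  and homog_uminus: "homog k f \<Longrightarrow> homog k (- f)"
  and in_vars_uminus: "in_vars d f \<Longrightarrow> in_vars d (- f)"
  by (auto simp: ord_ge_def homog_def in_vars_def)

lemma homog_diff: "homog k f \<Longrightarrow> homog k g \<Longrightarrow> homog k (f - g)"
  and in_vars_diff: "in_vars d f \<Longrightarrow> in_vars d g \<Longrightarrow> in_vars d (f - g)"
  using homog_add[of k f "- g"] in_vars_add[of d f "- g"]
  by (simp_all add: homog_uminus in_vars_uminus)

lemma ord_ge_mult: "ord_ge k f \<Longrightarrow> ord_ge l g \<Longrightarrow> ord_ge (k + l) (f * g)"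
  unfolding ord_ge_def by (auto simp: mon_degree_add intro!: add_mono elim!: keys_mult_mpolyE)

lemma homog_mult: "homog k f \<Longrightarrow> homog l g \<Longrightarrow> homog (k + l) (f * g)"
  unfolding homog_def by (auto simp: mon_degree_add elim!: keys_mult_mpolyE)

lemma in_vars_mult: "in_vars d f \<Longrightarrow> in_vars d g \<Longrightarrow> in_vars d (f * g)"
proof -
  assume *: "in_vars d f" "in_vars d g"
  show "in_vars d (f * g)"
    unfolding in_vars_def
  proof
    fix m assume "m \<in> keys (f * g)"
    then obtain a b where "a \<in> keys f" "b \<in> keys g" "m = a + b" by (rule keys_mult_mpolyE)
    then show "keys m \<subseteq> {..<d}"
      using * keys_add[of a b] by (fastforce simp: in_vars_def)
  qed
qed

lemma homog_Const [simp]: "homog 0 (Const r)"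
  and in_vars_Const [simp]: "in_vars d (Const r)"
  by (auto simp: homog_def in_vars_def dest!: keys_Const)

lemma homog_Var [simp]: "homog (Suc 0) (Var i)"
  and in_vars_Var: "i < d \<Longrightarrow> in_vars d (Var i)"
  by (auto simp: homog_def in_vars_def dest!: keys_Var)

lemma ord_ge_Var [simp]: "ord_ge (Suc 0) (Var i)"
  by (simp add: ord_ge_homog)

lemma ord_ge_smult: "ord_ge k f \<Longrightarrow> ord_ge k (Const r * f)"
  using ord_ge_mult[of 0 "Const r" k f] by simp

lemma homog_smult: "homog k f \<Longrightarrow> homog k (Const r * f)"
  using homog_mult[of 0 "Const r" k f] by simp

lemma in_vars_smult: "in_vars d f \<Longrightarrow> in_vars d (Const r * f)"
  by (simp add: in_vars_mult)

lemma ord_ge_sum: "(\<And>x. x \<in> A \<Longrightarrow> ord_ge k (g x)) \<Longrightarrow> ord_ge k (sum g A)"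
  and homog_sum: "(\<And>x. x \<in> A \<Longrightarrow> homog k (g x)) \<Longrightarrow> homog k (sum g A)"
  and in_vars_sum: "(\<And>x. x \<in> A \<Longrightarrow> in_vars d (g x)) \<Longrightarrow> in_vars d (sum g A)"
  by (induction A rule: infinite_finite_induct) (auto simp: ord_ge_add homog_add in_vars_add)

lemma in_vars_power: "in_vars d f \<Longrightarrow> in_vars d (f ^ k)"
  by (induction k) (auto simp: in_vars_mult simp flip: Const_1)

lemma in_vars_prod: "(\<And>x. x \<in> A \<Longrightarrow> in_vars d (g x)) \<Longrightarrow> in_vars d (prod g A)"
  by (induction A rule: infinite_finite_induct) (auto simp: in_vars_mult simp flip: Const_1)

lemma homog_power: "homog k f \<Longrightarrow> homog (k * n) (f ^ n)"
  by (induction n) (auto dest: homog_mult simp flip: Const_1)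

lemma ord_ge_power: "ord_ge k f \<Longrightarrow> ord_ge (k * n) (f ^ n)"
  by (induction n) (auto dest: ord_ge_mult)

lemma homog_prod: "(\<And>x. x \<in> A \<Longrightarrow> homog (k x) (g x)) \<Longrightarrow> homog (sum k A) (prod g A)"
  by (induction A rule: infinite_finite_induct) (auto simp: homog_mult simp flip: Const_1)

lemma ord_ge_prod: "(\<And>x. x \<in> A \<Longrightarrow> ord_ge (k x) (g x)) \<Longrightarrow> ord_ge (sum k A) (prod g A)"
  by (induction A rule: infinite_finite_induct) (auto simp: ord_ge_mult)

lemma in_vars_msubst:
  assumes "\<And>m v. m \<in> keys f \<Longrightarrow> v \<in> keys m \<Longrightarrow> in_vars d (\<sigma> v)"
  shows "in_vars d (msubst \<sigma> f)"
  unfolding msubst_def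
  by (intro in_vars_sum in_vars_smult in_vars_prod in_vars_power) (use assms in auto)

lemma homog_msubst:
  assumes "homog k f" "\<And>v. homog 1 (\<sigma> v)"
  shows "homog k (msubst \<sigma> f)"
proof -
  have "homog k (\<Prod>i\<in>keys m. \<sigma> i ^ lookup m i)" if "m \<in> keys f" for m
  proof -
    have "homog (lookup m i) (\<sigma> i ^ lookup m i)" for i
      using homog_power[OF assms(2)[of i], of "lookup m i"] by simp
    then have "homog (mon_degree m) (\<Prod>i\<in>keys m. \<sigma> i ^ lookup m i)"
      unfolding mon_degree_def by (intro homog_prod)
    moreover have "mon_degree m = k" using assms(1) that by (simp add: homog_def)
    ultimately show ?thesis by simp
  qed
  then show ?thesis unfolding msubst_def by (intro homog_sum homog_smult)
qed

lemma ord_ge_msubst: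
  assumes "ord_ge k f" "\<And>v. ord_ge 1 (\<sigma> v)"
  shows "ord_ge k (msubst \<sigma> f)"
proof -
  have "ord_ge k (\<Prod>i\<in>keys m. \<sigma> i ^ lookup m i)" if "m \<in> keys f" for m
  proof -
    have "ord_ge (lookup m i) (\<sigma> i ^ lookup m i)" for i
      using ord_ge_power[OF assms(2)[of i], of "lookup m i"] by simp
    then have "ord_ge (mon_degree m) (\<Prod>i\<in>keys m. \<sigma> i ^ lookup m i)"
      unfolding mon_degree_def by (intro ord_ge_prod)
    moreover have "k \<le> mon_degree m" using assms(1) that by (simp add: ord_ge_def)
    ultimately show ?thesis by (rule ord_ge_mono)
  qed
  then show ?thesis unfolding msubst_def by (intro ord_ge_sum ord_ge_smult)
qed

text \<open>A monomial of degree at least k is a product of that many factors. Exchanging them one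
  at a time, each exchange trades a factor of order 1 for a difference of order s + 1. This gain of
  s separates lower from higher orders in all later comparisons.\<close>

lemma ord_ge_msubst_diff:
  assumes "ord_ge k f" "\<And>v. ord_ge 1 (\<sigma> v)" "\<And>v. ord_ge 1 (\<tau> v)"
    and "\<And>v. ord_ge (Suc s) (\<sigma> v - \<tau> v)"
  shows "ord_ge (k + s) (msubst \<sigma> f - msubst \<tau> f)"
proof -
  \<comment> \<open>The product rule f g - f' g' = (f - f') g + f' (g - g') in terms of orders;
    powers and products follow from it by induction.\<close>
  have mult: "ord_ge (k + l + s) (f * g - f' * g')"
    if "ord_ge (k + s) (f - f')" "ord_ge k f'" "ord_ge (l + s) (g - g')" "ord_ge l g"
    for k l f g f' g'
  proof -
    have "f * g - f' * g' = (f - f') * g + f' * (g - g')" by (simp add: algebra_simps)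
    with ord_ge_mult[OF that(1,4)] ord_ge_mult[OF that(2,3)] show ?thesis
      by (simp add: ord_ge_add ac_simps)
  qed
  have pow: "ord_ge (n + s) (\<sigma> v ^ n - \<tau> v ^ n)" for v n
  proof (induction n)
    case (Suc n)
    show ?case
      using mult[of 1 "\<sigma> v" "\<tau> v" n "\<sigma> v ^ n" "\<tau> v ^ n"] Suc assms(3)[of v] assms(4)[of v]
        ord_ge_power[OF assms(2)[of v], of n] by simp
  qed simp
  have prd: "ord_ge (sum k A + s) ((\<Prod>i\<in>A. \<sigma> i ^ k i) - (\<Prod>i\<in>A. \<tau> i ^ k i))" for k A
  proof (induction A rule: infinite_finite_induct)
    case (insert x A)
    show ?case
      using mult[of "k x" "\<sigma> x ^ k x" "\<tau> x ^ k x" "sum k A" "\<Prod>i\<in>A. \<sigma> i ^ k i" "\<Prod>i\<in>A. \<tau> i ^ k i"]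
        insert pow[of "k x" x] ord_ge_power[OF assms(3)[of x], of "k x"]
        ord_ge_prod[of A k "\<lambda>i. \<sigma> i ^ k i"] ord_ge_power[OF assms(2)] by simp
  qed auto
  have "msubst \<sigma> f - msubst \<tau> f = (\<Sum>m\<in>keys f. Const (lookup f m) *
      ((\<Prod>i\<in>keys m. \<sigma> i ^ lookup m i) - (\<Prod>i\<in>keys m. \<tau> i ^ lookup m i)))"
    by (simp add: msubst_def sum_subtractf right_diff_distrib)
  moreover have "ord_ge (k + s) ((\<Prod>i\<in>keys m. \<sigma> i ^ lookup m i) - (\<Prod>i\<in>keys m. \<tau> i ^ lookup m i))"
    if "m \<in> keys f" for m
  proof (rule ord_ge_mono)
    show "ord_ge (mon_degree m + s) ((\<Prod>i\<in>keys m. \<sigma> i ^ lookup m i) - (\<Prod>i\<in>keys m. \<tau> i ^ lookup m i))"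
      using prd[of "lookup m" "keys m"] by (simp add: mon_degree_def)
    show "k + s \<le> mon_degree m + s" using assms(1) that by (simp add: ord_ge_def)
  qed
  ultimately show ?thesis by (simp add: ord_ge_sum ord_ge_smult)
qed

section \<open>Homogeneous components\<close>

lemma lookup_hom_part: "lookup (hom_part j f) m = (if mon_degree m = j then lookup f m else 0)"
proof -
  have "lookup (hom_part j f) m =
      (\<Sum>n\<in>{n \<in> keys f. mon_degree n = j}. if n = m then lookup f n else 0)"
    unfolding hom_part_def lookup_sum by (intro sum.cong) (auto simp: lookup_single when_def)
  then show ?thesis by (auto simp: in_keys_iff)
qed

lemma hom_part_add: "hom_part j (f + g) = hom_part j f + hom_part j g"
  and hom_part_diff: "hom_part j (f - g) = hom_part j f - hom_part j g"
  by (auto intro!: poly_mapping_eqI simp: lookup_hom_part lookup_add lookup_minus)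

lemma hom_part_zero [simp]: "hom_part j 0 = 0"
  by (auto intro!: poly_mapping_eqI simp: lookup_hom_part)

lemma hom_part_sum: "hom_part j (sum g A) = (\<Sum>x\<in>A. hom_part j (g x))"
  by (induction A rule: infinite_finite_induct) (auto simp: hom_part_add)

lemma homog_hom_part [simp]: "homog j (hom_part j f)"
  by (auto simp: homog_def in_keys_iff lookup_hom_part split: if_splits)

lemma in_vars_hom_part: "in_vars d f \<Longrightarrow> in_vars d (hom_part j f)"
  by (auto simp: in_vars_def in_keys_iff lookup_hom_part split: if_splits)

lemma hom_part_homog: "homog k f \<Longrightarrow> hom_part j f = (if j = k then f else 0)"
  by (rule poly_mapping_eqI) (auto simp: homog_def in_keys_iff lookup_hom_part)

lemma hom_part_ord_ge: "ord_ge k f \<Longrightarrow> j < k \<Longrightarrow> hom_part j f = 0"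
  by (rule poly_mapping_eqI) (force simp: ord_ge_def lookup_hom_part simp flip: not_in_keys_iff_lookup_eq_zero)

lemma ord_ge_iff_hom_part: "ord_ge k f \<longleftrightarrow> (\<forall>j<k. hom_part j f = 0)"
proof
  assume r: "\<forall>j<k. hom_part j f = 0"
  show "ord_ge k f" unfolding ord_ge_def
  proof
    fix m assume "m \<in> keys f"
    then have "lookup (hom_part (mon_degree m) f) m \<noteq> 0" by (simp add: lookup_hom_part in_keys_iff)
    with r show "k \<le> mon_degree m" by (metis lookup_zero not_less)
  qed
qed (simp add: hom_part_ord_ge)

lemma sum_hom_part_atMost: "ord_ge (Suc k) (f - (\<Sum>i\<le>k. hom_part i f))"
  by (subst ord_ge_iff_hom_part)
    (auto simp: hom_part_diff hom_part_sum hom_part_homog[OF homog_hom_part])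

lemma peval_scale_homog:
  assumes "homog k f"
  shows "peval (\<lambda>i. t * a i) f = t ^ k * peval a f"
proof -
  have "mon (\<lambda>i. t * a i) m = t ^ mon_degree m * mon a m" for m
    by (simp add: mon_def mon_degree_def power_mult_distrib prod.distrib power_sum)
  then show ?thesis
    using assms by (simp add: gsubst_def homog_def sum_distrib_left algebra_simps)
qed

subsection \<open>Truncations of formal maps\<close>

text \<open>\<open>msubst\<close> is defined for polynomials only, so a series enters every
  substitution through its partial sums.\<close>

definition trunc :: "nat \<Rightarrow> formal_map \<Rightarrow> nat \<Rightarrow> mpoly" where
  "trunc k f l = (\<Sum>i\<le>k. f i $ l)"

text \<open>The substitution behind \<open>subst_block\<close>, with a function in place of a
  vector: the block of n variables after the parameters is replaced, the parameters and all
  variables beyond the block stay.\<close>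

definition blk :: "nat \<Rightarrow> nat \<Rightarrow> (nat \<Rightarrow> mpoly) \<Rightarrow> nat \<Rightarrow> mpoly" where
  "blk p n g v = (if p \<le> v \<and> v < p + n then g (v - p) else Var v)"

definition cong_upto :: "nat \<Rightarrow> mpoly \<Rightarrow> mpoly \<Rightarrow> bool" where
  "cong_upto k f g \<longleftrightarrow> ord_ge (Suc k) (f - g)"

lemma hom_polys_iff:
  "h \<in> hom_polys d j n \<longleftrightarrow> dim_vec h = n \<and> (\<forall>i<n. homog j (h $ i) \<and> in_vars d (h $ i))"
  unfolding hom_polys_def homog_def in_vars_def carrier_vec_def mem_Collect_eq by blast

lemma hom_polysD:
  assumes "h \<in> hom_polys d j n"
  shows "dim_vec h = n" "i < n \<Longrightarrow> homog j (h $ i)" "i < n \<Longrightarrow> in_vars d (h $ i)"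
  using assms by (auto simp: hom_polys_iff)

lemma hom_polys_mono: "h \<in> hom_polys d j n \<Longrightarrow> d \<le> e \<Longrightarrow> h \<in> hom_polys e j n"
  by (auto simp: hom_polys_iff intro: in_vars_mono)

lemma zero_hom_polys [simp]: "0\<^sub>v n \<in> hom_polys d j n"
  by (simp add: hom_polys_iff)

lemma add_hom_polys: "v \<in> hom_polys d j n \<Longrightarrow> w \<in> hom_polys d j n \<Longrightarrow> v + w \<in> hom_polys d j n"
  and diff_hom_polys: "v \<in> hom_polys d j n \<Longrightarrow> w \<in> hom_polys d j n \<Longrightarrow> v - w \<in> hom_polys d j n"
  and smult_hom_polys: "v \<in> hom_polys d j n \<Longrightarrow> Const r \<cdot>\<^sub>v v \<in> hom_polys d j n"
  by (auto simp: hom_polys_iff homog_add in_vars_add homog_diff in_vars_diff homog_smult in_vars_smult)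

lemma append_hom_polys:
  "v \<in> hom_polys d j n \<Longrightarrow> w \<in> hom_polys d j m \<Longrightarrow> v @\<^sub>v w \<in> hom_polys d j (n + m)"
  by (auto simp: hom_polys_iff)

lemma vec_first_hom_polys: "v \<in> hom_polys d j n \<Longrightarrow> c \<le> n \<Longrightarrow> vec_first v c \<in> hom_polys d j c"
  by (auto simp: hom_polys_iff vec_first_def)

lemma vec_last_hom_polys: "v \<in> hom_polys d j n \<Longrightarrow> c \<le> n \<Longrightarrow> vec_last v c \<in> hom_polys d j c"
  by (auto simp: hom_polys_iff vec_last_def)

lemma index_vec_first [simp]: "i < c \<Longrightarrow> vec_first v c $ i = v $ i"
  and index_vec_last [simp]: "i < c \<Longrightarrow> vec_last v c $ i = v $ (dim_vec v - c + i)"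
  by (auto simp: vec_first_def vec_last_def)

lemma vec_first_append [simp]: "dim_vec v = c \<Longrightarrow> vec_first (v @\<^sub>v w) c = v"
  and vec_last_append [simp]: "dim_vec w = c \<Longrightarrow> vec_last (v @\<^sub>v w) c = w"
  by (auto intro!: eq_vecI)

lemma vec_first_last_append: "dim_vec v = c + q \<Longrightarrow> vec_first v c @\<^sub>v vec_last v q = v"
  by (auto intro!: eq_vecI)

lemma formal_mapD:
  assumes "is_formal_map d n f"
  shows "f 0 = 0\<^sub>v n" "f j \<in> hom_polys d j n" "dim_vec (f j) = n"
    "l < n \<Longrightarrow> homog j (f j $ l)" "l < n \<Longrightarrow> in_vars d (f j $ l)"
  using assms by (auto simp: is_formal_map_def hom_polys_iff)

lemma hom_part_trunc:
  assumes "is_formal_map d n f" "l < n"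
  shows "hom_part i (trunc k f l) = (if i \<le> k then f i $ l else 0)"
proof -
  have "hom_part i (trunc k f l) = (\<Sum>j\<le>k. if j = i then f j $ l else 0)"
    unfolding trunc_def hom_part_sum
    by (intro sum.cong refl) (use assms in \<open>auto simp: hom_part_homog[OF formal_mapD(4)]\<close>)
  then show ?thesis by simp
qed

lemma ord_ge_trunc:
  assumes "is_formal_map d n f" "l < n"
  shows "ord_ge (Suc 0) (trunc k f l)"
  using assms formal_mapD(1)[OF assms(1)] by (simp add: ord_ge_iff_hom_part hom_part_trunc)

lemma in_vars_trunc: "is_formal_map d n f \<Longrightarrow> l < n \<Longrightarrow> in_vars d (trunc k f l)"
  unfolding trunc_def by (intro in_vars_sum formal_mapD(5))

lemma cong_upto_refl [simp]: "cong_upto k f f"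
  by (simp add: cong_upto_def)

lemma cong_upto_sym: "cong_upto k f g \<Longrightarrow> cong_upto k g f"
  unfolding cong_upto_def by (drule ord_ge_uminus) simp

lemma cong_upto_trans [trans]: "cong_upto k f g \<Longrightarrow> cong_upto k g h \<Longrightarrow> cong_upto k f h"
  unfolding cong_upto_def by (drule (1) ord_ge_add) simp

lemma cong_upto_iff: "cong_upto k f g \<longleftrightarrow> (\<forall>j\<le>k. hom_part j f = hom_part j g)"
  by (auto simp: cong_upto_def ord_ge_iff_hom_part hom_part_diff less_Suc_eq_le)

lemma trunc_cong_le:
  assumes "is_formal_map d n f" "l < n" "j \<le> k"
  shows "cong_upto j (trunc k f l) (trunc j f l)"
  using assms by (simp add: cong_upto_iff hom_part_trunc)

lemma ord_ge_blk:
  assumes "\<And>s. s < n \<Longrightarrow> ord_ge (Suc 0) (g s)"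
  shows "ord_ge (Suc 0) (blk p n g v)"
  using assms by (auto simp: blk_def)

lemma cong_upto_blk:
  assumes "\<And>s. s < n \<Longrightarrow> cong_upto k (g s) (h s)"
  shows "cong_upto k (blk p n g v) (blk p n h v)"
  using assms by (auto simp: blk_def)

lemma blk_cong: "(\<And>s. s < n \<Longrightarrow> g s = h s) \<Longrightarrow> blk p n g = blk p n h"
  by (rule ext) (auto simp: blk_def)

text \<open>The error splits in two. Passing from \<sigma> to \<tau> inside f has order at least 1 +
  k by \<open>ord_ge_msubst_diff\<close>; passing from f to g keeps the order of f - g, since the
  inserted terms have no constant part.\<close>

lemma cong_upto_msubst:
  assumes "cong_upto k f g" "ord_ge (Suc 0) f" "\<And>v. ord_ge (Suc 0) (\<sigma> v)" "\<And>v. ord_ge (Suc 0) (\<tau> v)"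
    and "\<And>v. cong_upto k (\<sigma> v) (\<tau> v)"
  shows "cong_upto k (msubst \<sigma> f) (msubst \<tau> g)"
proof -
  have "ord_ge (1 + k) (msubst \<sigma> f - msubst \<tau> f)"
    by (rule ord_ge_msubst_diff) (use assms in \<open>auto simp: cong_upto_def\<close>)
  moreover have "ord_ge (Suc k) (msubst \<tau> (f - g))"
    by (rule ord_ge_msubst) (use assms in \<open>auto simp: cong_upto_def\<close>)
  ultimately have "ord_ge (Suc k) ((msubst \<sigma> f - msubst \<tau> f) + msubst \<tau> (f - g))"
    by (intro ord_ge_add) auto
  then show ?thesis by (simp add: cong_upto_def)
qed

lemma agree_upto_iff_trunc:
  assumes "is_formal_map d n f" "is_formal_map e n g"
  shows "agree_upto (enat k) f g \<longleftrightarrow> (\<forall>l<n. cong_upto k (trunc k f l) (trunc k g l))"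
proof -
  have "f j = g j \<longleftrightarrow> (\<forall>l<n. f j $ l = g j $ l)" for j
    using formal_mapD(3)[OF assms(1)] formal_mapD(3)[OF assms(2)] by (auto intro!: eq_vecI)
  then show ?thesis
    using assms by (auto simp: agree_upto_def cong_upto_iff hom_part_trunc)
qed

lemma agree_upto_refl [simp]: "agree_upto r f f"
  and agree_upto_sym: "agree_upto r f g \<Longrightarrow> agree_upto r g f"
  by (auto simp: agree_upto_def)

lemma agree_upto_trans [trans]: "agree_upto r f g \<Longrightarrow> agree_upto r g h \<Longrightarrow> agree_upto r f h"
  by (auto simp: agree_upto_def)

lemma agree_upto_mono: "agree_upto r f g \<Longrightarrow> s \<le> r \<Longrightarrow> agree_upto s f g"
  unfolding agree_upto_def by (meson order_trans)

lemma agree_uptoD: "agree_upto r f g \<Longrightarrow> enat k \<le> r \<Longrightarrow> f k = g k"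
  by (simp add: agree_upto_def)

lemma agree_upto_infinity: "agree_upto \<infinity> f g \<longleftrightarrow> f = g"
  by (auto simp: agree_upto_def)

lemma agree_upto_enat: "agree_upto (enat k) f g \<longleftrightarrow> (\<forall>j\<le>k. f j = g j)"
  by (simp add: agree_upto_def)

subsection \<open>Composition of formal maps\<close>

lemma dim_fcomp [simp]: "dim_vec (fcomp p f g j) = dim_vec (f j)"
  by (simp add: fcomp_def)

lemma subst_block_eq: "subst_block p e = msubst (blk p (dim_vec e) (\<lambda>s. e $ s))"
proof -
  have "(\<lambda>v. if p \<le> v \<and> v < p + dim_vec e then e $ (v - p) else Var v) = blk p (dim_vec e) (\<lambda>s. e $ s)"
    by (rule ext) (simp add: blk_def)
  then show ?thesis by (simp add: subst_block_def)
qed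

text \<open>Substitution is additive, so the defining sum over the parts of f collapses to one
  substitution into a partial sum.\<close>

lemma fcomp_nth:
  assumes "dim_vec (g j) = n" "l < dim_vec (f j)"
  shows "fcomp p f g j $ l = hom_part j (msubst (blk p n (trunc j g)) (trunc j f l))"
proof -
  have "blk p n (\<lambda>s. vec n (\<lambda>s. \<Sum>k\<le>j. g k $ s) $ s) = blk p n (trunc j g)"
    by (rule blk_cong) (simp add: trunc_def)
  then show ?thesis
    using assms by (simp add: fcomp_def subst_block_eq hom_part_sum trunc_def[of j f])
qed

lemma fcomp_cong:
  assumes "agree_upto r f f'" "agree_upto r g g'"
  shows "agree_upto r (fcomp p f g) (fcomp p f' g')"
  unfolding agree_upto_def
proof (intro allI impI)
  fix k assume k: "enat k \<le> r"
  have "f i = f' i" "g i = g' i" if "i \<le> k" for i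
  proof -
    have "enat i \<le> r" using that k by (meson enat_ord_simps(1) order_trans)
    then show "f i = f' i" "g i = g' i" using assms by (auto simp: agree_upto_def)
  qed
  then show "fcomp p f g k = fcomp p f' g' k"
    unfolding fcomp_def by (auto intro!: eq_vecI sum.cong)
qed

lemma in_vars_msubst_blk:
  assumes "in_vars (p + n) f" "\<And>s. s < n \<Longrightarrow> in_vars d (g s)" "p \<le> d"
  shows "in_vars d (msubst (blk p n g) f)"
proof (rule in_vars_msubst)
  fix m v assume "m \<in> keys f" "v \<in> keys m"
  with assms(1) have "v < p + n" by (auto simp: in_vars_def)
  with assms show "in_vars d (blk p n g v)" by (auto simp: blk_def intro: in_vars_Var)
qed

lemma fcomp_formal:
  assumes "is_formal_map (p + n) m f" "is_formal_map d n g" "p \<le> d"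
  shows "is_formal_map d m (fcomp p f g)"
proof -
  have "fcomp p f g j $ l = hom_part j (msubst (blk p n (trunc j g)) (trunc j f l))" if "l < m" for j l
    using that assms formal_mapD(3) by (intro fcomp_nth) auto
  moreover have "trunc 0 f l = 0" if "l < m" for l
    using that formal_mapD(1)[OF assms(1)] by (simp add: trunc_def)
  moreover have "in_vars d (msubst (blk p n (trunc j g)) (trunc j f l))" if "l < m" for j l
    by (intro in_vars_msubst_blk in_vars_trunc[OF assms(1)] in_vars_trunc[OF assms(2)] assms(3) that)
  ultimately have "homog j (fcomp p f g j $ l) \<and> in_vars d (fcomp p f g j $ l)" "fcomp p f g 0 $ l = 0"
    if "l < m" for j l
    using that by (simp_all add: in_vars_hom_part)
  moreover have "dim_vec (fcomp p f g j) = m" for j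
    using formal_mapD(3)[OF assms(1)] by simp
  ultimately show ?thesis
    unfolding is_formal_map_def hom_polys_iff by (metis eq_vecI index_zero_vec)
qed

text \<open>Each part of a composite is computed from truncations at its own order j. Cutting f and
  g at k instead changes nothing up to order j, because the additional terms have order above j; one
  substitution therefore represents all parts up to k.\<close>

lemma trunc_fcomp:
  assumes f: "is_formal_map e m f" and g: "is_formal_map d n g" and "l < m"
  shows "cong_upto k (trunc k (fcomp p f g) l) (msubst (blk p n (trunc k g)) (trunc k f l))"
  unfolding cong_upto_iff
proof (intro allI impI)
  fix j assume "j \<le> k"
  have dims: "dim_vec (g j) = n" "dim_vec (f j) = m" for j
    using f g by (simp_all add: formal_mapD(3))
  have nth: "fcomp p f g i $ l = hom_part i (msubst (blk p n (trunc i g)) (trunc i f l))" for i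
    using assms dims by (intro fcomp_nth) auto
  have "hom_part j (trunc k (fcomp p f g) l) = (\<Sum>i\<le>k. if i = j then fcomp p f g i $ l else 0)"
    unfolding trunc_def hom_part_sum
    by (intro sum.cong refl) (simp add: nth hom_part_homog[OF homog_hom_part])
  then have "hom_part j (trunc k (fcomp p f g) l) = hom_part j (msubst (blk p n (trunc j g)) (trunc j f l))"
    using \<open>j \<le> k\<close> by (simp add: nth)
  moreover have "cong_upto j (msubst (blk p n (trunc j g)) (trunc j f l)) (msubst (blk p n (trunc k g)) (trunc k f l))"
    using assms \<open>j \<le> k\<close>
    by (intro cong_upto_msubst ord_ge_blk cong_upto_blk cong_upto_sym[OF trunc_cong_le]) (auto intro: ord_ge_trunc)
  ultimately show "hom_part j (trunc k (fcomp p f g) l) = hom_part j (msubst (blk p n (trunc k g)) (trunc k f l))"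
    by (simp add: cong_upto_iff)
qed

text \<open>At order k all three maps may be replaced by polynomials, and for these associativity is
  \<open>msubst_msubst\<close>.\<close>

lemma fcomp_assoc:
  assumes f: "is_formal_map (p + n) m f" and g: "is_formal_map (p + n') n g"
    and h: "is_formal_map d n' h" and "p \<le> d"
  shows "fcomp p (fcomp p f g) h = fcomp p f (fcomp p g h)"
proof (rule agree_upto_infinity[THEN iffD1], unfold agree_upto_def, intro allI impI)
  fix k
  have fg: "is_formal_map (p + n') m (fcomp p f g)" and gh: "is_formal_map d n (fcomp p g h)"
    using assms by (auto intro: fcomp_formal)
  have lhs: "is_formal_map d m (fcomp p (fcomp p f g) h)" and rhs: "is_formal_map d m (fcomp p f (fcomp p g h))"
    using assms fg gh by (auto intro: fcomp_formal)
  let ?H = "blk p n' (trunc k h)" and ?G = "blk p n (trunc k g)"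
  have "cong_upto k (trunc k (fcomp p (fcomp p f g) h) l) (trunc k (fcomp p f (fcomp p g h)) l)"
    if l: "l < m" for l
  proof -
    have H: "ord_ge (Suc 0) (?H v)" and G: "ord_ge (Suc 0) (?G v)" for v
      using g h by (auto intro!: ord_ge_blk ord_ge_trunc)
    \<comment> \<open>Beyond the variables of f the substitution \<open>?H\<close> may still act,
      since its block has length n' instead of n; \<sigma> is the identity there, to match the block
      substitution on the right-hand side.\<close>
    define \<sigma> where "\<sigma> v = (if v < p + n then msubst ?H (?G v) else Var v)" for v
    have "cong_upto k (trunc k (fcomp p (fcomp p f g) h) l) (msubst ?H (trunc k (fcomp p f g) l))"
      by (rule trunc_fcomp[OF fg h l])
    also have "cong_upto k \<dots> (msubst ?H (msubst ?G (trunc k f l)))"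
      by (intro cong_upto_msubst cong_upto_refl H trunc_fcomp[OF f g l] ord_ge_trunc[OF fg l])
    also have "msubst ?H (msubst ?G (trunc k f l)) = msubst \<sigma> (trunc k f l)"
      unfolding msubst_msubst
    proof (rule msubst_cong)
      fix a v assume "a \<in> keys (trunc k f l)" "v \<in> keys a"
      with in_vars_trunc[OF f l] have "v < p + n" by (auto simp: in_vars_def)
      then show "msubst ?H (?G v) = \<sigma> v" by (simp add: \<sigma>_def)
    qed
    also have "cong_upto k \<dots> (msubst (blk p n (trunc k (fcomp p g h))) (trunc k f l))"
    proof (rule cong_upto_msubst)
      show "ord_ge (Suc 0) (\<sigma> v)" for v
        using ord_ge_msubst[of "Suc 0" "?G v" ?H] G H by (simp add: \<sigma>_def)
      show "ord_ge (Suc 0) (blk p n (trunc k (fcomp p g h)) v)" for v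
        using gh by (auto intro!: ord_ge_blk ord_ge_trunc)
      show "cong_upto k (\<sigma> v) (blk p n (trunc k (fcomp p g h)) v)" for v
        using cong_upto_sym[OF trunc_fcomp[OF g h, of "v - p" k p]] by (auto simp: \<sigma>_def blk_def)
    qed (use f l in \<open>auto intro: ord_ge_trunc\<close>)
    also have "cong_upto k \<dots> (trunc k (fcomp p f (fcomp p g h)) l)"
      by (rule cong_upto_sym[OF trunc_fcomp[OF f gh l]])
    finally show ?thesis .
  qed
  then have "agree_upto (enat k) (fcomp p (fcomp p f g) h) (fcomp p f (fcomp p g h))"
    by (simp add: agree_upto_iff_trunc[OF lhs rhs])
  then show "fcomp p (fcomp p f g) h k = fcomp p f (fcomp p g h) k"
    by (auto intro: agree_uptoD)
qed

text \<open>A map in the variables (x,alpha) sees only the x-components of what is inserted. For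
  this reason the x-parts of the normal form steps can be composed among themselves.\<close>

lemma fcomp_vec_first:
  assumes f: "is_formal_map (p + c) m f" and g: "is_formal_map d n g" and "c \<le> n"
  shows "fcomp p f g = fcomp p f (\<lambda>j. vec_first (g j) c)"
proof (rule ext, rule eq_vecI)
  fix j l assume "l < dim_vec (fcomp p f (\<lambda>j. vec_first (g j) c) j)"
  then have l: "l < m" using formal_mapD(3)[OF f] by simp
  have "msubst (blk p n (trunc j g)) (trunc j f l) =
    msubst (blk p c (trunc j (\<lambda>j. vec_first (g j) c))) (trunc j f l)"
  proof (rule msubst_cong)
    fix a v assume "a \<in> keys (trunc j f l)" "v \<in> keys a"
    with in_vars_trunc[OF f l] have "v < p + c" by (auto simp: in_vars_def)
    then show "blk p n (trunc j g) v = blk p c (trunc j (\<lambda>j. vec_first (g j) c)) v"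
      using \<open>c \<le> n\<close> by (auto simp: blk_def trunc_def)
  qed
  then show "fcomp p f g j $ l = fcomp p f (\<lambda>j. vec_first (g j) c) j $ l"
    using l fcomp_nth[of g j n l f] fcomp_nth[of "\<lambda>j. vec_first (g j) c" j c l f]
      formal_mapD(3)[OF f] formal_mapD(3)[OF g] by simp
qed simp

lemma vec_first_fcomp:
  "\<lbrakk>\<And>j. c \<le> dim_vec (f j)\<rbrakk> \<Longrightarrow> (\<lambda>j. vec_first (fcomp p f g j) c) = fcomp p (\<lambda>j. vec_first (f j) c) g"
proof (rule ext, rule eq_vecI)
  fix j i assume c: "\<And>j. c \<le> dim_vec (f j)" and "i < dim_vec (fcomp p (\<lambda>j. vec_first (f j) c) g j)"
  then have "i < c" by simp
  with c[of j] have "i < c" "i < dim_vec (f j)" by linarith+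
  then show "vec_first (fcomp p f g j) c $ i = fcomp p (\<lambda>j. vec_first (f j) c) g j $ i"
    by (simp add: fcomp_def)
qed simp

lemma vec_last_fcomp:
  assumes "\<And>j. dim_vec (f j) = n" "q \<le> n"
  shows "(\<lambda>j. vec_last (fcomp p f g j) q) = fcomp p (\<lambda>j. vec_last (f j) q) g"
  by (rule ext, rule eq_vecI) (use assms in \<open>auto simp: fcomp_def\<close>)

lemma append_fcomp:
  assumes "\<And>j. dim_vec (f j) = c" "\<And>j. dim_vec (h j) = q"
  shows "fcomp p (\<lambda>j. f j @\<^sub>v h j) g = (\<lambda>j. fcomp p f g j @\<^sub>v fcomp p h g j)"
  by (rule ext, rule eq_vecI) (use assms in \<open>auto simp: fcomp_def\<close>)

lemma append_formal:
  "is_formal_map d c f \<Longrightarrow> is_formal_map d q h \<Longrightarrow> is_formal_map d (c + q) (\<lambda>j. f j @\<^sub>v h j)"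
  by (auto simp: is_formal_map_def append_hom_polys intro!: eq_vecI)

lemma vec_first_formal: "is_formal_map d n f \<Longrightarrow> c \<le> n \<Longrightarrow> is_formal_map d c (\<lambda>j. vec_first (f j) c)"
  by (auto simp: is_formal_map_def intro!: vec_first_hom_polys[of _ _ _ n] eq_vecI)

subsection \<open>Maps near the identity\<close>

text \<open>The nonlinear part of \<open>near_id p n e\<close> as a formal map of its own, starting
  at order 2.\<close>

definition tail2 :: "nat \<Rightarrow> formal_map \<Rightarrow> formal_map" where
  "tail2 n e k = (if k < 2 then 0\<^sub>v n else e k)"

abbreviation id_map :: "nat \<Rightarrow> nat \<Rightarrow> formal_map" where
  "id_map p n \<equiv> near_id p n (\<lambda>_. 0\<^sub>v n)"

lemma dim_block_vars [simp]: "dim_vec (block_vars k n) = n"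
  and index_block_vars [simp]: "i < n \<Longrightarrow> block_vars k n $ i = Var (k + i)"
  by (simp_all add: block_vars_def)

lemma near_id_formal:
  assumes "\<And>k. 2 \<le> k \<Longrightarrow> e k \<in> hom_polys d k n" "p + n \<le> d"
  shows "is_formal_map d n (near_id p n e)"
proof -
  have "near_id p n e k \<in> hom_polys d k n" for k
    using assms by (cases "k = 0 \<or> k = 1") (auto simp: near_id_def hom_polys_iff in_vars_Var)
  then show ?thesis by (simp add: is_formal_map_def near_id_def)
qed

lemma tail2_formal:
  assumes "\<And>k. 2 \<le> k \<Longrightarrow> e k \<in> hom_polys d k n"
  shows "is_formal_map d n (tail2 n e)"
  using assms by (simp add: is_formal_map_def tail2_def)

lemma trunc_near_id:
  assumes "l < n"
  shows "trunc k (near_id p n e) l = (if k = 0 then 0 else Var (p + l)) + trunc k (tail2 n e) l"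
proof -
  have *: "near_id p n e i $ l = (if i = 1 then Var (p + l) else 0) + tail2 n e i $ l" for i
    using assms by (simp add: near_id_def tail2_def)
  show ?thesis by (simp add: trunc_def * sum.distrib)
qed

lemma ord_ge_trunc_tail2:
  assumes "\<And>k. 2 \<le> k \<Longrightarrow> e k \<in> hom_polys d k n" "l < n"
  shows "ord_ge 2 (trunc k (tail2 n e) l)"
  unfolding trunc_def
proof (rule ord_ge_sum)
  fix i show "ord_ge 2 (tail2 n e i $ l)"
  proof (cases "i < 2")
    case False
    then have "homog i (tail2 n e i $ l)" using hom_polysD(2)[OF assms(1)[of i] assms(2)] by (simp add: tail2_def)
    with False show ?thesis by (intro ord_ge_mono[OF ord_ge_homog]) auto
  qed (simp add: tail2_def assms)
qed

lemma fcomp_near_id: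
  assumes e: "\<And>k. 2 \<le> k \<Longrightarrow> e k \<in> hom_polys (p + n) k n" and g: "is_formal_map d n g"
  shows "fcomp p (near_id p n e) g k = g k + fcomp p (tail2 n e) g k"
proof (rule eq_vecI)
  have dims: "dim_vec (near_id p n e k) = n" "dim_vec (tail2 n e k) = n" "dim_vec (g k) = n"
    using hom_polysD(1)[OF e] formal_mapD(3)[OF g] by (auto simp: near_id_def tail2_def not_less)
  fix l assume "l < dim_vec (g k + fcomp p (tail2 n e) g k)"
  then have l: "l < n" using dims by simp
  have "hom_part k (msubst (blk p n (trunc k g)) (if k = 0 then 0 else Var (p + l))) = g k $ l"
    using l formal_mapD(1)[OF g] by (auto simp: blk_def hom_part_trunc[OF g])
  then show "fcomp p (near_id p n e) g k $ l = (g k + fcomp p (tail2 n e) g k) $ l"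
    using l dims by (simp add: fcomp_nth trunc_near_id hom_part_add)
qed (use hom_polysD(1)[OF e] formal_mapD(3)[OF g] in \<open>auto simp: near_id_def tail2_def not_less\<close>)

text \<open>Changing g at order k changes a nonlinear expression in g only from order k + 1 on.
  Equations of the form g + e(g) = K are thus triangular in the order; cancellation and solvability
  both rest on this.\<close>

lemma fcomp_tail2_cong:
  assumes e: "\<And>k. 2 \<le> k \<Longrightarrow> e k \<in> hom_polys (p + n) k n"
    and g: "is_formal_map d n g" and h: "is_formal_map d' n h" and eq: "\<And>i. i < k \<Longrightarrow> g i = h i"
  shows "fcomp p (tail2 n e) g k = fcomp p (tail2 n e) h k"
proof (rule eq_vecI)
  have dims: "dim_vec (tail2 n e k) = n" "dim_vec (g k) = n" "dim_vec (h k) = n"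
    using hom_polysD(1)[OF e] formal_mapD(3)[OF g] formal_mapD(3)[OF h]
    by (auto simp: tail2_def not_less)
  fix l assume "l < dim_vec (fcomp p (tail2 n e) h k)"
  then have l: "l < n" using dims by simp
  let ?E = "trunc k (tail2 n e) l"
  have "ord_ge (2 + (k - 1)) (msubst (blk p n (trunc k g)) ?E - msubst (blk p n (trunc k h)) ?E)"
  proof (rule ord_ge_msubst_diff)
    show "ord_ge 2 ?E" by (rule ord_ge_trunc_tail2[OF e l])
    show "ord_ge 1 (blk p n (trunc k g) v)" "ord_ge 1 (blk p n (trunc k h) v)" for v
      using ord_ge_trunc[OF g] ord_ge_trunc[OF h] by (auto intro!: ord_ge_blk)
    have "ord_ge (Suc (k - 1)) (trunc k g s - trunc k h s)" if "s < n" for s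
      using that formal_mapD(1)[OF g] formal_mapD(1)[OF h] eq
      by (cases "k = 0")
         (auto simp: ord_ge_iff_hom_part hom_part_diff hom_part_trunc[OF g] hom_part_trunc[OF h])
    then show "ord_ge (Suc (k - 1)) (blk p n (trunc k g) v - blk p n (trunc k h) v)" for v
      by (auto simp: blk_def)
  qed
  then have "hom_part k (msubst (blk p n (trunc k g)) ?E - msubst (blk p n (trunc k h)) ?E) = 0"
    by (rule hom_part_ord_ge) simp
  then show "fcomp p (tail2 n e) g k $ l = fcomp p (tail2 n e) h k $ l"
    using l dims by (simp add: fcomp_nth[of g k n] fcomp_nth[of h k n] hom_part_diff)
qed simp

lemma near_id_cancel:
  assumes e: "\<And>k. 2 \<le> k \<Longrightarrow> e k \<in> hom_polys (p + n) k n"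
    and g: "is_formal_map d n g" and h: "is_formal_map d' n h"
    and eq: "agree_upto r (fcomp p (near_id p n e) g) (fcomp p (near_id p n e) h)"
  shows "agree_upto r g h"
proof -
  have "enat k \<le> r \<Longrightarrow> g k = h k" for k
  proof (induction k rule: less_induct)
    case (less k)
    have "g i = h i" if "i < k" for i
      using that less by (meson enat_ord_simps(1) less_imp_le order_trans)
    then have "fcomp p (tail2 n e) g k = fcomp p (tail2 n e) h k"
      by (intro fcomp_tail2_cong[OF e g h]) auto
    moreover have "g k + fcomp p (tail2 n e) g k = h k + fcomp p (tail2 n e) h k"
      using agree_uptoD[OF eq less.prems] fcomp_near_id[OF e g] fcomp_near_id[OF e h] by simp
    ultimately have eq: "g k + fcomp p (tail2 n e) g k = h k + fcomp p (tail2 n e) g k" by simp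
    have dims: "dim_vec (g k) = n" "dim_vec (h k) = n" "dim_vec (fcomp p (tail2 n e) g k) = n"
      using formal_mapD(3)[OF g] formal_mapD(3)[OF h] hom_polysD(1)[OF e]
      by (auto simp: tail2_def not_less)
    show ?case
    proof (rule eq_vecI)
      fix i assume "i < dim_vec (h k)"
      with dims arg_cong[OF eq, of "\<lambda>v. v $ i"] show "g k $ i = h k $ i" by simp
    qed (simp add: dims)
  qed
  then show ?thesis by (simp add: agree_upto_def)
qed

lemma course_of_values_rec:
  assumes "\<And>G H k. (\<And>i. i < k \<Longrightarrow> G i = H i) \<Longrightarrow> \<Phi> G k = \<Phi> H (k::nat)"
  shows "\<exists>G. \<forall>k. G k = \<Phi> G k"
proof (intro exI allI)
  fix k
  have "wfrec less_than \<Phi> k = \<Phi> (cut (wfrec less_than \<Phi>) less_than k) k"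
    by (rule wfrec) simp
  also have "\<dots> = \<Phi> (wfrec less_than \<Phi>) k"
    by (rule assms) (simp add: cut_apply)
  finally show "wfrec less_than \<Phi> k = \<Phi> (wfrec less_than \<Phi>) k" .
qed

text \<open>Division from the left by a near-identity map: order k of the equation reads G_k = K_k -
  (e o G)_k, and the right-hand side involves only earlier parts of G. The inverse change of
  variables is never formed.\<close>

lemma near_id_solve:
  assumes e: "\<And>k. 2 \<le> k \<Longrightarrow> e k \<in> hom_polys (p + n) k n"
    and K: "is_formal_map d n K" and "p \<le> d"
  shows "\<exists>G. is_formal_map d n G \<and> fcomp p (near_id p n e) G = K"
proof -
  \<comment> \<open>G is cut off at k, so that \<Phi> visibly depends on earlier values only;
    \<open>fcomp_tail2_cong\<close> removes the cut-off afterwards.\<close>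
  define \<Phi> where "\<Phi> G k = K k - fcomp p (tail2 n e) (\<lambda>i. if i < k then G i else 0\<^sub>v n) k" for G and k :: nat
  have "\<exists>G. \<forall>k. G k = \<Phi> G k"
  proof (rule course_of_values_rec)
    fix G H :: formal_map and k assume "\<And>i. i < k \<Longrightarrow> G i = H i"
    then have "(\<lambda>i. if i < k then G i else 0\<^sub>v n) = (\<lambda>i. if i < k then H i else 0\<^sub>v n)" by auto
    then show "\<Phi> G k = \<Phi> H k" by (simp add: \<Phi>_def)
  qed
  then obtain G where G: "\<And>k. G k = \<Phi> G k" by blast
  have tl: "is_formal_map (p + n) n (tail2 n e)" by (rule tail2_formal[OF e])
  have hom: "G k \<in> hom_polys d k n" and zero: "k = 0 \<Longrightarrow> G k = 0\<^sub>v n" for k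
  proof (induction k rule: less_induct)
    case (less k)
    let ?G = "\<lambda>i. if i < k then G i else 0\<^sub>v n"
    have g: "is_formal_map d n ?G" using less by (auto simp: is_formal_map_def)
    have f: "is_formal_map d n (fcomp p (tail2 n e) ?G)"
      by (rule fcomp_formal[OF tl g \<open>p \<le> d\<close>])
    { case 1 show ?case
        using formal_mapD(2)[OF f, of k] formal_mapD(2)[OF K, of k] G[of k]
        by (simp add: \<Phi>_def diff_hom_polys) }
    { case 2 then show ?case
        using formal_mapD(1)[OF f] formal_mapD(1)[OF K] G[of k] by (simp add: \<Phi>_def) }
  qed
  have g: "is_formal_map d n G" using hom zero by (simp add: is_formal_map_def)
  have "fcomp p (near_id p n e) G k = K k" for k
  proof -
    let ?G = "\<lambda>i. if i < k then G i else 0\<^sub>v n"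
    have "is_formal_map d n ?G" using hom zero by (auto simp: is_formal_map_def)
    then have eq: "G k = K k - fcomp p (tail2 n e) G k"
      using G[of k] fcomp_tail2_cong[OF e g, of d ?G k] by (simp add: \<Phi>_def)
    have dims: "dim_vec (K k) = n" "dim_vec (tail2 n e k) = n"
      using formal_mapD(3)[OF K] formal_mapD(3)[OF tl] by simp_all
    show ?thesis
    proof (rule eq_vecI)
      fix i assume "i < dim_vec (K k)"
      with dims arg_cong[OF eq, of "\<lambda>v. v $ i"]
      show "fcomp p (near_id p n e) G k $ i = K k $ i" by (simp add: fcomp_near_id[OF e g])
    qed (simp add: dims fcomp_near_id[OF e g])
  qed
  with g show ?thesis by blast
qed

lemma fcomp_id_left: "is_formal_map d n g \<Longrightarrow> fcomp p (id_map p n) g = g"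
proof (rule ext)
  fix k assume g: "is_formal_map d n g"
  have "fcomp p (tail2 n (\<lambda>_. 0\<^sub>v n)) g k = 0\<^sub>v n"
    by (rule eq_vecI) (auto simp: fcomp_def tail2_def subst_block_eq)
  moreover have "g k + 0\<^sub>v n = g k"
    by (rule eq_vecI) (simp_all add: formal_mapD(3)[OF g])
  moreover have "fcomp p (id_map p n) g k = g k + fcomp p (tail2 n (\<lambda>_. 0\<^sub>v n)) g k"
    by (rule fcomp_near_id[OF _ g]) simp
  ultimately show "fcomp p (id_map p n) g k = g k" by simp
qed

lemma fcomp_id_right:
  assumes f: "is_formal_map (p + n) m f"
  shows "fcomp p f (id_map p n) = f"
proof (rule ext)
  fix k
  have dims: "dim_vec (id_map p n k) = n" "dim_vec (f k) = m"
    using formal_mapD(3)[OF f] by (simp_all add: near_id_def)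
  show "fcomp p f (id_map p n) k = f k"
  proof (rule eq_vecI)
    fix l assume "l < dim_vec (f k)"
    then have l: "l < m" using dims by simp
    have "fcomp p f (id_map p n) k $ l = hom_part k (msubst (blk p n (trunc k (id_map p n))) (trunc k f l))"
      by (rule fcomp_nth) (simp_all add: dims l)
    also have "msubst (blk p n (trunc k (id_map p n))) (trunc k f l) = trunc k f l"
    proof (cases "k = 0")
      case True
      then show ?thesis using formal_mapD(1)[OF f] l by (simp add: trunc_def)
    next
      case False
      have "trunc k (id_map p n) s = Var (p + s)" if "s < n" for s
        using that False by (subst trunc_near_id) (simp_all add: trunc_def tail2_def)
      then have "blk p n (trunc k (id_map p n)) = Var"
        by (intro ext) (auto simp: blk_def)
      then show ?thesis by simp
    qed
    finally show "fcomp p f (id_map p n) k $ l = f k $ l"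
      using l by (simp add: hom_part_trunc[OF f])
  qed simp
qed

lemma id_map_formal: "p + n \<le> d \<Longrightarrow> is_formal_map d n (id_map p n)"
  by (rule near_id_formal) auto

text \<open>Terms of g of order 2 and more raise the order of a form of degree k, so in degree k
  only the linear part of g counts. This produces the term h(Jx,alpha) of the homological
  operator.\<close>

lemma msubst_linear:
  assumes "homog k f" "is_formal_map d n g" "in_vars (p + n) f" "k \<le> j" "0 < k"
  shows "hom_part k (msubst (blk p n (trunc j g)) f) = msubst (blk p n (\<lambda>s. g 1 $ s)) f"
proof -
  have "ord_ge (k + 1) (msubst (blk p n (trunc j g)) f - msubst (blk p n (\<lambda>s. g 1 $ s)) f)"
  proof (rule ord_ge_msubst_diff)
    show "ord_ge k f" using assms by (simp add: ord_ge_homog)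
    show "ord_ge 1 (blk p n (trunc j g) v)" for v
      using assms by (auto intro!: ord_ge_blk ord_ge_trunc)
    show "ord_ge 1 (blk p n (\<lambda>s. g 1 $ s) v)" for v
      unfolding One_nat_def
      by (rule ord_ge_blk) (use formal_mapD(4)[OF assms(2), of _ 1] in \<open>auto intro: ord_ge_homog\<close>)
    have "ord_ge (Suc 1) (trunc j g s - g 1 $ s)" if "s < n" for s
      using that assms formal_mapD(1)[OF assms(2)] formal_mapD(4)[OF assms(2), of s 1]
      by (auto simp: ord_ge_iff_hom_part hom_part_diff hom_part_trunc less_Suc_eq hom_part_homog)
    then show "ord_ge (Suc 1) (blk p n (trunc j g) v - blk p n (\<lambda>s. g 1 $ s) v)" for v
      by (auto simp: blk_def)
  qed
  then have "hom_part k (msubst (blk p n (trunc j g)) f - msubst (blk p n (\<lambda>s. g 1 $ s)) f) = 0"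
    by (rule hom_part_ord_ge) simp
  moreover have "homog k (msubst (blk p n (\<lambda>s. g 1 $ s)) f)"
  proof (rule homog_msubst[OF assms(1)])
    show "homog 1 (blk p n (\<lambda>s. g 1 $ s) v)" for v
      using formal_mapD(4)[OF assms(2), of _ 1] by (auto simp: blk_def)
  qed
  ultimately show ?thesis by (simp add: hom_part_diff hom_part_homog)
qed

subsection \<open>The normal form steps\<close>

text \<open>Row l of the block diagonal matrix with blocks J and \<open>CQ\<close>, applied to an
  arbitrary sequence of polynomials.\<close>

definition lin_op :: "nat \<Rightarrow> nat \<Rightarrow> real mat \<Rightarrow> real mat \<Rightarrow> nat \<Rightarrow> (nat \<Rightarrow> mpoly) \<Rightarrow> mpoly" where
  "lin_op c q J CQ l v =
     (if l < c then \<Sum>k<c. Const (J $$ (l, k)) * v k else \<Sum>k<q. Const (CQ $$ (l - c, k)) * v (c + k))"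

lemma index_Const_mult_mat_vec:
  assumes "A \<in> carrier_mat n m" "dim_vec v = m" "i < n"
  shows "(map_mat Const A *\<^sub>v v) $ i = (\<Sum>k<m. Const (A $$ (i, k)) * v $ k)"
  using assms by (auto simp: scalar_prod_def lessThan_atLeast0 intro!: sum.cong)

lemma dim_lin_part [simp]: "dim_row J = c \<Longrightarrow> dim_row CQ = q \<Longrightarrow> dim_vec (lin_part p c q J CQ) = c + q"
  by (simp add: lin_part_def)

lemma lin_part_nth:
  assumes "J \<in> carrier_mat c c" "CQ \<in> carrier_mat q q" "l < c + q"
  shows "lin_part p c q J CQ $ l = lin_op c q J CQ l (\<lambda>s. Var (p + s))"
proof (cases "l < c")
  case True
  then have "lin_part p c q J CQ $ l = (map_mat Const J *\<^sub>v x_vars p c) $ l"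
    using assms by (simp add: lin_part_def)
  also have "\<dots> = (\<Sum>k<c. Const (J $$ (l, k)) * x_vars p c $ k)"
    by (rule index_Const_mult_mat_vec) (use assms True in auto)
  finally show ?thesis using True by (simp add: lin_op_def)
next
  case False
  then have "lin_part p c q J CQ $ l = (map_mat Const CQ *\<^sub>v y_vars p c q) $ (l - c)"
    using assms by (simp add: lin_part_def)
  also have "\<dots> = (\<Sum>k<q. Const (CQ $$ (l - c, k)) * y_vars p c q $ k)"
    by (rule index_Const_mult_mat_vec) (use assms False in auto)
  finally show ?thesis using False by (simp add: lin_op_def add.assoc)
qed

lemma lin_op_add: "lin_op c q J CQ l (\<lambda>s. v s + w s) = lin_op c q J CQ l v + lin_op c q J CQ l w"
  by (simp add: lin_op_def algebra_simps sum.distrib)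

lemma lin_op_smult: "lin_op c q J CQ l (\<lambda>s. a * v s) = a * lin_op c q J CQ l v"
  by (simp add: lin_op_def sum_distrib_left algebra_simps)

lemma lin_op_cong:
  "l < c + q \<Longrightarrow> (\<And>s. s < c + q \<Longrightarrow> v s = w s) \<Longrightarrow> lin_op c q J CQ l v = lin_op c q J CQ l w"
  by (simp add: lin_op_def)

lemma msubst_lin_op: "msubst \<sigma> (lin_op c q J CQ l v) = lin_op c q J CQ l (\<lambda>s. msubst \<sigma> (v s))"
  by (simp add: lin_op_def)

lemma homog_lin_op: "(\<And>s. s < c + q \<Longrightarrow> homog k (v s)) \<Longrightarrow> homog k (lin_op c q J CQ l v)"
  by (auto simp: lin_op_def intro!: homog_sum homog_smult)

lemma in_vars_lin_op: "(\<And>s. s < c + q \<Longrightarrow> in_vars d (v s)) \<Longrightarrow> in_vars d (lin_op c q J CQ l v)"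
  by (auto simp: lin_op_def intro!: in_vars_sum in_vars_smult)

lemma lin_part_hom_polys:
  assumes "J \<in> carrier_mat c c" "CQ \<in> carrier_mat q q" "p + (c + q) \<le> d"
  shows "lin_part p c q J CQ \<in> hom_polys d 1 (c + q)"
  using assms
  by (auto simp: hom_polys_iff lin_part_nth intro!: homog_lin_op in_vars_lin_op in_vars_Var)

section \<open>The homological operator in components\<close>

abbreviation lin_subst :: "nat \<Rightarrow> nat \<Rightarrow> real mat \<Rightarrow> nat \<Rightarrow> mpoly" where
  "lin_subst p c J \<equiv> blk p c (\<lambda>s. \<Sum>k<c. Const (J $$ (s, k)) * Var (p + k))"

lemma dim_M_op [simp]: "dim_vec (M_op p J A h) = dim_row A"
  by (simp add: M_op_def)

lemma M_op_nth:
  assumes "J \<in> carrier_mat c c" "A \<in> carrier_mat q q" "dim_vec h = q" "i < q"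
  shows "M_op p J A h $ i = msubst (lin_subst p c J) (h $ i) - (\<Sum>k<q. Const (A $$ (i, k)) * h $ k)"
proof -
  have "blk p c (($) (map_mat Const J *\<^sub>v x_vars p c)) = lin_subst p c J"
    by (rule blk_cong) (subst index_Const_mult_mat_vec[OF assms(1)], simp_all)
  then have "M_op p J A h $ i = msubst (lin_subst p c J) (h $ i) - (map_mat Const A *\<^sub>v h) $ i"
    using assms by (simp add: M_op_def subst_block_eq del: index_mult_mat_vec)
  then show ?thesis by (simp only: index_Const_mult_mat_vec[OF assms(2,3,4)])
qed

lemma dim_M_pair [simp]: "dim_row J = c \<Longrightarrow> dim_row CQ = q \<Longrightarrow> dim_vec (M_pair p c q J CQ h) = c + q"
  by (simp add: M_pair_def)

lemma M_pair_nth: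
  assumes "J \<in> carrier_mat c c" "CQ \<in> carrier_mat q q" "dim_vec h = c + q" "l < c + q"
  shows "M_pair p c q J CQ h $ l = msubst (lin_subst p c J) (h $ l) - lin_op c q J CQ l (\<lambda>s. h $ s)"
proof (cases "l < c")
  case True
  then have "M_pair p c q J CQ h $ l = M_op p J J (vec_first h c) $ l"
    using assms by (simp add: M_pair_def)
  with True assms show ?thesis by (simp add: M_op_nth[where q = c] lin_op_def)
next
  case False
  then have "M_pair p c q J CQ h $ l = M_op p J CQ (vec_last h q) $ (l - c)"
    using assms by (simp add: M_pair_def)
  with False assms show ?thesis by (simp add: M_op_nth[where q = q] lin_op_def)
qed

lemma homog_lin_subst: "homog 1 (lin_subst p c J v)"
  by (auto simp: blk_def intro!: homog_sum homog_smult)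

lemma in_vars_lin_subst: "p + c \<le> d \<Longrightarrow> v < d \<Longrightarrow> in_vars d (lin_subst p c J v)"
  by (auto simp: blk_def intro!: in_vars_sum in_vars_smult in_vars_Var)

lemma M_op_hom_polys:
  assumes "J \<in> carrier_mat c c" "A \<in> carrier_mat q q" "h \<in> hom_polys d j q" "p + c \<le> d"
  shows "M_op p J A h \<in> hom_polys d j q"
proof -
  have "homog j (msubst (lin_subst p c J) (h $ i))" "in_vars d (msubst (lin_subst p c J) (h $ i))" if "i < q" for i
  proof -
    show "homog j (msubst (lin_subst p c J) (h $ i))"
      by (rule homog_msubst[OF hom_polysD(2)[OF assms(3) that] homog_lin_subst])
    show "in_vars d (msubst (lin_subst p c J) (h $ i))"
    proof (rule in_vars_msubst)
      fix m v assume "m \<in> keys (h $ i)" "v \<in> keys m"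
      with hom_polysD(3)[OF assms(3) that] have "v < d" by (auto simp: in_vars_def)
      then show "in_vars d (lin_subst p c J v)" by (rule in_vars_lin_subst[OF assms(4)])
    qed
  qed
  moreover have "homog j (\<Sum>k<q. Const (A $$ (i, k)) * h $ k)" "in_vars d (\<Sum>k<q. Const (A $$ (i, k)) * h $ k)" for i
    using hom_polysD(2,3)[OF assms(3)] by (auto intro!: homog_sum homog_smult in_vars_sum in_vars_smult)
  ultimately show ?thesis
    unfolding hom_polys_iff using assms hom_polysD(1)[OF assms(3)]
    by (auto simp: M_op_nth[where q = q] homog_diff in_vars_diff)
qed

lemma M_pair_hom_polys:
  assumes "J \<in> carrier_mat c c" "CQ \<in> carrier_mat q q" "h \<in> hom_polys d j (c + q)" "p + c \<le> d"
  shows "M_pair p c q J CQ h \<in> hom_polys d j (c + q)"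
  unfolding M_pair_def
  by (intro append_hom_polys M_op_hom_polys[OF assms(1)] vec_first_hom_polys[OF assms(3)]
    vec_last_hom_polys[OF assms(3)] assms(1,2,4)) auto

lemma nf_step_formal:
  assumes "2 \<le> j \<Longrightarrow> U j \<in> hom_polys d j n" "p + n \<le> d"
  shows "is_formal_map d n (nf_step p n U j)"
  unfolding nf_step_def by (rule near_id_formal) (use assms in \<open>auto simp: smult_hom_polys\<close>)

lemma nf_step_agree_id: "agree_upto (enat (j - 1)) (nf_step p n U j) (id_map p n)"
  by (auto simp: agree_upto_def nf_step_def near_id_def)

text \<open>With \<Theta> = z + u and u of order j, the order j part of G o \<Theta> is G_j + L u,
  and that of \<Theta> o K is K_j + u(Jx,alpha). The difference of the two corrections is the
  homological operator applied to \<open>U j\<close>, divided by j!.\<close>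

lemma conj_step:
  assumes J: "J \<in> carrier_mat c c" and CQ: "CQ \<in> carrier_mat q q" and n: "n = c + q"
    and G: "is_formal_map (p + n) n G" and K: "is_formal_map (p + n) n K"
    and G1: "G 1 = lin_part p c q J CQ" and U: "U j \<in> hom_polys (p + c) j n" and j: "2 \<le> j"
    and eq: "agree_upto (enat j) (fcomp p G (nf_step p n U j)) (fcomp p (nf_step p n U j) K)"
  shows "\<And>i. i < j \<Longrightarrow> K i = G i"
    and "K j = G j - Const (1 / fact j) \<cdot>\<^sub>v M_pair p c q J CQ (U j)"
proof -
  define e where "e k = (if k = j then Const (1 / fact j) \<cdot>\<^sub>v U j else 0\<^sub>v n)" for k
  define u where "u s = Const (1 / fact j) * U j $ s" for s
  let ?T = "nf_step p n U j"
  have T: "?T = near_id p n e" by (simp add: nf_step_def e_def[abs_def])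
  have e: "e k \<in> hom_polys (p + c) k n" for k
    using U by (auto simp: e_def smult_hom_polys)
  have e': "e k \<in> hom_polys (p + n) k n" for k
    by (rule hom_polys_mono[OF e]) (simp add: n)
  have Tf: "is_formal_map (p + n) n ?T" unfolding T by (rule near_id_formal[OF e']) simp
  have less: "agree_upto (enat (j - 1)) K G"
  proof -
    have "agree_upto (enat (j - 1)) K (fcomp p (id_map p n) K)"
      by (simp add: fcomp_id_left[OF K])
    also have "agree_upto (enat (j - 1)) \<dots> (fcomp p ?T K)"
      by (intro fcomp_cong agree_upto_sym[OF nf_step_agree_id] agree_upto_refl)
    also have "agree_upto (enat (j - 1)) \<dots> (fcomp p G ?T)"
      by (intro agree_upto_sym[OF agree_upto_mono[OF eq]]) simp
    also have "agree_upto (enat (j - 1)) \<dots> (fcomp p G (id_map p n))"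
      by (intro fcomp_cong nf_step_agree_id agree_upto_refl)
    finally show ?thesis by (simp add: fcomp_id_right[OF G])
  qed
  then show KG: "\<And>i. i < j \<Longrightarrow> K i = G i"
    by (simp add: agree_upto_enat)
  have truncT: "trunc j ?T s = Var (p + s) + u s" if "s < n" for s
  proof -
    have "trunc j (tail2 n e) s = (\<Sum>i\<le>j. if i = j then u s else 0)"
      unfolding trunc_def using that j U
      by (intro sum.cong refl) (auto simp: tail2_def e_def u_def hom_polys_iff)
    then show ?thesis using that j by (simp add: T trunc_near_id)
  qed
  have dU: "dim_vec (U j) = n" using U by (simp add: hom_polys_iff)
  have u: "homog j (u l)" "in_vars (p + c) (u l)" if "l < n" for l
    using that U by (auto simp: u_def hom_polys_iff homog_smult in_vars_smult)
  show "K j = G j - Const (1 / fact j) \<cdot>\<^sub>v M_pair p c q J CQ (U j)"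
  proof (rule eq_vecI)
    have dims: "dim_vec (K k) = n" "dim_vec (G k) = n" "dim_vec (?T k) = n" "dim_vec (tail2 n e k) = n" for k
      using formal_mapD(3)[OF K] formal_mapD(3)[OF G] formal_mapD(3)[OF Tf]
        formal_mapD(3)[OF tail2_formal[OF e]] by simp_all
    fix l assume "l < dim_vec (G j - Const (1 / fact j) \<cdot>\<^sub>v M_pair p c q J CQ (U j))"
    then have l: "l < n" using dims J CQ n by simp
    have "trunc j (tail2 n e) l = u l"
      using truncT[OF l] j l by (simp add: T trunc_near_id)
    then have "fcomp p ?T K j $ l = K j $ l + hom_part j (msubst (blk p n (trunc j K)) (u l))"
      using l by (simp add: T fcomp_near_id[OF e' K] dims fcomp_nth[of K j n])
    also have "hom_part j (msubst (blk p n (trunc j K)) (u l)) = msubst (blk p n (\<lambda>s. K 1 $ s)) (u l)"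
      by (rule msubst_linear[OF u(1)[OF l] K]) (use u(2)[OF l] j n in \<open>auto elim: in_vars_mono\<close>)
    \<comment> \<open>u contains no y, so of the linear part of K only the block J is met.\<close>
    also have "\<dots> = msubst (lin_subst p c J) (u l)"
    proof (rule msubst_cong)
      fix m v assume "m \<in> keys (u l)" "v \<in> keys m"
      with u(2)[OF l] have "v < p + c" by (auto simp: in_vars_def)
      then show "blk p n (($) (K 1)) v = lin_subst p c J v"
        using KG[of 1] j n G1 by (auto simp: blk_def lin_part_nth[OF J CQ] lin_op_def)
    qed
    finally have lhs: "fcomp p ?T K j $ l = K j $ l + msubst (lin_subst p c J) (u l)" .
    have G1l: "G 1 $ l = lin_op c q J CQ l (\<lambda>s. Var (p + s))"
      using l n by (simp only: G1 lin_part_nth[OF J CQ])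
    \<comment> \<open>The nonlinear part of G up to order j. Moving its argument by u, of order j,
      alters it only from order 2 + (j - 1) = j + 1 on, so it contributes the unchanged G_j.\<close>
    define r where "r = trunc j G l - G 1 $ l"
    have "ord_ge 2 r"
      using l j formal_mapD(1)[OF G] formal_mapD(4)[OF G l, of 1]
      by (auto simp: r_def ord_ge_iff_hom_part hom_part_diff hom_part_trunc[OF G] hom_part_homog less_2_cases_iff)
    then have "ord_ge (2 + (j - 1)) (msubst (blk p n (trunc j ?T)) r - msubst Var r)"
    proof (rule ord_ge_msubst_diff)
      show "ord_ge 1 (blk p n (trunc j ?T) v)" for v
        unfolding One_nat_def by (rule ord_ge_blk) (rule ord_ge_trunc[OF Tf])
      have "ord_ge (Suc (j - 1)) (trunc j ?T s - Var (p + s))" if "s < n" for s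
        using truncT[OF that] u(1)[OF that] j by (simp add: ord_ge_homog)
      then show "ord_ge (Suc (j - 1)) (blk p n (trunc j ?T) v - Var v)" for v
        by (cases "p \<le> v \<and> v < p + n") (auto simp: blk_def dest!: meta_spec[of _ "v - p"])
    qed simp
    then have "hom_part j (msubst (blk p n (trunc j ?T)) r - r) = 0"
      by (intro hom_part_ord_ge[of "2 + (j - 1)"]) auto
    moreover have "hom_part j r = G j $ l"
      using l j formal_mapD(4)[OF G l, of 1] by (simp add: r_def hom_part_diff hom_part_trunc[OF G] hom_part_homog)
    ultimately have "hom_part j (msubst (blk p n (trunc j ?T)) r) = G j $ l"
      by (simp add: hom_part_diff)
    moreover have "hom_part j (msubst (blk p n (trunc j ?T)) (G 1 $ l)) = lin_op c q J CQ l u"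
    proof -
      have "msubst (blk p n (trunc j ?T)) (G 1 $ l) = lin_op c q J CQ l (\<lambda>s. Var (p + s) + u s)"
        unfolding G1l msubst_lin_op
        by (rule lin_op_cong) (use l n truncT in \<open>auto simp: blk_def\<close>)
      moreover have "homog 1 (lin_op c q J CQ l (\<lambda>s. Var (p + s)))"
        by (rule homog_lin_op) simp
      moreover have "homog j (lin_op c q J CQ l u)"
        by (rule homog_lin_op) (use u n in auto)
      ultimately show ?thesis using j by (simp add: lin_op_add hom_part_add hom_part_homog)
    qed
    ultimately have "hom_part j (msubst (blk p n (trunc j ?T)) (r + G 1 $ l)) = G j $ l + lin_op c q J CQ l u"
      by (simp only: msubst_simps hom_part_add)
    then have "fcomp p G ?T j $ l = G j $ l + lin_op c q J CQ l u"
      using l by (simp add: fcomp_nth[of ?T j n] dims r_def)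
    moreover have "fcomp p G ?T j = fcomp p ?T K j" by (rule agree_uptoD[OF eq]) simp
    ultimately have "K j $ l = G j $ l + lin_op c q J CQ l u - msubst (lin_subst p c J) (u l)"
      using lhs by (simp add: eq_diff_eq)
    also have "\<dots> = G j $ l - Const (1 / fact j) * M_pair p c q J CQ (U j) $ l"
    proof -
      have "msubst (lin_subst p c J) (u l) = Const (1 / fact j) * msubst (lin_subst p c J) (U j $ l)"
        "lin_op c q J CQ l u = Const (1 / fact j) * lin_op c q J CQ l (\<lambda>s. U j $ s)"
        by (simp_all only: u_def[abs_def] lin_op_smult msubst_simps)
      moreover have "M_pair p c q J CQ (U j) $ l = msubst (lin_subst p c J) (U j $ l) - lin_op c q J CQ l (\<lambda>s. U j $ s)"
        by (rule M_pair_nth[OF J CQ]) (use l n dU in auto)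
      ultimately show ?thesis by (simp only: right_diff_distrib) simp
    qed
    finally show "K j $ l = (G j - Const (1 / fact j) \<cdot>\<^sub>v M_pair p c q J CQ (U j)) $ l"
      using l dims J CQ n by simp
  qed (use formal_mapD(3)[OF K] J CQ n in simp)
qed

section \<open>Composites of the steps\<close>

lemma hom_polys_lift: "h \<in> hom_polys (p + c) j m \<Longrightarrow> c \<le> n \<Longrightarrow> h \<in> hom_polys (p + n) j m"
  by (rule hom_polys_mono) auto

lemma vec_first_near_id:
  "c \<le> n \<Longrightarrow> (\<lambda>k. vec_first (near_id p n e k) c) = near_id p c (\<lambda>k. vec_first (e k) c)"
  by (rule ext, rule eq_vecI) (auto simp: near_id_def)

lemma vec_first_id_map: "c \<le> n \<Longrightarrow> (\<lambda>k. vec_first (id_map p n k) c) = id_map p c"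
proof (rule ext, rule eq_vecI)
  fix k i assume "c \<le> n" "i < dim_vec (id_map p c k)"
  then show "vec_first (id_map p n k) c $ i = id_map p c k $ i"
    by (simp add: near_id_def split: if_splits)
qed (simp add: near_id_def)

lemma vec_first_nf_step:
  assumes "c \<le> n" "2 \<le> j \<Longrightarrow> dim_vec (U j) = n"
  shows "(\<lambda>k. vec_first (nf_step p n U j k) c) = nf_step p c (\<lambda>j. vec_first (U j) c) j"
proof -
  have "vec_first (if k = j then Const (1 / fact j) \<cdot>\<^sub>v U j else 0\<^sub>v n) c =
      (if k = j then Const (1 / fact j) \<cdot>\<^sub>v vec_first (U j) c else 0\<^sub>v c)" if "2 \<le> k" for k
    using assms that by (auto intro!: eq_vecI)
  then show ?thesis
    unfolding nf_step_def vec_first_near_id[OF assms(1)] by (auto simp: near_id_def fun_eq_iff)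
qed

text \<open>Changes whose nonlinear part depends on (x,alpha) alone are closed under composition:
  the outer nonlinear part sees only the x-components of the inner change, which are again functions
  of (x,alpha). This gives the final change of variables the form claimed for it.\<close>

lemma near_id_comp:
  assumes E: "\<And>k. 2 \<le> k \<Longrightarrow> E k \<in> hom_polys (p + c) k n" and F: "\<And>k. 2 \<le> k \<Longrightarrow> F k \<in> hom_polys (p + c) k n"
    and "c \<le> n"
  shows "\<exists>E'. (\<forall>k\<ge>2. E' k \<in> hom_polys (p + c) k n) \<and> fcomp p (near_id p n E) (near_id p n F) = near_id p n E'"
proof -
  have F': "is_formal_map (p + n) n (near_id p n F)"
    by (rule near_id_formal[OF hom_polys_lift[OF F \<open>c \<le> n\<close>]]) simp_all
  have tl: "is_formal_map (p + c) n (tail2 n E)" by (rule tail2_formal[OF E])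
  have Fc: "is_formal_map (p + c) c (near_id p c (\<lambda>k. vec_first (F k) c))"
    by (rule near_id_formal) (use F \<open>c \<le> n\<close> in \<open>auto intro!: vec_first_hom_polys[of _ _ _ n]\<close>)
  have *: "is_formal_map (p + c) n (fcomp p (tail2 n E) (near_id p n F))"
    unfolding fcomp_vec_first[OF tl F' \<open>c \<le> n\<close>] vec_first_near_id[OF \<open>c \<le> n\<close>]
    by (rule fcomp_formal[OF tl Fc]) simp
  let ?E = "\<lambda>k. F k + fcomp p (tail2 n E) (near_id p n F) k"
  have "near_id p n ?E k = fcomp p (near_id p n E) (near_id p n F) k" for k
  proof -
    have "fcomp p (near_id p n E) (near_id p n F) k = near_id p n F k + fcomp p (tail2 n E) (near_id p n F) k"
      by (rule fcomp_near_id[OF hom_polys_lift[OF E \<open>c \<le> n\<close>] F'])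
    moreover have "fcomp p (tail2 n E) (near_id p n F) 0 = 0\<^sub>v n" by (rule formal_mapD(1)[OF *])
    moreover have "fcomp p (tail2 n E) (near_id p n F) 1 = 0\<^sub>v n"
      by (rule eq_vecI) (auto simp: fcomp_def tail2_def subst_block_eq)
    ultimately show ?thesis
      by (auto simp: near_id_def intro!: eq_vecI)
  qed
  moreover have "?E k \<in> hom_polys (p + c) k n" if "2 \<le> k" for k
    by (rule add_hom_polys[OF F[OF that] formal_mapD(2)[OF *]])
  ultimately show ?thesis by (intro exI[of _ ?E]) auto
qed

lemma nf_steps_near_id:
  assumes U: "\<And>j. 2 \<le> j \<Longrightarrow> U j \<in> hom_polys (p + c) j n" and "c \<le> n"
  shows "\<exists>E. (\<forall>k\<ge>2. E k \<in> hom_polys (p + c) k n) \<and> nf_steps p n U j = near_id p n E"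
proof (induction j)
  case (Suc j)
  show ?case
  proof (cases "j = 0")
    case False
    from Suc obtain E where E: "\<And>k. 2 \<le> k \<Longrightarrow> E k \<in> hom_polys (p + c) k n" "nf_steps p n U j = near_id p n E"
      by blast
    have "\<exists>E'. (\<forall>k\<ge>2. E' k \<in> hom_polys (p + c) k n) \<and>
      fcomp p (near_id p n E) (near_id p n (\<lambda>k. if k = Suc j then Const (1 / fact (Suc j)) \<cdot>\<^sub>v U (Suc j) else 0\<^sub>v n))
       = near_id p n E'"
      by (rule near_id_comp[OF E(1) _ \<open>c \<le> n\<close>]) (use U in \<open>auto simp: smult_hom_polys simp del: fact_Suc\<close>)
    then show ?thesis using False E(2) by (simp add: nf_step_def del: fact_Suc)
  qed (auto intro!: exI[of _ "\<lambda>_. 0\<^sub>v n"])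
qed (auto intro!: exI[of _ "\<lambda>_. 0\<^sub>v n"])

lemma nf_steps_formal:
  assumes "\<And>j. 2 \<le> j \<Longrightarrow> U j \<in> hom_polys (p + c) j n" "c \<le> n"
  shows "is_formal_map (p + n) n (nf_steps p n U j)"
proof -
  obtain E where E: "\<And>k. 2 \<le> k \<Longrightarrow> E k \<in> hom_polys (p + c) k n" "nf_steps p n U j = near_id p n E"
    using nf_steps_near_id[OF assms, of j] by blast
  show ?thesis unfolding E(2)
    by (rule near_id_formal[OF hom_polys_lift[OF E(1) \<open>c \<le> n\<close>]]) simp_all
qed

text \<open>By the same independence of y, the x-components of the composite are the composite of
  the x-components; the latter act on the map reduced to the invariant manifold.\<close>

lemma vec_first_nf_steps:
  assumes U: "\<And>j. 2 \<le> j \<Longrightarrow> U j \<in> hom_polys (p + c) j n" and "c \<le> n"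
  shows "(\<lambda>k. vec_first (nf_steps p n U j k) c) = nf_steps p c (\<lambda>j. vec_first (U j) c) j"
proof (induction j)
  case 0
  show ?case using vec_first_id_map[OF \<open>c \<le> n\<close>] by simp
next
  case (Suc j)
  show ?case
  proof (cases "j = 0")
    case True
    then show ?thesis using vec_first_id_map[OF \<open>c \<le> n\<close>] by simp
  next
    case False
    obtain E where E0: "(\<forall>k\<ge>2. E k \<in> hom_polys (p + c) k n) \<and> nf_steps p n U j = near_id p n E"
      using nf_steps_near_id[where U = U and p = p and c = c and n = n and j = j] U \<open>c \<le> n\<close> by blast
    then have E: "\<And>k. 2 \<le> k \<Longrightarrow> E k \<in> hom_polys (p + c) k n" "nf_steps p n U j = near_id p n E"
      by simp_all
    let ?S = "nf_steps p n U j" and ?T = "nf_step p n U (Suc j)"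
    have S: "is_formal_map (p + n) n ?S" by (rule nf_steps_formal[OF U \<open>c \<le> n\<close>])
    have T: "is_formal_map (p + n) n ?T"
      by (rule nf_step_formal[OF hom_polys_lift[OF U \<open>c \<le> n\<close>]]) simp_all
    have Sc: "is_formal_map (p + c) c (\<lambda>k. vec_first (?S k) c)"
      unfolding E(2) vec_first_near_id[OF \<open>c \<le> n\<close>]
      by (rule near_id_formal) (use E(1) \<open>c \<le> n\<close> in \<open>auto intro!: vec_first_hom_polys[of _ _ _ n]\<close>)
    have "(\<lambda>k. vec_first (fcomp p ?S ?T k) c) = fcomp p (\<lambda>k. vec_first (?S k) c) ?T"
      by (rule vec_first_fcomp) (use formal_mapD(3)[OF S] \<open>c \<le> n\<close> in simp)
    also have "\<dots> = fcomp p (\<lambda>k. vec_first (?S k) c) (\<lambda>k. vec_first (?T k) c)"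
      by (rule fcomp_vec_first[OF Sc T \<open>c \<le> n\<close>])
    also have "(\<lambda>k. vec_first (?T k) c) = nf_step p c (\<lambda>j. vec_first (U j) c) (Suc j)"
      by (rule vec_first_nf_step[OF \<open>c \<le> n\<close>]) (use U in \<open>auto simp: hom_polys_iff\<close>)
    finally show ?thesis using False Suc by simp
  qed
qed

lemma nf_steps_agree:
  assumes U: "\<And>j. 2 \<le> j \<Longrightarrow> U j \<in> hom_polys (p + c) j n" and "c \<le> n" "j \<le> k"
  shows "agree_upto (enat j) (nf_steps p n U j) (nf_steps p n U k)"
  using \<open>j \<le> k\<close>
proof (induction k rule: dec_induct)
  case (step k)
  show ?case
  proof (cases "k = 0")
    case True
    then show ?thesis using step by simp
  next
    case False
    have S: "is_formal_map (p + n) n (nf_steps p n U k)" by (rule nf_steps_formal[OF U \<open>c \<le> n\<close>])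
    have "agree_upto (enat k) (nf_steps p n U (Suc k)) (fcomp p (nf_steps p n U k) (id_map p n))"
      using False nf_step_agree_id[of "Suc k"] by (simp add: fcomp_cong)
    then have "agree_upto (enat j) (nf_steps p n U (Suc k)) (nf_steps p n U k)"
      using step.hyps by (simp add: fcomp_id_right[OF S] agree_upto_mono)
    with step.IH show ?thesis by (blast intro: agree_upto_trans agree_upto_sym)
  qed
qed simp

subsection \<open>Operators annihilated by a product of linear factors\<close>

text \<open>Operators act on all complex functions on a set; invariant subspaces are given
  separately as sets of functions.\<close>

definition lin_map :: "(('x \<Rightarrow> complex) \<Rightarrow> 'y \<Rightarrow> complex) \<Rightarrow> bool" where
  "lin_map T \<longleftrightarrow> (\<forall>\<phi> \<psi>. T (\<lambda>y. \<phi> y + \<psi> y) = (\<lambda>x. T \<phi> x + T \<psi> x)) \<and>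
     (\<forall>a \<phi>. T (\<lambda>y. a * \<phi> y) = (\<lambda>x. a * T \<phi> x))"

definition shift :: "(('x \<Rightarrow> complex) \<Rightarrow> 'x \<Rightarrow> complex) \<Rightarrow> complex \<Rightarrow> ('x \<Rightarrow> complex) \<Rightarrow> 'x \<Rightarrow> complex" where
  "shift T \<sigma> \<phi> = (\<lambda>x. T \<phi> x - \<sigma> * \<phi> x)"

primrec shifts :: "(('x \<Rightarrow> complex) \<Rightarrow> 'x \<Rightarrow> complex) \<Rightarrow> complex list \<Rightarrow> ('x \<Rightarrow> complex) \<Rightarrow> 'x \<Rightarrow> complex" where
  "shifts T [] \<phi> = \<phi>"
| "shifts T (\<sigma> # xs) \<phi> = shifts T xs (shift T \<sigma> \<phi>)"

text \<open>Annihilation by the product of the factors T - \<sigma> over the list, repetitions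
  included. It can be stated for a single \<phi> without decomposing it into generalized
  eigenvectors.\<close>

definition kills :: "(('x \<Rightarrow> complex) \<Rightarrow> 'x \<Rightarrow> complex) \<Rightarrow> complex list \<Rightarrow> ('x \<Rightarrow> complex) \<Rightarrow> bool" where
  "kills T xs \<phi> \<longleftrightarrow> shifts T xs \<phi> = (\<lambda>_. 0)"

lemma lin_mapD:
  assumes "lin_map T"
  shows "T (\<lambda>y. \<phi> y + \<psi> y) = (\<lambda>x. T \<phi> x + T \<psi> x)" "T (\<lambda>y. a * \<phi> y) = (\<lambda>x. a * T \<phi> x)"
  using assms unfolding lin_map_def by blast+

lemma lin_map_zero: "lin_map T \<Longrightarrow> T (\<lambda>_. 0) = (\<lambda>_. 0)"
  using lin_mapD(2)[of T 0 "\<lambda>_. 0"] by simp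

lemma lin_map_diff: "lin_map T \<Longrightarrow> T (\<lambda>y. \<phi> y - \<psi> y) = (\<lambda>x. T \<phi> x - T \<psi> x)"
  using lin_mapD(1)[of T \<phi> "\<lambda>y. - 1 * \<psi> y"] lin_mapD(2)[of T "- 1" \<psi>] by simp

lemma lin_map_sum:
  "lin_map T \<Longrightarrow> T (\<lambda>y. \<Sum>k\<in>A. \<phi> k y) = (\<lambda>x. \<Sum>k\<in>A. T (\<phi> k) x)"
proof (induction A rule: infinite_finite_induct)
  case (insert a A)
  have "T (\<lambda>y. \<phi> a y + (\<Sum>k\<in>A. \<phi> k y)) = (\<lambda>x. T (\<phi> a) x + T (\<lambda>y. \<Sum>k\<in>A. \<phi> k y) x)"
    by (rule lin_mapD(1)[OF insert.prems])
  with insert show ?case by simp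
qed (simp_all add: lin_map_zero)

lemma lin_map_shift: "lin_map T \<Longrightarrow> lin_map (shift T \<sigma>)"
  by (simp add: lin_map_def shift_def fun_eq_iff algebra_simps)

lemma lin_map_comp: "lin_map T \<Longrightarrow> lin_map R \<Longrightarrow> lin_map (\<lambda>\<phi>. T (R \<phi>))"
  by (simp add: lin_map_def)

lemma lin_map_shifts: "lin_map T \<Longrightarrow> lin_map (shifts T xs)"
proof (induction xs)
  case (Cons \<sigma> xs)
  have "lin_map (\<lambda>\<phi>. shifts T xs (shift T \<sigma> \<phi>))"
    by (rule lin_map_comp[OF Cons.IH[OF Cons.prems] lin_map_shift[OF Cons.prems]])
  then show ?case by (simp add: lin_map_def)
qed (simp add: lin_map_def)

lemma shift_commute:
  assumes "lin_map T"
  shows "shift T \<sigma> (shift T \<tau> \<phi>) = shift T \<tau> (shift T \<sigma> \<phi>)"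
  unfolding shift_def lin_map_diff[OF assms] lin_mapD(2)[OF assms] by (simp add: algebra_simps)

lemma shifts_shift: "lin_map T \<Longrightarrow> shifts T xs (shift T \<sigma> \<phi>) = shift T \<sigma> (shifts T xs \<phi>)"
proof (induction xs arbitrary: \<phi>)
  case (Cons a xs)
  then show ?case by (simp add: shift_commute[of T a \<sigma> \<phi>])
qed simp

lemma shifts_append: "shifts T (xs @ ys) \<phi> = shifts T ys (shifts T xs \<phi>)"
  by (induction xs arbitrary: \<phi>) simp_all

lemma shifts_commute: "lin_map T \<Longrightarrow> shifts T ys (shifts T xs \<phi>) = shifts T xs (shifts T ys \<phi>)"
  by (induction xs arbitrary: \<phi>) (simp_all add: shifts_shift)

lemma kills_append1: "lin_map T \<Longrightarrow> kills T xs \<phi> \<Longrightarrow> kills T (xs @ ys) \<phi>"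
  by (simp add: kills_def shifts_append lin_map_zero lin_map_shifts)

lemma kills_append2: "lin_map T \<Longrightarrow> kills T ys \<phi> \<Longrightarrow> kills T (xs @ ys) \<phi>"
  by (simp add: kills_def shifts_append shifts_commute[of T ys] lin_map_zero lin_map_shifts)

lemma kills_concat: "lin_map T \<Longrightarrow> xs \<in> set xss \<Longrightarrow> kills T xs \<phi> \<Longrightarrow> kills T (concat xss) \<phi>"
  by (induction xss) (auto simp: kills_append1 kills_append2)

lemma kills_add: "lin_map T \<Longrightarrow> kills T xs \<phi> \<Longrightarrow> kills T xs \<psi> \<Longrightarrow> kills T xs (\<lambda>x. \<phi> x + \<psi> x)"
  by (simp add: kills_def lin_mapD(1)[OF lin_map_shifts])

lemma kills_smult: "lin_map T \<Longrightarrow> kills T xs \<phi> \<Longrightarrow> kills T xs (\<lambda>x. a * \<phi> x)"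
  by (simp add: kills_def lin_mapD(2)[OF lin_map_shifts])

lemma kills_sum: "lin_map T \<Longrightarrow> (\<And>k. k \<in> A \<Longrightarrow> kills T xs (\<phi> k)) \<Longrightarrow> kills T xs (\<lambda>x. \<Sum>k\<in>A. \<phi> k x)"
  by (simp add: kills_def lin_map_sum[OF lin_map_shifts])

section \<open>Bijectivity of differences of commuting operators\<close>

definition subspc :: "('x \<Rightarrow> complex) set \<Rightarrow> bool" where
  "subspc V \<longleftrightarrow> (\<lambda>_. 0) \<in> V \<and> (\<forall>\<phi>\<in>V. \<forall>\<psi>\<in>V. (\<lambda>x. \<phi> x + \<psi> x) \<in> V) \<and> (\<forall>a. \<forall>\<phi>\<in>V. (\<lambda>x. a * \<phi> x) \<in> V)"

lemma subspcD:
  assumes "subspc V"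
  shows "(\<lambda>_. 0) \<in> V" "\<phi> \<in> V \<Longrightarrow> \<psi> \<in> V \<Longrightarrow> (\<lambda>x. \<phi> x + \<psi> x) \<in> V" "\<phi> \<in> V \<Longrightarrow> (\<lambda>x. a * \<phi> x) \<in> V"
  using assms by (simp_all add: subspc_def)

lemma subspc_diff: "subspc V \<Longrightarrow> \<phi> \<in> V \<Longrightarrow> \<psi> \<in> V \<Longrightarrow> (\<lambda>x. \<phi> x - \<psi> x) \<in> V"
  using subspcD(2)[of V \<phi> "\<lambda>x. - 1 * \<psi> x"] subspcD(3)[of V \<psi> "- 1"] by simp

lemma subspc_shift: "subspc V \<Longrightarrow> T \<phi> \<in> V \<Longrightarrow> \<phi> \<in> V \<Longrightarrow> shift T \<sigma> \<phi> \<in> V"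
  unfolding shift_def by (intro subspc_diff subspcD(3))

text \<open>If S is annihilated by factors S - s for which B - s is bijective, then S - B is bijective:
  (S - s) w = (S - B) u amounts to (B - s) w = (S - B) (u - w).\<close>

lemma diff_surj:
  assumes S: "lin_map S" and B: "lin_map B" and SB: "\<And>\<phi>. S (B \<phi>) = B (S \<phi>)" and V: "subspc V"
    and SV: "\<And>\<phi>. \<phi> \<in> V \<Longrightarrow> S \<phi> \<in> V" and BV: "\<And>\<phi>. \<phi> \<in> V \<Longrightarrow> B \<phi> \<in> V"
    and "kills S xs w" "w \<in> V"
    and "\<And>\<sigma> v. \<sigma> \<in> set xs \<Longrightarrow> v \<in> V \<Longrightarrow> \<exists>u\<in>V. shift B \<sigma> u = v"
    and "\<And>\<sigma> v. \<sigma> \<in> set xs \<Longrightarrow> v \<in> V \<Longrightarrow> shift B \<sigma> v = (\<lambda>_. 0) \<Longrightarrow> v = (\<lambda>_. 0)"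
  shows "\<exists>u\<in>V. (\<lambda>x. S u x - B u x) = w"
  using assms(7-)
proof (induction xs arbitrary: w)
  case Nil
  then have "w = (\<lambda>_. 0)" by (simp add: kills_def)
  with V show ?case
    by (intro bexI[of _ "\<lambda>_. 0"]) (auto simp: lin_map_zero[OF S] lin_map_zero[OF B] subspc_def)
next
  case (Cons \<sigma> xs)
  have w': "shift S \<sigma> w \<in> V" by (intro subspc_shift V SV Cons.prems(2))
  have "\<exists>u\<in>V. (\<lambda>x. S u x - B u x) = shift S \<sigma> w"
  proof (rule Cons.IH[OF _ w'])
    show "kills S xs (shift S \<sigma> w)" using Cons.prems(1) by (simp add: kills_def)
  qed (use Cons.prems in auto)
  then obtain u where u: "u \<in> V" "(\<lambda>x. S u x - B u x) = shift S \<sigma> w" by blast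
  have "(\<lambda>x. u x - w x) \<in> V" by (rule subspc_diff[OF V u(1) Cons.prems(2)])
  then obtain v where v: "v \<in> V" "shift B \<sigma> v = (\<lambda>x. u x - w x)"
    using Cons.prems(3)[of \<sigma>] by auto
  \<comment> \<open>The defect of v as a solution. By commutation (B - \<sigma>)(S - B) v = (S -
    B)(u - w) = (S - \<sigma>) w - (S - B) w = (B - \<sigma>) w, so B - \<sigma> annihilates r, and
    injectivity gives r = 0.\<close>
  define r where "r = (\<lambda>x. (S v x - B v x) - w x)"
  have "r \<in> V"
    unfolding r_def by (intro subspc_diff V SV BV v(1) Cons.prems(2))
  moreover have "shift B \<sigma> r = (\<lambda>_. 0)"
  proof
    fix x
    have Bv: "B v = (\<lambda>x. u x - w x + \<sigma> * v x)"
      using v(2) by (auto simp: shift_def fun_eq_iff algebra_simps)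
    have SBv: "B (S v) x = S u x - S w x + \<sigma> * S v x"
      unfolding SB[symmetric] Bv lin_mapD(1)[OF S] lin_map_diff[OF S] lin_mapD(2)[OF S] by simp
    have BBv: "B (B v) x = B u x - B w x + \<sigma> * B v x"
      by (subst Bv) (simp add: lin_mapD(1)[OF B] lin_map_diff[OF B] lin_mapD(2)[OF B])
    have "S u x - B u x = S w x - \<sigma> * w x"
      using fun_cong[OF u(2), of x] by (simp add: shift_def)
    then show "shift B \<sigma> r x = 0"
      unfolding shift_def r_def lin_map_diff[OF B] SBv BBv by (simp add: algebra_simps)
  qed
  ultimately have "r = (\<lambda>_. 0)" using Cons.prems(4)[of \<sigma>] by simp
  then have "(\<lambda>x. S v x - B v x) = w" by (simp add: r_def fun_eq_iff)
  with v(1) show ?case by blast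
qed

text \<open>On a vector with S u = B u the factor S - \<sigma> acts as the injective B - \<sigma>,
  so the factors can be stripped off one at a time.\<close>

lemma diff_inj:
  assumes S: "lin_map S" and B: "lin_map B" and SB: "\<And>\<phi>. S (B \<phi>) = B (S \<phi>)" and V: "subspc V"
    and SV: "\<And>\<phi>. \<phi> \<in> V \<Longrightarrow> S \<phi> \<in> V"
    and "kills S xs u" "u \<in> V" "S u = B u"
    and "\<And>\<sigma> v. \<sigma> \<in> set xs \<Longrightarrow> v \<in> V \<Longrightarrow> shift B \<sigma> v = (\<lambda>_. 0) \<Longrightarrow> v = (\<lambda>_. 0)"
  shows "u = (\<lambda>_. 0)"
  using assms(6-)
proof (induction xs arbitrary: u)
  case (Cons \<sigma> xs)
  have u': "shift S \<sigma> u \<in> V" by (intro subspc_shift V SV Cons.prems(2))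
  have "shift S \<sigma> u = (\<lambda>_. 0)"
  proof (rule Cons.IH[OF _ u'])
    show "kills S xs (shift S \<sigma> u)" using Cons.prems(1) by (simp add: kills_def)
    show "S (shift S \<sigma> u) = B (shift S \<sigma> u)"
      unfolding shift_def lin_map_diff[OF S] lin_map_diff[OF B] lin_mapD(2)[OF S] lin_mapD(2)[OF B]
      using SB[of u] Cons.prems(3) by simp
  qed (use Cons.prems(4) in auto)
  then have "shift B \<sigma> u = (\<lambda>_. 0)" using Cons.prems(3) by (simp add: shift_def)
  then show ?case by (intro Cons.prems(4)[of \<sigma> u] Cons.prems(2)) simp
qed (simp add: kills_def)

text \<open>The two preceding lemmas with B in the place of S and the scalar \<sigma> in the place
  of B: the factors to invert are then the numbers \<sigma> - \<kappa> for \<kappa> in ys.\<close>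

lemma shift_bij:
  assumes B: "lin_map B" and V: "subspc V" and BV: "\<And>\<phi>. \<phi> \<in> V \<Longrightarrow> B \<phi> \<in> V"
    and kill: "\<And>\<phi>. \<phi> \<in> V \<Longrightarrow> kills B ys \<phi>" and \<sigma>: "\<sigma> \<notin> set ys"
  shows "\<And>v. v \<in> V \<Longrightarrow> \<exists>u\<in>V. shift B \<sigma> u = v"
    and "\<And>v. v \<in> V \<Longrightarrow> shift B \<sigma> v = (\<lambda>_. 0) \<Longrightarrow> v = (\<lambda>_. 0)"
proof -
  let ?R = "\<lambda>\<phi> x. \<sigma> * \<phi> x"
  have R: "lin_map ?R" by (simp add: lin_map_def algebra_simps)
  have BR: "B (?R \<phi>) = ?R (B \<phi>)" for \<phi> by (rule lin_mapD(2)[OF B])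
  have RV: "?R \<phi> \<in> V" if "\<phi> \<in> V" for \<phi> using V that by (simp add: subspc_def)
  have surj: "\<exists>u\<in>V. shift ?R \<kappa> u = v" if "\<kappa> \<in> set ys" "v \<in> V" for \<kappa> v
  proof (rule bexI)
    have "\<sigma> \<noteq> \<kappa>" using that \<sigma> by auto
    then have "\<sigma> * (inverse (\<sigma> - \<kappa>) * v x) - \<kappa> * (inverse (\<sigma> - \<kappa>) * v x) = v x" for x
      by (metis left_diff_distrib mult.assoc mult_1 right_inverse right_minus_eq)
    then show "shift ?R \<kappa> (\<lambda>x. inverse (\<sigma> - \<kappa>) * v x) = v" by (simp add: shift_def)
    show "(\<lambda>x. inverse (\<sigma> - \<kappa>) * v x) \<in> V" using V that by (simp add: subspc_def)
  qed
  have inj: "v = (\<lambda>_. 0)" if "\<kappa> \<in> set ys" "v \<in> V" "shift ?R \<kappa> v = (\<lambda>_. 0)" for \<kappa> v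
  proof
    fix x
    have "(\<sigma> - \<kappa>) * v x = 0" using fun_cong[OF that(3), of x] by (simp add: shift_def algebra_simps)
    with that(1) \<sigma> show "v x = 0" by auto
  qed
  show "\<exists>u\<in>V. shift B \<sigma> u = v" if "v \<in> V" for v
    using diff_surj[OF B R BR V BV RV kill[OF that] that surj inj] by (simp add: shift_def)
  show "v = (\<lambda>_. 0)" if "v \<in> V" "shift B \<sigma> v = (\<lambda>_. 0)" for v
  proof (rule diff_inj[OF B R BR V BV kill[OF that(1)] that(1) _ inj])
    show "B v = ?R v" using that(2) by (simp add: shift_def fun_eq_iff)
  qed
qed

subsection \<open>Matrices restricted to invariant subspaces\<close>

text \<open>Vectors are sequences continued by zero, which makes a matrix an operator on functions
  in the sense of \<open>lin_map\<close>.\<close>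

definition mat_op :: "nat \<Rightarrow> real mat \<Rightarrow> (nat \<Rightarrow> complex) \<Rightarrow> nat \<Rightarrow> complex" where
  "mat_op n A b i = (if i < n then \<Sum>k<n. of_real (A $$ (i, k)) * b k else 0)"

lemma lin_map_mat_op: "lin_map (mat_op n A)"
  by (auto simp: lin_map_def mat_op_def fun_eq_iff algebra_simps sum.distrib sum_distrib_left)

abbreviation vec_fun :: "nat \<Rightarrow> complex vec \<Rightarrow> nat \<Rightarrow> complex" where
  "vec_fun n v \<equiv> \<lambda>i. if i < n then v $ i else 0"

lemma shift_mat_op:
  assumes "C \<in> carrier_mat N N" "v \<in> carrier_vec N"
  shows "shift (mat_op N C) \<kappa> (vec_fun N v) = vec_fun N ((cmat C - \<kappa> \<cdot>\<^sub>m 1\<^sub>m N) *\<^sub>v v)"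
proof
  fix i
  show "shift (mat_op N C) \<kappa> (vec_fun N v) i = vec_fun N ((cmat C - \<kappa> \<cdot>\<^sub>m 1\<^sub>m N) *\<^sub>v v) i"
  proof (cases "i < N")
    case True
    have "((cmat C - \<kappa> \<cdot>\<^sub>m 1\<^sub>m N) *\<^sub>v v) $ i =
        (\<Sum>k<N. (of_real (C $$ (i, k)) - (if i = k then \<kappa> else 0)) * v $ k)"
      using True assms by (auto simp: scalar_prod_def lessThan_atLeast0 intro!: sum.cong)
    also have "\<dots> = (\<Sum>k<N. of_real (C $$ (i, k)) * v $ k) - (\<Sum>k<N. if i = k then \<kappa> * v $ k else 0)"
      unfolding sum_subtractf[symmetric] by (rule sum.cong) (auto simp: algebra_simps)
    also have "(\<Sum>k<N. if i = k then \<kappa> * v $ k else 0) = \<kappa> * v $ i"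
      using True by (simp add: sum.delta')
    finally show ?thesis using True by (simp add: shift_def mat_op_def)
  qed (simp add: shift_def mat_op_def)
qed

lemma shifts_mat_op:
  assumes "C \<in> carrier_mat N N" "v \<in> carrier_vec N"
  shows "shifts (mat_op N C) (replicate m \<kappa>) (vec_fun N v) = vec_fun N (((cmat C - \<kappa> \<cdot>\<^sub>m 1\<^sub>m N) ^\<^sub>m m) *\<^sub>v v)"
  using assms(2)
proof (induction m arbitrary: v)
  case 0
  have "(cmat C - \<kappa> \<cdot>\<^sub>m 1\<^sub>m N) ^\<^sub>m 0 *\<^sub>v v = v"
    using assms(1) 0 by (simp only: pow_mat.simps) (simp del: index_mult_mat_vec)
  then show ?case by (simp del: pow_mat.simps index_mult_mat_vec cong: if_cong)
next
  case (Suc m)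
  let ?D = "cmat C - \<kappa> \<cdot>\<^sub>m 1\<^sub>m N"
  have D: "?D \<in> carrier_mat N N" by (intro minus_carrier_mat smult_carrier_mat one_carrier_mat)
  then have "?D *\<^sub>v v \<in> carrier_vec N" using Suc.prems by simp
  from Suc.IH[OF this] shift_mat_op[OF assms(1) Suc.prems, of \<kappa>]
  have "shifts (mat_op N C) (replicate (Suc m) \<kappa>) (vec_fun N v) = vec_fun N (?D ^\<^sub>m m *\<^sub>v (?D *\<^sub>v v))"
    by (simp del: index_mult_mat_vec)
  also have "?D ^\<^sub>m m *\<^sub>v (?D *\<^sub>v v) = ?D ^\<^sub>m Suc m *\<^sub>v v"
    unfolding pow_mat.simps
    by (rule assoc_mult_mat_vec[symmetric, OF pow_carrier_mat[OF D] D Suc.prems])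
  finally show ?case .
qed

lemma cols_basis_col:
  assumes "cols_basis N \<Phi> S" "\<Phi> \<in> carrier_mat N c" "k < c"
  shows "col \<Phi> k \<in> S"
proof -
  interpret vec_space "TYPE(real)" N .
  have "col \<Phi> k \<in> set (cols \<Phi>)" using assms(2,3) by (auto simp: cols_def)
  moreover have "set (cols \<Phi>) \<subseteq> carrier_vec N" using assms(2) cols_dim[of \<Phi>] by auto
  ultimately have "col \<Phi> k \<in> span (set (cols \<Phi>))" using in_own_span by auto
  with assms(1) show ?thesis by (simp add: cols_basis_def)
qed

text \<open>The columns of \<Phi> are sums of generalized eigenvectors of C for S, hence annihilated
  by factors of C. As \<Phi> intertwines J with C and has the left inverse \<Psi>, the same factors
  annihilate J. This stands in for the statement that the spectrum of J lies in S.\<close>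

lemma restriction_annihilated:
  assumes C: "C \<in> carrier_mat N N" and \<Phi>: "\<Phi> \<in> carrier_mat N c" and \<Psi>: "\<Psi> \<in> carrier_mat c N"
    and J: "J \<in> carrier_mat c c" and inv: "\<Psi> * \<Phi> = 1\<^sub>m c" and int: "C * \<Phi> = \<Phi> * J"
    and basis: "cols_basis N \<Phi> (inv_subspace N C S)" and S: "finite S"
  obtains xs where "set xs \<subseteq> S" "\<And>b. (\<And>i. c \<le> i \<Longrightarrow> b i = 0) \<Longrightarrow> kills (mat_op c J) xs b"
proof -
  obtain ss where ss: "set ss = S" using finite_list[OF S] by blast
  \<comment> \<open>Each eigenvalue occurs N times, the exponent used in
    \<open>inv_subspace\<close>.\<close>
  define xs where "xs = concat (map (replicate N) ss)"
  let ?F = "\<lambda>b i. if i < N then \<Sum>k<c. of_real (\<Phi> $$ (i, k)) * b k else (0::complex)"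
  have lin: "lin_map (mat_op N C)" by (rule lin_map_mat_op)
  have col: "kills (mat_op N C) xs (\<lambda>i. if i < N then of_real (\<Phi> $$ (i, k)) else 0)" if k: "k < c" for k
  proof -
    have "col \<Phi> k \<in> inv_subspace N C S" by (rule cols_basis_col[OF basis \<Phi> k])
    then obtain v where v: "\<And>\<kappa>. \<kappa> \<in> S \<Longrightarrow> v \<kappa> \<in> carrier_vec N \<and> ((cmat C - \<kappa> \<cdot>\<^sub>m 1\<^sub>m N) ^\<^sub>m N) *\<^sub>v v \<kappa> = 0\<^sub>v N"
      and sum: "\<And>i. i < N \<Longrightarrow> complex_of_real (col \<Phi> k $ i) = (\<Sum>\<kappa>\<in>S. v \<kappa> $ i)"
      unfolding inv_subspace_def by blast
    have "kills (mat_op N C) xs (vec_fun N (v \<kappa>))" if "\<kappa> \<in> S" for \<kappa>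
    proof -
      have "kills (mat_op N C) (replicate N \<kappa>) (vec_fun N (v \<kappa>))"
        using shifts_mat_op[OF C, of "v \<kappa>" N \<kappa>] v[OF that] by (auto simp: kills_def fun_eq_iff)
      moreover have "replicate N \<kappa> \<in> set (map (replicate N) ss)" using that ss by auto
      ultimately show ?thesis unfolding xs_def by (intro kills_concat[OF lin])
    qed
    then have "kills (mat_op N C) xs (\<lambda>i. \<Sum>\<kappa>\<in>S. vec_fun N (v \<kappa>) i)" by (rule kills_sum[OF lin])
    moreover have "(\<lambda>i. \<Sum>\<kappa>\<in>S. vec_fun N (v \<kappa>) i) = (\<lambda>i. if i < N then of_real (\<Phi> $$ (i, k)) else 0)"
      using sum \<Phi> k by (auto simp: fun_eq_iff)
    ultimately show ?thesis by simp
  qed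
  have F: "kills (mat_op N C) xs (?F b)" for b
  proof -
    have "?F b = (\<lambda>i. \<Sum>k<c. b k * (if i < N then of_real (\<Phi> $$ (i, k)) else 0))"
      by (auto simp: fun_eq_iff mult.commute)
    moreover have "kills (mat_op N C) xs (\<lambda>i. \<Sum>k<c. b k * (if i < N then of_real (\<Phi> $$ (i, k)) else 0))"
      by (intro kills_sum kills_smult lin col) auto
    ultimately show ?thesis by simp
  qed
  have int': "mat_op N C (?F b) = ?F (mat_op c J b)" for b
  proof
    fix i
    show "mat_op N C (?F b) i = ?F (mat_op c J b) i"
    proof (cases "i < N")
      case True
      have *: "(\<Sum>k<N. C $$ (i, k) * \<Phi> $$ (k, l)) = (\<Sum>k<c. \<Phi> $$ (i, k) * J $$ (k, l))" if "l < c" for l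
        using arg_cong[OF int, of "\<lambda>M. M $$ (i, l)"] True that C \<Phi> J
        by (simp add: scalar_prod_def lessThan_atLeast0)
      have "mat_op N C (?F b) i = (\<Sum>k<N. \<Sum>l<c. of_real (C $$ (i, k) * \<Phi> $$ (k, l)) * b l)"
        using True by (simp add: mat_op_def sum_distrib_left mult.assoc)
      also have "\<dots> = (\<Sum>l<c. of_real (\<Sum>k<N. C $$ (i, k) * \<Phi> $$ (k, l)) * b l)"
        by (subst sum.swap) (simp add: sum_distrib_right)
      also have "\<dots> = (\<Sum>l<c. \<Sum>k<c. of_real (\<Phi> $$ (i, k)) * (of_real (J $$ (k, l)) * b l))"
        using * by (simp add: sum_distrib_right mult.assoc)
      also have "\<dots> = ?F (mat_op c J b) i"
        using True by (subst sum.swap) (simp add: mat_op_def sum_distrib_left)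
      finally show ?thesis .
    qed (simp add: mat_op_def)
  qed
  have Fshift: "shift (mat_op N C) \<sigma> (?F b) = ?F (shift (mat_op c J) \<sigma> b)" for b \<sigma>
    unfolding shift_def int' by (auto simp: fun_eq_iff algebra_simps sum_subtractf sum_distrib_left)
  have Fshifts: "shifts (mat_op N C) ys (?F b) = ?F (shifts (mat_op c J) ys b)" for ys b
  proof (induction ys arbitrary: b)
    case (Cons \<sigma> ys)
    show ?case unfolding shifts.simps Fshift by (rule Cons.IH)
  qed (simp only: shifts.simps)
  have supp: "shifts (mat_op c J) ys b i = 0" if "\<And>i. c \<le> i \<Longrightarrow> b i = 0" "c \<le> i" for ys b i
    using that by (induction ys arbitrary: b) (auto simp: shift_def mat_op_def)
  have "kills (mat_op c J) xs b" if b: "\<And>i. c \<le> i \<Longrightarrow> b i = 0" for b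
    unfolding kills_def
  proof
    fix i
    define d where "d = shifts (mat_op c J) xs b"
    have "?F d = (\<lambda>_. 0)" using F[of b] unfolding kills_def Fshifts d_def .
    then have Fd: "(\<Sum>k<c. of_real (\<Phi> $$ (j, k)) * d k) = 0" if "j < N" for j
      using that by (drule_tac x = j in fun_cong) simp
    show "shifts (mat_op c J) xs b i = 0"
    proof (cases "i < c")
      case True
      have *: "(\<Sum>j<N. \<Psi> $$ (i, j) * \<Phi> $$ (j, k)) = (if i = k then 1 else 0)" if "k < c" for k
        using arg_cong[OF inv, of "\<lambda>M. M $$ (i, k)"] True that \<Psi> \<Phi>
        by (simp add: scalar_prod_def lessThan_atLeast0)
      \<comment> \<open>Apply \<Psi> to \<Phi> d = 0 to recover d.\<close>
      have "0 = (\<Sum>j<N. of_real (\<Psi> $$ (i, j)) * (\<Sum>k<c. of_real (\<Phi> $$ (j, k)) * d k))"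
        using Fd by simp
      also have "\<dots> = (\<Sum>k<c. \<Sum>j<N. of_real (\<Psi> $$ (i, j) * \<Phi> $$ (j, k)) * d k)"
        by (subst sum.swap) (simp add: sum_distrib_left mult.assoc)
      also have "\<dots> = (\<Sum>k<c. of_real (\<Sum>j<N. \<Psi> $$ (i, j) * \<Phi> $$ (j, k)) * d k)"
        by (simp add: sum_distrib_right)
      also have "\<dots> = (\<Sum>k<c. if i = k then d k else 0)"
        using * by (intro sum.cong) auto
      also have "\<dots> = d i" using True by (simp add: sum.delta')
      finally show ?thesis by (simp add: d_def)
    qed (simp add: supp b)
  qed
  moreover have "set xs \<subseteq> S" using ss by (auto simp: xs_def)
  ultimately show ?thesis by (rule that[rotated])
qed

subsection \<open>The homological operator under nonresonance\<close>

definition lin_pt :: "nat \<Rightarrow> nat \<Rightarrow> real mat \<Rightarrow> (nat \<Rightarrow> real) \<Rightarrow> nat \<Rightarrow> real" where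
  "lin_pt p c J a v = (if p \<le> v \<and> v < p + c then \<Sum>k<c. J $$ (v - p, k) * a (p + k) else a v)"

definition comp_op :: "nat \<Rightarrow> nat \<Rightarrow> real mat \<Rightarrow> ((nat \<Rightarrow> real) \<Rightarrow> complex) \<Rightarrow> (nat \<Rightarrow> real) \<Rightarrow> complex" where
  "comp_op p c J \<phi> a = \<phi> (lin_pt p c J a)"

definition prods :: "complex set \<Rightarrow> nat \<Rightarrow> complex set" where
  "prods S j = prod_list ` {ws. length ws = j \<and> set ws \<subseteq> S}"

text \<open>The list is existentially bound: lists grow under sums and products, and what has to be
  controlled is the set of numbers in them.\<close>

definition killed_by :: "(('x \<Rightarrow> complex) \<Rightarrow> 'x \<Rightarrow> complex) \<Rightarrow> complex set \<Rightarrow> ('x \<Rightarrow> complex) \<Rightarrow> bool" where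
  "killed_by T E \<phi> \<longleftrightarrow> (\<exists>xs. set xs \<subseteq> E \<and> kills T xs \<phi>)"

lemma lin_map_comp_op: "lin_map (comp_op p c J)"
  by (simp add: lin_map_def comp_op_def fun_eq_iff)

lemma killed_by_add:
  assumes "lin_map T" "killed_by T E \<phi>" "killed_by T E \<psi>"
  shows "killed_by T E (\<lambda>x. \<phi> x + \<psi> x)"
proof -
  from assms obtain xs ys where "set xs \<subseteq> E" "kills T xs \<phi>" "set ys \<subseteq> E" "kills T ys \<psi>"
    unfolding killed_by_def by auto
  then have "set (xs @ ys) \<subseteq> E" "kills T (xs @ ys) (\<lambda>x. \<phi> x + \<psi> x)"
    using kills_add[OF assms(1) kills_append1[OF assms(1)] kills_append2[OF assms(1)]] by auto
  then show ?thesis unfolding killed_by_def by blast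
qed

lemma killed_by_smult: "lin_map T \<Longrightarrow> killed_by T E \<phi> \<Longrightarrow> killed_by T E (\<lambda>x. a * \<phi> x)"
  unfolding killed_by_def by (elim exE conjE) (rule exI, rule conjI, assumption, rule kills_smult)

lemma killed_by_zero: "killed_by T E (\<lambda>_. 0)"
  unfolding killed_by_def kills_def by (intro exI[of _ "[]"]) simp

lemma killed_by_sum:
  "lin_map T \<Longrightarrow> (\<And>k. k \<in> A \<Longrightarrow> killed_by T E (\<phi> k)) \<Longrightarrow> killed_by T E (\<lambda>x. \<Sum>k\<in>A. \<phi> k x)"
proof (induction A rule: infinite_finite_induct)
  case (insert a A)
  then show ?case using killed_by_add[of T E "\<phi> a" "\<lambda>x. \<Sum>k\<in>A. \<phi> k x"] by simp
qed (simp_all add: killed_by_zero)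

text \<open>The composition operator is multiplicative, so generalized eigenfunctions for s and t multiply
  to a generalized eigenfunction for st.\<close>

lemma kills_mult:
  assumes "kills (comp_op p c J) xs \<phi>" "kills (comp_op p c J) ys \<psi>"
  shows "\<exists>zs. set zs \<subseteq> (\<lambda>(x, y). x * y) ` (set xs \<times> set ys) \<and> kills (comp_op p c J) zs (\<lambda>a. \<phi> a * \<psi> a)"
  using assms
\<comment> \<open>The product rule below splits the shifted product into a term with a shorter list
  for \<phi> and one with a shorter list for \<psi>, so the total length decreases.\<close>
proof (induction "length xs + length ys" arbitrary: xs ys \<phi> \<psi> rule: less_induct)
  case less
  let ?S = "comp_op p c J"
  show ?case
  proof (cases "xs = [] \<or> ys = []")
    case True
    with less.prems have "(\<lambda>a. \<phi> a * \<psi> a) = (\<lambda>_. 0)" by (auto simp: kills_def fun_eq_iff)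
    then show ?thesis by (intro exI[of _ "[]"]) (simp add: kills_def)
  next
    case False
    then obtain \<sigma> xs' \<tau> ys' where xs: "xs = \<sigma> # xs'" and ys: "ys = \<tau> # ys'"
      by (meson neq_Nil_conv)
    have lin: "lin_map ?S" by (rule lin_map_comp_op)
    have Sps: "kills ?S ys (?S \<psi>)"
    proof -
      \<comment> \<open>Read as a factor with number 0, the operator itself commutes with all other
        factors.\<close>
      have "?S \<psi> = shift ?S 0 \<psi>" by (simp add: shift_def)
      then have "shifts ?S ys (?S \<psi>) = shift ?S 0 (shifts ?S ys \<psi>)" by (simp only: shifts_shift[OF lin])
      then show ?thesis using less.prems(2) lin_map_zero[OF lin] by (simp add: kills_def shift_def)
    qed
    have "\<exists>zs. set zs \<subseteq> (\<lambda>(x, y). x * y) ` (set xs' \<times> set ys) \<and> kills ?S zs (\<lambda>a. shift ?S \<sigma> \<phi> a * ?S \<psi> a)"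
      by (rule less.hyps[OF _ _ Sps]) (use less.prems(1) in \<open>auto simp: xs kills_def\<close>)
    then obtain zs1 where z1: "set zs1 \<subseteq> (\<lambda>(x, y). x * y) ` (set xs' \<times> set ys)"
      "kills ?S zs1 (\<lambda>a. shift ?S \<sigma> \<phi> a * ?S \<psi> a)" by blast
    have "\<exists>zs. set zs \<subseteq> (\<lambda>(x, y). x * y) ` (set xs \<times> set ys') \<and> kills ?S zs (\<lambda>a. \<sigma> * \<phi> a * shift ?S \<tau> \<psi> a)"
      by (rule less.hyps) (use less.prems in \<open>auto simp: ys kills_def lin_mapD(2)[OF lin_map_shifts[OF lin]]\<close>)
    then obtain zs2 where z2: "set zs2 \<subseteq> (\<lambda>(x, y). x * y) ` (set xs \<times> set ys')"
      "kills ?S zs2 (\<lambda>a. \<sigma> * \<phi> a * shift ?S \<tau> \<psi> a)" by blast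
    have "shift ?S (\<sigma> * \<tau>) (\<lambda>a. \<phi> a * \<psi> a) = (\<lambda>a. shift ?S \<sigma> \<phi> a * ?S \<psi> a + \<sigma> * \<phi> a * shift ?S \<tau> \<psi> a)"
      by (simp add: shift_def comp_op_def fun_eq_iff algebra_simps)
    moreover have "kills ?S (zs1 @ zs2) (\<lambda>a. shift ?S \<sigma> \<phi> a * ?S \<psi> a + \<sigma> * \<phi> a * shift ?S \<tau> \<psi> a)"
      by (intro kills_add kills_append1 kills_append2 lin z1 z2)
    ultimately have "kills ?S (\<sigma> * \<tau> # zs1 @ zs2) (\<lambda>a. \<phi> a * \<psi> a)" by (simp add: kills_def)
    moreover have "set (\<sigma> * \<tau> # zs1 @ zs2) \<subseteq> (\<lambda>(x, y). x * y) ` (set xs \<times> set ys)"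
    proof -
      have "(\<lambda>(x, y). x * y) ` (set xs' \<times> set ys) \<subseteq> (\<lambda>(x, y). x * y) ` (set xs \<times> set ys)"
        "(\<lambda>(x, y). x * y) ` (set xs \<times> set ys') \<subseteq> (\<lambda>(x, y). x * y) ` (set xs \<times> set ys)"
        by (rule image_mono, auto simp: xs ys)+
      with z1(1) z2(1) have "set zs1 \<union> set zs2 \<subseteq> (\<lambda>(x, y). x * y) ` (set xs \<times> set ys)" by blast
      moreover have "\<sigma> * \<tau> \<in> (\<lambda>(x, y). x * y) ` (set xs \<times> set ys)"
        by (rule image_eqI[of _ _ "(\<sigma>, \<tau>)"]) (auto simp: xs ys)
      ultimately show ?thesis by simp
    qed
    ultimately show ?thesis by blast
  qed
qed

lemma prods_mult: "x \<in> prods S j \<Longrightarrow> y \<in> prods S k \<Longrightarrow> x * y \<in> prods S (j + k)"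
proof -
  assume "x \<in> prods S j" "y \<in> prods S k"
  then obtain u v where "length u = j" "set u \<subseteq> S" "x = prod_list u" "length v = k" "set v \<subseteq> S" "y = prod_list v"
    by (auto simp: prods_def)
  then show ?thesis unfolding prods_def by (intro image_eqI[of _ _ "u @ v"]) auto
qed

lemma killed_by_mult:
  assumes "killed_by (comp_op p c J) (prods S j) \<phi>" "killed_by (comp_op p c J) (prods S k) \<psi>"
  shows "killed_by (comp_op p c J) (prods S (j + k)) (\<lambda>a. \<phi> a * \<psi> a)"
proof -
  obtain xs ys where x: "set xs \<subseteq> prods S j" "kills (comp_op p c J) xs \<phi>"
    and y: "set ys \<subseteq> prods S k" "kills (comp_op p c J) ys \<psi>"
    using assms unfolding killed_by_def by auto
  obtain zs where z: "set zs \<subseteq> (\<lambda>(x, y). x * y) ` (set xs \<times> set ys)" "kills (comp_op p c J) zs (\<lambda>a. \<phi> a * \<psi> a)"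
    using kills_mult[OF x(2) y(2)] by blast
  have "set zs \<subseteq> prods S (j + k)"
  proof
    fix z assume "z \<in> set zs"
    with z(1) have "z \<in> (\<lambda>(x, y). x * y) ` (set xs \<times> set ys)" by blast
    then obtain x y where "z = x * y" "x \<in> set xs" "y \<in> set ys" by auto
    with x(1) y(1) show "z \<in> prods S (j + k)" by (auto intro: prods_mult)
  qed
  with z(2) show ?thesis unfolding killed_by_def by blast
qed

lemma kills_single_iff: "kills T [\<sigma>] \<phi> \<longleftrightarrow> (\<forall>x. T \<phi> x = \<sigma> * \<phi> x)"
  by (simp add: kills_def shift_def fun_eq_iff)

lemma killed_by_one: "killed_by (comp_op p c J) (prods S 0) (\<lambda>_. 1)"
  unfolding killed_by_def
  by (intro exI[of _ "[1]"]) (auto simp: kills_single_iff comp_op_def prods_def image_iff)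

lemma killed_by_power:
  assumes "killed_by (comp_op p c J) (prods S 1) \<phi>"
  shows "killed_by (comp_op p c J) (prods S n) (\<lambda>a. \<phi> a ^ n)"
proof (induction n)
  case (Suc n)
  show ?case using killed_by_mult[OF assms Suc] by simp
qed (simp add: killed_by_one)

lemma killed_by_prod:
  assumes "finite A" "\<And>i. i \<in> A \<Longrightarrow> killed_by (comp_op p c J) (prods S (n i)) (\<phi> i)"
  shows "killed_by (comp_op p c J) (prods S (sum n A)) (\<lambda>a. \<Prod>i\<in>A. \<phi> i a)"
  using assms
proof (induction A rule: finite_induct)
  case (insert i A)
  then show ?case using killed_by_mult[of p c J S "n i" "\<phi> i" "sum n A" "\<lambda>a. \<Prod>i\<in>A. \<phi> i a"] by simp
qed (simp add: killed_by_one)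

text \<open>A parameter is fixed by the composition operator, which gives the factor with number 1.
  On the coordinates x the operator acts by applying J to the point, so the factors annihilating J
  carry over.\<close>

lemma killed_by_coord:
  assumes xs: "set xs \<subseteq> S" "\<And>b. (\<And>i. c \<le> i \<Longrightarrow> b i = 0) \<Longrightarrow> kills (mat_op c J) xs b"
    and p1: "0 < p \<Longrightarrow> 1 \<in> S" and v: "v < p + c"
  shows "killed_by (comp_op p c J) (prods S 1) (\<lambda>a. of_real (a v))"
proof (cases "v < p")
  case True
  then have "kills (comp_op p c J) [1] (\<lambda>a. of_real (a v))"
    by (simp add: kills_single_iff comp_op_def lin_pt_def)
  moreover have "1 \<in> prods S 1"
    using True p1 unfolding prods_def by (intro image_eqI[of _ _ "[1]"]) auto
  ultimately show ?thesis unfolding killed_by_def by (intro exI[of _ "[1]"]) auto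
next
  case False
  define \<iota> :: "(nat \<Rightarrow> real) \<Rightarrow> nat \<Rightarrow> complex" where
    "\<iota> a k = (if k < c then of_real (a (p + k)) else 0)" for a k
  have \<iota>: "\<iota> (lin_pt p c J a) = mat_op c J (\<iota> a)" for a
    by (auto simp: \<iota>_def lin_pt_def mat_op_def fun_eq_iff)
  \<comment> \<open>Q collects the factors already peeled off; with the bare coordinate function
    alone the induction hypothesis would not apply after the first factor.\<close>
  have *: "shifts (comp_op p c J) ys (\<lambda>a. Q (\<iota> a) k) = (\<lambda>a. Q (shifts (mat_op c J) ys (\<iota> a)) k)"
    if "lin_map Q" "\<And>b. Q (mat_op c J b) = mat_op c J (Q b)" for Q ys k
    using that
  proof (induction ys arbitrary: Q)
    case (Cons \<sigma> ys)
    let ?Q = "\<lambda>b. shift (mat_op c J) \<sigma> (Q b)"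
    have Q: "?Q b = Q (shift (mat_op c J) \<sigma> b)" for b
      unfolding shift_def lin_map_diff[OF Cons.prems(1)] lin_mapD(2)[OF Cons.prems(1)] Cons.prems(2) ..
    have "shifts (comp_op p c J) (\<sigma> # ys) (\<lambda>a. Q (\<iota> a) k) = shifts (comp_op p c J) ys (\<lambda>a. ?Q (\<iota> a) k)"
      by (simp add: shift_def comp_op_def \<iota> Cons.prems(2))
    also have "\<dots> = (\<lambda>a. ?Q (shifts (mat_op c J) ys (\<iota> a)) k)"
    proof (rule Cons.IH)
      show "lin_map ?Q" by (rule lin_map_comp[OF lin_map_shift[OF lin_map_mat_op] Cons.prems(1)])
      show "?Q (mat_op c J b) = mat_op c J (?Q b)" for b
        unfolding Cons.prems(2) shift_def lin_map_diff[OF lin_map_mat_op] lin_mapD(2)[OF lin_map_mat_op] ..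
    qed
    also have "\<dots> = (\<lambda>a. Q (shifts (mat_op c J) (\<sigma> # ys) (\<iota> a)) k)"
      by (simp add: Q shifts_shift[OF lin_map_mat_op])
    finally show ?case .
  qed simp
  have "kills (comp_op p c J) xs (\<lambda>a. of_real (a v))"
  proof -
    have "lin_map (\<lambda>b. b :: nat \<Rightarrow> complex)" by (simp add: lin_map_def)
    then have "shifts (comp_op p c J) xs (\<lambda>a. \<iota> a (v - p)) = (\<lambda>a. shifts (mat_op c J) xs (\<iota> a) (v - p))"
      using *[of "\<lambda>b. b" xs "v - p"] by simp
    also have "\<dots> = (\<lambda>_. 0)"
      using xs(2)[of "\<iota> _"] by (simp add: kills_def \<iota>_def)
    finally have "kills (comp_op p c J) xs (\<lambda>a. \<iota> a (v - p))" by (simp only: kills_def)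
    moreover have "(\<lambda>a. \<iota> a (v - p)) = (\<lambda>a. of_real (a v))"
    proof -
      have "v - p < c" "p + (v - p) = v" using False v by auto
      then show ?thesis by (simp add: \<iota>_def)
    qed
    ultimately show ?thesis by simp
  qed
  moreover have "set xs \<subseteq> prods S 1"
  proof
    fix x assume "x \<in> set xs"
    then show "x \<in> prods S 1"
      using xs(1) unfolding prods_def by (intro image_eqI[of _ _ "[x]"]) auto
  qed
  ultimately show ?thesis unfolding killed_by_def by blast
qed

lemma killed_by_poly:
  assumes xs: "set xs \<subseteq> S" "\<And>b. (\<And>i. c \<le> i \<Longrightarrow> b i = 0) \<Longrightarrow> kills (mat_op c J) xs b"
    and p1: "0 < p \<Longrightarrow> 1 \<in> S" and f: "homog j f" "in_vars (p + c) f"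
  shows "killed_by (comp_op p c J) (prods S j) (\<lambda>a. of_real (peval a f))"
proof -
  have lin: "lin_map (comp_op p c J)" by (rule lin_map_comp_op)
  have "killed_by (comp_op p c J) (prods S j) (\<lambda>a. of_real (lookup f m) * of_real (mon a m))"
    if m: "m \<in> keys f" for m
  proof -
    have "killed_by (comp_op p c J) (prods S (\<Sum>i\<in>keys m. lookup m i))
       (\<lambda>a. \<Prod>i\<in>keys m. of_real (a i) ^ lookup m i)"
    proof (rule killed_by_prod)
      fix i assume "i \<in> keys m"
      with m f(2) have "i < p + c" by (auto simp: in_vars_def)
      then show "killed_by (comp_op p c J) (prods S (lookup m i)) (\<lambda>a. of_real (a i) ^ lookup m i)"
        by (intro killed_by_power killed_by_coord[OF xs p1])
    qed simp
    moreover have "(\<Sum>i\<in>keys m. lookup m i) = j" using m f(1) by (simp add: homog_def mon_degree_def)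
    ultimately have "killed_by (comp_op p c J) (prods S j) (\<lambda>a. of_real (mon a m))"
      by (simp add: mon_def)
    then show ?thesis by (rule killed_by_smult[OF lin])
  qed
  then have "killed_by (comp_op p c J) (prods S j) (\<lambda>a. \<Sum>m\<in>keys f. of_real (lookup f m) * of_real (mon a m))"
    by (rule killed_by_sum[OF lin])
  then show ?thesis by (simp add: gsubst_def)
qed

section \<open>The operator \<open>M_op\<close> as a difference of commuting maps\<close>

lemma peval_lin_subst: "peval a (msubst (lin_subst p c J) f) = peval (lin_pt p c J a) f"
proof -
  have "(\<lambda>v. peval a (lin_subst p c J v)) = lin_pt p c J a"
    by (auto simp: blk_def lin_pt_def fun_eq_iff)
  then show ?thesis by (simp add: peval_msubst)
qed

text \<open>\<open>f + \<i> g\<close>, as a function of the pair of a component and a point: the setting in which the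
  two parts of the homological operator are commuting linear maps.\<close>

definition cfun :: "nat \<Rightarrow> mpoly vec \<Rightarrow> mpoly vec \<Rightarrow> nat \<times> (nat \<Rightarrow> real) \<Rightarrow> complex" where
  "cfun q f g x = (if fst x < q then Complex (peval (snd x) (f $ fst x)) (peval (snd x) (g $ fst x)) else 0)"

text \<open>E holds the numbers that annihilate the given polynomials under composition with J, Y
  those of the matrix A. E is left free: it is \<open>prods S j\<close> in degree j \<ge> 2 and
  \<open>{1}\<close> for linear forms in the parameters.\<close>

locale homological =
  fixes p c q j :: nat and J A :: "real mat" and E Y :: "complex set" and ys :: "complex list"
  assumes J: "J \<in> carrier_mat c c" and A: "A \<in> carrier_mat q q"
    and Y: "set ys \<subseteq> Y" "\<And>b. (\<And>i. q \<le> i \<Longrightarrow> b i = 0) \<Longrightarrow> kills (mat_op q A) ys b"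
    and disj: "E \<inter> Y = {}"
begin

definition V :: "(nat \<times> (nat \<Rightarrow> real) \<Rightarrow> complex) set" where
  "V = {cfun q f g |f g. f \<in> hom_polys (p + c) j q \<and> g \<in> hom_polys (p + c) j q}"

definition S :: "(nat \<times> (nat \<Rightarrow> real) \<Rightarrow> complex) \<Rightarrow> nat \<times> (nat \<Rightarrow> real) \<Rightarrow> complex" where
  "S \<phi> x = \<phi> (fst x, lin_pt p c J (snd x))"

definition B :: "(nat \<times> (nat \<Rightarrow> real) \<Rightarrow> complex) \<Rightarrow> nat \<times> (nat \<Rightarrow> real) \<Rightarrow> complex" where
  "B \<phi> x = mat_op q A (\<lambda>k. \<phi> (k, snd x)) (fst x)"

definition Sv :: "mpoly vec \<Rightarrow> mpoly vec" where
  "Sv h = vec q (\<lambda>i. msubst (lin_subst p c J) (h $ i))"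

definition Bv :: "mpoly vec \<Rightarrow> mpoly vec" where
  "Bv h = vec q (\<lambda>i. \<Sum>k<q. Const (A $$ (i, k)) * h $ k)"

lemma lin_S: "lin_map S" and lin_B: "lin_map B"
  using lin_mapD[OF lin_map_mat_op] by (simp_all add: lin_map_def S_def B_def fun_eq_iff)

lemma S_B: "S (B \<phi>) = B (S \<phi>)"
  by (simp add: S_def B_def fun_eq_iff)

lemma Sv_hom: "h \<in> hom_polys (p + c) j q \<Longrightarrow> Sv h \<in> hom_polys (p + c) j q"
proof -
  assume h: "h \<in> hom_polys (p + c) j q"
  have "homog j (msubst (lin_subst p c J) (h $ i)) \<and> in_vars (p + c) (msubst (lin_subst p c J) (h $ i))" if "i < q" for i
  proof
    show "homog j (msubst (lin_subst p c J) (h $ i))"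
      by (rule homog_msubst[OF hom_polysD(2)[OF h that] homog_lin_subst])
    show "in_vars (p + c) (msubst (lin_subst p c J) (h $ i))"
    proof (rule in_vars_msubst)
      fix m v assume "m \<in> keys (h $ i)" "v \<in> keys m"
      with hom_polysD(3)[OF h that] have "v < p + c" by (auto simp: in_vars_def)
      then show "in_vars (p + c) (lin_subst p c J v)" by (intro in_vars_lin_subst) auto
    qed
  qed
  then show ?thesis by (simp add: hom_polys_iff Sv_def)
qed

lemma Bv_hom: "h \<in> hom_polys (p + c) j q \<Longrightarrow> Bv h \<in> hom_polys (p + c) j q"
  by (auto simp: hom_polys_iff Bv_def intro!: homog_sum homog_smult in_vars_sum in_vars_smult)

lemma S_cfun: "S (cfun q f g) = cfun q (Sv f) (Sv g)"
  by (auto simp: S_def cfun_def Sv_def fun_eq_iff peval_lin_subst)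

lemma B_cfun: "B (cfun q f g) = cfun q (Bv f) (Bv g)"
proof
  fix x :: "nat \<times> (nat \<Rightarrow> real)"
  have "(\<Sum>k<q. of_real (A $$ (fst x, k)) * Complex (peval (snd x) (f $ k)) (peval (snd x) (g $ k))) =
     Complex (\<Sum>k<q. A $$ (fst x, k) * peval (snd x) (f $ k)) (\<Sum>k<q. A $$ (fst x, k) * peval (snd x) (g $ k))"
    by (simp add: complex_eq_iff Re_sum Im_sum)
  then show "B (cfun q f g) x = cfun q (Bv f) (Bv g) x"
    by (simp add: B_def cfun_def Bv_def mat_op_def)
qed

lemma M_op_eq:
  assumes "h \<in> hom_polys d j' q"
  shows "M_op p J A h = Sv h - Bv h"
  by (rule eq_vecI) (use M_op_nth[OF J A hom_polysD(1)[OF assms]] A in \<open>auto simp: Sv_def Bv_def\<close>)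

lemma cfun_add: "dim_vec f = q \<Longrightarrow> dim_vec g = q \<Longrightarrow> dim_vec f' = q \<Longrightarrow> dim_vec g' = q \<Longrightarrow>
   cfun q (f + f') (g + g') = (\<lambda>x. cfun q f g x + cfun q f' g' x)"
  by (auto simp: cfun_def fun_eq_iff complex_eq_iff)

lemma subspc_V: "subspc V"
  unfolding subspc_def
proof (intro conjI ballI allI)
  have "(\<lambda>_. 0) = cfun q (0\<^sub>v q) (0\<^sub>v q)" by (auto simp: cfun_def fun_eq_iff zero_complex.code)
  then show "(\<lambda>_. 0) \<in> V" unfolding V_def using zero_hom_polys by blast
next
  fix \<phi> \<psi> assume "\<phi> \<in> V" "\<psi> \<in> V"
  then obtain f g f' g' where *: "\<phi> = cfun q f g" "\<psi> = cfun q f' g'"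
    "f \<in> hom_polys (p + c) j q" "g \<in> hom_polys (p + c) j q" "f' \<in> hom_polys (p + c) j q" "g' \<in> hom_polys (p + c) j q"
    unfolding V_def by blast
  then have "(\<lambda>x. \<phi> x + \<psi> x) = cfun q (f + f') (g + g')" by (simp add: cfun_add hom_polysD(1))
  moreover have "f + f' \<in> hom_polys (p + c) j q" "g + g' \<in> hom_polys (p + c) j q"
    using * by (auto intro: add_hom_polys)
  ultimately show "(\<lambda>x. \<phi> x + \<psi> x) \<in> V" unfolding V_def by blast
next
  fix \<phi> :: "nat \<times> (nat \<Rightarrow> real) \<Rightarrow> complex" and z assume "\<phi> \<in> V"
  then obtain f g where *: "\<phi> = cfun q f g" "f \<in> hom_polys (p + c) j q" "g \<in> hom_polys (p + c) j q"
    unfolding V_def by blast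
  let ?f = "Const (Re z) \<cdot>\<^sub>v f - Const (Im z) \<cdot>\<^sub>v g" and ?g = "Const (Im z) \<cdot>\<^sub>v f + Const (Re z) \<cdot>\<^sub>v g"
  have "(\<lambda>x. z * \<phi> x) = cfun q ?f ?g"
    using * by (auto simp: cfun_def fun_eq_iff complex_eq_iff hom_polysD(1))
  moreover have "?f \<in> hom_polys (p + c) j q" "?g \<in> hom_polys (p + c) j q"
    using * by (auto intro!: add_hom_polys diff_hom_polys smult_hom_polys)
  ultimately show "(\<lambda>x. z * \<phi> x) \<in> V" unfolding V_def by blast
qed

lemma S_V: "\<phi> \<in> V \<Longrightarrow> S \<phi> \<in> V"
proof -
  assume "\<phi> \<in> V"
  then obtain f g where *: "\<phi> = cfun q f g" "f \<in> hom_polys (p + c) j q" "g \<in> hom_polys (p + c) j q"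
    unfolding V_def by blast
  with Sv_hom S_cfun show ?thesis unfolding V_def by blast
qed

lemma B_V: "\<phi> \<in> V \<Longrightarrow> B \<phi> \<in> V"
proof -
  assume "\<phi> \<in> V"
  then obtain f g where *: "\<phi> = cfun q f g" "f \<in> hom_polys (p + c) j q" "g \<in> hom_polys (p + c) j q"
    unfolding V_def by blast
  with Bv_hom B_cfun show ?thesis unfolding V_def by blast
qed

lemma kills_B: "\<phi> \<in> V \<Longrightarrow> kills B ys \<phi>"
proof -
  assume "\<phi> \<in> V"
  then have supp: "\<phi> (i, a) = 0" if "q \<le> i" for i a using that by (auto simp: V_def cfun_def)
  have "shifts B xs \<phi> x = shifts (mat_op q A) xs (\<lambda>k. \<phi> (k, snd x)) (fst x)" for xs \<phi> x
    by (induction xs arbitrary: \<phi>) (simp_all add: shift_def B_def)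
  then show ?thesis using Y(2)[of "\<lambda>k. \<phi> (k, _)"] supp by (simp add: kills_def fun_eq_iff)
qed

lemma shift_B_bij:
  assumes "\<sigma> \<in> E"
  shows "\<And>v. v \<in> V \<Longrightarrow> \<exists>u\<in>V. shift B \<sigma> u = v"
    and "\<And>v. v \<in> V \<Longrightarrow> shift B \<sigma> v = (\<lambda>_. 0) \<Longrightarrow> v = (\<lambda>_. 0)"
proof -
  have "\<sigma> \<notin> set ys" using assms disj Y(1) by blast
  then show "\<And>v. v \<in> V \<Longrightarrow> \<exists>u\<in>V. shift B \<sigma> u = v"
    and "\<And>v. v \<in> V \<Longrightarrow> shift B \<sigma> v = (\<lambda>_. 0) \<Longrightarrow> v = (\<lambda>_. 0)"
    using shift_bij[OF lin_B subspc_V B_V kills_B] by blast+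
qed

text \<open>The components come with separate lists; the concatenation of all of them works for
  every component at once.\<close>

lemma killed_cfun:
  assumes "\<And>i. i < q \<Longrightarrow> killed_by (comp_op p c J) E (\<lambda>a. of_real (peval a (h $ i)))"
  obtains xs where "set xs \<subseteq> E" "kills S xs (cfun q h (0\<^sub>v q))"
proof -
  have "\<forall>i. \<exists>xs. i < q \<longrightarrow> set xs \<subseteq> E \<and> kills (comp_op p c J) xs (\<lambda>a. of_real (peval a (h $ i)))"
    using assms unfolding killed_by_def by blast
  then obtain xs where xs: "\<And>i. i < q \<Longrightarrow> set (xs i) \<subseteq> E"
    "\<And>i. i < q \<Longrightarrow> kills (comp_op p c J) (xs i) (\<lambda>a. of_real (peval a (h $ i)))" by metis
  define zs where "zs = concat (map xs [0..<q])"
  have "set (xs i) \<subseteq> E" if "i \<in> {0..<q}" for i using xs(1) that by simp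
  then have 1: "set zs \<subseteq> E" unfolding zs_def by (simp add: UN_subset_iff)
  have *: "kills (comp_op p c J) zs (\<lambda>a. of_real (peval a (h $ i)))" if "i < q" for i
    unfolding zs_def using xs(2)[OF that] that by (intro kills_concat[OF lin_map_comp_op]) auto
  have sh: "shifts S ws \<phi> x = shifts (comp_op p c J) ws (\<lambda>a. \<phi> (fst x, a)) (snd x)" for ws \<phi> x
    by (induction ws arbitrary: \<phi>) (simp_all add: shift_def S_def comp_op_def)
  have "shifts S zs (cfun q h (0\<^sub>v q)) x = 0" for x
  proof (cases "fst x < q")
    case True
    then have "(\<lambda>a. cfun q h (0\<^sub>v q) (fst x, a)) = (\<lambda>a. of_real (peval a (h $ fst x)))"
      by (simp add: cfun_def complex_of_real_def)
    then show ?thesis using *[OF True] by (simp add: sh kills_def)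
  next
    case False
    then have "(\<lambda>a. cfun q h (0\<^sub>v q) (fst x, a)) = (\<lambda>_. 0)" by (simp add: cfun_def)
    then show ?thesis by (simp add: sh lin_map_zero[OF lin_map_shifts[OF lin_map_comp_op]])
  qed
  with 1 show ?thesis using that[of zs] by (simp add: kills_def fun_eq_iff)
qed

lemma cfun_inject:
  assumes "cfun q f g = cfun q f' g'" "dim_vec f = q" "dim_vec f' = q"
  shows "f = f'"
proof (rule eq_vecI)
  fix i assume "i < dim_vec f'"
  then have "i < q" using assms by simp
  then have "peval a (f $ i) = peval a (f' $ i)" for a
    using fun_cong[OF assms(1), of "(i, a)"] by (simp add: cfun_def)
  then show "f $ i = f' $ i" by (rule peval_inject)
qed (simp add: assms)

lemma M_op_surj:
  assumes h: "h \<in> hom_polys (p + c) j q"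
    and "\<And>i. i < q \<Longrightarrow> killed_by (comp_op p c J) E (\<lambda>a. of_real (peval a (h $ i)))"
  shows "\<exists>u\<in>hom_polys (p + c) j q. M_op p J A u = h"
proof -
  obtain xs where xs: "set xs \<subseteq> E" "kills S xs (cfun q h (0\<^sub>v q))" using killed_cfun[OF assms(2)] .
  have "cfun q h (0\<^sub>v q) \<in> V" unfolding V_def using h zero_hom_polys by blast
  from diff_surj[OF lin_S lin_B S_B subspc_V S_V B_V xs(2) this] shift_B_bij xs(1)
  obtain u where "u \<in> V" and u: "(\<lambda>x. S u x - B u x) = cfun q h (0\<^sub>v q)" by blast
  then obtain f g where fg: "u = cfun q f g" "f \<in> hom_polys (p + c) j q" "g \<in> hom_polys (p + c) j q"
    unfolding V_def by blast
  have dims: "dim_vec (Sv h) = q" "dim_vec (Bv h) = q" for h by (simp_all add: Sv_def Bv_def)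
  \<comment> \<open>Both operators have real coefficients, so the real part f of the complex
    solution already solves the equation.\<close>
  have "cfun q (Sv f - Bv f) (Sv g - Bv g) = cfun q h (0\<^sub>v q)"
    unfolding u[symmetric] fg(1) S_cfun B_cfun by (auto simp: cfun_def fun_eq_iff dims complex_eq_iff)
  then have "Sv f - Bv f = h" by (rule cfun_inject) (simp_all add: dims hom_polysD(1)[OF h])
  then show ?thesis using fg(2) M_op_eq[OF fg(2)] by blast
qed

lemma M_op_inj:
  assumes h: "h \<in> hom_polys (p + c) j q" "M_op p J A h = 0\<^sub>v q"
    and "\<And>i. i < q \<Longrightarrow> killed_by (comp_op p c J) E (\<lambda>a. of_real (peval a (h $ i)))"
  shows "h = 0\<^sub>v q"
proof -
  obtain xs where xs: "set xs \<subseteq> E" "kills S xs (cfun q h (0\<^sub>v q))" using killed_cfun[OF assms(3)] .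
  have V: "cfun q h (0\<^sub>v q) \<in> V" unfolding V_def using h zero_hom_polys by blast
  have "Sv h = Bv h"
  proof (rule eq_vecI)
    fix i assume "i < dim_vec (Bv h)"
    then show "Sv h $ i = Bv h $ i"
      using arg_cong[OF h(2), of "\<lambda>v. v $ i"] by (simp add: M_op_eq[OF h(1)] Bv_def)
  qed (simp add: Sv_def Bv_def)
  moreover have "Sv (0\<^sub>v q) = Bv (0\<^sub>v q)" by (rule eq_vecI) (simp_all add: Sv_def Bv_def)
  ultimately have "S (cfun q h (0\<^sub>v q)) = B (cfun q h (0\<^sub>v q))" by (simp add: S_cfun B_cfun)
  from diff_inj[OF lin_S lin_B S_B subspc_V S_V xs(2) V this] shift_B_bij(2) xs(1)
  have "cfun q h (0\<^sub>v q) = (\<lambda>_. 0)" by blast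
  also have "\<dots> = cfun q (0\<^sub>v q) (0\<^sub>v q)" by (auto simp: cfun_def fun_eq_iff zero_complex.code)
  finally show ?thesis by (rule cfun_inject) (simp_all add: hom_polysD(1)[OF h(1)])
qed

end

text \<open>Nonresonance speaks of exponent vectors over a list of eigenvalues, the operator
  argument of products of j factors from a set. The set is contained in the list because eigenvalues
  have positive algebraic multiplicity and 1 is listed when there are parameters.\<close>

lemma nonresonant_prods:
  assumes nr: "nonresonant C \<Lambda> p" and \<Lambda>: "\<Lambda> \<subseteq> spectrum (cmat C)" "finite \<Lambda>" and C: "C \<in> carrier_mat N N"
    and j: "2 \<le> j" and S: "S \<subseteq> \<Lambda> \<union> (if 0 < p then {1} else {})"
  shows "prods S j \<inter> (spectrum (cmat C) - \<Lambda>) = {}"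
proof -
  obtain ls where ls: "mset ls = (\<Sum>\<kappa>\<in>\<Lambda>. replicate_mset (alg_mult C \<kappa>) \<kappa>) + replicate_mset p 1"
    using ex_mset by blast
  have "0 < alg_mult C \<kappa>" if "\<kappa> \<in> \<Lambda>" for \<kappa>
  proof -
    have Cc: "cmat C \<in> carrier_mat N N" using C by simp
    have "eigenvalue (cmat C) \<kappa>" using that \<Lambda>(1) by (auto simp: spectrum_def)
    then have "poly (char_poly (cmat C)) \<kappa> = 0" using eigenvalue_root_char_poly[OF Cc] by simp
    moreover have "char_poly (cmat C) \<noteq> 0" using degree_monic_char_poly[OF Cc] by auto
    ultimately show ?thesis by (simp add: order_root)
  qed
  then have "\<Lambda> \<subseteq> set_mset (\<Sum>\<kappa>\<in>\<Lambda>. replicate_mset (alg_mult C \<kappa>) \<kappa>)"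
    using \<Lambda>(2) by (auto simp: set_mset_sum)
  then have Sls: "S \<subseteq> set ls"
    using S unfolding set_mset_mset[symmetric] ls by (auto split: if_splits)
  have ex: "\<exists>k::nat list. length k = length ls \<and> sum_list k = length ws \<and> (\<Prod>i<length ls. ls ! i ^ k ! i) = prod_list ws"
    if "set ws \<subseteq> S" for ws
    using that
  proof (induction ws)
    case Nil
    show ?case by (intro exI[of _ "replicate (length ls) 0"]) simp
  next
    case (Cons w ws)
    then obtain k :: "nat list" where k: "length k = length ls" "sum_list k = length ws"
      "(\<Prod>i<length ls. ls ! i ^ k ! i) = prod_list ws" by auto
    obtain n where n: "n < length ls" "ls ! n = w"
    proof -
      have "w \<in> set ls" using Cons.prems Sls by auto
      then show ?thesis using that by (auto simp: in_set_conv_nth)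
    qed
    \<comment> \<open>Prepending w raises the exponent at one position n that holds w.\<close>
    let ?k = "k[n := k ! n + 1]"
    have "sum_list ?k = sum_list k + 1" using n k by (simp add: sum_list_update elem_le_sum_list)
    moreover have "(\<Prod>i<length ls. ls ! i ^ ?k ! i) = w * prod_list ws"
    proof -
      have "(\<Prod>i<length ls. ls ! i ^ ?k ! i) = (\<Prod>i<length ls. (if i = n then w else 1) * ls ! i ^ k ! i)"
        by (rule prod.cong) (use n k in \<open>auto simp: nth_list_update\<close>)
      also have "\<dots> = (\<Prod>i<length ls. if i = n then w else 1) * prod_list ws"
        by (simp add: prod.distrib k)
      also have "(\<Prod>i<length ls. if i = n then w else 1) = w" using n by (simp add: prod.delta)
      finally show ?thesis .
    qed
    ultimately show ?case using k by (intro exI[of _ ?k]) simp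
  qed
  show ?thesis
  proof (rule ccontr)
    assume "prods S j \<inter> (spectrum (cmat C) - \<Lambda>) \<noteq> {}"
    then obtain ws where ws: "length ws = j" "set ws \<subseteq> S" "prod_list ws \<in> spectrum (cmat C) - \<Lambda>"
      by (auto simp: prods_def)
    obtain k :: "nat list" where k: "length k = length ls" "sum_list k = length ws"
      "(\<Prod>i<length ls. ls ! i ^ k ! i) = prod_list ws" using ex[OF ws(2)] by blast
    then have "2 \<le> sum_list k" using ws(1) j by simp
    from nr[unfolded nonresonant_def, rule_format, OF ls ws(3) k(1) this] k(3) show False by simp
  qed
qed

subsection \<open>Differentiable functions of finitely many coordinates\<close>

text \<open>A basic neighbourhood in the product topology restricts finitely many coordinates, so
  only finitely many eventualities have to be intersected.\<close>

lemma tendsto_coordinatewise: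
  fixes f :: "'a \<Rightarrow> nat \<Rightarrow> real"
  assumes "\<And>i. ((\<lambda>x. f x i) \<longlongrightarrow> l i) F"
  shows "(f \<longlongrightarrow> l) F"
proof (rule topological_tendstoI)
  fix U :: "(nat \<Rightarrow> real) set" assume "open U" "l \<in> U"
  then have "openin (product_topology (\<lambda>i. euclidean) UNIV) U" by (simp add: open_fun_def)
  from product_topology_open_contains_basis[OF this \<open>l \<in> U\<close>]
  obtain X where X: "l \<in> (\<Pi>\<^sub>E i\<in>UNIV. X i)" "\<And>i. openin euclidean (X i)"
    "finite {i. X i \<noteq> topspace euclidean}" "(\<Pi>\<^sub>E i\<in>UNIV. X i) \<subseteq> U" by blast
  let ?J = "{i. X i \<noteq> UNIV}"
  have fin: "finite ?J" using X(3) by simp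
  have "eventually (\<lambda>x. f x i \<in> X i) F" for i
    using topological_tendstoD[OF assms[of i]] X(1,2) by (auto simp: PiE_iff)
  then have "eventually (\<lambda>x. \<forall>i\<in>?J. f x i \<in> X i) F" by (intro eventually_ball_finite fin) simp
  then show "eventually (\<lambda>x. f x \<in> U) F"
  proof (rule eventually_mono)
    fix x assume "\<forall>i\<in>?J. f x i \<in> X i"
    then have "\<forall>i. f x i \<in> X i" by blast
    then have "f x \<in> (\<Pi>\<^sub>E i\<in>UNIV. X i)" by (simp add: PiE_iff)
    with X(4) show "f x \<in> U" by blast
  qed
qed

definition pd :: "nat \<Rightarrow> ((nat \<Rightarrow> real) \<Rightarrow> real) \<Rightarrow> (nat \<Rightarrow> real) \<Rightarrow> real" where
  "pd i \<phi> a = deriv (\<lambda>t. \<phi> (a(i := a i + t))) 0"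

text \<open>The class \<open>C_nat_on\<close> transported to sequences, where a coordinate is moved
  by a function update and continuity is that of the type.\<close>

primrec Ck :: "nat \<Rightarrow> (nat \<Rightarrow> real) set \<Rightarrow> nat \<Rightarrow> ((nat \<Rightarrow> real) \<Rightarrow> real) \<Rightarrow> bool" where
  "Ck d S 0 \<phi> \<longleftrightarrow> continuous_on S \<phi>"
| "Ck d S (Suc k) \<phi> \<longleftrightarrow> continuous_on S \<phi> \<and>
     (\<forall>i<d. (\<forall>a\<in>S. (\<lambda>t. \<phi> (a(i := a i + t))) field_differentiable (at 0)) \<and> Ck d S k (pd i \<phi>))"

definition cbox0 :: "nat \<Rightarrow> real \<Rightarrow> (nat \<Rightarrow> real) set" where
  "cbox0 d \<epsilon> = {a. \<forall>i<d. \<bar>a i\<bar> < \<epsilon>}"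

text \<open>Allows the coordinates from d on to be changed at will, in particular to be set to zero
  so that limits exist in the product space.\<close>

definition dep :: "nat \<Rightarrow> ((nat \<Rightarrow> real) \<Rightarrow> real) \<Rightarrow> bool" where
  "dep d \<phi> \<longleftrightarrow> (\<forall>a b. (\<forall>i<d. a i = b i) \<longrightarrow> \<phi> a = \<phi> b)"

lemma open_cbox0: "open (cbox0 d \<epsilon>)"
proof -
  have "cbox0 d \<epsilon> = (\<Inter>i\<in>{..<d}. {a. \<bar>a i\<bar> < \<epsilon>})" by (auto simp: cbox0_def)
  moreover have "open {a::nat \<Rightarrow> real. \<bar>a i\<bar> < \<epsilon>}" for i
    by (intro open_Collect_less continuous_on_rabs continuous_on_product_coordinates continuous_on_const)
  ultimately show ?thesis by (auto intro: open_INT)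
qed

lemma eventually_cbox0_upd:
  assumes "a \<in> cbox0 d \<epsilon>"
  shows "eventually (\<lambda>t. a(i := a i + t) \<in> cbox0 d \<epsilon>) (nhds 0)"
proof -
  have "((\<lambda>t. a(i := a i + t)) \<longlongrightarrow> a) (nhds 0)"
  proof (rule tendsto_coordinatewise)
    fix j
    have "((\<lambda>t. a i + t) \<longlongrightarrow> a i + 0) (nhds 0)" by (intro tendsto_intros) (simp add: filterlim_ident)
    then show "((\<lambda>t. (a(i := a i + t)) j) \<longlongrightarrow> a j) (nhds 0)" by (cases "j = i") auto
  qed
  from topological_tendstoD[OF this open_cbox0 assms] show ?thesis .
qed

lemma Ck_deriv:
  assumes "Ck d S (Suc k) \<phi>" "a \<in> S" "i < d"
  shows "((\<lambda>t. \<phi> (a(i := a i + t))) has_real_derivative pd i \<phi> a) (at 0)"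
  unfolding pd_def using assms by (simp add: DERIV_deriv_iff_field_differentiable)

lemma Ck_continuous: "Ck d S k \<phi> \<Longrightarrow> continuous_on S \<phi>"
  by (cases k) auto

lemma Ck_pd: "Ck d S (Suc k) \<phi> \<Longrightarrow> i < d \<Longrightarrow> Ck d S k (pd i \<phi>)"
  by simp

lemma Ck_Suc_imp: "Ck d S (Suc k) \<phi> \<Longrightarrow> Ck d S k \<phi>"
proof (induction k arbitrary: \<phi>)
  case (Suc k)
  have "continuous_on S \<phi>" by (rule Ck_continuous[OF Suc.prems])
  moreover have "(\<forall>a\<in>S. (\<lambda>t. \<phi> (a(i := a i + t))) field_differentiable (at 0)) \<and> Ck d S k (pd i \<phi>)" if "i < d" for i
    using Suc.IH[OF Ck_pd[OF Suc.prems that]] Suc.prems that unfolding Ck.simps(2)[of d S "Suc k"] by blast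
  ultimately show ?case by (simp only: Ck.simps(2)) blast
qed simp

lemma Ck_subset: "Ck d S k \<phi> \<Longrightarrow> T \<subseteq> S \<Longrightarrow> Ck d T k \<phi>"
  by (induction k arbitrary: \<phi>) (auto intro: continuous_on_subset)

lemma Ck_cong:
  assumes "\<And>a. a \<in> cbox0 d \<epsilon> \<Longrightarrow> \<phi> a = \<psi> a" "Ck d (cbox0 d \<epsilon>) k \<phi>"
  shows "Ck d (cbox0 d \<epsilon>) k \<psi>"
  using assms
proof (induction k arbitrary: \<phi> \<psi>)
  case 0
  have "continuous_on (cbox0 d \<epsilon>) \<psi> \<longleftrightarrow> continuous_on (cbox0 d \<epsilon>) \<phi>"
    by (rule continuous_on_cong) (simp_all add: 0(1))
  with 0(2) show ?case by simp
next
  case (Suc k)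
  let ?S = "cbox0 d \<epsilon>"
  have ev: "eventually (\<lambda>t. \<phi> (a(i := a i + t)) = \<psi> (a(i := a i + t))) (nhds 0)" if "a \<in> ?S" for a i
    by (rule eventually_mono[OF eventually_cbox0_upd[OF that]]) (rule Suc.prems(1))
  have "continuous_on ?S \<psi> \<longleftrightarrow> continuous_on ?S \<phi>"
    by (rule continuous_on_cong) (simp_all add: Suc.prems(1))
  then have "continuous_on ?S \<psi>" using Ck_continuous[OF Suc.prems(2)] by simp
  moreover have "(\<lambda>t. \<psi> (a(i := a i + t))) field_differentiable (at 0)" if "a \<in> ?S" "i < d" for a i
    using Ck_deriv[OF Suc.prems(2) that] DERIV_cong_ev[OF refl ev[OF that(1)] refl]
    unfolding field_differentiable_def by blast
  moreover have "Ck d ?S k (pd i \<psi>)" if "i < d" for i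
  proof (rule Suc.IH[OF _ Ck_pd[OF Suc.prems(2) that]])
    fix a assume "a \<in> ?S"
    then show "pd i \<phi> a = pd i \<psi> a" unfolding pd_def by (intro deriv_cong_ev ev) auto
  qed
  ultimately show ?case by simp
qed

lemma Ck_SucI:
  assumes "continuous_on (cbox0 d \<epsilon>) \<phi>"
    and "\<And>i a. i < d \<Longrightarrow> a \<in> cbox0 d \<epsilon> \<Longrightarrow> ((\<lambda>t. \<phi> (a(i := a i + t))) has_real_derivative \<phi>' i a) (at 0)"
    and "\<And>i. i < d \<Longrightarrow> Ck d (cbox0 d \<epsilon>) k (\<phi>' i)"
  shows "Ck d (cbox0 d \<epsilon>) (Suc k) \<phi>"
proof -
  have "Ck d (cbox0 d \<epsilon>) k (pd i \<phi>)" if "i < d" for i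
  proof (rule Ck_cong[OF _ assms(3)[OF that]])
    fix a assume "a \<in> cbox0 d \<epsilon>"
    from DERIV_imp_deriv[OF assms(2)[OF that this]] show "\<phi>' i a = pd i \<phi> a" by (simp add: pd_def)
  qed
  then show ?thesis
    using assms(1,2) unfolding Ck.simps(2) field_differentiable_def by blast
qed

lemma Ck_const: "Ck d (cbox0 d \<epsilon>) k (\<lambda>_. c)"
proof (induction k arbitrary: c)
  case (Suc k)
  show ?case by (rule Ck_SucI[where \<phi>' = "\<lambda>_ _. 0"]) (auto simp: Suc)
qed simp

lemma continuous_on_coord: "continuous_on S (\<lambda>a::nat \<Rightarrow> real. a j)"
  by (rule continuous_on_subset[OF continuous_on_product_coordinates subset_UNIV])

lemma Ck_coord: "Ck d (cbox0 d \<epsilon>) k (\<lambda>a. a j)"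
proof (cases k)
  case (Suc k')
  have "((\<lambda>t. (a(i := a i + t)) j) has_real_derivative (if i = j then 1 else 0)) (at 0)" for a :: "nat \<Rightarrow> real" and i
    by (cases "i = j") (auto intro!: derivative_eq_intros)
  then show ?thesis unfolding Suc
    by (intro Ck_SucI[where \<phi>' = "\<lambda>i _. if i = j then 1 else 0"] Ck_const continuous_on_coord) auto
qed (simp add: continuous_on_coord)

lemma Ck_add: "Ck d (cbox0 d \<epsilon>) k \<phi> \<Longrightarrow> Ck d (cbox0 d \<epsilon>) k \<psi> \<Longrightarrow> Ck d (cbox0 d \<epsilon>) k (\<lambda>a. \<phi> a + \<psi> a)"
proof (induction k arbitrary: \<phi> \<psi>)
  case (Suc k)
  show ?case
  proof (rule Ck_SucI[where \<phi>' = "\<lambda>i a. pd i \<phi> a + pd i \<psi> a"])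
    show "continuous_on (cbox0 d \<epsilon>) (\<lambda>a. \<phi> a + \<psi> a)"
      by (intro continuous_on_add Ck_continuous[OF Suc.prems(1)] Ck_continuous[OF Suc.prems(2)])
  next
    fix i a assume "i < d" "a \<in> cbox0 d \<epsilon>"
    from Ck_deriv[OF Suc.prems(1) this(2,1)] Ck_deriv[OF Suc.prems(2) this(2,1)]
    show "((\<lambda>t. \<phi> (a(i := a i + t)) + \<psi> (a(i := a i + t))) has_real_derivative pd i \<phi> a + pd i \<psi> a) (at 0)"
      by (rule DERIV_add)
  qed (intro Suc.IH Ck_pd[OF Suc.prems(1)] Ck_pd[OF Suc.prems(2)])
qed (simp add: continuous_on_add)

lemma Ck_mult: "Ck d (cbox0 d \<epsilon>) k \<phi> \<Longrightarrow> Ck d (cbox0 d \<epsilon>) k \<psi> \<Longrightarrow> Ck d (cbox0 d \<epsilon>) k (\<lambda>a. \<phi> a * \<psi> a)"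
proof (induction k arbitrary: \<phi> \<psi>)
  case (Suc k)
  show ?case
  proof (rule Ck_SucI[where \<phi>' = "\<lambda>i a. pd i \<phi> a * \<psi> a + pd i \<psi> a * \<phi> a"])
    show "continuous_on (cbox0 d \<epsilon>) (\<lambda>a. \<phi> a * \<psi> a)"
      by (intro continuous_on_mult Ck_continuous[OF Suc.prems(1)] Ck_continuous[OF Suc.prems(2)])
  next
    fix i a assume "i < d" "a \<in> cbox0 d \<epsilon>"
    note D = DERIV_mult[OF Ck_deriv[OF Suc.prems(1) this(2,1)] Ck_deriv[OF Suc.prems(2) this(2,1)]]
    have "a(i := a i + 0) = a" by simp
    then show "((\<lambda>t. \<phi> (a(i := a i + t)) * \<psi> (a(i := a i + t))) has_real_derivative
       pd i \<phi> a * \<psi> a + pd i \<psi> a * \<phi> a) (at 0)"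
      by (intro DERIV_cong[OF D]) (simp only:)
  qed (intro Ck_add Suc.IH Ck_pd[OF Suc.prems(1)] Ck_pd[OF Suc.prems(2)] Ck_Suc_imp[OF Suc.prems(1)] Ck_Suc_imp[OF Suc.prems(2)])
qed (simp add: continuous_on_mult)

lemma Ck_sum: "(\<And>x. x \<in> A \<Longrightarrow> Ck d (cbox0 d \<epsilon>) k (\<phi> x)) \<Longrightarrow> Ck d (cbox0 d \<epsilon>) k (\<lambda>a. \<Sum>x\<in>A. \<phi> x a)"
  by (induction A rule: infinite_finite_induct) (auto simp: Ck_const Ck_add)

section \<open>The chain rule\<close>

lemma dep_pd: "dep d \<phi> \<Longrightarrow> dep d (pd s \<phi>)"
proof -
  assume dep: "dep d \<phi>"
  have "pd s \<phi> a = pd s \<phi> b" if "\<forall>i<d. a i = b i" for a b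
  proof (cases "s < d")
    case True
    have "\<phi> (a(s := a s + t)) = \<phi> (b(s := b s + t))" for t
      using dep[unfolded dep_def, rule_format, of "a(s := a s + t)" "b(s := b s + t)"] that True by simp
    then show ?thesis by (simp add: pd_def)
  next
    case False
    have "\<phi> (a(s := a s + t)) = \<phi> (b(s := b s + t))" for t
      using dep[unfolded dep_def, rule_format, of "a(s := a s + t)" "b(s := b s + t)"] that False by auto
    then show ?thesis by (simp add: pd_def)
  qed
  then show ?thesis by (auto simp: dep_def)
qed

text \<open>The coordinate of a curve may lie on either side of its base value, or coincide with it,
  in every neighbourhood of the base time. The form with min and max covers all cases, with v = x
  when x = y.\<close>

lemma mvt_coord:
  assumes f: "Ck d (cbox0 d \<epsilon>) (Suc k) f" and s: "s < d"
    and b: "\<And>v. min x y \<le> v \<Longrightarrow> v \<le> max x y \<Longrightarrow> b(s := v) \<in> cbox0 d \<epsilon>"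
  shows "\<exists>v. min x y \<le> v \<and> v \<le> max x y \<and> f (b(s := y)) - f (b(s := x)) = pd s f (b(s := v)) * (y - x)"
proof -
  have D: "((\<lambda>v. f (b(s := v))) has_real_derivative pd s f (b(s := v))) (at v)" if "min x y \<le> v" "v \<le> max x y" for v
  proof -
    have "((\<lambda>t. f (b(s := t + v))) has_real_derivative pd s f (b(s := v))) (at 0)"
      using Ck_deriv[OF f b[OF that] s] by (simp add: add.commute)
    then show ?thesis using DERIV_shift[of "\<lambda>v. f (b(s := v))" "pd s f (b(s := v))" 0 v] by simp
  qed
  consider "x = y" | "x < y" | "y < x" by linarith
  then show ?thesis
  proof cases
    case 1
    then show ?thesis by (intro exI[of _ x]) simp
  next
    case 2
    have "\<exists>z. x < z \<and> z < y \<and> f (b(s := y)) - f (b(s := x)) = (y - x) * pd s f (b(s := z))"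
      using MVT2[OF 2, of "\<lambda>v. f (b(s := v))" "\<lambda>v. pd s f (b(s := v))"] D 2 by simp
    then obtain z where z: "x < z" "z < y" "f (b(s := y)) - f (b(s := x)) = (y - x) * pd s f (b(s := z))" by auto
    then have "f (b(s := y)) - f (b(s := x)) = pd s f (b(s := z)) * (y - x)" by (simp only: mult.commute)
    with z 2 show ?thesis by (intro exI[of _ z]) simp
  next
    case 3
    have "\<exists>z. y < z \<and> z < x \<and> f (b(s := x)) - f (b(s := y)) = (x - y) * pd s f (b(s := z))"
      using MVT2[OF 3, of "\<lambda>v. f (b(s := v))" "\<lambda>v. pd s f (b(s := v))"] D 3 by simp
    then obtain z where z: "y < z" "z < x" "f (b(s := x)) - f (b(s := y)) = (x - y) * pd s f (b(s := z))" by auto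
    moreover have "u * (y - x) = - ((x - y) * u)" for u :: real by (simp add: algebra_simps)
    ultimately have "f (b(s := y)) - f (b(s := x)) = pd s f (b(s := z)) * (y - x)" by simp
    with z 3 show ?thesis by (intro exI[of _ z]) simp
  qed
qed

text \<open>Changing one coordinate at a time reduces the chain rule to the mean value theorem in one variable.\<close>

lemma chain_curve:
  assumes f: "Ck d (cbox0 d \<epsilon>) (Suc k) f" "dep d f" and \<gamma>0: "\<gamma> t0 \<in> cbox0 d \<epsilon>"
    and \<gamma>: "\<And>s. s < d \<Longrightarrow> ((\<lambda>t. \<gamma> t s) has_real_derivative \<gamma>' s) (at t0)"
  shows "((\<lambda>t. f (\<gamma> t)) has_real_derivative (\<Sum>s<d. pd s f (\<gamma> t0) * \<gamma>' s)) (at t0)"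
proof -
  \<comment> \<open>\<open>m s t\<close> has its first s coordinates at time t and the others still
    at time t0, so consecutive points differ in coordinate s only.\<close>
  define m where "m s t = (\<lambda>i. if i < s then \<gamma> t i else \<gamma> t0 i)" for s t
  have lim: "((\<lambda>t. \<gamma> t i) \<longlongrightarrow> \<gamma> t0 i) (at t0)" if "i < d" for i
    using DERIV_isCont[OF \<gamma>[OF that]] by (simp add: isCont_def)
  have evbox: "eventually (\<lambda>t. \<forall>i<d. \<bar>\<gamma> t i\<bar> < \<epsilon>) (at t0)"
  proof -
    have "eventually (\<lambda>t. \<bar>\<gamma> t i\<bar> < \<epsilon>) (at t0)" if "i < d" for i
      using order_tendstoD(2)[OF tendsto_rabs[OF lim[OF that]], of \<epsilon>] \<gamma>0 that by (simp add: cbox0_def)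
    then have "eventually (\<lambda>t. \<forall>i\<in>{..<d}. \<bar>\<gamma> t i\<bar> < \<epsilon>) (at t0)" by (intro eventually_ball_finite) auto
    then show ?thesis by (simp add: Ball_def)
  qed
  have step: "((\<lambda>t. f (m (Suc s) t) - f (m s t)) has_real_derivative pd s f (\<gamma> t0) * \<gamma>' s) (at t0)" if s: "s < d" for s
  proof -
    define P where "P t v \<longleftrightarrow> min (\<gamma> t0 s) (\<gamma> t s) \<le> v \<and> v \<le> max (\<gamma> t0 s) (\<gamma> t s) \<and>
       f (m (Suc s) t) - f (m s t) = pd s f ((m s t)(s := v)) * (\<gamma> t s - \<gamma> t0 s)" for t v
    have ex: "\<exists>v. P t v" if box: "\<forall>i<d. \<bar>\<gamma> t i\<bar> < \<epsilon>" for t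
    proof -
      have eqs: "(m s t)(s := \<gamma> t s) = m (Suc s) t" "(m s t)(s := \<gamma> t0 s) = m s t"
        by (auto simp: m_def fun_eq_iff less_Suc_eq)
      have "(m s t)(s := v) \<in> cbox0 d \<epsilon>"
        if "min (\<gamma> t0 s) (\<gamma> t s) \<le> v" "v \<le> max (\<gamma> t0 s) (\<gamma> t s)" for v
      proof -
        have "\<bar>\<gamma> t s\<bar> < \<epsilon>" "\<bar>\<gamma> t0 s\<bar> < \<epsilon>" using box \<gamma>0 s by (auto simp: cbox0_def)
        then have "\<bar>v\<bar> < \<epsilon>" using that by (auto simp: min_def max_def split: if_splits)
        then show ?thesis using box \<gamma>0 by (auto simp: cbox0_def m_def)
      qed
      from mvt_coord[where x = "\<gamma> t0 s" and y = "\<gamma> t s" and b = "m s t", OF f(1) s this] show ?thesis unfolding P_def eqs .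
    qed
    define v where "v t = (SOME v. P t v)" for t
    have v: "P t (v t)" if "\<forall>i<d. \<bar>\<gamma> t i\<bar> < \<epsilon>" for t
      unfolding v_def by (rule someI_ex[OF ex[OF that]])
    \<comment> \<open>The intermediate value is squeezed between two ends that both tend to
      \<open>\<gamma> t0 s\<close>; continuity of the partial derivative then yields the limit of
      the difference quotient.\<close>
    have vlim: "(v \<longlongrightarrow> \<gamma> t0 s) (at t0)"
    proof (rule tendsto_sandwich)
      show "eventually (\<lambda>t. min (\<gamma> t0 s) (\<gamma> t s) \<le> v t) (at t0)" "eventually (\<lambda>t. v t \<le> max (\<gamma> t0 s) (\<gamma> t s)) (at t0)"
        using evbox by (rule eventually_mono, use v in \<open>simp add: P_def\<close>)+
      show "((\<lambda>t. min (\<gamma> t0 s) (\<gamma> t s)) \<longlongrightarrow> \<gamma> t0 s) (at t0)"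
        using tendsto_min[OF tendsto_const lim[OF s], of "\<gamma> t0 s"] by simp
      show "((\<lambda>t. max (\<gamma> t0 s) (\<gamma> t s)) \<longlongrightarrow> \<gamma> t0 s) (at t0)"
        using tendsto_max[OF tendsto_const lim[OF s], of "\<gamma> t0 s"] by simp
    qed
    have \<xi>: "((\<lambda>t. (m s t)(s := v t)) \<longlongrightarrow> \<gamma> t0) (at t0)"
    proof (rule tendsto_coordinatewise)
      fix i
      show "((\<lambda>t. ((m s t)(s := v t)) i) \<longlongrightarrow> \<gamma> t0 i) (at t0)"
      proof (cases "i = s")
        case True
        then show ?thesis using vlim by simp
      next
        case False
        then show ?thesis using lim[of i] s by (cases "i < s") (simp_all add: m_def)
      qed
    qed
    have "((\<lambda>t. pd s f ((m s t)(s := v t))) \<longlongrightarrow> pd s f (\<gamma> t0)) (at t0)"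
      by (rule continuous_on_tendsto_compose[OF Ck_continuous[OF Ck_pd[OF f(1) s]] \<xi> \<gamma>0
            topological_tendstoD[OF \<xi> open_cbox0 \<gamma>0]])
    moreover have "((\<lambda>t. (\<gamma> t s - \<gamma> t0 s) / (t - t0)) \<longlongrightarrow> \<gamma>' s) (at t0)"
      using \<gamma>[OF s] by (simp add: has_field_derivative_iff)
    ultimately have L: "((\<lambda>t. pd s f ((m s t)(s := v t)) * ((\<gamma> t s - \<gamma> t0 s) / (t - t0))) \<longlongrightarrow> pd s f (\<gamma> t0) * \<gamma>' s) (at t0)"
      by (rule tendsto_mult)
    have m0: "f (m (Suc s) t0) - f (m s t0) = 0" by (simp add: m_def)
    show ?thesis
      unfolding has_field_derivative_iff m0 diff_0_right
    proof (rule Lim_transform_eventually[OF L])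
      show "eventually (\<lambda>t. pd s f ((m s t)(s := v t)) * ((\<gamma> t s - \<gamma> t0 s) / (t - t0)) =
          (f (m (Suc s) t) - f (m s t)) / (t - t0)) (at t0)"
        using evbox by (rule eventually_mono) (use v in \<open>simp add: P_def\<close>)
    qed
  qed
  have "((\<lambda>t. f (m n t)) has_real_derivative (\<Sum>s<n. pd s f (\<gamma> t0) * \<gamma>' s)) (at t0)" if "n \<le> d" for n
    using that
  proof (induction n)
    case 0
    have "(\<lambda>t. f (m 0 t)) = (\<lambda>_. f (\<gamma> t0))" by (simp add: m_def)
    then show ?case by simp
  next
    case (Suc n)
    have "((\<lambda>t. f (m n t) + (f (m (Suc n) t) - f (m n t))) has_real_derivative
        (\<Sum>s<n. pd s f (\<gamma> t0) * \<gamma>' s) + pd n f (\<gamma> t0) * \<gamma>' n) (at t0)"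
      by (rule DERIV_add) (use Suc step in auto)
    then show ?case by (simp add: add.commute)
  qed
  from this[of d] have "((\<lambda>t. f (m d t)) has_real_derivative (\<Sum>s<d. pd s f (\<gamma> t0) * \<gamma>' s)) (at t0)" by simp
  moreover have "f (m d t) = f (\<gamma> t)" for t
    using f(2)[unfolded dep_def, rule_format, of "m d t" "\<gamma> t"] by (simp add: m_def)
  ultimately show ?thesis by simp
qed

text \<open>The chain rule is available on centred boxes, so the domain D of f is required to be a
  union of such boxes; the whole space is one. The components of g from d' on are zero, which makes
  g continuous into the product space.\<close>

lemma Ck_compose:
  assumes f: "Ck d' D k f" "dep d' f"
    and g: "\<And>s. s < d' \<Longrightarrow> Ck d (cbox0 d \<epsilon>) k (\<lambda>a. g a s)"
    and zero: "\<And>a s. d' \<le> s \<Longrightarrow> g a s = 0"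
    and map: "\<And>a. a \<in> cbox0 d \<epsilon> \<Longrightarrow> g a \<in> D"
    and D: "\<And>b. b \<in> D \<Longrightarrow> \<exists>\<epsilon>'. b \<in> cbox0 d' \<epsilon>' \<and> cbox0 d' \<epsilon>' \<subseteq> D"
  shows "Ck d (cbox0 d \<epsilon>) k (\<lambda>a. f (g a))"
proof -
  have contg: "continuous_on (cbox0 d \<epsilon>) g"
  proof (rule continuous_on_coordinatewise_then_product)
    fix s show "continuous_on (cbox0 d \<epsilon>) (\<lambda>a. g a s)"
      using Ck_continuous[OF g[of s]] zero[of s] by (cases "s < d'") auto
  qed
  have contf: "continuous_on (cbox0 d \<epsilon>) (\<lambda>a. h (g a))" if "continuous_on D h" for h :: "(nat \<Rightarrow> real) \<Rightarrow> real"
    by (rule continuous_on_compose2[OF that contg]) (use map in auto)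
  show ?thesis using f g
  proof (induction k arbitrary: f)
    case 0
    then show ?case using contf by simp
  next
    case (Suc k)
    show ?case
    proof (rule Ck_SucI[where \<phi>' = "\<lambda>i a. \<Sum>s<d'. pd s f (g a) * pd i (\<lambda>a. g a s) a"])
      show "continuous_on (cbox0 d \<epsilon>) (\<lambda>a. f (g a))" by (rule contf[OF Ck_continuous[OF Suc.prems(1)]])
    next
      fix i a assume i: "i < d" and a: "a \<in> cbox0 d \<epsilon>"
      have upd: "a(i := a i + 0) = a" by simp
      obtain \<epsilon>' where \<epsilon>': "g a \<in> cbox0 d' \<epsilon>'" "cbox0 d' \<epsilon>' \<subseteq> D" using D[OF map[OF a]] by blast
      have "((\<lambda>t. f (g (a(i := a i + t)))) has_real_derivative
         (\<Sum>s<d'. pd s f (g (a(i := a i + 0))) * pd i (\<lambda>a. g a s) a)) (at 0)"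
      proof (rule chain_curve[OF Ck_subset[OF Suc.prems(1) \<epsilon>'(2)] Suc.prems(2)])
        show "g (a(i := a i + 0)) \<in> cbox0 d' \<epsilon>'" unfolding upd by (rule \<epsilon>'(1))
        show "((\<lambda>t. g (a(i := a i + t)) s) has_real_derivative pd i (\<lambda>a. g a s) a) (at 0)" if "s < d'" for s
          by (rule Ck_deriv[OF Suc.prems(3)[OF that] a i])
      qed
      then show "((\<lambda>t. f (g (a(i := a i + t)))) has_real_derivative
         (\<Sum>s<d'. pd s f (g a) * pd i (\<lambda>a. g a s) a)) (at 0)" unfolding upd .
    next
      fix i assume i: "i < d"
      show "Ck d (cbox0 d \<epsilon>) k (\<lambda>a. \<Sum>s<d'. pd s f (g a) * pd i (\<lambda>a. g a s) a)"
      proof (intro Ck_sum Ck_mult)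
        fix s assume "s \<in> {..<d'}"
        then have s: "s < d'" by simp
        show "Ck d (cbox0 d \<epsilon>) k (\<lambda>a. pd s f (g a))"
          by (rule Suc.IH[OF Ck_pd[OF Suc.prems(1) s] dep_pd[OF Suc.prems(2)] Ck_Suc_imp[OF Suc.prems(3)]])
        show "Ck d (cbox0 d \<epsilon>) k (pd i (\<lambda>a. g a s))" by (rule Ck_pd[OF Suc.prems(3)[OF s] i])
      qed
    qed
  qed
qed

subsection \<open>Taylor polynomials\<close>

abbreviation dlists :: "nat \<Rightarrow> nat \<Rightarrow> nat list set" where
  "dlists d m \<equiv> {is. length is = m \<and> set is \<subseteq> {..<d}}"

text \<open>The m-th derivative of t |-> \<phi>(ta). Index lists are ordered, so that one more
  derivative in t just prepends an index to each list.\<close>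

definition taylor_term :: "nat \<Rightarrow> ((nat \<Rightarrow> real) \<Rightarrow> real) \<Rightarrow> (nat \<Rightarrow> real) \<Rightarrow> nat \<Rightarrow> real \<Rightarrow> real" where
  "taylor_term d \<phi> a m t = (\<Sum>is\<in>dlists d m. foldr pd is \<phi> (\<lambda>i. t * a i) * prod_list (map a is))"

definition taylor_poly :: "nat \<Rightarrow> nat \<Rightarrow> ((nat \<Rightarrow> real) \<Rightarrow> real) \<Rightarrow> mpoly" where
  "taylor_poly d k \<phi> = (\<Sum>m\<le>k. Const (1 / fact m) *
     (\<Sum>is\<in>dlists d m. Const (foldr pd is \<phi> (\<lambda>_. 0)) * prod_list (map Var is)))"

lemma dlists_Suc: "dlists d (Suc m) = (\<lambda>(s, is). s # is) ` ({..<d} \<times> dlists d m)"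
  by (auto simp: length_Suc_conv image_iff)

lemma Ck_foldr_pd:
  "Ck d S k \<phi> \<Longrightarrow> set is \<subseteq> {..<d} \<Longrightarrow> length is \<le> k \<Longrightarrow> Ck d S (k - length is) (foldr pd is \<phi>)"
proof (induction "is")
  case (Cons i "is")
  then have "Ck d S (Suc (k - length (i # is))) (foldr pd is \<phi>)" by (simp add: Suc_diff_Suc)
  then show ?case using Cons.prems by (simp add: Ck_pd del: Ck.simps)
qed simp

lemma dep_foldr_pd: "dep d \<phi> \<Longrightarrow> dep d (foldr pd is \<phi>)"
  by (induction "is") (simp_all add: dep_pd)

lemma taylor_term_deriv:
  assumes \<phi>: "Ck d (cbox0 d \<epsilon>) k \<phi>" "dep d \<phi>" and "m < k" and "(\<lambda>i. t * a i) \<in> cbox0 d \<epsilon>"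
  shows "((taylor_term d \<phi> a m) has_real_derivative taylor_term d \<phi> a (Suc m) t) (at t)"
proof -
  have "((\<lambda>t. foldr pd is \<phi> (\<lambda>i. t * a i)) has_real_derivative
      (\<Sum>s<d. pd s (foldr pd is \<phi>) (\<lambda>i. t * a i) * a s)) (at t)" if "is \<in> dlists d m" for "is"
  proof (rule chain_curve)
    show "Ck d (cbox0 d \<epsilon>) (Suc (k - Suc m)) (foldr pd is \<phi>)"
      using Ck_foldr_pd[OF \<phi>(1), of "is"] that \<open>m < k\<close> by (simp add: Suc_diff_Suc del: Ck.simps)
    show "dep d (foldr pd is \<phi>)" by (rule dep_foldr_pd[OF \<phi>(2)])
    show "((\<lambda>t. t * a s) has_real_derivative a s) (at t)" for s
      by (auto intro!: derivative_eq_intros)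
  qed (rule assms(4))
  then have "((\<lambda>t. \<Sum>is\<in>dlists d m. foldr pd is \<phi> (\<lambda>i. t * a i) * prod_list (map a is)) has_real_derivative
      (\<Sum>is\<in>dlists d m. (\<Sum>s<d. pd s (foldr pd is \<phi>) (\<lambda>i. t * a i) * a s) * prod_list (map a is))) (at t)"
    by (intro DERIV_sum DERIV_cmult_right)
  moreover have "(\<Sum>is\<in>dlists d m. (\<Sum>s<d. pd s (foldr pd is \<phi>) (\<lambda>i. t * a i) * a s) * prod_list (map a is)) =
      taylor_term d \<phi> a (Suc m) t"
  proof -
    have inj: "inj_on (\<lambda>(s, is). s # is) ({..<d} \<times> dlists d m)" by (auto simp: inj_on_def)
    have "taylor_term d \<phi> a (Suc m) t = (\<Sum>(s, is)\<in>{..<d} \<times> dlists d m.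
       pd s (foldr pd is \<phi>) (\<lambda>i. t * a i) * (a s * prod_list (map a is)))"
      unfolding taylor_term_def dlists_Suc sum.reindex[OF inj] by (intro sum.cong) auto
    also have "\<dots> = (\<Sum>s<d. \<Sum>is\<in>dlists d m. pd s (foldr pd is \<phi>) (\<lambda>i. t * a i) * (a s * prod_list (map a is)))"
      by (rule sum.cartesian_product[symmetric])
    also have "\<dots> = (\<Sum>is\<in>dlists d m. (\<Sum>s<d. pd s (foldr pd is \<phi>) (\<lambda>i. t * a i) * a s) * prod_list (map a is))"
      by (subst sum.swap) (simp add: sum_distrib_right mult.assoc)
    finally show ?thesis by simp
  qed
  ultimately show ?thesis by (simp add: taylor_term_def[abs_def])
qed

text \<open>The one-variable Maclaurin formula with Lagrange remainder for t |-> \<phi>(ta), read at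
  t = 1.\<close>

lemma taylor_point:
  assumes \<phi>: "Ck d (cbox0 d \<epsilon>) k \<phi>" "dep d \<phi>" and "0 < k" and a: "a \<in> cbox0 d \<epsilon>"
  shows "\<exists>\<theta>. 0 \<le> \<theta> \<and> \<theta> \<le> 1 \<and> \<phi> a = (\<Sum>m<k. taylor_term d \<phi> a m 0 / fact m) + taylor_term d \<phi> a k \<theta> / fact k"
proof -
  have "(\<lambda>i. t * a i) \<in> cbox0 d \<epsilon>" if "0 \<le> t" "t \<le> 1" for t
    unfolding cbox0_def
  proof (intro CollectI allI impI)
    fix i assume "i < d"
    then have "\<bar>a i\<bar> < \<epsilon>" using a by (simp add: cbox0_def)
    moreover have "\<bar>t * a i\<bar> \<le> \<bar>a i\<bar>" using that by (simp add: abs_mult mult_left_le_one_le)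
    ultimately show "\<bar>t * a i\<bar> < \<epsilon>" by linarith
  qed
  then have D: "\<forall>m t. m < k \<and> 0 \<le> t \<and> t \<le> 1 \<longrightarrow> DERIV (taylor_term d \<phi> a m) t :> taylor_term d \<phi> a (Suc m) t"
    using taylor_term_deriv[OF \<phi>] by blast
  have "dlists d 0 = {[]}" by auto
  then have "taylor_term d \<phi> a 0 1 = \<phi> a" by (simp add: taylor_term_def)
  moreover have "\<exists>\<theta>. 0 < \<theta> \<and> \<theta> < 1 \<and> taylor_term d \<phi> a 0 1 =
      (\<Sum>m<k. taylor_term d \<phi> a m 0 / fact m * 1 ^ m) + taylor_term d \<phi> a k \<theta> / fact k * 1 ^ k"
  proof (rule Maclaurin)
    show "\<forall>m t. m < k \<and> 0 \<le> t \<and> t \<le> 1 \<longrightarrow> DERIV (taylor_term d \<phi> a m) t :> taylor_term d \<phi> a (Suc m) t"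
      by (rule D)
  qed (use \<open>0 < k\<close> in simp_all)
  ultimately obtain \<theta> where "0 < \<theta>" "\<theta> < 1"
      "\<phi> a = (\<Sum>m<k. taylor_term d \<phi> a m 0 / fact m) + taylor_term d \<phi> a k \<theta> / fact k"
    by auto
  then show ?thesis by (intro exI[of _ \<theta>]) simp
qed

lemma taylor_poly_cong:
  assumes "0 < \<epsilon>" "\<And>a. a \<in> cbox0 d \<epsilon> \<Longrightarrow> \<phi> a = \<psi> a"
  shows "taylor_poly d k \<phi> = taylor_poly d k \<psi>"
proof -
  have "\<forall>a\<in>cbox0 d \<epsilon>. foldr pd is \<phi> a = foldr pd is \<psi> a" for "is"
  proof (induction "is")
    case (Cons i "is")
    show ?case
    proof
      fix a assume "a \<in> cbox0 d \<epsilon>"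
      then have "eventually (\<lambda>t. a(i := a i + t) \<in> cbox0 d \<epsilon>) (nhds 0)" by (rule eventually_cbox0_upd)
      then have "eventually (\<lambda>t. foldr pd is \<phi> (a(i := a i + t)) = foldr pd is \<psi> (a(i := a i + t))) (nhds 0)"
        by (rule eventually_mono) (rule bspec[OF Cons.IH])
      from deriv_cong_ev[OF this refl] show "foldr pd (i # is) \<phi> a = foldr pd (i # is) \<psi> a"
        by (simp add: pd_def[of i])
    qed
  qed (use assms(2) in simp)
  moreover have "(\<lambda>_. 0) \<in> cbox0 d \<epsilon>" using assms(1) by (simp add: cbox0_def)
  ultimately show ?thesis by (simp add: taylor_poly_def)
qed

lemma peval_prod_list_Var: "peval a (prod_list (map Var is)) = prod_list (map a is)"
  by (induction "is") simp_all

lemma peval_taylor_poly: "peval a (taylor_poly d k \<phi>) = (\<Sum>m\<le>k. taylor_term d \<phi> a m 0 / fact m)"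
  by (simp add: taylor_poly_def taylor_term_def peval_prod_list_Var)

lemma bigo_id_tendsto_0:
  assumes "f \<in> O[at 0](\<lambda>t::real. t)"
  shows "(f \<longlongrightarrow> (0::real)) (at 0)"
proof -
  have "(\<lambda>t::real. t) \<in> o[at 0](\<lambda>_. 1)" by (rule smalloI_tendsto) (auto intro: tendsto_ident_at)
  with assms have "f \<in> o[at 0](\<lambda>_. 1)" by (rule landau_o.big_small_trans)
  from smalloD_tendsto[OF this] show ?thesis by simp
qed

lemma prod_list_bigo:
  assumes "\<And>i. i \<in> set is \<Longrightarrow> (\<lambda>t. \<gamma> t i) \<in> O[at 0](\<lambda>t::real. t)"
  shows "(\<lambda>t. prod_list (map (\<gamma> t) is) :: real) \<in> O[at 0](\<lambda>t. t ^ length is)"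
  using assms
proof (induction "is")
  case (Cons i "is")
  then show ?case using landau_o.big.mult[of "\<lambda>t. \<gamma> t i" "at 0" "\<lambda>t. t"] by simp
qed simp

lemma taylor_curve:
  assumes \<phi>: "Ck d (cbox0 d \<epsilon>) k \<phi>" "dep d \<phi>" and "0 < k" "0 < \<epsilon>"
    and \<gamma>: "\<And>i. i < d \<Longrightarrow> (\<lambda>t. \<gamma> t i) \<in> O[at 0](\<lambda>t. t)"
  shows "(\<lambda>t. \<phi> (\<gamma> t) - peval (\<gamma> t) (taylor_poly d k \<phi>)) \<in> o[at 0](\<lambda>t. t ^ k)"
proof -
  \<comment> \<open>Coordinates from d on are set to zero, so that the curve converges to 0 in the
    full product space.\<close>
  define \<gamma>' where "\<gamma>' t = (\<lambda>i. if i < d then \<gamma> t i else 0)" for t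
  have \<gamma>': "(\<lambda>t. \<gamma>' t i) \<in> O[at 0](\<lambda>t. t)" for i
    using \<gamma> by (cases "i < d") (simp_all add: \<gamma>'_def)
  have lim: "((\<lambda>t. \<gamma>' t i) \<longlongrightarrow> 0) (at 0)" for i by (rule bigo_id_tendsto_0[OF \<gamma>'])
  have eq\<phi>: "\<phi> (\<gamma> t) = \<phi> (\<gamma>' t)" for t
    using \<phi>(2)[unfolded dep_def, rule_format, of "\<gamma> t" "\<gamma>' t"] by (simp add: \<gamma>'_def)
  have eqP: "peval (\<gamma> t) (taylor_poly d k \<phi>) = peval (\<gamma>' t) (taylor_poly d k \<phi>)" for t
  proof -
    have "prod_list (map (\<gamma> t) is) = prod_list (map (\<gamma>' t) is)" if "set is \<subseteq> {..<d}" for "is"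
      using that by (induction "is") (auto simp: \<gamma>'_def)
    then show ?thesis by (simp add: peval_taylor_poly taylor_term_def)
  qed
  have zero: "(\<lambda>_. 0) \<in> cbox0 d \<epsilon>" using \<open>0 < \<epsilon>\<close> by (simp add: cbox0_def)
  have "(\<gamma>' \<longlongrightarrow> (\<lambda>_. 0)) (at 0)" by (rule tendsto_coordinatewise) (rule lim)
  from topological_tendstoD[OF this open_cbox0 zero]
  have evbox: "eventually (\<lambda>t. \<gamma>' t \<in> cbox0 d \<epsilon>) (at 0)" .
  define Q where "Q t \<theta> \<longleftrightarrow> 0 \<le> \<theta> \<and> \<theta> \<le> 1 \<and> \<phi> (\<gamma>' t) = (\<Sum>m<k. taylor_term d \<phi> (\<gamma>' t) m 0 / fact m) +
      taylor_term d \<phi> (\<gamma>' t) k \<theta> / fact k" for t \<theta>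
  \<comment> \<open>The default 0 keeps \<theta> in [0,1] for all t, also where the curve is outside
    the box.\<close>
  define \<theta> where "\<theta> t = (if \<gamma>' t \<in> cbox0 d \<epsilon> then SOME \<theta>. Q t \<theta> else 0)" for t
  have Q: "Q t (\<theta> t)" if "\<gamma>' t \<in> cbox0 d \<epsilon>" for t
  proof -
    have "\<exists>\<theta>. Q t \<theta>" unfolding Q_def by (rule taylor_point[OF \<phi> \<open>0 < k\<close> that])
    from someI_ex[OF this] show ?thesis using that by (simp add: \<theta>_def)
  qed
  have \<theta>: "0 \<le> \<theta> t \<and> \<theta> t \<le> 1" for t
  proof (cases "\<gamma>' t \<in> cbox0 d \<epsilon>")
    case True
    from Q[OF this] show ?thesis unfolding Q_def by blast
  qed (simp add: \<theta>_def)
  define c where "c is t = (foldr pd is \<phi> (\<lambda>i. \<theta> t * \<gamma>' t i) - foldr pd is \<phi> (\<lambda>_. 0)) / fact k" for "is" t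
  have "((\<lambda>t. (\<lambda>i. \<theta> t * \<gamma>' t i)) \<longlongrightarrow> (\<lambda>_. 0)) (at 0)"
  proof (rule tendsto_coordinatewise)
    fix i
    show "((\<lambda>t. \<theta> t * \<gamma>' t i) \<longlongrightarrow> 0) (at 0)"
    proof (rule Lim_null_comparison)
      show "eventually (\<lambda>t. norm (\<theta> t * \<gamma>' t i) \<le> \<bar>\<gamma>' t i\<bar>) (at 0)"
        using \<theta> by (simp add: abs_mult mult_left_le_one_le)
      show "((\<lambda>t. \<bar>\<gamma>' t i\<bar>) \<longlongrightarrow> 0) (at 0)" using tendsto_rabs[OF lim[of i]] by simp
    qed
  qed
  note \<theta>lim = this
  have c: "c is \<in> o[at 0](\<lambda>_. 1)" if "is \<in> dlists d k" for "is"
  proof (rule smalloI_tendsto)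
    have "continuous_on (cbox0 d \<epsilon>) (foldr pd is \<phi>)"
      using Ck_foldr_pd[OF \<phi>(1), of "is"] that by (intro Ck_continuous[of d _ "k - length is"]) simp
    from continuous_on_tendsto_compose[OF this \<theta>lim zero topological_tendstoD[OF \<theta>lim open_cbox0 zero]]
    have "((\<lambda>t. foldr pd is \<phi> (\<lambda>i. \<theta> t * \<gamma>' t i)) \<longlongrightarrow> foldr pd is \<phi> (\<lambda>_. 0)) (at 0)" .
    then have "((\<lambda>t. (foldr pd is \<phi> (\<lambda>i. \<theta> t * \<gamma>' t i) - foldr pd is \<phi> (\<lambda>_. 0)) / fact k) \<longlongrightarrow> 0) (at 0)"
      using tendsto_divide[OF tendsto_diff[OF _ tendsto_const] tendsto_const, of _ "foldr pd is \<phi> (\<lambda>_. 0)" "at 0" "fact k" "foldr pd is \<phi> (\<lambda>_. 0)"]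
      by fastforce
    then show "((\<lambda>t. c is t / 1) \<longlongrightarrow> 0) (at 0)" by (simp add: c_def)
  qed simp
  have "(\<lambda>t. c is t * prod_list (map (\<gamma>' t) is)) \<in> o[at 0](\<lambda>t. t ^ k)" if "is \<in> dlists d k" for "is"
  proof -
    have "(\<lambda>t. prod_list (map (\<gamma>' t) is)) \<in> O[at 0](\<lambda>t. t ^ length is)" by (rule prod_list_bigo) (rule \<gamma>')
    with c[OF that] have "(\<lambda>t. c is t * prod_list (map (\<gamma>' t) is)) \<in> o[at 0](\<lambda>t. 1 * t ^ length is)"
      by (rule landau_o.small_big_mult)
    then show ?thesis using that by simp
  qed
  then have "(\<lambda>t. \<Sum>is\<in>dlists d k. c is t * prod_list (map (\<gamma>' t) is)) \<in> o[at 0](\<lambda>t. t ^ k)"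
    by (rule big_sum_in_smallo)
  note A = this
  have "eventually (\<lambda>t. (\<Sum>is\<in>dlists d k. c is t * prod_list (map (\<gamma>' t) is)) =
     \<phi> (\<gamma> t) - peval (\<gamma> t) (taylor_poly d k \<phi>)) (at 0)"
    using evbox
  proof (rule eventually_mono)
    fix t assume t: "\<gamma>' t \<in> cbox0 d \<epsilon>"
    have "(\<Sum>is\<in>dlists d k. c is t * prod_list (map (\<gamma>' t) is)) =
      (taylor_term d \<phi> (\<gamma>' t) k (\<theta> t) - taylor_term d \<phi> (\<gamma>' t) k 0) / fact k"
      by (simp add: c_def taylor_term_def sum_subtractf[symmetric] sum_divide_distrib left_diff_distrib[symmetric])
    also have "\<dots> = \<phi> (\<gamma>' t) - peval (\<gamma>' t) (taylor_poly d k \<phi>)"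
      using Q[OF t] by (simp add: Q_def peval_taylor_poly lessThan_Suc_atMost[symmetric] diff_divide_distrib)
    finally show "(\<Sum>is\<in>dlists d k. c is t * prod_list (map (\<gamma>' t) is)) =
      \<phi> (\<gamma> t) - peval (\<gamma> t) (taylor_poly d k \<phi>)" by (simp only: eq\<phi> eqP)
  qed
  from landau_o.small.in_cong[OF this] A show ?thesis by (rule iffD1)
qed

subsection \<open>Jets\<close>

text \<open>Approximation along every line through 0, without uniformity in the direction; this
  already determines the polynomial up to order k.\<close>

definition jet :: "nat \<Rightarrow> ((nat \<Rightarrow> real) \<Rightarrow> real) \<Rightarrow> mpoly \<Rightarrow> bool" where
  "jet k \<phi> f \<longleftrightarrow> (\<forall>a. (\<lambda>t. \<phi> (\<lambda>i. t * a i) - peval (\<lambda>i. t * a i) f) \<in> o[at 0](\<lambda>t. t ^ k))"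

lemma bigo_scale: "(\<lambda>t::real. t * x) \<in> O[at 0](\<lambda>t. t)" for x :: real
  by (rule bigoI[of _ "\<bar>x\<bar>"]) (simp add: abs_mult mult.commute)

lemma jet_taylor_poly:
  assumes "Ck d (cbox0 d \<epsilon>) k \<phi>" "dep d \<phi>" "0 < k" "0 < \<epsilon>"
  shows "jet k \<phi> (taylor_poly d k \<phi>)"
  unfolding jet_def by (intro allI taylor_curve[OF assms] bigo_scale)

lemma jet_peval: "jet k (\<lambda>a. peval a f) f"
  by (simp add: jet_def)

lemma jet_add: "jet k \<phi> f \<Longrightarrow> jet k \<psi> g \<Longrightarrow> jet k (\<lambda>a. \<phi> a + \<psi> a) (f + g)"
  unfolding jet_def
proof (intro allI)
  fix a assume *: "\<forall>a. (\<lambda>t. \<phi> (\<lambda>i. t * a i) - peval (\<lambda>i. t * a i) f) \<in> o[at 0](\<lambda>t. t ^ k)"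
    "\<forall>a. (\<lambda>t. \<psi> (\<lambda>i. t * a i) - peval (\<lambda>i. t * a i) g) \<in> o[at 0](\<lambda>t. t ^ k)"
  from sum_in_smallo(1)[OF *(1)[rule_format, of a] *(2)[rule_format, of a]]
  show "(\<lambda>t. \<phi> (\<lambda>i. t * a i) + \<psi> (\<lambda>i. t * a i) - peval (\<lambda>i. t * a i) (f + g)) \<in> o[at 0](\<lambda>t. t ^ k)"
    by (simp add: algebra_simps)
qed

lemma jet_smult: "jet k \<phi> f \<Longrightarrow> jet k (\<lambda>a. r * \<phi> a) (Const r * f)"
  unfolding jet_def
proof (intro allI)
  fix a assume *: "\<forall>a. (\<lambda>t. \<phi> (\<lambda>i. t * a i) - peval (\<lambda>i. t * a i) f) \<in> o[at 0](\<lambda>t. t ^ k)"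
  have "(\<lambda>t. r * (\<phi> (\<lambda>i. t * a i) - peval (\<lambda>i. t * a i) f)) \<in> o[at 0](\<lambda>t. t ^ k)"
    using *[rule_format, of a] by (cases "r = 0") simp_all
  then show "(\<lambda>t. r * \<phi> (\<lambda>i. t * a i) - peval (\<lambda>i. t * a i) (Const r * f)) \<in> o[at 0](\<lambda>t. t ^ k)"
    by (simp add: right_diff_distrib)
qed

lemma jet_sum: "(\<And>x. x \<in> A \<Longrightarrow> jet k (\<phi> x) (f x)) \<Longrightarrow> jet k (\<lambda>a. \<Sum>x\<in>A. \<phi> x a) (\<Sum>x\<in>A. f x)"
  by (induction A rule: infinite_finite_induct) (auto simp: jet_add jet_def[of _ "\<lambda>_. 0"])

lemma jet_cong:
  assumes "jet k \<phi> f" "0 < \<epsilon>" "\<And>a. a \<in> cbox0 d \<epsilon> \<Longrightarrow> \<phi> a = \<psi> a"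
  shows "jet k \<psi> f"
  unfolding jet_def
proof
  fix a :: "nat \<Rightarrow> real"
  have lim: "((\<lambda>t. (\<lambda>i. t * a i)) \<longlongrightarrow> (\<lambda>_. 0)) (at 0)"
    by (rule tendsto_coordinatewise) (rule bigo_id_tendsto_0[OF bigo_scale])
  have "(\<lambda>_. 0) \<in> cbox0 d \<epsilon>" using assms(2) by (simp add: cbox0_def)
  from topological_tendstoD[OF lim open_cbox0 this]
  have "eventually (\<lambda>t. (\<lambda>i. t * a i) \<in> cbox0 d \<epsilon>) (at 0)" .
  then have "eventually (\<lambda>t. \<phi> (\<lambda>i. t * a i) - peval (\<lambda>i. t * a i) f = \<psi> (\<lambda>i. t * a i) - peval (\<lambda>i. t * a i) f) (at 0)"
    by (rule eventually_mono) (simp add: assms(3))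
  from landau_o.small.in_cong[OF this] assms(1)[unfolded jet_def, rule_format, of a]
  show "(\<lambda>t. \<psi> (\<lambda>i. t * a i) - peval (\<lambda>i. t * a i) f) \<in> o[at 0](\<lambda>t. t ^ k)"
    by (rule iffD1)
qed

lemma eventually_power_neq_0: "eventually (\<lambda>t::real. t ^ k \<noteq> 0) (at 0)"
  by (rule eventually_mono[OF eventually_neq_at_within[of 0]]) simp

text \<open>A function that is o(t^(k+1)) is also o(t^k), so the lower coefficients vanish by
  induction; the remaining one is then a constant with limit 0.\<close>

lemma smallo_polynomial:
  fixes c :: "nat \<Rightarrow> real"
  assumes "(\<lambda>t. \<Sum>i\<le>k. c i * t ^ i) \<in> o[at 0](\<lambda>t. t ^ k)"
  shows "\<forall>i\<le>k. c i = 0"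
  using assms
proof (induction k)
  case 0
  then have "((\<lambda>t::real. c 0) \<longlongrightarrow> 0) (at 0)" using smalloD_tendsto[of "\<lambda>_. c 0" "at 0" "\<lambda>_. 1"] by simp
  then show ?case using tendsto_const_iff[of "at (0::real)" "c 0" 0] by simp
next
  case (Suc k)
  have pw: "(\<lambda>t::real. t ^ Suc k) \<in> o[at 0](\<lambda>t. t ^ k)"
  proof (rule smalloI_tendsto)
    show "((\<lambda>t::real. t ^ Suc k / t ^ k) \<longlongrightarrow> 0) (at 0)"
      by (rule Lim_transform_eventually[OF tendsto_ident_at])
        (rule eventually_mono[OF eventually_power_neq_0[of k]], simp)
  qed (rule eventually_power_neq_0)
  have "(\<lambda>t. \<Sum>i\<le>Suc k. c i * t ^ i) \<in> o[at 0](\<lambda>t. t ^ k)"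
    by (rule landau_o.small_trans[OF Suc.prems pw])
  moreover have "(\<lambda>t. c (Suc k) * t ^ Suc k) \<in> o[at 0](\<lambda>t. t ^ k)"
    using pw by (cases "c (Suc k) = 0") simp_all
  ultimately have "(\<lambda>t. (\<Sum>i\<le>Suc k. c i * t ^ i) - c (Suc k) * t ^ Suc k) \<in> o[at 0](\<lambda>t. t ^ k)"
    by (rule sum_in_smallo(2))
  then have "(\<lambda>t. \<Sum>i\<le>k. c i * t ^ i) \<in> o[at 0](\<lambda>t. t ^ k)"
    by (simp only: sum.atMost_Suc add_diff_cancel_right')
  then have IH: "\<forall>i\<le>k. c i = 0" by (rule Suc.IH)
  have "(\<Sum>i\<le>k. c i * t ^ i) = 0" for t
  proof (intro sum.neutral ballI)
    fix i assume "i \<in> {..k}"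
    then have "c i = 0" using IH by blast
    then show "c i * t ^ i = 0" by simp
  qed
  then have "(\<lambda>t. \<Sum>i\<le>Suc k. c i * t ^ i) = (\<lambda>t. c (Suc k) * t ^ Suc k)"
    by (simp only: sum.atMost_Suc add_0)
  with Suc.prems have "(\<lambda>t. c (Suc k) * t ^ Suc k) \<in> o[at 0](\<lambda>t. t ^ Suc k)" by (simp only:)
  from smalloD_tendsto[OF this] have "((\<lambda>t::real. c (Suc k) * t ^ Suc k / t ^ Suc k) \<longlongrightarrow> 0) (at 0)" .
  then have "((\<lambda>t::real. c (Suc k)) \<longlongrightarrow> 0) (at 0)"
    by (rule Lim_transform_eventually) (rule eventually_mono[OF eventually_power_neq_0[of "Suc k"]], simp)
  then have "c (Suc k) = 0" using tendsto_const_iff[of "at (0::real)" "c (Suc k)" 0] by simp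
  show ?case
  proof (intro allI impI)
    fix i assume "i \<le> Suc k"
    then consider "i \<le> k" | "i = Suc k" by (auto simp: le_Suc_eq)
    then show "c i = 0" by cases (use IH \<open>c (Suc k) = 0\<close> in blast)+
  qed
qed

lemma peval_ord_ge_smallo:
  assumes "ord_ge (Suc k) f"
  shows "(\<lambda>t. peval (\<lambda>i. t * a i) f) \<in> o[at 0](\<lambda>t. t ^ k)"
proof -
  have "(\<lambda>t. lookup f m * mon (\<lambda>i. t * a i) m) \<in> o[at 0](\<lambda>t. t ^ k)" if m: "m \<in> keys f" for m
  proof -
    obtain n where n: "mon_degree m = Suc (k + n)"
      using assms m by (auto simp: ord_ge_def dest!: bspec le_Suc_ex)
    have "mon (\<lambda>i. t * a i) m = t ^ mon_degree m * mon a m" for t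
      by (simp add: mon_def mon_degree_def power_mult_distrib prod.distrib power_sum)
    then have eq: "(\<lambda>t. lookup f m * mon (\<lambda>i. t * a i) m) = (\<lambda>t. (t * (t ^ n * (lookup f m * mon a m))) * t ^ k)"
      by (simp add: n power_add fun_eq_iff ac_simps)
    show ?thesis unfolding eq
    proof (rule smalloI_tendsto)
      have "((\<lambda>t::real. t * (t ^ n * (lookup f m * mon a m))) \<longlongrightarrow> 0 * (0 ^ n * (lookup f m * mon a m))) (at 0)"
        by (intro tendsto_intros)
      then have "((\<lambda>t::real. t * (t ^ n * (lookup f m * mon a m))) \<longlongrightarrow> 0) (at 0)" by simp
      then show "((\<lambda>t::real. (t * (t ^ n * (lookup f m * mon a m))) * t ^ k / t ^ k) \<longlongrightarrow> 0) (at 0)"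
        by (rule Lim_transform_eventually) (rule eventually_mono[OF eventually_power_neq_0[of k]], simp)
    qed (rule eventually_power_neq_0)
  qed
  then show ?thesis unfolding gsubst_def by (rule big_sum_in_smallo)
qed

text \<open>Along the ray through a, the homogeneous parts of the difference become the coefficients
  of a polynomial in t that is o(t^k); they vanish for every a.\<close>

lemma jet_unique:
  assumes "jet k \<phi> f" "jet k \<phi> g"
  shows "cong_upto k f g"
proof -
  define h where "h = f - g"
  have "peval a (hom_part i h) = 0" if "i \<le> k" for a i
  proof -
    have "(\<lambda>t. (\<phi> (\<lambda>i. t * a i) - peval (\<lambda>i. t * a i) g) - (\<phi> (\<lambda>i. t * a i) - peval (\<lambda>i. t * a i) f)) \<in> o[at 0](\<lambda>t. t ^ k)"
      by (rule sum_in_smallo(2)[OF assms(2)[unfolded jet_def, rule_format] assms(1)[unfolded jet_def, rule_format]])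
    then have "(\<lambda>t. peval (\<lambda>i. t * a i) h) \<in> o[at 0](\<lambda>t. t ^ k)" by (simp add: h_def)
    moreover have "(\<lambda>t. peval (\<lambda>i. t * a i) (h - (\<Sum>i\<le>k. hom_part i h))) \<in> o[at 0](\<lambda>t. t ^ k)"
      by (rule peval_ord_ge_smallo[OF sum_hom_part_atMost])
    ultimately have "(\<lambda>t. peval (\<lambda>i. t * a i) h - peval (\<lambda>i. t * a i) (h - (\<Sum>i\<le>k. hom_part i h))) \<in> o[at 0](\<lambda>t. t ^ k)"
      by (rule sum_in_smallo(2))
    then have "(\<lambda>t. \<Sum>i\<le>k. peval a (hom_part i h) * t ^ i) \<in> o[at 0](\<lambda>t. t ^ k)"
      by (simp add: peval_scale_homog[OF homog_hom_part] mult.commute)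
    from smallo_polynomial[OF this] that show ?thesis by blast
  qed
  then have "hom_part i h = 0" if "i \<le> k" for i using that by (intro peval_eq_0_imp)
  then show ?thesis by (simp add: cong_upto_iff h_def hom_part_diff)
qed

text \<open>Boundedness is carried along in the induction because the difference of two products
  needs it for one factor in each term.\<close>

lemma peval_smallo:
  fixes u v :: "real \<Rightarrow> nat \<Rightarrow> real"
  assumes d: "\<And>i. (\<lambda>t. u t i - v t i) \<in> o[at 0](\<lambda>t. t ^ k)"
    and bd: "\<And>i. (\<lambda>t. u t i) \<in> O[at 0](\<lambda>_. 1)" "\<And>i. (\<lambda>t. v t i) \<in> O[at 0](\<lambda>_. 1)"
  shows "(\<lambda>t. peval (u t) f - peval (v t) f) \<in> o[at 0](\<lambda>t. t ^ k)"
    and "(\<lambda>t. peval (u t) f) \<in> O[at 0](\<lambda>_. 1)" and "(\<lambda>t. peval (v t) f) \<in> O[at 0](\<lambda>_. 1)"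
proof (induction f rule: mpoly_induct)
  case (add f g)
  { case 1 show ?case using sum_in_smallo(1)[OF add(1,4)] by (simp add: algebra_simps) }
  { case 2 show ?case using sum_in_bigo(1)[OF add(2,5)] by simp }
  { case 3 show ?case using sum_in_bigo(1)[OF add(3,6)] by simp }
next
  case (mult f g)
  { case 1
    have "(\<lambda>t. (peval (u t) f - peval (v t) f) * peval (u t) g) \<in> o[at 0](\<lambda>t. t ^ k * 1)"
      by (rule landau_o.small_big_mult[OF mult(1,5)])
    moreover have "(\<lambda>t. peval (v t) f * (peval (u t) g - peval (v t) g)) \<in> o[at 0](\<lambda>t. 1 * t ^ k)"
      by (rule landau_o.big_small_mult[OF mult(3,4)])
    ultimately have "(\<lambda>t. (peval (u t) f - peval (v t) f) * peval (u t) g + peval (v t) f * (peval (u t) g - peval (v t) g)) \<in> o[at 0](\<lambda>t. t ^ k)"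
      by (intro sum_in_smallo(1)) simp_all
    then show ?case by (simp add: algebra_simps) }
  { case 2 show ?case using landau_o.big_mult[OF mult(2,5)] by simp }
  { case 3 show ?case using landau_o.big_mult[OF mult(3,6)] by simp }
qed (use d bd in simp_all)

text \<open>Two errors arise: the Taylor remainder of f along the curve t |-> g(ta), and the
  replacement of g by its jet inside the Taylor polynomial. The first requires this curve to be
  O(t), which holds since the jets q have no constant term and k is positive.\<close>

lemma jet_compose:
  assumes f: "Ck d (cbox0 d \<epsilon>) k f" "dep d f" "0 < k" "0 < \<epsilon>"
    and g: "\<And>s. s < d \<Longrightarrow> jet k (\<lambda>a. g a s) (q s)" and q: "\<And>s. s < d \<Longrightarrow> ord_ge (Suc 0) (q s)"
  shows "jet k (\<lambda>a. f (g a)) (msubst (\<lambda>s. if s < d then q s else 0) (taylor_poly d k f))"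
  unfolding jet_def
proof
  fix a :: "nat \<Rightarrow> real"
  define u where "u t = (\<lambda>s. if s < d then g (\<lambda>i. t * a i) s else 0)" for t
  define v where "v t = (\<lambda>s. if s < d then peval (\<lambda>i. t * a i) (q s) else 0)" for t
  have pk: "(\<lambda>t::real. t ^ k) \<in> O[at 0](\<lambda>t. t)"
  proof -
    obtain j where j: "k = Suc j" using \<open>0 < k\<close> by (cases k) auto
    have "((\<lambda>t::real. t ^ j) \<longlongrightarrow> 0 ^ j) (at 0)" by (intro tendsto_intros)
    then have "(\<lambda>t::real. t ^ j) \<in> O[at 0](\<lambda>_. 1)" by (intro bigoI_tendsto[where c = "0 ^ j"]) simp_all
    then have "(\<lambda>t::real. t * t ^ j) \<in> O[at 0](\<lambda>t. t * 1)" by (intro landau_o.big_mult) simp_all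
    then show ?thesis by (simp add: j)
  qed
  have uv: "(\<lambda>t. u t s - v t s) \<in> o[at 0](\<lambda>t. t ^ k)" for s
    using g[of s] by (cases "s < d") (simp_all add: u_def v_def jet_def)
  have vO: "(\<lambda>t. v t s) \<in> O[at 0](\<lambda>t. t)" for s
  proof (cases "s < d")
    case True
    have "ord_ge (Suc (Suc 0)) (q s - (\<Sum>i\<le>Suc 0. hom_part i (q s)))" by (rule sum_hom_part_atMost)
    moreover have "hom_part 0 (q s) = 0" by (rule hom_part_ord_ge[OF q[OF True]]) simp
    ultimately have "(\<lambda>t. peval (\<lambda>i. t * a i) (q s - hom_part 1 (q s))) \<in> o[at 0](\<lambda>t. t ^ Suc 0)"
      by (intro peval_ord_ge_smallo) simp
    then have "(\<lambda>t. peval (\<lambda>i. t * a i) (q s - hom_part 1 (q s))) \<in> O[at 0](\<lambda>t. t)"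
      using landau_o.small_imp_big by simp
    moreover have "(\<lambda>t. peval (\<lambda>i. t * a i) (hom_part 1 (q s))) \<in> O[at 0](\<lambda>t. t)"
      by (simp add: peval_scale_homog[OF homog_hom_part] bigo_scale)
    ultimately have "(\<lambda>t. peval (\<lambda>i. t * a i) (q s - hom_part 1 (q s)) + peval (\<lambda>i. t * a i) (hom_part 1 (q s))) \<in> O[at 0](\<lambda>t. t)"
      by (rule sum_in_bigo(1))
    then show ?thesis using True by (simp add: v_def)
  qed (simp add: v_def)
  have "(\<lambda>t. u t s - v t s) \<in> O[at 0](\<lambda>t. t)" for s
    by (rule landau_o.big_trans[OF landau_o.small_imp_big[OF uv] pk])
  then have uO: "(\<lambda>t. u t s) \<in> O[at 0](\<lambda>t. t)" for s
    using sum_in_bigo(1)[OF \<open>\<And>s. (\<lambda>t. u t s - v t s) \<in> O[at 0](\<lambda>t. t)\<close>[of s] vO[of s]] by simp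
  have t1: "(\<lambda>t::real. t) \<in> O[at 0](\<lambda>_. 1)"
    by (rule bigoI_tendsto[where c = 0]) (auto intro: tendsto_ident_at)
  have "(\<lambda>t. f (u t) - peval (u t) (taylor_poly d k f)) \<in> o[at 0](\<lambda>t. t ^ k)"
    by (rule taylor_curve[OF f]) (rule uO)
  moreover have "(\<lambda>t. peval (u t) (taylor_poly d k f) - peval (v t) (taylor_poly d k f)) \<in> o[at 0](\<lambda>t. t ^ k)"
    by (rule peval_smallo(1)[OF uv landau_o.big_trans[OF uO t1] landau_o.big_trans[OF vO t1]])
  ultimately have "(\<lambda>t. (f (u t) - peval (u t) (taylor_poly d k f)) +
     (peval (u t) (taylor_poly d k f) - peval (v t) (taylor_poly d k f))) \<in> o[at 0](\<lambda>t. t ^ k)"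
    by (rule sum_in_smallo(1))
  moreover have "f (u t) = f (g (\<lambda>i. t * a i))" for t
    using f(2)[unfolded dep_def, rule_format, of "u t" "g (\<lambda>i. t * a i)"] by (simp add: u_def)
  moreover have "peval (v t) (taylor_poly d k f) = peval (\<lambda>i. t * a i) (msubst (\<lambda>s. if s < d then q s else 0) (taylor_poly d k f))" for t
  proof -
    have "(\<lambda>s. peval (\<lambda>i. t * a i) (if s < d then q s else 0)) = v t" by (auto simp: v_def)
    then show ?thesis by (simp add: peval_msubst)
  qed
  ultimately show "(\<lambda>t. f (g (\<lambda>i. t * a i)) - peval (\<lambda>i. t * a i) (msubst (\<lambda>s. if s < d then q s else 0) (taylor_poly d k f))) \<in> o[at 0](\<lambda>t. t ^ k)"
    by simp
qed

subsection \<open>Taylor series as formal maps\<close>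

lemma foldr_pdiff:
  assumes "set is \<subseteq> {..<d}"
  shows "foldr (pdiff d) is f (vec d a) = foldr pd is (\<lambda>a. f (vec d a)) a"
  using assms
proof (induction "is" arbitrary: a)
  case (Cons i "is")
  have "vec d a + t \<cdot>\<^sub>v unit_vec d i = vec d (a(i := a i + t))" for t
    using Cons.prems by (intro eq_vecI) (auto simp: unit_vec_def)
  then have "pdiff d i (foldr (pdiff d) is f) (vec d a) = deriv (\<lambda>t. foldr (pdiff d) is f (vec d (a(i := a i + t)))) 0"
    by (simp add: pdiff_def)
  also have "\<dots> = deriv (\<lambda>t. foldr pd is (\<lambda>a. f (vec d a)) (a(i := a i + t))) 0"
    using Cons by simp
  finally show ?case by (simp add: pd_def[of i])
qed simp

lemma trunc_taylor:
  assumes "l < n"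
  shows "trunc k (taylor d n f) l = taylor_poly d k (\<lambda>a. f (vec d a) $ l)"
proof -
  have z: "0\<^sub>v d = vec d (\<lambda>_. 0::real)" by (intro eq_vecI) auto
  have "taylor d n f j $ l = Const (1 / fact j) *
      (\<Sum>is\<in>dlists d j. Const (foldr pd is (\<lambda>a. f (vec d a) $ l) (\<lambda>_. 0)) * prod_list (map Var is))" for j
    using assms foldr_pdiff[of _ d "\<lambda>z. f z $ l" "\<lambda>_. 0"] by (auto simp: taylor_def diff_form_def z intro!: sum.cong)
  then show ?thesis by (simp add: trunc_def taylor_poly_def)
qed

lemma diff_form_hom_polys: "diff_form d n f j \<in> hom_polys d j n"
proof -
  have "homog (length is) (prod_list (map Var is))" for "is"
    by (induction "is") (auto simp: homog_mult[of 1, simplified] simp flip: Const_1)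
  moreover have "set is \<subseteq> {..<d} \<Longrightarrow> in_vars d (prod_list (map Var is))" for "is"
    by (induction "is") (auto simp: in_vars_mult in_vars_Var simp flip: Const_1)
  ultimately show ?thesis
    unfolding hom_polys_iff diff_form_def
    by (auto intro!: homog_sum in_vars_sum homog_smult in_vars_smult)
qed

lemma taylor_formal:
  assumes "f (0\<^sub>v d) = 0\<^sub>v n"
  shows "is_formal_map d n (taylor d n f)"
proof -
  have "dlists d 0 = {[]}" by auto
  then have nth: "taylor d n f 0 $ l = Const (f (0\<^sub>v d) $ l)" if "l < n" for l
    using that by (simp add: taylor_def diff_form_def)
  have "taylor d n f 0 = 0\<^sub>v n"
    by (rule eq_vecI) (simp_all add: nth assms, simp add: taylor_def diff_form_def)
  then show ?thesis
    unfolding is_formal_map_def by (auto simp: taylor_def smult_hom_polys diff_form_hom_polys)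
qed

lemma C_nat_on_Ck:
  assumes "C_nat_on d S k f" "S \<subseteq> carrier_vec d"
  shows "Ck d {a. vec d a \<in> S} k (\<lambda>a. f (vec d a))"
  using assms(1)
proof (induction k arbitrary: f)
  case (Suc k)
  have upd: "vec d a + t \<cdot>\<^sub>v unit_vec d i = vec d (a(i := a i + t))" if "i < d" for a i and t :: real
    using that by (intro eq_vecI) (auto simp: unit_vec_def)
  have "Ck d {a. vec d a \<in> S} k (pd i (\<lambda>a. f (vec d a)))" if i: "i < d" for i
  proof -
    have "(\<lambda>a. pdiff d i f (vec d a)) = pd i (\<lambda>a. f (vec d a))"
      using upd[OF i] by (simp add: pdiff_def pd_def fun_eq_iff)
    then show ?thesis using Suc.IH[of "pdiff d i f"] Suc.prems i by simp
  qed
  moreover have "(\<lambda>t. f (vec d (a(i := a i + t)))) field_differentiable (at 0)" if "i < d" "vec d a \<in> S" for i a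
    using Suc.prems that by (simp add: upd[symmetric])
  ultimately show ?case using Suc.prems by simp
qed simp

lemma box0_cbox0: "{a. vec d a \<in> box0 d \<epsilon>} = cbox0 d \<epsilon>"
  by (auto simp: box0_def cbox0_def)

lemma dep_vec: "dep d (\<lambda>a. f (vec d a))"
  unfolding dep_def by (intro allI impI arg_cong[where f = f] eq_vecI) auto

subsection \<open>The coordinates given by the invariant subspaces\<close>

text \<open>Row i of A times a column of polynomials. Columns are functions here, so that matrix
  products, duality and intertwining become rewrite rules free of vector dimensions.\<close>

definition pm :: "nat \<Rightarrow> real mat \<Rightarrow> (nat \<Rightarrow> mpoly) \<Rightarrow> nat \<Rightarrow> mpoly" where
  "pm m A v i = (\<Sum>k<m. Const (A $$ (i, k)) * v k)"

lemma pm_assoc: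
  assumes "A \<in> carrier_mat n m" "B \<in> carrier_mat m r" "i < n"
  shows "pm m A (pm r B v) i = pm r (A * B) v i"
proof -
  have "(A * B) $$ (i, k) = (\<Sum>j<m. A $$ (i, j) * B $$ (j, k))" if "k < r" for k
    using assms that by (simp add: scalar_prod_def lessThan_atLeast0)
  then have "pm r (A * B) v i = (\<Sum>k<r. \<Sum>j<m. Const (A $$ (i, j)) * (Const (B $$ (j, k)) * v k))"
    by (simp add: pm_def Const_sum Const_mult sum_distrib_right mult.assoc)
  also have "\<dots> = pm m A (pm r B v) i"
    by (subst sum.swap) (simp add: pm_def sum_distrib_left)
  finally show ?thesis by simp
qed

lemma pm_one: "i < n \<Longrightarrow> pm n (1\<^sub>m n) v i = v i"
proof -
  assume i: "i < n"
  have "pm n (1\<^sub>m n) v i = (\<Sum>k<n. if i = k then v k else 0)"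
    unfolding pm_def using i by (intro sum.cong) auto
  then show ?thesis using i by simp
qed

lemma pm_zero: "i < n \<Longrightarrow> pm m (0\<^sub>m n m) v i = 0"
  by (simp add: pm_def)

lemma pm_add: "pm m A (\<lambda>k. v k + w k) i = pm m A v i + pm m A w i"
  by (simp add: pm_def algebra_simps sum.distrib)

lemma pm_smult: "pm m A (\<lambda>k. r * v k) i = r * pm m A v i"
  by (simp add: pm_def sum_distrib_left algebra_simps)

lemma pm_sum: "pm m A (\<lambda>k. \<Sum>x\<in>X. v x k) i = (\<Sum>x\<in>X. pm m A (v x) i)"
  by (simp add: pm_def sum_distrib_left) (rule sum.swap)

lemma pm_cong: "(\<And>k. k < m \<Longrightarrow> v k = w k) \<Longrightarrow> pm m A v i = pm m A w i"
  by (simp add: pm_def)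

lemma msubst_pm: "msubst \<sigma> (pm m A v i) = pm m A (\<lambda>k. msubst \<sigma> (v k)) i"
  by (simp add: pm_def)

lemma homog_pm: "(\<And>k. k < m \<Longrightarrow> homog j (v k)) \<Longrightarrow> homog j (pm m A v i)"
  and in_vars_pm: "(\<And>k. k < m \<Longrightarrow> in_vars d (v k)) \<Longrightarrow> in_vars d (pm m A v i)"
  and ord_ge_pm: "(\<And>k. k < m \<Longrightarrow> ord_ge j (v k)) \<Longrightarrow> ord_ge j (pm m A v i)"
  by (auto simp: pm_def intro!: homog_sum homog_smult in_vars_sum in_vars_smult ord_ge_sum ord_ge_smult)

lemma jet_pm: "(\<And>k. k < m \<Longrightarrow> jet j (\<lambda>a. \<phi> k a) (v k)) \<Longrightarrow> jet j (\<lambda>a. \<Sum>k<m. A $$ (i, k) * \<phi> k a) (pm m A v i)"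
  unfolding pm_def by (intro jet_sum jet_smult) auto

lemma index_mult_mat_vec_sum:
  "A \<in> carrier_mat n m \<Longrightarrow> dim_vec v = m \<Longrightarrow> i < n \<Longrightarrow> (A *\<^sub>v v) $ i = (\<Sum>k<m. A $$ (i, k) * v $ k)"
  for A :: "real mat"
  by (auto simp: scalar_prod_def lessThan_atLeast0 intro!: sum.cong)

lemma lin_op_pm:
  "lin_op c q J CQ l v = (if l < c then pm c J v l else pm q CQ (\<lambda>k. v (c + k)) (l - c))"
  by (simp add: lin_op_def pm_def)

locale coords =
  fixes p c q N :: nat and C J CQ \<Phi>c \<Phi>su \<Psi>c \<Psi>su :: "real mat"
  assumes N: "N = c + q"
    and C: "C \<in> carrier_mat N N" and J: "J \<in> carrier_mat c c" and CQ: "CQ \<in> carrier_mat q q"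
    and \<Phi>c: "\<Phi>c \<in> carrier_mat N c" and \<Phi>su: "\<Phi>su \<in> carrier_mat N q"
    and \<Psi>c: "\<Psi>c \<in> carrier_mat c N" and \<Psi>su: "\<Psi>su \<in> carrier_mat q N"
    and cc: "\<Psi>c * \<Phi>c = 1\<^sub>m c" and ss: "\<Psi>su * \<Phi>su = 1\<^sub>m q"
    and cs: "\<Psi>c * \<Phi>su = 0\<^sub>m c q" and sc: "\<Psi>su * \<Phi>c = 0\<^sub>m q c"
    and CJ: "C * \<Phi>c = \<Phi>c * J" and CCQ: "C * \<Phi>su = \<Phi>su * CQ"
begin

text \<open>By the intertwining relations C maps \<Phi>c x + \<Phi>su y to \<Phi>c J x + \<Phi>su CQ
  y, and the dual bases read off the two blocks.\<close>

lemma lin_coords: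
  shows "l < c \<Longrightarrow> pm N \<Psi>c (pm N C (\<lambda>s. pm c \<Phi>c x s + pm q \<Phi>su y s)) l = pm c J x l"
    and "l < q \<Longrightarrow> pm N \<Psi>su (pm N C (\<lambda>s. pm c \<Phi>c x s + pm q \<Phi>su y s)) l = pm q CQ y l"
proof -
  have 1: "pm N C (\<lambda>s. pm c \<Phi>c x s + pm q \<Phi>su y s) i = pm c \<Phi>c (pm c J x) i + pm q \<Phi>su (pm q CQ y) i" if "i < N" for i
    using that by (simp add: pm_add pm_assoc[OF C \<Phi>c] pm_assoc[OF C \<Phi>su] pm_assoc[OF \<Phi>c J] pm_assoc[OF \<Phi>su CQ] CJ CCQ)
  show "pm N \<Psi>c (pm N C (\<lambda>s. pm c \<Phi>c x s + pm q \<Phi>su y s)) l = pm c J x l" if "l < c"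
  proof -
    have "pm N \<Psi>c (pm N C (\<lambda>s. pm c \<Phi>c x s + pm q \<Phi>su y s)) l = pm N \<Psi>c (\<lambda>i. pm c \<Phi>c (pm c J x) i + pm q \<Phi>su (pm q CQ y) i) l"
      by (rule pm_cong) (rule 1)
    then show ?thesis using that by (simp add: pm_add pm_assoc[OF \<Psi>c \<Phi>c] pm_assoc[OF \<Psi>c \<Phi>su] cc cs pm_one pm_zero)
  qed
  show "pm N \<Psi>su (pm N C (\<lambda>s. pm c \<Phi>c x s + pm q \<Phi>su y s)) l = pm q CQ y l" if "l < q"
  proof -
    have "pm N \<Psi>su (pm N C (\<lambda>s. pm c \<Phi>c x s + pm q \<Phi>su y s)) l = pm N \<Psi>su (\<lambda>i. pm c \<Phi>c (pm c J x) i + pm q \<Phi>su (pm q CQ y) i) l"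
      by (rule pm_cong) (rule 1)
    then show ?thesis using that by (simp add: pm_add pm_assoc[OF \<Psi>su \<Phi>c] pm_assoc[OF \<Psi>su \<Phi>su] ss sc pm_one pm_zero)
  qed
qed

abbreviation u_sub :: "nat \<Rightarrow> mpoly" where
  "u_sub \<equiv> blk p N (\<lambda>s. pm c \<Phi>c (\<lambda>k. Var (p + k)) s + pm q \<Phi>su (\<lambda>k. Var (p + c + k)) s)"

lemma coord_terms_nth:
  fixes F :: "real vec \<Rightarrow> real vec \<Rightarrow> real vec"
  defines "D \<equiv> diff_form (p + N) N (joint p N F)"
  assumes "l < N"
  shows "coord_terms p c N \<Phi>c \<Phi>su \<Psi>c \<Psi>su F j $ l =
    (if l < c then pm N \<Psi>c (\<lambda>i. msubst u_sub (D j $ i)) l else pm N \<Psi>su (\<lambda>i. msubst u_sub (D j $ i)) (l - c))"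
proof -
  let ?e = "map_mat Const \<Phi>c *\<^sub>v x_vars p c + map_mat Const \<Phi>su *\<^sub>v y_vars p c (N - c)"
  have q: "N - c = q" using N by simp
  have dD: "dim_vec (D j) = N" by (simp add: D_def diff_form_def)
  have de: "dim_vec ?e = N" using \<Phi>su by simp
  have "?e $ s = pm c \<Phi>c (\<lambda>k. Var (p + k)) s + pm q \<Phi>su (\<lambda>k. Var (p + c + k)) s" if "s < N" for s
  proof -
    have "(map_mat Const \<Phi>c *\<^sub>v x_vars p c) $ s = pm c \<Phi>c (\<lambda>k. Var (p + k)) s"
      using index_Const_mult_mat_vec[OF \<Phi>c, of "x_vars p c" s] that by (simp add: pm_def del: index_mult_mat_vec)
    moreover have "(map_mat Const \<Phi>su *\<^sub>v y_vars p c q) $ s = pm q \<Phi>su (\<lambda>k. Var (p + c + k)) s"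
      using index_Const_mult_mat_vec[OF \<Phi>su, of "y_vars p c q" s] that by (simp add: pm_def del: index_mult_mat_vec)
    ultimately show ?thesis using that \<Phi>su q by (simp del: index_mult_mat_vec)
  qed
  then have "blk p N (($) ?e) = u_sub" by (rule blk_cong)
  then have sb: "subst_block p ?e = msubst u_sub" unfolding subst_block_eq de by simp
  define Fj where "Fj = map_vec (msubst u_sub) (D j)"
  have dF: "dim_vec Fj = N" by (simp add: Fj_def dD)
  have ct: "coord_terms p c N \<Phi>c \<Phi>su \<Psi>c \<Psi>su F j = (map_mat Const \<Psi>c *\<^sub>v Fj) @\<^sub>v (map_mat Const \<Psi>su *\<^sub>v Fj)"
    unfolding coord_terms_def Let_def sb Fj_def D_def ..
  show ?thesis
  proof (cases "l < c")
    case True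
    then have "coord_terms p c N \<Phi>c \<Phi>su \<Psi>c \<Psi>su F j $ l = (map_mat Const \<Psi>c *\<^sub>v Fj) $ l"
      unfolding ct using \<Psi>c \<Psi>su by (simp del: index_mult_mat_vec)
    also have "\<dots> = pm N \<Psi>c (\<lambda>i. Fj $ i) l"
      using index_Const_mult_mat_vec[OF \<Psi>c dF True] by (simp add: pm_def del: index_mult_mat_vec)
    also have "\<dots> = pm N \<Psi>c (\<lambda>i. msubst u_sub (D j $ i)) l"
      by (rule pm_cong) (simp add: Fj_def dD)
    finally show ?thesis using True by simp
  next
    case False
    then have l: "l - c < q" using assms(2) N by simp
    from False have "coord_terms p c N \<Phi>c \<Phi>su \<Psi>c \<Psi>su F j $ l = (map_mat Const \<Psi>su *\<^sub>v Fj) $ (l - c)"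
      unfolding ct using \<Psi>c \<Psi>su l by (simp del: index_mult_mat_vec)
    also have "\<dots> = pm N \<Psi>su (\<lambda>i. Fj $ i) (l - c)"
      using index_Const_mult_mat_vec[OF \<Psi>su dF l] by (simp add: pm_def del: index_mult_mat_vec)
    also have "\<dots> = pm N \<Psi>su (\<lambda>i. msubst u_sub (D j $ i)) (l - c)"
      by (rule pm_cong) (simp add: Fj_def dD)
    finally show ?thesis using False by simp
  qed
qed

lemma dim_coord_terms [simp]: "dim_vec (coord_terms p c N \<Phi>c \<Phi>su \<Psi>c \<Psi>su F j) = N"
  using \<Psi>c \<Psi>su N by (simp add: coord_terms_def Let_def)

lemma homog_u_sub: "homog 1 (u_sub v)"
  by (auto simp: blk_def intro!: homog_add homog_pm)

lemma in_vars_u_sub: "v < p + N \<Longrightarrow> in_vars (p + N) (u_sub v)"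
  using N by (auto simp: blk_def intro!: in_vars_add in_vars_pm in_vars_Var)

lemma coord_terms_hom_polys: "coord_terms p c N \<Phi>c \<Phi>su \<Psi>c \<Psi>su F j \<in> hom_polys (p + N) j N"
proof -
  let ?D = "diff_form (p + N) N (joint p N F) j"
  have D: "?D \<in> hom_polys (p + N) j N" by (rule diff_form_hom_polys)
  have "homog j (msubst u_sub (?D $ i))" "in_vars (p + N) (msubst u_sub (?D $ i))" if "i < N" for i
  proof -
    show "homog j (msubst u_sub (?D $ i))" by (rule homog_msubst[OF hom_polysD(2)[OF D that] homog_u_sub])
    show "in_vars (p + N) (msubst u_sub (?D $ i))"
    proof (rule in_vars_msubst)
      fix m v assume "m \<in> keys (?D $ i)" "v \<in> keys m"
      with hom_polysD(3)[OF D that] have "v < p + N" by (auto simp: in_vars_def)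
      then show "in_vars (p + N) (u_sub v)" by (rule in_vars_u_sub)
    qed
  qed
  then show ?thesis unfolding hom_polys_iff by (auto simp: coord_terms_nth intro!: homog_pm in_vars_pm)
qed

abbreviation L where "L \<equiv> lin_part p c q J CQ"

lemma T'_formal: "is_formal_map (p + N) N (map_series L (coord_terms p c N \<Phi>c \<Phi>su \<Psi>c \<Psi>su F))"
proof -
  have L: "L \<in> hom_polys (p + N) 1 N" using lin_part_hom_polys[OF J CQ, of p "p + N"] N by simp
  then have "map_series L (coord_terms p c N \<Phi>c \<Phi>su \<Psi>c \<Psi>su F) k \<in> hom_polys (p + N) k N" for k
    by (auto simp: map_series_def hom_polysD(1)[OF L] smult_hom_polys coord_terms_hom_polys)
  then show ?thesis by (simp add: is_formal_map_def map_series_def hom_polysD(1)[OF L])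
qed

text \<open>\<open>map_series\<close> takes the terms of F from order 2 on; since the lower ones
  vanish, the whole Taylor polynomial of F may stand on the right.\<close>

lemma trunc_T':
  assumes "0 < k" "l < N" and D0: "\<And>j. j < 2 \<Longrightarrow> diff_form (p + N) N (joint p N F) j = 0\<^sub>v N"
  shows "trunc k (map_series L (coord_terms p c N \<Phi>c \<Phi>su \<Psi>c \<Psi>su F)) l =
    lin_op c q J CQ l (\<lambda>s. Var (p + s)) +
    (if l < c then pm N \<Psi>c (\<lambda>i. msubst u_sub (trunc k (taylor (p + N) N (joint p N F)) i)) l
     else pm N \<Psi>su (\<lambda>i. msubst u_sub (trunc k (taylor (p + N) N (joint p N F)) i)) (l - c))"
proof -
  let ?ct = "coord_terms p c N \<Phi>c \<Phi>su \<Psi>c \<Psi>su F"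
  have ct0: "?ct j $ l = 0" if "j < 2" for j
  proof -
    have "pm N A (\<lambda>i. msubst u_sub (diff_form (p + N) N (joint p N F) j $ i)) l' = pm N A (\<lambda>i. 0) l'" for A l'
      by (rule pm_cong) (simp add: D0[OF that])
    then show ?thesis by (simp add: coord_terms_nth[OF assms(2)]) (simp add: pm_def)
  qed
  have "map_series L ?ct j $ l = (if j = 1 then L $ l else 0) + Const (1 / fact j) * ?ct j $ l" for j
  proof -
    have "dim_vec L = N" using N J CQ by simp
    then show ?thesis
      using ct0[of j] assms(2) by (cases "j = 0 \<or> j = 1") (auto simp: map_series_def)
  qed
  then have "trunc k (map_series L ?ct) l = L $ l + (\<Sum>j\<le>k. Const (1 / fact j) * ?ct j $ l)"
    using assms(1) by (simp add: trunc_def sum.distrib)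
  also have "L $ l = lin_op c q J CQ l (\<lambda>s. Var (p + s))" using assms(2) N by (intro lin_part_nth[OF J CQ]) simp
  also have "(\<Sum>j\<le>k. Const (1 / fact j) * ?ct j $ l) =
     (if l < c then pm N \<Psi>c (\<lambda>i. msubst u_sub (trunc k (taylor (p + N) N (joint p N F)) i)) l
     else pm N \<Psi>su (\<lambda>i. msubst u_sub (trunc k (taylor (p + N) N (joint p N F)) i)) (l - c))"
  proof -
    have "pm N A (\<lambda>i. msubst u_sub (trunc k (taylor (p + N) N (joint p N F)) i)) l' =
        (\<Sum>j\<le>k. Const (1 / fact j) * pm N A (\<lambda>i. msubst u_sub (diff_form (p + N) N (joint p N F) j $ i)) l')" for A l'
    proof -
      have "pm N A (\<lambda>i. msubst u_sub (trunc k (taylor (p + N) N (joint p N F)) i)) l' =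
         pm N A (\<lambda>i. \<Sum>j\<le>k. Const (1 / fact j) * msubst u_sub (diff_form (p + N) N (joint p N F) j $ i)) l'"
        by (rule pm_cong) (simp add: trunc_def taylor_def diff_form_def)
      then show ?thesis by (simp add: pm_sum pm_smult)
    qed
    then show ?thesis by (simp add: coord_terms_nth[OF assms(2)])
  qed
  finally show ?thesis .
qed

end

subsection \<open>The Taylor series of an invariant graph\<close>

lemma dim_id_map [simp]: "dim_vec (id_map p c j) = c"
  by (simp add: near_id_def)

lemma trunc_append:
  assumes "\<And>j. dim_vec (f j) = c" "\<And>j. dim_vec (h j) = q" "s < c + q"
  shows "trunc k (\<lambda>j. f j @\<^sub>v h j) s = (if s < c then trunc k f s else trunc k h (s - c))"
  using assms by (simp add: trunc_def)

lemma trunc_id_map: "s < n \<Longrightarrow> trunc k (id_map p n) s = (if k = 0 then 0 else Var (p + s))"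
  by (subst trunc_near_id) (simp_all add: trunc_def tail2_def)

locale graph = coords +
  fixes F :: "real vec \<Rightarrow> real vec \<Rightarrow> real vec" and w :: "real vec \<Rightarrow> real vec" and \<delta> :: real and r :: enat
  assumes F_smooth: "\<And>k i. i < N \<Longrightarrow> Ck (p + N) UNIV k (\<lambda>b. joint p N F (vec (p + N) b) $ i)"
    and F_dim: "\<And>z. z \<in> carrier_vec (p + N) \<Longrightarrow> joint p N F z \<in> carrier_vec N"
    and F_low: "\<And>j. j < 2 \<Longrightarrow> diff_form (p + N) N (joint p N F) j = 0\<^sub>v N"
    and \<delta>: "0 < \<delta>" and r: "1 \<le> r"
    and w_smooth: "\<And>k l. enat k \<le> r \<Longrightarrow> l < q \<Longrightarrow> Ck (p + c) (cbox0 (p + c) \<delta>) k (\<lambda>a. w (vec (p + c) a) $ l)"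
    and w0: "w (0\<^sub>v (p + c)) = 0\<^sub>v q"
begin

text \<open>In what follows \<open>uf a\<close> is the graph point u over a = (alpha,x),
  \<open>Gf a\<close> its image under the map, \<open>Rf a\<close> and \<open>Yf a\<close> the x-
  and y-coordinates of the image; \<open>g1\<close> and \<open>g2\<close> assemble the arguments
  (alpha,u) and (alpha,R). All live on sequences, where \<open>Ck\<close> and \<open>jet\<close>
  apply.\<close>

definition wf :: "(nat \<Rightarrow> real) \<Rightarrow> nat \<Rightarrow> real" where
  "wf a l = w (vec (p + c) a) $ l"

definition uf :: "(nat \<Rightarrow> real) \<Rightarrow> nat \<Rightarrow> real" where
  "uf a s = (\<Sum>k<c. \<Phi>c $$ (s, k) * a (p + k)) + (\<Sum>k<q. \<Phi>su $$ (s, k) * wf a k)"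

definition g1 :: "(nat \<Rightarrow> real) \<Rightarrow> nat \<Rightarrow> real" where
  "g1 a s = (if s < p then a s else if s < p + N then uf a (s - p) else 0)"

definition Ff :: "(nat \<Rightarrow> real) \<Rightarrow> nat \<Rightarrow> real" where
  "Ff b i = joint p N F (vec (p + N) b) $ i"

definition Gf :: "(nat \<Rightarrow> real) \<Rightarrow> nat \<Rightarrow> real" where
  "Gf a i = (\<Sum>k<N. C $$ (i, k) * uf a k) + Ff (g1 a) i"

definition Rf :: "(nat \<Rightarrow> real) \<Rightarrow> nat \<Rightarrow> real" where
  "Rf a l = (\<Sum>i<N. \<Psi>c $$ (l, i) * Gf a i)"

definition Yf :: "(nat \<Rightarrow> real) \<Rightarrow> nat \<Rightarrow> real" where
  "Yf a l = (\<Sum>i<N. \<Psi>su $$ (l, i) * Gf a i)"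

abbreviation T :: "real vec \<Rightarrow> real vec \<Rightarrow> real vec" where
  "T u \<alpha> \<equiv> C *\<^sub>v u + F u \<alpha>"

abbreviation R :: "real vec \<Rightarrow> real vec" where
  "R \<equiv> map_on_graph p c \<Phi>c \<Phi>su \<Psi>c (\<lambda>u \<alpha>. T u \<alpha>) w"

definition g2 :: "(nat \<Rightarrow> real) \<Rightarrow> nat \<Rightarrow> real" where
  "g2 a s = (if s < p then a s else if s < p + c then Rf a (s - p) else 0)"

lemma u_vec:
  assumes "dim_vec (w (vec (p + c) a)) = q"
  shows "\<Phi>c *\<^sub>v vec c (\<lambda>i. a (p + i)) + \<Phi>su *\<^sub>v w (vec (p + c) a) = vec N (uf a)"
proof (rule eq_vecI)
  fix i assume "i < dim_vec (vec N (uf a))"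
  then have i: "i < N" by simp
  show "(\<Phi>c *\<^sub>v vec c (\<lambda>i. a (p + i)) + \<Phi>su *\<^sub>v w (vec (p + c) a)) $ i = vec N (uf a) $ i"
    using i \<Phi>su index_mult_mat_vec_sum[OF \<Phi>c, of "vec c (\<lambda>i. a (p + i))" i]
      index_mult_mat_vec_sum[OF \<Phi>su assms i]
    by (simp add: uf_def wf_def del: index_mult_mat_vec)
qed (use \<Phi>su in simp)

lemma joint_vec: "joint p N F (vec (p + N) b) = F (vec N (\<lambda>i. b (p + i))) (vec p b)"
proof -
  have "vec_last (vec (p + N) b) N = vec N (\<lambda>i. b (p + i))" "vec_first (vec (p + N) b) p = vec p b"
    by (auto intro!: eq_vecI)
  then show ?thesis by (simp add: joint_def)
qed

lemma T_vec: "T (vec N (uf a)) (vec p a) = vec N (Gf a)"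
proof (rule eq_vecI)
  have J: "joint p N F (vec (p + N) (g1 a)) = F (vec N (uf a)) (vec p a)"
    unfolding joint_vec by (intro arg_cong2[where f = F] eq_vecI) (auto simp: g1_def)
  have dF: "dim_vec (F (vec N (uf a)) (vec p a)) = N"
    using F_dim[of "vec (p + N) (g1 a)"] unfolding J by (simp add: vec_carrier carrier_vecD)
  then show "dim_vec (T (vec N (uf a)) (vec p a)) = dim_vec (vec N (Gf a))" by simp
  fix i assume "i < dim_vec (vec N (Gf a))"
  then have i: "i < N" by simp
  show "T (vec N (uf a)) (vec p a) $ i = vec N (Gf a) $ i"
    using i dF index_mult_mat_vec_sum[OF C, of "vec N (uf a)" i]
    by (simp add: Gf_def Ff_def J del: index_mult_mat_vec)
qed

lemma R_nth:
  assumes "dim_vec (w (vec (p + c) a)) = q" "l < c"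
  shows "R (vec (p + c) a) $ l = Rf a l"
proof -
  have "vec_last (vec (p + c) a) c = vec c (\<lambda>i. a (p + i))" "vec_first (vec (p + c) a) p = vec p a"
    by (auto intro!: eq_vecI)
  then have "R (vec (p + c) a) = \<Psi>c *\<^sub>v vec N (Gf a)"
    by (simp add: map_on_graph_def u_vec[OF assms(1)] T_vec)
  then show ?thesis using assms(2) index_mult_mat_vec_sum[OF \<Psi>c, of "vec N (Gf a)" l]
    by (simp add: Rf_def del: index_mult_mat_vec)
qed

lemma uf_Ck: "enat k \<le> r \<Longrightarrow> Ck (p + c) (cbox0 (p + c) \<delta>) k (\<lambda>a. uf a s)"
  unfolding uf_def wf_def by (intro Ck_add Ck_sum Ck_mult Ck_const Ck_coord w_smooth) auto

lemma Gf_Ck: "enat k \<le> r \<Longrightarrow> i < N \<Longrightarrow> Ck (p + c) (cbox0 (p + c) \<delta>) k (\<lambda>a. Gf a i)"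
proof -
  assume k: "enat k \<le> r" and "i < N"
  have "Ck (p + c) (cbox0 (p + c) \<delta>) k (\<lambda>a. Ff (g1 a) i)" if "i < N" for i
  proof (rule Ck_compose[where D = UNIV and d' = "p + N" and f = "\<lambda>b. Ff b i" and g = g1])
    show "Ck (p + N) UNIV k (\<lambda>b. Ff b i)" unfolding Ff_def by (rule F_smooth[OF that])
    show "dep (p + N) (\<lambda>b. Ff b i)" unfolding Ff_def by (rule dep_vec[where f = "\<lambda>z. joint p N F z $ i"])
    show "Ck (p + c) (cbox0 (p + c) \<delta>) k (\<lambda>a. g1 a s)" if "s < p + N" for s
    proof (cases "s < p")
      case True
      then show ?thesis unfolding g1_def by (simp add: Ck_coord)
    next
      case False
      then show ?thesis using that uf_Ck[OF k, of "s - p"] unfolding g1_def by simp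
    qed
    show "\<exists>\<epsilon>'. b \<in> cbox0 (p + N) \<epsilon>' \<and> cbox0 (p + N) \<epsilon>' \<subseteq> UNIV" for b :: "nat \<Rightarrow> real"
    proof (intro exI[of _ "(\<Sum>i<p + N. \<bar>b i\<bar>) + 1"] conjI)
      have "\<bar>b i\<bar> < (\<Sum>i<p + N. \<bar>b i\<bar>) + 1" if "i < p + N" for i
        using member_le_sum[of i "{..<p + N}" "\<lambda>i. \<bar>b i\<bar>"] that by simp
      then show "b \<in> cbox0 (p + N) ((\<Sum>i<p + N. \<bar>b i\<bar>) + 1)" by (simp add: cbox0_def)
    qed simp
  qed (auto simp: g1_def)
  then show ?thesis using \<open>i < N\<close> unfolding Gf_def
    by (intro Ck_sum Ck_mult Ck_add Ck_const uf_Ck[OF k]) auto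
qed

lemma Rf_Ck: "enat k \<le> r \<Longrightarrow> Ck (p + c) (cbox0 (p + c) \<delta>) k (\<lambda>a. Rf a l)"
  unfolding Rf_def by (intro Ck_sum Ck_mult Ck_const Gf_Ck) auto

lemma uf_dep: "dep (p + c) (\<lambda>a. uf a s)" and Gf_dep: "dep (p + c) (\<lambda>a. Gf a i)" and Rf_dep: "dep (p + c) (\<lambda>a. Rf a l)"
proof -
  have e: "uf a s = uf b s \<and> Gf a i = Gf b i" if "\<forall>i<p + c. a i = b i" for a b s i
  proof -
    have "vec (p + c) a = vec (p + c) b" using that by (intro eq_vecI) auto
    then have "uf a s = uf b s" for s using that by (simp add: uf_def wf_def)
    moreover from this have "g1 a = g1 b" using that by (auto simp: g1_def fun_eq_iff)
    ultimately show ?thesis by (simp add: Gf_def)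
  qed
  show "dep (p + c) (\<lambda>a. uf a s)" "dep (p + c) (\<lambda>a. Gf a i)" using e unfolding dep_def by simp_all
  show "dep (p + c) (\<lambda>a. Rf a l)"
    unfolding dep_def
  proof (intro allI impI)
    fix a b :: "nat \<Rightarrow> real" assume "\<forall>i<p + c. a i = b i"
    from e[OF this] have "Gf a i = Gf b i" for i by blast
    then show "Rf a l = Rf b l" by (simp add: Rf_def)
  qed
qed

lemma F0: "joint p N F (0\<^sub>v (p + N)) = 0\<^sub>v N"
proof (rule eq_vecI)
  fix i assume "i < dim_vec (0\<^sub>v N :: real vec)"
  then have i: "i < N" by simp
  have "dlists (p + N) 0 = {[]}" by auto
  then have "diff_form (p + N) N (joint p N F) 0 $ i = Const (joint p N F (0\<^sub>v (p + N)) $ i)"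
    using i by (simp add: diff_form_def)
  then have "Const (joint p N F (0\<^sub>v (p + N)) $ i) = Const 0" using F_low[of 0] i by simp
  then show "joint p N F (0\<^sub>v (p + N)) $ i = 0\<^sub>v N $ i"
  proof -
    have "lookup (Const x) 0 = x" for x by (simp add: Const_def)
    with arg_cong[OF \<open>Const (joint p N F (0\<^sub>v (p + N)) $ i) = Const 0\<close>, of "\<lambda>f. lookup f 0"] i
    show ?thesis by simp
  qed
qed (use F_dim[of "0\<^sub>v (p + N)"] in simp)

lemma uf_zero: "uf (\<lambda>_. 0) s = 0" and Gf_zero: "i < N \<Longrightarrow> Gf (\<lambda>_. 0) i = 0"
proof -
  have z: "0\<^sub>v n = vec n (\<lambda>_. 0::real)" for n by (intro eq_vecI) auto
  have wz: "wf (\<lambda>_. 0) k = 0" if "k < q" for k using w0 that by (simp add: wf_def z[symmetric])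
  then have uz: "uf (\<lambda>_. 0) s = 0" for s by (simp add: uf_def)
  then have "g1 (\<lambda>_. 0) = (\<lambda>_. 0)" by (auto simp: g1_def)
  then have "Ff (g1 (\<lambda>_. 0)) i = 0" if "i < N" for i using F0 that by (simp add: Ff_def z[symmetric])
  then show "uf (\<lambda>_. 0) s = 0" "i < N \<Longrightarrow> Gf (\<lambda>_. 0) i = 0" by (simp_all add: Gf_def uz)
qed

lemma R0: "R (0\<^sub>v (p + c)) = 0\<^sub>v c"
proof (rule eq_vecI)
  have z: "0\<^sub>v n = vec n (\<lambda>_. 0::real)" for n by (intro eq_vecI) auto
  have "Rf (\<lambda>_. 0) l = 0" for l by (simp add: Rf_def Gf_zero)
  then show "R (0\<^sub>v (p + c)) $ i = 0\<^sub>v c $ i" if "i < dim_vec (0\<^sub>v c :: real vec)" for i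
    using R_nth[of "\<lambda>_. 0" i] that w0 by (simp add: z[symmetric])
qed (use \<Psi>c in \<open>simp add: map_on_graph_def\<close>)

abbreviation ws :: formal_map where "ws \<equiv> taylor (p + c) q w"
abbreviation Rs :: formal_map where "Rs \<equiv> taylor (p + c) c R"

lemma ws_formal: "is_formal_map (p + c) q ws" by (rule taylor_formal[where f = w, OF w0])
lemma Rs_formal: "is_formal_map (p + c) c Rs" by (rule taylor_formal[where f = R, OF R0])

text \<open>The embedding x |-> (x, w(x,alpha)) of the graph as a formal map.\<close>

definition gw :: formal_map where
  "gw j = id_map p c j @\<^sub>v ws j"

lemma gw_formal: "is_formal_map (p + c) N gw"
  unfolding gw_def[abs_def] N by (rule append_formal[OF id_map_formal ws_formal]) simp

abbreviation T' :: formal_map where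
  "T' \<equiv> map_series L (coord_terms p c N \<Phi>c \<Phi>su \<Psi>c \<Psi>su F)"

text \<open>Both sides of the functional equation have jets obtained by substituting Taylor
  polynomials into each other. By uniqueness of jets these polynomials agree up to every positive
  order k \<le> r, which is the formal equation T' o gw = gw o Rs.\<close>

lemma graph_invariance:
  assumes w_dim: "\<And>a. a \<in> cbox0 (p + c) \<delta> \<Longrightarrow> dim_vec (w (vec (p + c) a)) = q"
    and inv: "0 < \<epsilon>" "\<And>a l. a \<in> cbox0 (p + c) \<epsilon> \<Longrightarrow> l < q \<Longrightarrow> Yf a l = wf (g2 a) l"
  shows "agree_upto r (fcomp p T' gw) (fcomp p gw Rs)"
proof -
  have lhs: "is_formal_map (p + c) N (fcomp p T' gw)" by (rule fcomp_formal[OF T'_formal gw_formal]) simp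
  have rhs: "is_formal_map (p + c) N (fcomp p gw Rs)" by (rule fcomp_formal[OF gw_formal Rs_formal]) simp
  have "agree_upto (enat k) (fcomp p T' gw) (fcomp p gw Rs)" if k0: "0 < k" and k: "enat k \<le> r" for k
    unfolding agree_upto_iff_trunc[OF lhs rhs]
  proof (intro allI impI)
    define W where "W = trunc k ws"
    define \<rho> where "\<rho> = trunc k Rs"
    define TF where "TF = trunc k (taylor (p + N) N (joint p N F))"
    \<comment> \<open>\<open>U\<close> and \<open>QG\<close> are the polynomial counterparts of
      \<open>uf\<close> and \<open>Gf\<close>.\<close>
    define U where "U s = pm c \<Phi>c (\<lambda>k. Var (p + k)) s + pm q \<Phi>su W s" for s
    define QG where "QG i = pm N C U i + msubst (blk p N U) (TF i)" for i
    have W: "W l = taylor_poly (p + c) k (\<lambda>a. wf a l)" if "l < q" for l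
      using that by (simp add: W_def trunc_taylor wf_def)
    have jw: "jet k (\<lambda>a. wf a l) (W l)" if "l < q" for l
      unfolding W[OF that] wf_def
      by (rule jet_taylor_poly[OF w_smooth[OF k that] dep_vec[where f = "\<lambda>z. w z $ l"] k0 \<delta>])
    have oW: "ord_ge (Suc 0) (W l)" if "l < q" for l
      unfolding W_def by (rule ord_ge_trunc[OF ws_formal that])
    have jV: "jet k (\<lambda>a. a v) (Var v)" for v using jet_peval[of k "Var v"] by simp
    have ju: "jet k (\<lambda>a. uf a s) (U s)" for s
      unfolding uf_def U_def by (intro jet_add jet_pm jw jV)
    have oU: "ord_ge (Suc 0) (U s)" for s
      unfolding U_def by (intro ord_ge_add ord_ge_pm oW) simp
    have jF: "jet k (\<lambda>a. Ff (g1 a) i) (msubst (blk p N U) (TF i))" if i: "i < N" for i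
    proof -
      have sm: "Ck (p + N) (cbox0 (p + N) 1) k (\<lambda>b. Ff b i)"
        unfolding Ff_def by (rule Ck_subset[OF F_smooth[OF i]]) simp
      have dp: "dep (p + N) (\<lambda>b. Ff b i)" unfolding Ff_def by (rule dep_vec[where f = "\<lambda>z. joint p N F z $ i"])
      have jg: "jet k (\<lambda>a. g1 a s) (blk p N U s)" if "s < p + N" for s
        using that ju[of "s - p"] jV[of s] by (cases "s < p") (auto simp: g1_def blk_def)
      have og: "ord_ge (Suc 0) (blk p N U s)" for s by (rule ord_ge_blk) (rule oU)
      have TF: "TF i = taylor_poly (p + N) k (\<lambda>b. Ff b i)"
        using i by (simp add: TF_def trunc_taylor Ff_def)
      have "msubst (\<lambda>s. if s < p + N then blk p N U s else 0) (TF i) = msubst (blk p N U) (TF i)"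
      proof (rule msubst_cong)
        have "joint p N F (0\<^sub>v (p + N)) = 0\<^sub>v N" by (rule F0)
        from in_vars_trunc[OF taylor_formal[where f = "joint p N F", OF this] i, of k]
        show "(if v < p + N then blk p N U v else 0) = blk p N U v" if "m \<in> keys (TF i)" "v \<in> keys m" for m v
          using that by (auto simp: TF_def in_vars_def)
      qed
      moreover have "jet k (\<lambda>a. Ff (g1 a) i) (msubst (\<lambda>s. if s < p + N then blk p N U s else 0) (TF i))"
        unfolding TF by (rule jet_compose[OF sm dp k0]) (simp, rule jg, assumption, rule og)
      ultimately show ?thesis by simp
    qed
    have jG: "jet k (\<lambda>a. Gf a i) (QG i)" if "i < N" for i
      unfolding Gf_def QG_def by (intro jet_add jet_pm ju jF that)
    have jR: "jet k (\<lambda>a. Rf a l) (pm N \<Psi>c QG l)" for l unfolding Rf_def by (intro jet_pm jG)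
    have jY: "jet k (\<lambda>a. Yf a l) (pm N \<Psi>su QG l)" for l unfolding Yf_def by (intro jet_pm jG)
    have j\<rho>: "jet k (\<lambda>a. Rf a l) (\<rho> l)" if l: "l < c" for l
    proof -
      have "\<rho> l = taylor_poly (p + c) k (\<lambda>a. Rf a l)"
        unfolding \<rho>_def trunc_taylor[OF l]
        by (rule taylor_poly_cong[OF \<delta>]) (rule R_nth[OF w_dim l])
      then show ?thesis using jet_taylor_poly[OF Rf_Ck[OF k] Rf_dep k0 \<delta>] by simp
    qed
    have o\<rho>: "ord_ge (Suc 0) (\<rho> l)" if "l < c" for l unfolding \<rho>_def by (rule ord_ge_trunc[OF Rs_formal that])
    \<comment> \<open>Two jets of the same function \<open>Rf\<close>: one computed by substitution,
      the other its own Taylor polynomial.\<close>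
    have cx: "cong_upto k (pm N \<Psi>c QG l) (\<rho> l)" if "l < c" for l by (rule jet_unique[OF jR j\<rho>[OF that]])
    have cy: "cong_upto k (pm N \<Psi>su QG l) (msubst (blk p c \<rho>) (W l))" if l: "l < q" for l
    proof (rule jet_unique)
      show "jet k (\<lambda>a. wf (g2 a) l) (pm N \<Psi>su QG l)"
        by (rule jet_cong[OF jY inv(1)]) (rule inv(2)[OF _ l])
      have sm: "Ck (p + c) (cbox0 (p + c) \<delta>) k (\<lambda>a. wf a l)" unfolding wf_def by (rule w_smooth[OF k l])
      have dp: "dep (p + c) (\<lambda>a. wf a l)" unfolding wf_def by (rule dep_vec[where f = "\<lambda>z. w z $ l"])
      have jg: "jet k (\<lambda>a. g2 a s) (blk p c \<rho> s)" if "s < p + c" for s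
        using that j\<rho>[of "s - p"] jV[of s] by (cases "s < p") (auto simp: g2_def blk_def)
      have og: "ord_ge (Suc 0) (blk p c \<rho> s)" for s by (rule ord_ge_blk) (rule o\<rho>)
      have "msubst (\<lambda>s. if s < p + c then blk p c \<rho> s else 0) (W l) = msubst (blk p c \<rho>) (W l)"
      proof (rule msubst_cong)
        from in_vars_trunc[OF ws_formal l, of k]
        show "(if v < p + c then blk p c \<rho> v else 0) = blk p c \<rho> v" if "m \<in> keys (W l)" "v \<in> keys m" for m v
          using that by (auto simp: W_def in_vars_def)
      qed
      moreover have "jet k (\<lambda>a. wf (g2 a) l) (msubst (\<lambda>s. if s < p + c then blk p c \<rho> s else 0) (W l))"
        unfolding W[OF l] by (rule jet_compose[OF sm dp k0 \<delta>]) (rule jg, assumption, rule og)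
      ultimately show "jet k (\<lambda>a. wf (g2 a) l) (msubst (blk p c \<rho>) (W l))" by simp
    qed
    have gwt: "trunc k gw s = (if s < c then Var (p + s) else W (s - c))" if "s < N" for s
      using that N k0 trunc_append[of "id_map p c" c ws q s k] formal_mapD(3)[OF ws_formal]
      by (auto simp: gw_def[abs_def] W_def trunc_id_map)
    let ?V = "blk p N (trunc k gw)"
    \<comment> \<open>Writing F in the coordinates (x,y) and then inserting the graph amounts to
      inserting u = \<Phi>c x + \<Phi>su w directly.\<close>
    have TFv: "msubst ?V (msubst u_sub (TF i)) = msubst (blk p N U) (TF i)" if i: "i < N" for i
      unfolding msubst_msubst
    proof (rule msubst_cong)
      fix m v assume "m \<in> keys (TF i)" "v \<in> keys m"
      with in_vars_trunc[OF taylor_formal[where f = "joint p N F", OF F0] i, of k]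
      have v: "v < p + N" by (auto simp: TF_def in_vars_def)
      have V: "?V (p + s) = trunc k gw s" if "s < N" for s using that by (simp add: blk_def)
      have "msubst ?V (pm c \<Phi>c (\<lambda>k. Var (p + k)) s + pm q \<Phi>su (\<lambda>k. Var (p + c + k)) s) = U s" for s
      proof -
        have "pm c \<Phi>c (\<lambda>k. ?V (p + k)) s = pm c \<Phi>c (\<lambda>k. Var (p + k)) s"
          by (rule pm_cong) (use N V gwt in simp)
        moreover have "pm q \<Phi>su (\<lambda>k. ?V (p + c + k)) s = pm q \<Phi>su W s"
          by (rule pm_cong) (use N V[of "c + _"] gwt in \<open>simp add: add.assoc\<close>)
        ultimately show ?thesis by (simp add: msubst_pm U_def)
      qed
      then show "msubst ?V (u_sub v) = blk p N U v" using v by (auto simp: blk_def[of p N])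
    qed
    fix l assume l: "l < N"
    have "cong_upto k (trunc k (fcomp p T' gw) l) (msubst ?V (trunc k T' l))"
      by (rule trunc_fcomp[OF T'_formal gw_formal l])
    also have "msubst ?V (trunc k T' l) = (if l < c then pm N \<Psi>c QG l else pm N \<Psi>su QG (l - c))"
    proof -
      have lin: "msubst ?V (lin_op c q J CQ l (\<lambda>s. Var (p + s))) = lin_op c q J CQ l (trunc k gw)"
        unfolding msubst_lin_op by (rule lin_op_cong) (use l N in \<open>auto simp: blk_def\<close>)
      have pmF: "msubst ?V (pm N A (\<lambda>i. msubst u_sub (TF i)) l') = pm N A (\<lambda>i. msubst (blk p N U) (TF i)) l'" for A l'
        unfolding msubst_pm by (rule pm_cong) (rule TFv)
      have QG: "pm N A QG l' = pm N A (pm N C U) l' + pm N A (\<lambda>i. msubst (blk p N U) (TF i)) l'" for A l'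
        unfolding QG_def[abs_def] by (simp add: pm_add)
      show ?thesis
      proof (cases "l < c")
        case True
        have "lin_op c q J CQ l (trunc k gw) = pm c J (\<lambda>k. Var (p + k)) l"
          using True N gwt by (auto simp: lin_op_pm intro!: pm_cong)
        also have "\<dots> = pm N \<Psi>c (pm N C U) l" unfolding U_def by (rule lin_coords(1)[symmetric, OF True])
        finally show ?thesis using True
          by (simp add: trunc_T'[OF k0 l F_low] lin pmF[unfolded TF_def] QG TF_def)
      next
        case False
        have "lin_op c q J CQ l (trunc k gw) = pm q CQ W (l - c)"
          using False N gwt by (auto simp: lin_op_pm intro!: pm_cong)
        also have "\<dots> = pm N \<Psi>su (pm N C U) (l - c)" unfolding U_def
          by (rule lin_coords(2)[symmetric]) (use False l N in simp)
        finally show ?thesis using False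
          by (simp add: trunc_T'[OF k0 l F_low] lin pmF[unfolded TF_def] QG TF_def)
      qed
    qed
    also have "cong_upto k \<dots> (trunc k (fcomp p gw Rs) l)"
    proof -
      have gR: "fcomp p gw Rs = (\<lambda>j. Rs j @\<^sub>v fcomp p ws Rs j)"
        unfolding gw_def[abs_def] using append_fcomp[of "id_map p c" c ws q p Rs] formal_mapD(3)[OF ws_formal]
        by (simp add: fcomp_id_left[OF Rs_formal] near_id_def)
      show ?thesis
      proof (cases "l < c")
        case True
        then have "trunc k (fcomp p gw Rs) l = \<rho> l"
          using formal_mapD(3)[OF Rs_formal] by (simp add: gR trunc_def \<rho>_def)
        then show ?thesis using cx[OF True] True by simp
      next
        case False
        then have lq: "l - c < q" using l N by simp
        have "trunc k (fcomp p gw Rs) l = trunc k (fcomp p ws Rs) (l - c)"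
          using False formal_mapD(3)[OF Rs_formal] formal_mapD(3)[OF ws_formal] lq by (simp add: gR trunc_def)
        moreover have "cong_upto k (trunc k (fcomp p ws Rs) (l - c)) (msubst (blk p c \<rho>) (W (l - c)))"
          unfolding \<rho>_def W_def by (rule trunc_fcomp[OF ws_formal Rs_formal lq])
        ultimately show ?thesis using False cong_upto_trans[OF cy[OF lq] cong_upto_sym] by simp
      qed
    qed
    finally show "cong_upto k (trunc k (fcomp p T' gw) l) (trunc k (fcomp p gw Rs) l)" .
  qed
  \<comment> \<open>Jets were taken for positive k; order 0 holds because both sides fix the
    origin.\<close>
  then have "fcomp p T' gw k = fcomp p gw Rs k" if "enat k \<le> r" for k
    using that formal_mapD(1)[OF lhs] formal_mapD(1)[OF rhs]
    by (cases "k = 0") (auto dest: agree_uptoD)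
  then show ?thesis by (simp add: agree_upto_def)
qed

end

subsection \<open>Projections and right inverses\<close>

lemma M_op_add:
  assumes "J \<in> carrier_mat c c" "A \<in> carrier_mat n n" "dim_vec v = n" "dim_vec w = n"
  shows "M_op p J A (v + w) = M_op p J A v + M_op p J A w"
proof (rule eq_vecI)
  fix i assume "i < dim_vec (M_op p J A v + M_op p J A w)"
  then have i: "i < n" using assms by simp
  have "M_op p J A (v + w) $ i = msubst (lin_subst p c J) ((v + w) $ i) - (\<Sum>k<n. Const (A $$ (i, k)) * (v + w) $ k)"
    by (rule M_op_nth[OF assms(1,2)]) (use assms i in auto)
  also have "\<dots> = M_op p J A v $ i + M_op p J A w $ i"
    using i assms by (simp add: M_op_nth[OF assms(1,2)] algebra_simps sum.distrib)
  finally show "M_op p J A (v + w) $ i = (M_op p J A v + M_op p J A w) $ i" using i assms by simp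
qed (use assms in simp)

lemma M_op_diff:
  assumes "J \<in> carrier_mat c c" "A \<in> carrier_mat n n" "dim_vec v = n" "dim_vec w = n"
  shows "M_op p J A (v - w) = M_op p J A v - M_op p J A w"
proof (rule eq_vecI)
  fix i assume "i < dim_vec (M_op p J A v - M_op p J A w)"
  then have i: "i < n" using assms by simp
  have "M_op p J A (v - w) $ i = msubst (lin_subst p c J) ((v - w) $ i) - (\<Sum>k<n. Const (A $$ (i, k)) * (v - w) $ k)"
    by (rule M_op_nth[OF assms(1,2)]) (use assms i in auto)
  also have "\<dots> = M_op p J A v $ i - M_op p J A w $ i"
    using i assms by (simp add: M_op_nth[OF assms(1,2)] algebra_simps sum_subtractf)
  finally show "M_op p J A (v - w) $ i = (M_op p J A v - M_op p J A w) $ i" using i assms by simp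
qed (use assms in simp)

lemma vec_diff_eq_0: "v - w = 0\<^sub>v n \<Longrightarrow> dim_vec v = n \<Longrightarrow> dim_vec w = n \<Longrightarrow> v = w" for v w :: "mpoly vec"
proof (rule eq_vecI)
  fix i assume "v - w = 0\<^sub>v n" "dim_vec v = n" "dim_vec w = n" "i < dim_vec w"
  from arg_cong[OF this(1), of "\<lambda>x. x $ i"] this(2-) show "v $ i = w $ i" by simp
qed simp

lemma complement_diff:
  assumes "is_complement S A n B" "S \<subseteq> hom_polys d j n" "v \<in> B" "w \<in> B"
  shows "v - w \<in> B"
proof -
  have "Const (- 1) \<cdot>\<^sub>v w \<in> B" using assms by (simp add: is_complement_def)
  then have "v + Const (- 1) \<cdot>\<^sub>v w \<in> B" using assms by (simp add: is_complement_def)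
  moreover have "v \<in> hom_polys d j n" "w \<in> hom_polys d j n" using assms by (auto simp: is_complement_def)
  then have "v + Const (- 1) \<cdot>\<^sub>v w = v - w"
    by (intro eq_vecI) (auto simp: hom_polysD(1) Const_minus)
  ultimately show ?thesis by simp
qed

text \<open>The definite description in \<open>im_proj\<close> denotes: two candidates differ by an
  element of the image that also lies in the complement B, hence by zero.\<close>

lemma im_proj:
  assumes J: "J \<in> carrier_mat c c" and A: "A \<in> carrier_mat n n"
    and compl: "is_complement (hom_polys (p + c) j n) (M_im p J A j) n B" and h: "h \<in> hom_polys (p + c) j n"
  shows "im_proj p J A j B h \<in> M_im p J A j" "h - im_proj p J A j B h \<in> B"
proof -
  let ?Q = "\<lambda>a. a \<in> M_im p J A j \<and> h - a \<in> B"
  have dims: "dim_row J = c" "dim_row A = n" using J A by auto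
  have im_dim: "dim_vec a = n" if "a \<in> M_im p J A j" for a using that dims by (auto simp: M_im_def)
  have "\<exists>!a. ?Q a"
  proof (rule ex_ex1I)
    obtain a b where ab: "a \<in> M_im p J A j" "b \<in> B" "h = a + b"
      using compl h unfolding is_complement_def by blast
    have "b \<in> hom_polys (p + c) j n" using compl ab by (auto simp: is_complement_def)
    then have "h - a = b" using ab im_dim[OF ab(1)] by (intro eq_vecI) (auto simp: hom_polysD(1))
    with ab show "\<exists>a. ?Q a" by auto
  next
    fix a a' assume a: "?Q a" and a': "?Q a'"
    then obtain u u' where u: "u \<in> hom_polys (p + c) j n" "u' \<in> hom_polys (p + c) j n" "a = M_op p J A u" "a' = M_op p J A u'"
      unfolding M_im_def dims by blast
    have "(h - a') - (h - a) \<in> B" by (rule complement_diff[OF compl order_refl]) (use a a' in auto)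
    moreover have "(h - a') - (h - a) = a - a'"
      using im_dim a a' hom_polysD(1)[OF h] by (intro eq_vecI) auto
    moreover have "a - a' = M_op p J A (u - u')" by (simp add: u M_op_diff[OF J A hom_polysD(1)[OF u(1)] hom_polysD(1)[OF u(2)]])
    then have "a - a' \<in> M_im p J A j" unfolding M_im_def dims using diff_hom_polys[OF u(1,2)] by blast
    ultimately have "a - a' = 0\<^sub>v n" using compl unfolding is_complement_def by auto
    then show "a = a'" by (rule vec_diff_eq_0) (use im_dim a a' in auto)
  qed
  from theI'[OF this] show "im_proj p J A j B h \<in> M_im p J A j" "h - im_proj p J A j B h \<in> B"
    by (simp_all add: im_proj_def)
qed

text \<open>A complement of the kernel is mapped bijectively onto the image, so the definite
  description in \<open>right_inv\<close> denotes as well.\<close>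

lemma right_inv:
  assumes J: "J \<in> carrier_mat c c" and A: "A \<in> carrier_mat n n"
    and compl: "is_complement (hom_polys (p + c) j n) (M_ker p J A j) n B" and w: "w \<in> M_im p J A j"
  shows "right_inv p J A B w \<in> B" "right_inv p J A B w \<in> hom_polys (p + c) j n" "M_op p J A (right_inv p J A B w) = w"
proof -
  let ?Q = "\<lambda>h. h \<in> B \<and> M_op p J A h = w"
  have dims: "dim_row J = c" "dim_row A = n" using J A by auto
  have B: "B \<subseteq> hom_polys (p + c) j n" using compl by (simp add: is_complement_def)
  have "\<exists>!h. ?Q h"
  proof (rule ex_ex1I)
    obtain h where h: "h \<in> hom_polys (p + c) j n" "w = M_op p J A h" using w unfolding M_im_def dims by blast
    obtain a b where ab: "a \<in> M_ker p J A j" "b \<in> B" "h = a + b"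
      using compl h(1) unfolding is_complement_def by blast
    have da: "dim_vec a = n" "M_op p J A a = 0\<^sub>v n" using ab(1) dims by (auto simp: M_ker_def hom_polysD(1))
    have db: "dim_vec b = n" using ab(2) B by (auto simp: hom_polysD(1))
    have "w = 0\<^sub>v n + M_op p J A b" by (simp add: h(2) ab(3) M_op_add[OF J A da(1) db] da(2))
    also have "\<dots> = M_op p J A b" by (rule eq_vecI) (simp_all add: dims)
    finally show "\<exists>h. ?Q h" using ab(2) by auto
  next
    fix h h' assume h: "?Q h" and h': "?Q h'"
    then have hh: "h \<in> hom_polys (p + c) j n" "h' \<in> hom_polys (p + c) j n" using B by auto
    have "M_op p J A (h - h') = w - w" using h h' by (simp add: M_op_diff[OF J A] hom_polysD(1)[OF hh(1)] hom_polysD(1)[OF hh(2)])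
    also have "\<dots> = 0\<^sub>v n" using h dims by (intro eq_vecI) auto
    finally have "h - h' \<in> M_ker p J A j" using diff_hom_polys[OF hh] by (simp add: M_ker_def dims)
    moreover have "h - h' \<in> B" by (rule complement_diff[OF compl order_refl]) (use h h' in auto)
    ultimately have "h - h' = 0\<^sub>v n" using compl unfolding is_complement_def by auto
    then show "h = h'" by (rule vec_diff_eq_0) (simp_all add: hom_polysD(1)[OF hh(1)] hom_polysD(1)[OF hh(2)])
  qed
  from theI'[OF this] have "right_inv p J A B w \<in> B \<and> M_op p J A (right_inv p J A B w) = w"
    by (simp add: right_inv_def)
  with B show "right_inv p J A B w \<in> B" "right_inv p J A B w \<in> hom_polys (p + c) j n" "M_op p J A (right_inv p J A B w) = w"
    by auto
qed

lemma M_inv_P_I: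
  assumes J: "J \<in> carrier_mat c c" and CQ: "CQ \<in> carrier_mat q q"
    and I1: "is_complement (hom_polys (p + c) j c) (M_im p J J j) c I1"
    and K1: "is_complement (hom_polys (p + c) j c) (M_ker p J J j) c K1"
    and I2: "is_complement (hom_polys (p + c) j q) (M_im p J CQ j) q I2"
    and K2: "is_complement (hom_polys (p + c) j q) (M_ker p J CQ j) q K2"
    and h: "h \<in> hom_polys (p + c) j (c + q)"
  shows "M_inv p c q J CQ K1 K2 (P_I p c q J CQ j I1 I2 h) \<in> hom_polys (p + c) j (c + q)"
    and "M_pair p c q J CQ (M_inv p c q J CQ K1 K2 (P_I p c q J CQ j I1 I2 h)) = P_I p c q J CQ j I1 I2 h"
    and "vec_first (M_inv p c q J CQ K1 K2 (P_I p c q J CQ j I1 I2 h)) c =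
           right_inv p J J K1 (im_proj p J J j I1 (vec_first h c))"
proof -
  let ?a = "im_proj p J J j I1 (vec_first h c)" and ?b = "im_proj p J CQ j I2 (vec_last h q)"
  have a: "?a \<in> M_im p J J j" by (rule im_proj(1)[OF J J I1 vec_first_hom_polys[OF h]]) simp
  have b: "?b \<in> M_im p J CQ j" by (rule im_proj(1)[OF J CQ I2 vec_last_hom_polys[OF h]]) simp
  have d: "dim_vec ?a = c" "dim_vec ?b = q" using a b J CQ by (auto simp: M_im_def)
  then have eq: "M_inv p c q J CQ K1 K2 (P_I p c q J CQ j I1 I2 h) = right_inv p J J K1 ?a @\<^sub>v right_inv p J CQ K2 ?b"
    by (simp add: M_inv_def P_I_def)
  note ra = right_inv[OF J J K1 a] and rb = right_inv[OF J CQ K2 b]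
  show "M_inv p c q J CQ K1 K2 (P_I p c q J CQ j I1 I2 h) \<in> hom_polys (p + c) j (c + q)"
    unfolding eq by (rule append_hom_polys[OF ra(2) rb(2)])
  have dr: "dim_vec (right_inv p J J K1 ?a) = c" "dim_vec (right_inv p J CQ K2 ?b) = q"
    using ra(2) rb(2) by (simp_all add: hom_polysD(1))
  then show "M_pair p c q J CQ (M_inv p c q J CQ K1 K2 (P_I p c q J CQ j I1 I2 h)) = P_I p c q J CQ j I1 I2 h"
    unfolding eq by (simp add: M_pair_def ra(3) rb(3) P_I_def)
  show "vec_first (M_inv p c q J CQ K1 K2 (P_I p c q J CQ j I1 I2 h)) c = right_inv p J J K1 ?a"
    unfolding eq using dr by simp
qed

lemma at_y0_hom_polys: "h \<in> hom_polys d j n \<Longrightarrow> at_y0 p c h \<in> hom_polys (p + c) j n"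
proof -
  assume h: "h \<in> hom_polys d j n"
  let ?s = "\<lambda>v. if v < p + c then Var v else 0"
  have "homog j (msubst ?s (h $ i))" if "i < n" for i
    by (rule homog_msubst[OF hom_polysD(2)[OF h that]]) simp
  moreover have "in_vars (p + c) (msubst ?s (h $ i))" for i
    by (rule in_vars_msubst) (simp add: in_vars_Var)
  ultimately show ?thesis using hom_polysD(1)[OF h] by (simp add: hom_polys_iff at_y0_def)
qed

lemma at_y0_id: "h \<in> hom_polys (p + c) j n \<Longrightarrow> at_y0 p c h = h"
proof (rule eq_vecI)
  fix i assume h: "h \<in> hom_polys (p + c) j n" and i: "i < dim_vec h"
  have "msubst (\<lambda>v. if v < p + c then Var v else 0) (h $ i) = msubst Var (h $ i)"
  proof (rule msubst_cong)
    fix m v assume "m \<in> keys (h $ i)" "v \<in> keys m"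
    with hom_polysD(1,3)[OF h] i show "(if v < p + c then Var v else 0) = Var v" by (auto simp: in_vars_def)
  qed
  then show "at_y0 p c h $ i = h $ i" using i by (simp add: at_y0_def)
qed (simp add: at_y0_def)

lemma dim_at_y0 [simp]: "dim_vec (at_y0 p c h) = dim_vec h"
  by (simp add: at_y0_def)

lemma at_y0_diff: "dim_vec v = dim_vec w \<Longrightarrow> at_y0 p c (v - w) = at_y0 p c v - at_y0 p c w"
  by (auto simp: at_y0_def intro!: eq_vecI)

subsection \<open>Conjugation by the composite of the steps\<close>

lemma nf_steps_conj:
  assumes U: "\<And>j. 2 \<le> j \<Longrightarrow> U j \<in> hom_polys (p + c) j n" and cn: "c \<le> n"
    and G: "\<And>j. 1 \<le> j \<Longrightarrow> is_formal_map (p + n) n (G j)"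
    and step: "\<And>j. 2 \<le> j \<Longrightarrow> fcomp p (G (j - 1)) (nf_step p n U j) = fcomp p (nf_step p n U j) (G j)"
    and "1 \<le> j"
  shows "fcomp p (G 1) (nf_steps p n U j) = fcomp p (nf_steps p n U j) (G j)"
  using \<open>1 \<le> j\<close>
proof (induction j rule: dec_induct)
  case base
  show ?case using fcomp_id_right[OF G[of 1]] fcomp_id_left[OF G[of 1]] by simp
next
  case (step j)
  let ?S = "nf_steps p n U j" and ?T = "nf_step p n U (Suc j)"
  have S: "is_formal_map (p + n) n ?S" by (rule nf_steps_formal[OF U cn])
  have T: "is_formal_map (p + n) n ?T"
    by (rule nf_step_formal[OF hom_polys_lift[OF U cn]]) simp_all
  have G1: "is_formal_map (p + n) n (G 1)" and Gj: "is_formal_map (p + n) n (G j)" and GS: "is_formal_map (p + n) n (G (Suc j))"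
    using G step.hyps by auto
  have "fcomp p (G 1) (nf_steps p n U (Suc j)) = fcomp p (fcomp p (G 1) ?S) ?T"
    using step.hyps fcomp_assoc[OF G1 S T] by simp
  also have "\<dots> = fcomp p ?S (fcomp p (G j) ?T)"
    unfolding step.IH by (rule fcomp_assoc[OF S Gj T]) simp
  also have "fcomp p (G j) ?T = fcomp p ?T (G (Suc j))"
    using assms(4)[of "Suc j"] step.hyps by simp
  also have "fcomp p ?S (fcomp p ?T (G (Suc j))) = fcomp p (nf_steps p n U (Suc j)) (G (Suc j))"
    using step.hyps fcomp_assoc[OF S T GS] by simp
  finally show ?case .
qed

lemma nf_sequence_exists:
  assumes T: "is_formal_map (p + n) n T" and cn: "c \<le> n"
    and W: "\<And>j f. 2 \<le> j \<Longrightarrow> is_formal_map (p + n) n f \<Longrightarrow> W j f \<in> hom_polys (p + c) j n"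
  shows "\<exists>G. G 1 = T \<and> (\<forall>j\<ge>1. is_formal_map (p + n) n (G j)) \<and>
    (\<forall>j\<ge>2. fcomp p (G (j - 1)) (nf_step p n (\<lambda>j. W j (G (j - 1))) j) =
            fcomp p (nf_step p n (\<lambda>j. W j (G (j - 1))) j) (G j))"
proof -
  define next_map where "next_map j f = (SOME K. is_formal_map (p + n) n K \<and>
     fcomp p (nf_step p n (\<lambda>j. W j f) (Suc j)) K = fcomp p f (nf_step p n (\<lambda>j. W j f) (Suc j)))" for j f
  have nm: "is_formal_map (p + n) n (next_map j f) \<and>
     fcomp p (nf_step p n (\<lambda>j. W j f) (Suc j)) (next_map j f) = fcomp p f (nf_step p n (\<lambda>j. W j f) (Suc j))"
    if "1 \<le> j" "is_formal_map (p + n) n f" for j f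
  proof -
    have U: "W (Suc j) f \<in> hom_polys (p + n) (Suc j) n"
      by (rule hom_polys_lift[OF W cn]) (use that in auto)
    have Th: "is_formal_map (p + n) n (nf_step p n (\<lambda>j. W j f) (Suc j))"
      by (rule nf_step_formal) (simp_all add: U)
    have "\<exists>K. is_formal_map (p + n) n K \<and> fcomp p (nf_step p n (\<lambda>j. W j f) (Suc j)) K = fcomp p f (nf_step p n (\<lambda>j. W j f) (Suc j))"
      unfolding nf_step_def
    proof (rule near_id_solve)
      show "(if k = Suc j then Const (1 / fact (Suc j)) \<cdot>\<^sub>v W (Suc j) f else 0\<^sub>v n) \<in> hom_polys (p + n) k n" for k
        using U by (simp add: smult_hom_polys del: fact_Suc)
      show "is_formal_map (p + n) n (fcomp p f (near_id p n (\<lambda>k. if k = Suc j then Const (1 / fact (Suc j)) \<cdot>\<^sub>v W (Suc j) f else 0\<^sub>v n)))"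
        by (rule fcomp_formal[OF that(2) Th[unfolded nf_step_def]]) simp
    qed simp
    from someI_ex[OF this] show ?thesis by (simp only: next_map_def)
  qed
  \<comment> \<open>The recursion does nothing from 0 to 1, so that \<open>G j\<close> is the map
    after the steps 2, ..., j.\<close>
  define G where "G = rec_nat T (\<lambda>j f. if j = 0 then T else next_map j f)"
  have GS: "G (Suc j) = next_map j (G j)" if "1 \<le> j" for j using that by (simp add: G_def)
  have G1: "G 1 = T" by (simp add: G_def)
  have form: "is_formal_map (p + n) n (G j)" if "1 \<le> j" for j
    using that by (induction j rule: dec_induct) (use T G1 GS nm in auto)
  moreover have "fcomp p (G (j - 1)) (nf_step p n (\<lambda>j. W j (G (j - 1))) j) = fcomp p (nf_step p n (\<lambda>j. W j (G (j - 1))) j) (G j)"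
    if "2 \<le> j" for j
  proof -
    obtain i where i: "j = Suc i" "1 \<le> i" using \<open>2 \<le> j\<close> by (cases j) auto
    have "nf_step p n (\<lambda>j. W j (G (j - 1))) (Suc i) = nf_step p n (\<lambda>j. W j (G i)) (Suc i)"
      unfolding nf_step_def by (simp only: diff_Suc_1)
    then show ?thesis using nm[OF i(2) form[OF i(2)]] GS[OF i(2)] i(1) by simp
  qed
  ultimately show ?thesis using G1 by blast
qed

subsection \<open>The normal form and the formal invariant graph\<close>

text \<open>Nonresonance enters through the last three assumptions only. The third concerns linear
  forms in the parameters and is meant for the first-order part of a graph.\<close>

locale nf = coords +
  fixes T :: formal_map and ImC1 KerC1 ImC2 KerC2 :: "nat \<Rightarrow> mpoly vec set"
  assumes T: "is_formal_map (p + N) N T" and T1: "T 1 = lin_part p c q J CQ"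
    and I1: "\<And>j. 2 \<le> j \<Longrightarrow> is_complement (hom_polys (p + c) j c) (M_im p J J j) c (ImC1 j)"
    and K1: "\<And>j. 2 \<le> j \<Longrightarrow> is_complement (hom_polys (p + c) j c) (M_ker p J J j) c (KerC1 j)"
    and I2: "\<And>j. 2 \<le> j \<Longrightarrow> is_complement (hom_polys (p + c) j q) (M_im p J CQ j) q (ImC2 j)"
    and K2: "\<And>j. 2 \<le> j \<Longrightarrow> is_complement (hom_polys (p + c) j q) (M_ker p J CQ j) q (KerC2 j)"
    and surj2: "\<And>j h. 2 \<le> j \<Longrightarrow> h \<in> hom_polys (p + c) j q \<Longrightarrow> h \<in> M_im p J CQ j"
    and inj2: "\<And>j h. 2 \<le> j \<Longrightarrow> h \<in> hom_polys (p + c) j q \<Longrightarrow> M_op p J CQ h = 0\<^sub>v q \<Longrightarrow> h = 0\<^sub>v q"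
    and inj1: "\<And>h. h \<in> hom_polys p 1 q \<Longrightarrow> M_op p J CQ h = 0\<^sub>v q \<Longrightarrow> h = 0\<^sub>v q"
begin

definition PI :: "nat \<Rightarrow> mpoly vec \<Rightarrow> mpoly vec" where
  "PI j h = P_I p c q J CQ j (ImC1 j) (ImC2 j) h"

definition W :: "nat \<Rightarrow> formal_map \<Rightarrow> mpoly vec" where
  "W j f = M_inv p c q J CQ (KerC1 j) (KerC2 j) (PI j (at_y0 p c (Const (fact j) \<cdot>\<^sub>v f j)))"

lemma at_y0_fbar: "is_formal_map (p + N) N f \<Longrightarrow> at_y0 p c (Const (fact j) \<cdot>\<^sub>v f j) \<in> hom_polys (p + c) j (c + q)"
  unfolding N[symmetric] by (rule at_y0_hom_polys[OF smult_hom_polys[OF formal_mapD(2)]])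

lemma W_hom: "2 \<le> j \<Longrightarrow> is_formal_map (p + N) N f \<Longrightarrow> W j f \<in> hom_polys (p + c) j N"
  and M_pair_W: "2 \<le> j \<Longrightarrow> is_formal_map (p + N) N f \<Longrightarrow>
    M_pair p c q J CQ (W j f) = PI j (at_y0 p c (Const (fact j) \<cdot>\<^sub>v f j))"
  using M_inv_P_I(1,2)[OF J CQ I1 K1 I2 K2 at_y0_fbar] by (simp_all add: W_def PI_def N)

definition Gs :: "nat \<Rightarrow> formal_map" where
  "Gs = (SOME G. G 1 = T \<and> (\<forall>j\<ge>1. is_formal_map (p + N) N (G j)) \<and>
    (\<forall>j\<ge>2. fcomp p (G (j - 1)) (nf_step p N (\<lambda>j. W j (G (j - 1))) j) =
            fcomp p (nf_step p N (\<lambda>j. W j (G (j - 1))) j) (G j)))"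

definition U :: "nat \<Rightarrow> mpoly vec" where "U j = W j (Gs (j - 1))"
definition fbar :: "nat \<Rightarrow> mpoly vec" where "fbar j = Const (fact j) \<cdot>\<^sub>v Gs (j - 1) j"
definition g :: "nat \<Rightarrow> mpoly vec" where "g j = fbar j - M_pair p c q J CQ (U j)"

lemma cN: "c \<le> N" and qN: "q \<le> N" using N by simp_all

lemma append_N:
  "v \<in> hom_polys d j c \<Longrightarrow> w \<in> hom_polys d j q \<Longrightarrow> v @\<^sub>v w \<in> hom_polys d j N"
  "is_formal_map d c f1 \<Longrightarrow> is_formal_map d q f2 \<Longrightarrow> is_formal_map d N (\<lambda>j. f1 j @\<^sub>v f2 j)"
  "0\<^sub>v c @\<^sub>v 0\<^sub>v q = (0\<^sub>v N :: mpoly vec)"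
  unfolding N by (rule append_hom_polys, assumption+) (rule append_formal, assumption+, auto)

lemma Gs: "Gs 1 = T" "\<And>j. 1 \<le> j \<Longrightarrow> is_formal_map (p + N) N (Gs j)"
  "\<And>j. 2 \<le> j \<Longrightarrow> fcomp p (Gs (j - 1)) (nf_step p N U j) = fcomp p (nf_step p N U j) (Gs j)"
proof -
  have "\<exists>G. G 1 = T \<and> (\<forall>j\<ge>1. is_formal_map (p + N) N (G j)) \<and>
    (\<forall>j\<ge>2. fcomp p (G (j - 1)) (nf_step p N (\<lambda>j. W j (G (j - 1))) j) =
            fcomp p (nf_step p N (\<lambda>j. W j (G (j - 1))) j) (G j))"
    by (rule nf_sequence_exists[OF T cN W_hom])
  note S = someI_ex[OF this, folded Gs_def]
  have U': "U = (\<lambda>j. W j (Gs (j - 1)))" by (rule ext) (simp add: U_def)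
  show "Gs 1 = T" by (rule conjunct1[OF S])
  show "is_formal_map (p + N) N (Gs j)" if "1 \<le> j" for j
    using conjunct1[OF conjunct2[OF S]] that by (elim allE impE)
  show "fcomp p (Gs (j - 1)) (nf_step p N U j) = fcomp p (nf_step p N U j) (Gs j)" if "2 \<le> j" for j
    unfolding U' using conjunct2[OF conjunct2[OF S]] that by (elim allE impE)
qed

lemma Gs': "2 \<le> j \<Longrightarrow> is_formal_map (p + N) N (Gs (j - 1))"
  by (rule Gs(2)) simp

lemma U: "2 \<le> j \<Longrightarrow> U j \<in> hom_polys (p + c) j N"
  unfolding U_def by (rule W_hom[OF _ Gs'])

lemma M_pair_U: "2 \<le> j \<Longrightarrow> M_pair p c q J CQ (U j) = PI j (at_y0 p c (fbar j))"
  unfolding U_def fbar_def by (rule M_pair_W[OF _ Gs'])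

text \<open>Step j alters nothing below order j, so the part of order j is final once step j is
  made; it is then \<open>g j\<close> divided by j!.\<close>

lemma Gs_step:
  assumes "1 \<le> j"
  shows "Gs j 1 = lin_part p c q J CQ" "\<And>i. i \<le> j \<Longrightarrow> Gs (Suc j) i = Gs j i"
    and "2 \<le> j \<Longrightarrow> Gs j j = Const (1 / fact j) \<cdot>\<^sub>v g j"
proof -
  have conj: "(\<forall>i<j. Gs j i = Gs (j - 1) i) \<and> Gs j j = Gs (j - 1) j - Const (1 / fact j) \<cdot>\<^sub>v M_pair p c q J CQ (U j)"
    if j: "2 \<le> j" and L: "Gs (j - 1) 1 = lin_part p c q J CQ" for j
  proof -
    have Gj: "is_formal_map (p + N) N (Gs j)" by (rule Gs(2)) (use j in simp)
    have eq: "agree_upto (enat j) (fcomp p (Gs (j - 1)) (nf_step p N U j)) (fcomp p (nf_step p N U j) (Gs j))"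
      unfolding Gs(3)[OF j] by (rule agree_upto_refl)
    note st = conj_step[OF J CQ N Gs'[OF j] Gj L U[OF j] j eq]
    show ?thesis by (intro conjI allI impI st)
  qed
  have L: "Gs j 1 = lin_part p c q J CQ" if "1 \<le> j" for j
    using that
  proof (induction j rule: dec_induct)
    case (step j)
    then have "2 \<le> Suc j" "Gs (Suc j - 1) 1 = lin_part p c q J CQ" by simp_all
    from conj[OF this] step show ?case by simp
  qed (use Gs(1) T1 in simp)
  show "Gs j 1 = lin_part p c q J CQ" by (rule L[OF assms])
  show "Gs (Suc j) i = Gs j i" if "i \<le> j" for i
    using conj[of "Suc j"] L[OF assms] assms that by simp
  show "Gs j j = Const (1 / fact j) \<cdot>\<^sub>v g j" if j: "2 \<le> j"
  proof -
    have G: "Gs j j = Gs (j - 1) j - Const (1 / fact j) \<cdot>\<^sub>v M_pair p c q J CQ (U j)"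
      using conj[OF j] L[of "j - 1"] j by simp
    define K where "K = Gs (j - 1) j"
    have d: "dim_vec K = N" unfolding K_def by (rule formal_mapD(3)[OF Gs'[OF j]])
    have dM: "dim_vec (M_pair p c q J CQ (U j)) = N" using J CQ N by simp
    have one: "Const (1 / fact j) * (Const (fact j) * f) = f" for f
      by (simp add: Const_mult[symmetric] mult.assoc[symmetric])
    show ?thesis unfolding G g_def fbar_def K_def[symmetric]
      by (rule eq_vecI) (simp_all add: d dM right_diff_distrib one)
  qed
qed

lemma Gs_stable: "1 \<le> i \<Longrightarrow> i \<le> j \<Longrightarrow> k \<le> i \<Longrightarrow> Gs j k = Gs i k"
proof (induction j)
  case (Suc j)
  then show ?case using Gs_step(2)[of j k] by (cases "i = Suc j") auto
qed simp

abbreviation Ginf :: formal_map where "Ginf \<equiv> map_series (lin_part p c q J CQ) g"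

lemma Ginf: "1 \<le> j \<Longrightarrow> agree_upto (enat j) (Gs j) Ginf"
proof -
  assume j: "1 \<le> j"
  have "Gs j k = Ginf k" if "k \<le> j" for k
  proof -
    consider "k = 0" | "k = 1" | "2 \<le> k" by linarith
    then show ?thesis
    proof cases
      case 1
      then show ?thesis using formal_mapD(1)[OF Gs(2)[OF j]] N J CQ by (simp add: map_series_def)
    next
      case 2
      then show ?thesis using Gs_step(1)[OF j] by (simp add: map_series_def)
    next
      case 3
      then show ?thesis using Gs_stable[of k j k] Gs_step(3)[of k] that by (simp add: map_series_def)
    qed
  qed
  then show ?thesis by (simp add: agree_upto_enat)
qed

lemma Ginf_formal: "is_formal_map (p + N) N Ginf"
proof -
  have "Ginf k \<in> hom_polys (p + N) k N" for k
    using agree_uptoD[OF Ginf[of "max 1 k"], of k] formal_mapD(2)[OF Gs(2)[of "max 1 k"], of k] by simp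
  moreover have "Ginf 0 = 0\<^sub>v N" using N J CQ by (simp add: map_series_def)
  ultimately show ?thesis by (simp add: is_formal_map_def)
qed

section \<open>The formal limit of the changes of variables\<close>

definition P :: formal_map where "P k = (if k < 2 then 0\<^sub>v c else vec_first (nf_steps p N U k k) c)"
definition H :: formal_map where "H k = (if k < 2 then 0\<^sub>v q else vec_last (nf_steps p N U k k) q)"

abbreviation Th :: formal_map where "Th \<equiv> near_id p N (\<lambda>j. P j @\<^sub>v H j)"
abbreviation Xp :: formal_map where "Xp \<equiv> near_id p c P"

lemma nf_steps_diag: "2 \<le> k \<Longrightarrow> nf_steps p N U k k \<in> hom_polys (p + c) k N"
proof -
  assume k: "2 \<le> k"
  obtain E where E: "(\<forall>k\<ge>2. E k \<in> hom_polys (p + c) k N) \<and> nf_steps p N U k = near_id p N E"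
    using nf_steps_near_id[where U = U and p = p and c = c and n = N and j = k] U cN by blast
  then have "nf_steps p N U k k = E k" using k by (simp add: near_id_def)
  with E k show ?thesis by simp
qed

lemma PH_hom: "2 \<le> k \<Longrightarrow> P k \<in> hom_polys (p + c) k c" "2 \<le> k \<Longrightarrow> H k \<in> hom_polys (p + c) k q"
  using vec_first_hom_polys[OF nf_steps_diag cN] vec_last_hom_polys[OF nf_steps_diag qN]
  by (simp_all add: P_def H_def)

lemma P_formal: "is_formal_map (p + c) c P" and H_formal: "is_formal_map (p + c) q H"
  using PH_hom by (auto simp: is_formal_map_def P_def H_def not_less)

lemma PH_low: "k < 2 \<Longrightarrow> P k = 0\<^sub>v c" "k < 2 \<Longrightarrow> H k = 0\<^sub>v q"
  by (simp_all add: P_def H_def)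

lemma Th_diag: "Th k = nf_steps p N U k k"
proof -
  consider "k = 0" | "k = 1" | "2 \<le> k" by linarith
  then show ?thesis
  proof cases
    case 3
    have "vec_first (nf_steps p N U k k) c @\<^sub>v vec_last (nf_steps p N U k k) q = nf_steps p N U k k"
      by (rule vec_first_last_append) (use hom_polysD(1)[OF nf_steps_diag[OF 3]] N in simp)
    then show ?thesis using 3 by (simp add: near_id_def P_def H_def)
  qed (simp_all add: near_id_def)
qed

lemma Th_agree: "agree_upto (enat k) Th (nf_steps p N U k)"
proof -
  have "nf_steps p N U i i = nf_steps p N U k i" if "i \<le> k" for i
    by (rule agree_uptoD[OF nf_steps_agree[OF U cN that]]) simp_all
  then show ?thesis by (simp add: agree_upto_enat Th_diag)
qed

lemma e_hom: "2 \<le> k \<Longrightarrow> P k @\<^sub>v H k \<in> hom_polys (p + c) k N"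
  by (rule append_N(1)[OF PH_hom])

lemma Th_formal: "is_formal_map (p + N) N Th"
  by (rule near_id_formal[OF hom_polys_lift[OF e_hom cN]]) simp_all

lemma Xp_formal: "is_formal_map (p + c) c Xp"
  by (rule near_id_formal[OF PH_hom(1)]) simp_all

text \<open>Up to order k the limits may be replaced by the k-th composite and the k-th map, for
  which conjugation holds to all orders.\<close>

lemma Th_conj: "fcomp p T Th = fcomp p Th Ginf"
proof
  fix k :: nat
  \<comment> \<open>The sequence of maps starts at index 1, so order 0 is read off there.\<close>
  let ?k = "max 1 k"
  have S: "fcomp p T (nf_steps p N U ?k) = fcomp p (nf_steps p N U ?k) (Gs ?k)"
    using nf_steps_conj[where G = Gs and U = U and c = c and j = ?k, OF U cN Gs(2) Gs(3)] Gs(1) by simp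
  have "agree_upto (enat ?k) (fcomp p T Th) (fcomp p T (nf_steps p N U ?k))"
    by (rule fcomp_cong[OF agree_upto_refl Th_agree])
  moreover have "agree_upto (enat ?k) (fcomp p T (nf_steps p N U ?k)) (fcomp p Th Ginf)"
    unfolding S by (rule fcomp_cong[OF agree_upto_sym[OF Th_agree] Ginf]) simp
  ultimately have "agree_upto (enat ?k) (fcomp p T Th) (fcomp p Th Ginf)" by (rule agree_upto_trans)
  then show "fcomp p T Th k = fcomp p Th Ginf k" by (rule agree_uptoD) simp
qed

lemma U_eq: "U j = M_inv p c q J CQ (KerC1 j) (KerC2 j) (PI j (at_y0 p c (fbar j)))"
  by (simp add: U_def W_def fbar_def)

lemma fbar_y0: "2 \<le> j \<Longrightarrow> at_y0 p c (fbar j) \<in> hom_polys (p + c) j (c + q)"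
  unfolding fbar_def by (rule at_y0_fbar[OF Gs'])

lemma dim_fbar: "2 \<le> j \<Longrightarrow> dim_vec (fbar j) = N"
  using hom_polysD(1)[OF fbar_y0, of j] N by simp

lemma g_y0: "2 \<le> j \<Longrightarrow> at_y0 p c (g j) = at_y0 p c (fbar j) - PI j (at_y0 p c (fbar j))"
proof -
  assume j: "2 \<le> j"
  have M: "M_pair p c q J CQ (U j) \<in> hom_polys (p + c) j (c + q)"
    by (rule M_pair_hom_polys[OF J CQ]) (use U[OF j] N in simp_all)
  have "at_y0 p c (g j) = at_y0 p c (fbar j) - at_y0 p c (M_pair p c q J CQ (U j))"
    unfolding g_def by (rule at_y0_diff) (use dim_fbar[OF j] hom_polysD(1)[OF M] N in simp)
  then show ?thesis using at_y0_id[OF M] M_pair_U[OF j] by simp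
qed

lemma normal_form: "normal_form \<infinity> p c q J CQ ImC1 KerC1 ImC2 KerC2 T U fbar g"
  unfolding normal_form_def
proof (intro exI[of _ Gs] conjI allI impI)
  fix j assume "2 \<le> j \<and> enat j \<le> \<infinity>"
  then have j: "2 \<le> j" by simp
  show "U j \<in> hom_polys (p + c) j (c + q)" using U[OF j] N by simp
  show "is_formal_map (p + c + q) (c + q) (Gs j)" using Gs(2)[of j] j N by (simp add: add.assoc)
  show "conjugated \<infinity> p (nf_step p (c + q) U j) (Gs (j - 1)) (Gs j)"
    using Gs(3)[OF j] N by (simp add: conjugated_def)
  show "fbar j = Const (fact j) \<cdot>\<^sub>v Gs (j - 1) j" by (simp add: fbar_def)
  show "g j = fbar j - M_pair p c q J CQ (U j)" by (simp add: g_def)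
  show "U j = M_inv p c q J CQ (KerC1 j) (KerC2 j) (P_I p c q J CQ j (ImC1 j) (ImC2 j) (at_y0 p c (fbar j)))"
    using U_eq by (simp add: PI_def)
  show "at_y0 p c (g j) = at_y0 p c (fbar j) - P_I p c q J CQ j (ImC1 j) (ImC2 j) (at_y0 p c (fbar j))"
    using g_y0[OF j] by (simp add: PI_def)
qed (simp add: Gs(1)[simplified])

text \<open>As the operator for the y-components is onto, what the projection leaves over lies in
  the image as well as in its complement, hence is zero.\<close>

lemma g2_y0: "2 \<le> j \<Longrightarrow> vec_last (at_y0 p c (g j)) q = 0\<^sub>v q"
proof -
  assume j: "2 \<le> j"
  let ?h = "at_y0 p c (fbar j)"
  let ?a = "im_proj p J J j (ImC1 j) (vec_first ?h c)" and ?b = "im_proj p J CQ j (ImC2 j) (vec_last ?h q)"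
  have h: "vec_last ?h q \<in> hom_polys (p + c) j q" by (rule vec_last_hom_polys[OF fbar_y0[OF j]]) simp
  note b = im_proj[OF J CQ I2[OF j] h]
  have a: "?a \<in> M_im p J J j" by (rule im_proj(1)[OF J J I1[OF j] vec_first_hom_polys[OF fbar_y0[OF j]]]) simp
  have d: "dim_vec ?a = c" "dim_vec ?b = q" using a b(1) J CQ by (auto simp: M_im_def)
  have "vec_last (at_y0 p c (g j)) q = vec_last ?h q - ?b"
    using d hom_polysD(1)[OF fbar_y0[OF j]]
    by (intro eq_vecI) (auto simp: g_y0[OF j] PI_def P_I_def)
  moreover have "vec_last ?h q - ?b \<in> hom_polys (p + c) j q"
    using b(2) I2[OF j] by (auto simp: is_complement_def)
  then have "vec_last ?h q - ?b \<in> M_im p J CQ j" by (rule surj2[OF j])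
  then have "vec_last ?h q - ?b = 0\<^sub>v q" using b(2) I2[OF j] unfolding is_complement_def by blast
  ultimately show ?thesis by simp
qed

end

locale nf_graph = nf +
  fixes ws Rs :: formal_map and r :: enat
  assumes ws: "is_formal_map (p + c) q ws" and Rs: "is_formal_map (p + c) c Rs" and r: "1 \<le> r"
    and ws1: "ws 1 \<in> hom_polys p 1 q"
    and inv: "agree_upto r (fcomp p T (\<lambda>j. id_map p c j @\<^sub>v ws j)) (fcomp p (\<lambda>j. id_map p c j @\<^sub>v ws j) Rs)"
begin

abbreviation I :: formal_map where "I \<equiv> id_map p c"
abbreviation gw :: formal_map where "gw \<equiv> \<lambda>j. I j @\<^sub>v ws j"

text \<open>In the new coordinates the graph is y' = \<omega>(x',alpha), and the aim is to show that
  \<omega> vanishes up to order r. The map on the graph in the coordinate x' is \<open>Rt\<close>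
  below.\<close>

definition \<omega> :: formal_map where "\<omega> k = fcomp p ws Xp k - H k"

abbreviation i\<omega> :: formal_map where "i\<omega> \<equiv> \<lambda>j. I j @\<^sub>v \<omega> j"
abbreviation i0 :: formal_map where "i0 \<equiv> \<lambda>j. I j @\<^sub>v 0\<^sub>v q"

definition Rt :: formal_map where "Rt k = vec_first (fcomp p Ginf i\<omega> k) c"

lemma I_formal: "is_formal_map (p + c) c I"
  by (rule id_map_formal) simp

lemma wX_formal: "is_formal_map (p + c) q (fcomp p ws Xp)"
  by (rule fcomp_formal[OF ws Xp_formal]) simp

lemma \<omega>_formal: "is_formal_map (p + c) q \<omega>"
  using formal_mapD(1)[OF wX_formal] formal_mapD(1)[OF H_formal] diff_hom_polys[OF formal_mapD(2)[OF wX_formal] formal_mapD(2)[OF H_formal]]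
  by (simp add: is_formal_map_def \<omega>_def[abs_def])

lemma gw_formal: "is_formal_map (p + c) N gw"
  by (rule append_N(2)[OF I_formal ws])

lemma i\<omega>_formal: "is_formal_map (p + c) N i\<omega>"
  by (rule append_N(2)[OF I_formal \<omega>_formal])

lemma i0_formal: "is_formal_map (p + c) N i0"
  by (rule append_N(2)[OF I_formal]) (simp add: is_formal_map_def)

lemma Gi_formal: "is_formal_map (p + c) N (fcomp p Ginf i\<omega>)"
  by (rule fcomp_formal[OF Ginf_formal i\<omega>_formal]) simp

lemma Rt_formal: "is_formal_map (p + c) c Rt"
  unfolding Rt_def[abs_def] by (rule vec_first_formal[OF Gi_formal cN])

lemma first_Th: "(\<lambda>k. vec_first (Th k) c) = Xp"
proof -
  have "vec_first (P k @\<^sub>v H k) c = P k" for k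
    using formal_mapD(3)[OF P_formal] by simp
  then show ?thesis unfolding vec_first_near_id[OF cN] by simp
qed

text \<open>Both sides parametrize the old graph by x': the change of variables applied to (x',
  \<omega>(x')), where H cancels by the definition of \<omega>, and the old parametrization taken at
  x = x' + P(x',alpha).\<close>

lemma Th_i\<omega>: "fcomp p Th i\<omega> = fcomp p gw Xp"
proof
  fix k
  have dI: "dim_vec (I j) = c" "dim_vec (ws j) = q" "dim_vec (P j) = c" "dim_vec (H j) = q" "dim_vec (\<omega> j) = q" for j
    using formal_mapD(3)[OF ws] formal_mapD(3)[OF P_formal] formal_mapD(3)[OF H_formal] formal_mapD(3)[OF \<omega>_formal] by simp_all
  have PH: "is_formal_map (p + c) N (\<lambda>j. P j @\<^sub>v H j)"
    by (rule append_N(2)[OF P_formal H_formal])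
  have tl: "tail2 N (\<lambda>j. P j @\<^sub>v H j) = (\<lambda>j. P j @\<^sub>v H j)"
    by (auto simp: tail2_def fun_eq_iff PH_low append_N(3))
  have first: "(\<lambda>j. vec_first (i\<omega> j) c) = I" using dI by simp
  have "fcomp p Th i\<omega> k = i\<omega> k + fcomp p (\<lambda>j. P j @\<^sub>v H j) i\<omega> k"
    using fcomp_near_id[OF hom_polys_lift[OF e_hom cN] i\<omega>_formal] unfolding tl by simp
  also have "fcomp p (\<lambda>j. P j @\<^sub>v H j) i\<omega> = fcomp p (\<lambda>j. P j @\<^sub>v H j) I"
    unfolding fcomp_vec_first[OF PH i\<omega>_formal cN] first ..
  also have "\<dots> = (\<lambda>j. P j @\<^sub>v H j)" by (rule fcomp_id_right[OF PH])
  also have "i\<omega> k + (P k @\<^sub>v H k) = Xp k @\<^sub>v fcomp p ws Xp k"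
  proof -
    have "I k + P k = Xp k"
      by (rule eq_vecI) (auto simp: near_id_def PH_low dI split: if_splits)
    moreover have "\<omega> k + H k = fcomp p ws Xp k"
      by (rule eq_vecI) (auto simp: \<omega>_def dI)
    moreover have "i\<omega> k + (P k @\<^sub>v H k) = (I k + P k) @\<^sub>v (\<omega> k + H k)"
      by (rule eq_vecI) (auto simp: dI)
    ultimately show ?thesis by simp
  qed
  also have "\<dots> = fcomp p gw Xp k"
    using append_fcomp[of I c ws q p Xp] dI by (simp add: fcomp_id_left[OF Xp_formal])
  finally show "fcomp p Th i\<omega> k = fcomp p gw Xp k" .
qed

lemma RX_formal: "is_formal_map (p + c) c (fcomp p Rs Xp)"
  by (rule fcomp_formal[OF Rs Xp_formal]) simp

text \<open>Reassociation moves the invariance of the old graph through the conjugation by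
  \<open>Th\<close>.\<close>

lemma Th_G: "agree_upto r (fcomp p Th (fcomp p Ginf i\<omega>)) (fcomp p gw (fcomp p Rs Xp))"
proof -
  have "fcomp p Th (fcomp p Ginf i\<omega>) = fcomp p (fcomp p T gw) Xp"
  proof -
    have "fcomp p Th (fcomp p Ginf i\<omega>) = fcomp p (fcomp p T Th) i\<omega>"
      unfolding Th_conj by (rule fcomp_assoc[symmetric, OF Th_formal Ginf_formal i\<omega>_formal]) simp
    also have "\<dots> = fcomp p T (fcomp p Th i\<omega>)" by (rule fcomp_assoc[OF T Th_formal i\<omega>_formal]) simp
    also have "\<dots> = fcomp p (fcomp p T gw) Xp"
      unfolding Th_i\<omega> by (rule fcomp_assoc[symmetric, OF T gw_formal Xp_formal]) simp
    finally show ?thesis .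
  qed
  moreover have "agree_upto r (fcomp p (fcomp p T gw) Xp) (fcomp p (fcomp p gw Rs) Xp)"
    by (rule fcomp_cong[OF inv agree_upto_refl])
  moreover have "fcomp p (fcomp p gw Rs) Xp = fcomp p gw (fcomp p Rs Xp)"
    by (rule fcomp_assoc[OF gw_formal Rs Xp_formal]) simp
  ultimately show ?thesis by (simp only:)
qed

lemma agree_vec_first: "agree_upto r f h \<Longrightarrow> agree_upto r (\<lambda>k. vec_first (f k) n) (\<lambda>k. vec_first (h k) n)"
  and agree_vec_last: "agree_upto r f h \<Longrightarrow> agree_upto r (\<lambda>k. vec_last (f k) n) (\<lambda>k. vec_last (h k) n)"
  by (simp_all add: agree_upto_def)

text \<open>The x-components of \<open>Th_G\<close>: those of \<open>Th\<close> are
  \<open>Xp\<close>, those of \<open>gw\<close> the identity.\<close>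

lemma Xp_Rt: "agree_upto r (fcomp p Xp Rt) (fcomp p Rs Xp)"
proof -
  have "(\<lambda>k. vec_first (fcomp p Th (fcomp p Ginf i\<omega>) k) c) = fcomp p Xp (fcomp p Ginf i\<omega>)"
    using vec_first_fcomp[of c Th p "fcomp p Ginf i\<omega>"] formal_mapD(3)[OF Th_formal] cN by (simp add: first_Th)
  also have "\<dots> = fcomp p Xp Rt"
    unfolding Rt_def[abs_def] by (rule fcomp_vec_first[OF Xp_formal Gi_formal cN])
  finally have 1: "(\<lambda>k. vec_first (fcomp p Th (fcomp p Ginf i\<omega>) k) c) = fcomp p Xp Rt" .
  have "(\<lambda>k. vec_first (fcomp p gw (fcomp p Rs Xp) k) c) = fcomp p I (fcomp p Rs Xp)"
    using vec_first_fcomp[of c gw p "fcomp p Rs Xp"] formal_mapD(3)[OF gw_formal] cN by simp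
  then have "(\<lambda>k. vec_first (fcomp p gw (fcomp p Rs Xp) k) c) = fcomp p Rs Xp"
    by (simp add: fcomp_id_left[OF RX_formal])
  with 1 agree_vec_first[OF Th_G, of c] show ?thesis by simp
qed

text \<open>By \<open>Xp_Rt\<close> the map on the old graph becomes \<open>Rt\<close> in the
  variable x'; inserting this into \<open>Th_G\<close> and cancelling \<open>Th\<close> from the
  left gives the invariance equation in the new coordinates.\<close>

lemma G_i\<omega>: "agree_upto r (fcomp p Ginf i\<omega>) (fcomp p i\<omega> Rt)"
proof -
  have iR: "is_formal_map (p + c) N (fcomp p i\<omega> Rt)" by (rule fcomp_formal[OF i\<omega>_formal Rt_formal]) simp
  have 1: "agree_upto r (fcomp p Th (fcomp p Ginf i\<omega>)) (fcomp p gw (fcomp p Xp Rt))"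
    by (rule agree_upto_trans[OF Th_G fcomp_cong[OF agree_upto_refl agree_upto_sym[OF Xp_Rt]]])
  have 2: "fcomp p gw (fcomp p Xp Rt) = fcomp p (fcomp p gw Xp) Rt"
    by (rule fcomp_assoc[symmetric, OF gw_formal Xp_formal Rt_formal]) simp
  have 3: "fcomp p (fcomp p gw Xp) Rt = fcomp p Th (fcomp p i\<omega> Rt)"
    unfolding Th_i\<omega>[symmetric] by (rule fcomp_assoc[OF Th_formal i\<omega>_formal Rt_formal]) simp
  show ?thesis by (rule near_id_cancel[OF hom_polys_lift[OF e_hom cN] Gi_formal iR 1[unfolded 2 3]])
qed

lemma y_part: "agree_upto r (\<lambda>k. vec_last (fcomp p Ginf i\<omega> k) q) (fcomp p \<omega> Rt)"
proof -
  have "vec_last (i\<omega> j) q = \<omega> j" for j using formal_mapD(3)[OF \<omega>_formal] by simp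
  then have "(\<lambda>k. vec_last (fcomp p i\<omega> Rt k) q) = fcomp p \<omega> Rt"
    using vec_last_fcomp[of i\<omega> N q p Rt] formal_mapD(3)[OF i\<omega>_formal] qN by simp
  with agree_vec_last[OF G_i\<omega>, of q] show ?thesis by simp
qed

abbreviation y0s :: "nat \<Rightarrow> mpoly" where "y0s \<equiv> \<lambda>v. if v < p + c then Var v else 0"

lemma trunc_i\<omega>: "s < N \<Longrightarrow> 0 < k \<Longrightarrow> trunc k i\<omega> s = (if s < c then Var (p + s) else trunc k \<omega> (s - c))"
  using trunc_append[of I c \<omega> q s k] formal_mapD(3)[OF \<omega>_formal] N by (auto simp: trunc_id_map)

lemma msubst_i0:
  assumes "0 < k" "in_vars (p + N) f"
  shows "msubst (blk p N (trunc k i0)) f = msubst y0s f"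
proof (rule msubst_cong)
  fix m v assume "m \<in> keys f" "v \<in> keys m"
  with assms(2) have v: "v < p + N" by (auto simp: in_vars_def)
  have "trunc k i0 s = (if s < c then Var (p + s) else 0)" if "s < N" for s
  proof -
    have "trunc k i0 s = (if s < c then trunc k I s else trunc k (\<lambda>_. 0\<^sub>v q) (s - c))"
      by (rule trunc_append) (use that N in simp_all)
    moreover have "trunc k (\<lambda>_. 0\<^sub>v q) (s - c) = 0" if "\<not> s < c"
      using that \<open>s < N\<close> N by (simp add: trunc_def)
    ultimately show ?thesis using assms(1) by (simp add: trunc_id_map)
  qed
  then show "blk p N (trunc k i0) v = y0s v" using v by (auto simp: blk_def)
qed

lemma Ginf_nth: "2 \<le> j \<Longrightarrow> msubst y0s (Ginf j $ s) = Const (1 / fact j) * at_y0 p c (g j) $ s" if "s < N" for j s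
proof -
  assume j: "2 \<le> j"
  have dg: "dim_vec (g j) = N" unfolding g_def using J CQ N by simp
  show ?thesis using that j by (simp add: map_series_def dg at_y0_def)
qed

lemma L_nth: "l < N \<Longrightarrow> Ginf 1 $ l = lin_op c q J CQ l (\<lambda>s. Var (p + s))"
  using lin_part_nth[OF J CQ, of l p] N by (simp add: map_series_def)

lemma trunc_Ginf:
  assumes "l < N" "0 < k"
  shows "trunc k Ginf l = Ginf 1 $ l + trunc k (tail2 N Ginf) l"
proof -
  have "Ginf j $ l = (if j = 1 then Ginf 1 $ l else 0) + tail2 N Ginf j $ l" for j
    using formal_mapD(1)[OF Ginf_formal] assms(1) by (auto simp: tail2_def less_2_cases_iff)
  then have "trunc k Ginf l = (\<Sum>j\<le>k. (if j = 1 then Ginf 1 $ l else 0) + tail2 N Ginf j $ l)"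
    unfolding trunc_def by (intro sum.cong) auto
  then show ?thesis using assms(2) by (simp add: trunc_def sum.distrib)
qed

lemma Rt1: "s < c \<Longrightarrow> Rt 1 $ s = pm c J (\<lambda>k. Var (p + k)) s"
proof -
  assume s: "s < c"
  then have sN: "s < N" using cN by simp
  have homL: "homog 1 (Ginf 1 $ s)" "in_vars (p + N) (Ginf 1 $ s)"
    using formal_mapD(4,5)[OF Ginf_formal sN] by auto
  have "trunc 1 Ginf s = Ginf 1 $ s"
    using formal_mapD(1)[OF Ginf_formal] sN by (simp add: trunc_def)
  then have "Rt 1 $ s = hom_part 1 (msubst (blk p N (trunc 1 i\<omega>)) (Ginf 1 $ s))"
    using s sN fcomp_nth[of i\<omega> 1 N s Ginf p] formal_mapD(3)[OF i\<omega>_formal] formal_mapD(3)[OF Ginf_formal]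
    by (simp add: Rt_def)
  also have "\<dots> = msubst (blk p N (\<lambda>s. i\<omega> 1 $ s)) (Ginf 1 $ s)"
    by (rule msubst_linear[OF homL(1) i\<omega>_formal homL(2)]) auto
  also have "\<dots> = pm c J (\<lambda>k. Var (p + k)) s"
    unfolding L_nth[OF sN] using s N
    by (simp add: lin_op_pm msubst_pm) (rule pm_cong, simp add: blk_def near_id_def)
  finally show ?thesis .
qed

lemma lin_subst_Rt: "blk p c (\<lambda>s. Rt 1 $ s) = lin_subst p c J"
  by (rule blk_cong) (simp only: Rt1 pm_def)

text \<open>If \<omega> starts at order k, the order k part of the invariance equation is CQ
  \<omega>_k = \<omega>_k(Jx,alpha). The nonlinear y-terms of the new map vanish at y = 0 and feel
  \<omega> only above order k; on the other side only the linear part Jx of \<open>Rt\<close>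
  enters.\<close>

lemma \<omega>_step:
  assumes k: "0 < k" "enat k \<le> r" and IH: "\<And>i. i < k \<Longrightarrow> \<omega> i = 0\<^sub>v q"
  shows "M_op p J CQ (\<omega> k) = 0\<^sub>v q"
proof (rule eq_vecI)
  have d\<omega>: "dim_vec (\<omega> j) = q" for j by (rule formal_mapD(3)[OF \<omega>_formal])
  fix l assume "l < dim_vec (0\<^sub>v q :: mpoly vec)"
  then have l: "l < q" by simp
  have lN: "c + l < N" using l N by simp
  have tr\<omega>: "trunc k \<omega> s = \<omega> k $ s" if "s < q" for s
  proof -
    have "trunc k \<omega> s = (\<Sum>i\<le>k. if i = k then \<omega> k $ s else 0)"
      unfolding trunc_def by (rule sum.cong) (use IH that in \<open>auto simp: le_less\<close>)
    then show ?thesis by simp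
  qed
  let ?\<sigma> = "blk p N (trunc k i\<omega>)" and ?\<tau> = "blk p N (trunc k i0)"
  define \<rho> where "\<rho> = trunc k (tail2 N Ginf) (c + l)"
  have tl: "is_formal_map (p + N) N (tail2 N Ginf)" by (rule tail2_formal[OF formal_mapD(2)[OF Ginf_formal]])
  have \<rho>: "ord_ge 2 \<rho>" "in_vars (p + N) \<rho>"
    unfolding \<rho>_def by (rule ord_ge_trunc_tail2[OF formal_mapD(2)[OF Ginf_formal] lN], rule in_vars_trunc[OF tl lN])
  \<comment> \<open>Compare the graph with y = 0: the two embeddings differ from order k on, and
    \<rho> starts at order 2, so the values of \<rho> differ from order k + 1 on.\<close>
  have "ord_ge (2 + (k - 1)) (msubst ?\<sigma> \<rho> - msubst ?\<tau> \<rho>)"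
  proof (rule ord_ge_msubst_diff[OF \<rho>(1)])
    show "ord_ge 1 (?\<sigma> v)" "ord_ge 1 (?\<tau> v)" for v
      unfolding One_nat_def by (rule ord_ge_blk, rule ord_ge_trunc[OF i\<omega>_formal], assumption)
        (rule ord_ge_blk, rule ord_ge_trunc[OF i0_formal], assumption)
    have "ord_ge (Suc (k - 1)) (trunc k i\<omega> s - trunc k i0 s)" if s: "s < N" for s
    proof (cases "s < c")
      case True
      have "trunc k i0 s = Var (p + s)" using trunc_append[of I c "\<lambda>_. 0\<^sub>v q" q s k] True k N s by (simp add: trunc_id_map)
      then show ?thesis using trunc_i\<omega>[OF s k(1)] True by simp
    next
      case False
      then have sq: "s - c < q" using s N by simp
      have "trunc k i0 s = trunc k (\<lambda>_. 0\<^sub>v q) (s - c)" using trunc_append[of I c "\<lambda>_. 0\<^sub>v q" q s k] False N s by simp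
      also have "\<dots> = 0" using sq by (simp add: trunc_def)
      finally show ?thesis
        using trunc_i\<omega>[OF s k(1)] False tr\<omega>[OF sq] formal_mapD(4)[OF \<omega>_formal sq, of k] k
        by (simp add: ord_ge_homog)
    qed
    then show "ord_ge (Suc (k - 1)) (?\<sigma> v - ?\<tau> v)" for v
      by (cases "p \<le> v \<and> v < p + N") (auto simp: blk_def dest!: meta_spec[of _ "v - p"])
  qed
  then have "hom_part k (msubst ?\<sigma> \<rho> - msubst ?\<tau> \<rho>) = 0" by (rule hom_part_ord_ge) (use k in simp)
  moreover have "msubst ?\<tau> \<rho> = 0"
  proof -
    have "msubst y0s (tail2 N Ginf j $ (c + l)) = 0" for j
    proof (cases "j < 2")
      case True
      then show ?thesis using lN by (simp add: tail2_def)
    next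
      case False
      then have j: "2 \<le> j" by simp
      have dg: "dim_vec (g j) = N" unfolding g_def using J CQ N by simp
      have "vec_last (at_y0 p c (g j)) q $ l = 0" using g2_y0[OF j] l by simp
      then have "at_y0 p c (g j) $ (c + l) = 0" using l N dg by simp
      then show ?thesis using Ginf_nth[OF lN j] False by (simp add: tail2_def)
    qed
    then show ?thesis unfolding msubst_i0[OF k(1) \<rho>(2)] by (simp add: \<rho>_def trunc_def)
  qed
  ultimately have h\<rho>: "hom_part k (msubst ?\<sigma> \<rho>) = 0" by (simp add: hom_part_diff)
  have "msubst ?\<sigma> (Ginf 1 $ (c + l)) = pm q CQ (\<lambda>s. \<omega> k $ s) l"
  proof -
    have "msubst ?\<sigma> (Ginf 1 $ (c + l)) = pm q CQ (\<lambda>s. ?\<sigma> (p + (c + s))) l"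
      unfolding L_nth[OF lN] by (simp add: lin_op_pm msubst_pm)
    also have "\<dots> = pm q CQ (\<lambda>s. \<omega> k $ s) l"
      by (rule pm_cong) (use trunc_i\<omega> k N tr\<omega> in \<open>simp add: blk_def\<close>)
    finally show ?thesis .
  qed
  then have "hom_part k (msubst ?\<sigma> (Ginf 1 $ (c + l))) = pm q CQ (\<lambda>s. \<omega> k $ s) l"
    using homog_pm[of q k "\<lambda>s. \<omega> k $ s" CQ l] formal_mapD(4)[OF \<omega>_formal] by (simp add: hom_part_homog)
  then have lhs: "fcomp p Ginf i\<omega> k $ (c + l) = pm q CQ (\<lambda>s. \<omega> k $ s) l"
    using fcomp_nth[of i\<omega> k N "c + l" Ginf p] formal_mapD(3)[OF i\<omega>_formal] formal_mapD(3)[OF Ginf_formal] lN h\<rho>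
    by (simp add: trunc_Ginf[OF lN k(1)] \<rho>_def hom_part_add)
  have "fcomp p \<omega> Rt k $ l = hom_part k (msubst (blk p c (trunc k Rt)) (\<omega> k $ l))"
    using fcomp_nth[of Rt k c l \<omega> p] formal_mapD(3)[OF Rt_formal] d\<omega> l tr\<omega>[OF l] by simp
  also have "\<dots> = msubst (blk p c (\<lambda>s. Rt 1 $ s)) (\<omega> k $ l)"
    by (rule msubst_linear[OF formal_mapD(4)[OF \<omega>_formal l] Rt_formal formal_mapD(5)[OF \<omega>_formal l]]) (use k in auto)
  also have "\<dots> = msubst (lin_subst p c J) (\<omega> k $ l)" unfolding lin_subst_Rt ..
  finally have rhs: "fcomp p \<omega> Rt k $ l = msubst (lin_subst p c J) (\<omega> k $ l)" .
  have "vec_last (fcomp p Ginf i\<omega> k) q $ l = fcomp p Ginf i\<omega> k $ (c + l)"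
    using l formal_mapD(3)[OF Ginf_formal] N by simp
  with agree_uptoD[OF y_part k(2)] lhs rhs have "pm q CQ (\<lambda>s. \<omega> k $ s) l = msubst (lin_subst p c J) (\<omega> k $ l)" by simp
  then show "M_op p J CQ (\<omega> k) $ l = 0\<^sub>v q $ l"
    using l by (simp add: M_op_nth[OF J CQ d\<omega>] pm_def)
qed (use CQ in simp)

lemma \<omega>_zero: "enat k \<le> r \<Longrightarrow> \<omega> k = 0\<^sub>v q"
proof (induction k rule: less_induct)
  case (less k)
  have IH: "\<omega> i = 0\<^sub>v q" if "i < k" for i
  proof (rule less.IH[OF that])
    show "enat i \<le> r" using that less.prems by (meson enat_ord_simps(1) less_imp_le order_trans)
  qed
  consider "k = 0" | "k = 1" | "2 \<le> k" by linarith
  then show ?case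
  proof cases
    case 1
    then show ?thesis using formal_mapD(1)[OF \<omega>_formal] by simp
  next
    case 2
    \<comment> \<open>The change of variables is the identity to first order, so tangency still says
      that the linear part contains only the parameters.\<close>
    have "\<omega> 1 = ws 1"
    proof (rule eq_vecI)
      fix l assume "l < dim_vec (ws 1)"
      then have l: "l < q" using formal_mapD(3)[OF ws] by simp
      have "trunc 1 ws l = ws 1 $ l" using formal_mapD(1)[OF ws] l by (simp add: trunc_def)
      then have "fcomp p ws Xp 1 $ l = hom_part 1 (msubst (blk p c (trunc 1 Xp)) (ws 1 $ l))"
        using fcomp_nth[of Xp 1 c l ws p] formal_mapD(3)[OF Xp_formal] formal_mapD(3)[OF ws] l by simp
      also have "\<dots> = msubst (blk p c (\<lambda>s. Xp 1 $ s)) (ws 1 $ l)"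
        by (rule msubst_linear[OF formal_mapD(4)[OF ws l] Xp_formal formal_mapD(5)[OF ws l]]) auto
      also have "blk p c (\<lambda>s. Xp 1 $ s) = Var" by (rule ext) (auto simp: blk_def near_id_def)
      finally show "\<omega> 1 $ l = ws 1 $ l" using l PH_low(2)[of 1] formal_mapD(3)[OF H_formal] by (simp add: \<omega>_def)
    qed (simp add: formal_mapD(3)[OF ws] formal_mapD(3)[OF \<omega>_formal])
    moreover have "M_op p J CQ (\<omega> 1) = 0\<^sub>v q" by (rule \<omega>_step) (use 2 less.prems IH in auto)
    ultimately show ?thesis using 2 inj1[OF ws1] by simp
  next
    case 3
    have "M_op p J CQ (\<omega> k) = 0\<^sub>v q" by (rule \<omega>_step) (use 3 less.prems IH in auto)
    then show ?thesis by (rule inj2[OF 3 formal_mapD(2)[OF \<omega>_formal]])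
  qed
qed

lemma graph_y0: "graph_is_y0 r p c ws P H"
  unfolding graph_is_y0_def agree_upto_def
proof (intro allI impI)
  fix k assume "enat k \<le> r"
  from \<omega>_zero[OF this] show "fcomp p ws Xp k = H k"
    unfolding \<omega>_def by (rule vec_diff_eq_0) (simp_all add: formal_mapD(3)[OF ws] formal_mapD(3)[OF H_formal])
qed

section \<open>The map on the invariant graph\<close>

abbreviation h1 :: "nat \<Rightarrow> mpoly vec" where "h1 \<equiv> \<lambda>j. vec_first (at_y0 p c (g j)) c"
abbreviation G1 :: formal_map where "G1 \<equiv> map_series (map_mat Const J *\<^sub>v x_vars p c) h1"

lemma G1_eq: "(\<lambda>k. vec_first (fcomp p Ginf i0 k) c) = G1"
proof (rule ext, rule eq_vecI)
  fix k l
  have dG1: "dim_vec (G1 k) = c" using J by (simp add: map_series_def)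
  then show "dim_vec (vec_first (fcomp p Ginf i0 k) c) = dim_vec (G1 k)" by simp
  assume "l < dim_vec (G1 k)"
  then have l: "l < c" using dG1 by simp
  then have lN: "l < N" using cN by simp
  have Gl: "vec_first (fcomp p Ginf i0 k) c $ l = hom_part k (msubst (blk p N (trunc k i0)) (trunc k Ginf l))"
    using l lN fcomp_nth[of i0 k N l Ginf p] formal_mapD(3)[OF i0_formal] formal_mapD(3)[OF Ginf_formal] by simp
  show "vec_first (fcomp p Ginf i0 k) c $ l = G1 k $ l"
  proof (cases "k = 0")
    case True
    have "trunc 0 Ginf l = 0" using formal_mapD(1)[OF Ginf_formal] lN by (simp add: trunc_def)
    then show ?thesis using Gl True l J by (simp add: map_series_def)
  next
    case False
    then have k: "0 < k" by simp
    have "hom_part k (msubst y0s (trunc k Ginf l)) = (\<Sum>i\<le>k. if i = k then msubst y0s (Ginf k $ l) else 0)"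
    proof -
      have "homog i (msubst y0s (Ginf i $ l))" for i
        by (rule homog_msubst[OF formal_mapD(4)[OF Ginf_formal lN]]) simp
      from hom_part_homog[OF this] have "hom_part k (msubst y0s (Ginf i $ l)) = (if i = k then msubst y0s (Ginf k $ l) else 0)" for i
        by (cases "i = k") simp_all
      then show ?thesis unfolding trunc_def msubst_simps hom_part_sum by (simp only:)
    qed
    then have "hom_part k (msubst y0s (trunc k Ginf l)) = msubst y0s (Ginf k $ l)"
      by (simp only: sum.delta finite_atMost atMost_iff order_refl if_True)
    then have G: "vec_first (fcomp p Ginf i0 k) c $ l = msubst y0s (Ginf k $ l)"
      unfolding Gl msubst_i0[OF k in_vars_trunc[OF Ginf_formal lN]] .
    show ?thesis
    proof (cases "k = 1")
      case True
      have "msubst y0s (Ginf 1 $ l) = pm c J (\<lambda>k. Var (p + k)) l"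
        unfolding L_nth[OF lN] using l by (simp add: lin_op_pm msubst_pm) (rule pm_cong, simp)
      also have "\<dots> = (map_mat Const J *\<^sub>v x_vars p c) $ l"
        using index_Const_mult_mat_vec[OF J, of "x_vars p c" l] l by (simp add: pm_def del: index_mult_mat_vec)
      finally have "msubst y0s (Ginf 1 $ l) = (map_mat Const J *\<^sub>v x_vars p c) $ l" .
      then show ?thesis unfolding G unfolding True by (simp add: map_series_def del: index_mult_mat_vec)
    next
      case k1: False
      then have k2: "2 \<le> k" using k by simp
      show ?thesis unfolding G Ginf_nth[OF lN k2] using k k1 l by (simp add: map_series_def)
    qed
  qed
qed

lemma G1_formal: "is_formal_map (p + c) c G1"
  unfolding G1_eq[symmetric] by (rule vec_first_formal[OF fcomp_formal[OF Ginf_formal i0_formal] cN]) simp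

lemma Rt_G1: "agree_upto r Rt G1"
proof -
  have "agree_upto r i\<omega> i0" using \<omega>_zero by (simp add: agree_upto_def)
  from agree_vec_first[OF fcomp_cong[OF agree_upto_refl this], of p Ginf c]
  show ?thesis by (simp only: G1_eq Rt_def[abs_def])
qed

lemma RX_G1: "agree_upto r (fcomp p Rs Xp) (fcomp p Xp G1)"
  by (rule agree_upto_trans[OF agree_upto_sym[OF Xp_Rt] fcomp_cong[OF agree_upto_refl Rt_G1]])

lemma reduced_conj: "conjugated r p Xp Rs G1"
  unfolding conjugated_def by (rule RX_G1)

end

subsection \<open>The normal form of the reduced map\<close>

lemma dim_0_vec: "dim_vec v = 0 \<Longrightarrow> v = 0\<^sub>v 0"
  by (rule eq_vecI) auto

lemma append_dim_0: "dim_vec w = 0 \<Longrightarrow> v @\<^sub>v w = v"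
  by (rule eq_vecI) auto

text \<open>For maps in x alone there are no y-components, and the zero space is its own complement;
  with this \<open>normal_form\<close> at q = 0 serves as the normal form for maps.\<close>

lemma is_complement_dim_0:
  assumes "0\<^sub>v 0 \<in> A" "\<And>a. a \<in> A \<Longrightarrow> dim_vec a = 0"
  shows "is_complement (hom_polys d j 0) A 0 {0\<^sub>v 0}"
proof -
  have A: "A = {0\<^sub>v 0}" using assms dim_0_vec by blast
  have S: "s = 0\<^sub>v 0" if "s \<in> hom_polys d j 0" for s using hom_polysD(1)[OF that] by (rule dim_0_vec)
  have z: "v + w = 0\<^sub>v 0" "Const r \<cdot>\<^sub>v w = 0\<^sub>v 0" if "v \<in> {0\<^sub>v 0}" "w \<in> {0\<^sub>v 0}" for v w :: "mpoly vec" and r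
    using that by (auto intro!: dim_0_vec simp del: zero_vec_zero)
  show ?thesis
    unfolding is_complement_def A
  proof (intro conjI ballI allI)
    fix s :: "mpoly vec" assume "s \<in> hom_polys d j 0"
    then have "s = 0\<^sub>v 0" by (rule S)
    then show "\<exists>a\<in>{0\<^sub>v 0}. \<exists>b\<in>{0\<^sub>v 0}. s = a + b" using z(1)[of "0\<^sub>v 0" "0\<^sub>v 0"] by (metis insertI1)
  next
    fix v w :: "mpoly vec" assume "v \<in> {0\<^sub>v 0}" "w \<in> {0\<^sub>v 0}"
    from z(1)[OF this] show "v + w \<in> {0\<^sub>v 0}" by (simp only: singleton_iff)
  next
    fix v :: "mpoly vec" and r assume "v \<in> {0\<^sub>v 0}"
    from z(2)[OF this this] show "Const r \<cdot>\<^sub>v v \<in> {0\<^sub>v 0}" by (simp only: singleton_iff)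
  qed (auto simp del: zero_vec_zero)
qed

lemma is_complement_M_0:
  "is_complement (hom_polys (p + c) j 0) (M_im p J (0\<^sub>m 0 0) j) 0 {0\<^sub>v 0}"
  "is_complement (hom_polys (p + c) j 0) (M_ker p J (0\<^sub>m 0 0) j) 0 {0\<^sub>v 0}"
proof -
  have z: "M_op p J (0\<^sub>m 0 0) (0\<^sub>v 0) = 0\<^sub>v 0" by (rule dim_0_vec) simp
  have h: "0\<^sub>v 0 \<in> hom_polys d j 0" for d by (rule zero_hom_polys)
  have im: "0\<^sub>v 0 \<in> M_im p J (0\<^sub>m 0 0) j"
    using imageI[OF h, of "M_op p J (0\<^sub>m 0 0)" "p + dim_row J"] unfolding z by (simp only: M_im_def index_zero_mat)
  have ker: "0\<^sub>v 0 \<in> M_ker p J (0\<^sub>m 0 0) j"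
    unfolding M_ker_def by (rule CollectI, rule conjI) (use h z in \<open>simp_all only: index_zero_mat\<close>)
  show "is_complement (hom_polys (p + c) j 0) (M_im p J (0\<^sub>m 0 0) j) 0 {0\<^sub>v 0}"
    by (rule is_complement_dim_0[OF im]) (auto simp: M_im_def)
  show "is_complement (hom_polys (p + c) j 0) (M_ker p J (0\<^sub>m 0 0) j) 0 {0\<^sub>v 0}"
    by (rule is_complement_dim_0[OF ker]) (auto simp: M_ker_def hom_polysD(1))
qed

lemma M_pair_dim_0:
  assumes "dim_vec h = c"
  shows "M_pair p c 0 J (0\<^sub>m 0 0) h = M_op p J J h"
proof -
  have "vec_first h c = h" using assms by (intro eq_vecI) auto
  then show ?thesis by (simp add: M_pair_def append_dim_0)
qed

context nf_graph
begin

abbreviation U1 :: "nat \<Rightarrow> mpoly vec" where "U1 \<equiv> \<lambda>j. vec_first (U j) c"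

lemma U1_hom: "2 \<le> j \<Longrightarrow> U1 j \<in> hom_polys (p + c) j c"
  by (rule vec_first_hom_polys[OF U cN])

lemma Xp_steps: "agree_upto (enat j) Xp (nf_steps p c U1 j)"
proof -
  have "vec_first (Th k) c = vec_first (nf_steps p N U j k) c" if "k \<le> j" for k
    using Th_agree[of j] that by (simp add: agree_upto_enat)
  moreover have "vec_first (Th k) c = Xp k" for k by (rule fun_cong[OF first_Th])
  moreover have "vec_first (nf_steps p N U j k) c = nf_steps p c U1 j k" for k
    by (rule fun_cong[OF vec_first_nf_steps[OF U cN]])
  ultimately show ?thesis by (simp only: agree_upto_enat) simp
qed

lemma first_fbar:
  assumes j: "2 \<le> j"
  shows "h1 j = vec_first (at_y0 p c (fbar j)) c - M_op p J J (U1 j)"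
proof -
  have "M_op p J J (U1 j) = vec_first (M_pair p c q J CQ (U j)) c"
    unfolding M_pair_def by (rule vec_first_append[symmetric]) (use J in simp)
  also have "\<dots> = vec_first (PI j (at_y0 p c (fbar j))) c" by (simp only: M_pair_U[OF j])
  finally have M: "M_op p J J (U1 j) = vec_first (PI j (at_y0 p c (fbar j))) c" .
  have "dim_vec (PI j (at_y0 p c (fbar j))) = N"
    unfolding M_pair_U[OF j, symmetric] using J CQ N by simp
  then show ?thesis
    unfolding M g_y0[OF j] using dim_fbar[OF j] cN by (intro eq_vecI) auto
qed

lemma G1_1: "G1 1 = lin_part p c 0 J (0\<^sub>m 0 0)"
  by (simp add: map_series_def lin_part_def append_dim_0)

text \<open>The steps \<open>U1\<close> are applied to the reduced map exactly, giving
  \<open>Rq\<close>. Their composite of index j agrees with \<open>Xp\<close> up to order j, and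
  \<open>Xp\<close> takes the reduced map to \<open>G1\<close> up to order r; by cancellation
  \<open>Rq j\<close> is \<open>G1\<close> up to order j \<le> r. The terms to be normalized at step
  j are then forced to be the x-part of \<open>fbar j\<close> at y = 0, from which
  \<open>U1 j\<close> was computed in the first place.\<close>

lemma reduced_normal_form:
  "\<exists>U1 fbar1. normal_form r p c 0 J (0\<^sub>m 0 0) ImC1 KerC1 (\<lambda>_. {0\<^sub>v 0}) (\<lambda>_. {0\<^sub>v 0}) Rs U1 fbar1 h1"
proof -
  let ?S = "nf_steps p c U1"
  \<comment> \<open>The rule for choosing steps is constant in the current map: the steps are those
    of the full problem.\<close>
  have "\<exists>Rq. Rq 1 = Rs \<and> (\<forall>j\<ge>1. is_formal_map (p + c) c (Rq j)) \<and>
    (\<forall>j\<ge>2. fcomp p (Rq (j - 1)) (nf_step p c U1 j) = fcomp p (nf_step p c U1 j) (Rq j))"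
    by (rule nf_sequence_exists[where W = "\<lambda>j f. U1 j" and p = p and c = c, OF Rs order_refl]) (rule U1_hom)
  then obtain Rq where Rq: "Rq 1 = Rs \<and> (\<forall>j\<ge>1. is_formal_map (p + c) c (Rq j)) \<and>
    (\<forall>j\<ge>2. fcomp p (Rq (j - 1)) (nf_step p c U1 j) = fcomp p (nf_step p c U1 j) (Rq j))"
    by (elim exE)
  note Rq_1 = conjunct1[OF Rq]
  have Rq_formal: "is_formal_map (p + c) c (Rq j)" if "1 \<le> j" for j
    using conjunct1[OF conjunct2[OF Rq]] that by (elim allE impE)
  have Rq_step: "fcomp p (Rq (j - 1)) (nf_step p c U1 j) = fcomp p (nf_step p c U1 j) (Rq j)" if "2 \<le> j" for j
    using conjunct2[OF conjunct2[OF Rq]] that by (elim allE impE)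
  have Rq_G1: "agree_upto (enat j) (Rq j) G1" if j: "1 \<le> j" "enat j \<le> r" for j
  proof -
    have S: "fcomp p Rs (?S j) = fcomp p (?S j) (Rq j)"
      using nf_steps_conj[where G = Rq and U = U1 and c = c and j = j, OF U1_hom order_refl Rq_formal Rq_step j(1)]
      unfolding Rq_1 .
    have "\<exists>E. (\<forall>k\<ge>2. E k \<in> hom_polys (p + c) k c) \<and> ?S j = near_id p c E"
      by (rule nf_steps_near_id[where U = U1 and p = p and c = c and n = c and j = j, OF _ order_refl]) (rule U1_hom)
    then obtain E where E: "(\<forall>k\<ge>2. E k \<in> hom_polys (p + c) k c) \<and> ?S j = near_id p c E"
      by (elim exE)
    have E': "E k \<in> hom_polys (p + c) k c" if "2 \<le> k" for k
      using conjunct1[OF E] that by (elim allE impE)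
    have "agree_upto (enat j) (fcomp p (?S j) (Rq j)) (fcomp p Rs Xp)"
      unfolding S[symmetric] by (rule fcomp_cong[OF agree_upto_refl agree_upto_sym[OF Xp_steps]])
    moreover have "agree_upto (enat j) (fcomp p Rs Xp) (fcomp p Xp G1)"
      by (rule agree_upto_mono[OF RX_G1 j(2)])
    moreover have "agree_upto (enat j) (fcomp p Xp G1) (fcomp p (?S j) G1)"
      by (rule fcomp_cong[OF Xp_steps agree_upto_refl])
    ultimately have eq: "agree_upto (enat j) (fcomp p (?S j) (Rq j)) (fcomp p (?S j) G1)"
      by (rule agree_upto_trans[OF agree_upto_trans])
    show ?thesis
      by (rule near_id_cancel[OF E' Rq_formal[OF j(1)] G1_formal eq[unfolded conjunct2[OF E]]])
  qed
  have h1_dim: "dim_vec (h1 j) = c" for j by simp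
  have main: "normal_form r p c 0 J (0\<^sub>m 0 0) ImC1 KerC1 (\<lambda>_. {0\<^sub>v 0}) (\<lambda>_. {0\<^sub>v 0}) Rs U1
      (\<lambda>j. Const (fact j) \<cdot>\<^sub>v Rq (j - 1) j) h1"
    unfolding normal_form_def
  proof (rule exI[of _ Rq], intro conjI allI impI)
    show "Rq 1 = Rs" by (rule Rq_1)
    fix j assume "2 \<le> j \<and> enat j \<le> r"
    then have j: "2 \<le> j" and jr: "enat j \<le> r" by simp_all
    have j1: "1 \<le> j" "1 \<le> j - 1" "enat (j - 1) \<le> r"
      using j jr by (auto intro: order_trans[OF _ jr])
    define B where "B = vec_first (at_y0 p c (fbar j)) c"
    have B: "B \<in> hom_polys (p + c) j c"
      unfolding B_def by (rule vec_first_hom_polys[OF fbar_y0[OF j]]) simp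
    have dU1: "dim_vec (U1 j) = c" by simp
    have lin: "Rq (j - 1) 1 = lin_part p c 0 J (0\<^sub>m 0 0)"
      unfolding G1_1[symmetric] by (rule agree_uptoD[OF Rq_G1[OF j1(2,3)]]) (use j in simp)
    have eq: "agree_upto (enat j) (fcomp p (Rq (j - 1)) (nf_step p c U1 j)) (fcomp p (nf_step p c U1 j) (Rq j))"
      unfolding Rq_step[OF j] by (rule agree_upto_refl)
    have "Rq j j = Rq (j - 1) j - Const (1 / fact j) \<cdot>\<^sub>v M_pair p c 0 J (0\<^sub>m 0 0) (U1 j)"
      by (rule conj_step(2)[OF J _ _ Rq_formal[OF j1(2)] Rq_formal[OF j1(1)] lin U1_hom[OF j] j eq]) simp_all
    moreover have "Rq j j = Const (1 / fact j) \<cdot>\<^sub>v h1 j"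
      using agree_uptoD[OF Rq_G1[OF j1(1) jr] order_refl] j by (simp add: map_series_def)
    ultimately have R: "Const (1 / fact j) \<cdot>\<^sub>v h1 j = Rq (j - 1) j - Const (1 / fact j) \<cdot>\<^sub>v M_op p J J (U1 j)"
      by (simp only: M_pair_dim_0[OF dU1])
    \<comment> \<open>Up to the factor j!, step j subtracts the same homological term from
      \<open>Rq (j - 1) j\<close> and, by \<open>first_fbar\<close>, from B; the results coincide,
      hence so do the terms it is subtracted from.\<close>
    have fb: "Const (fact j) \<cdot>\<^sub>v Rq (j - 1) j = B"
    proof (rule eq_vecI)
      fix i assume "i < dim_vec B"
      then have i: "i < c" by (simp add: B_def)
      have dR: "dim_vec (Rq (j - 1) j) = c" by (rule formal_mapD(3)[OF Rq_formal[OF j1(2)]])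
      define K where "K = Rq (j - 1) j"
      define M where "M = M_op p J J (U1 j)"
      have dM: "dim_vec M = c" using J by (simp add: M_def)
      have "h1 j = B - M" unfolding B_def M_def by (rule first_fbar[OF j])
      with R have "Const (1 / fact j) \<cdot>\<^sub>v (B - M) = K - Const (1 / fact j) \<cdot>\<^sub>v M" by (simp only: K_def M_def)
      from arg_cong[OF this, of "\<lambda>v. v $ i"]
      have "Const (1 / fact j) * (B $ i - M $ i) = K $ i - Const (1 / fact j) * M $ i"
        using i dM dR hom_polysD(1)[OF B] by (simp add: K_def)
      then have "Const (1 / fact j) * B $ i = K $ i" by (simp add: right_diff_distrib)
      then have "Const (fact j) * K $ i = (Const (fact j) * Const (1 / fact j)) * B $ i" by (simp add: mult.assoc)
      also have "\<dots> = B $ i" by (simp add: Const_mult[symmetric])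
      finally show "(Const (fact j) \<cdot>\<^sub>v Rq (j - 1) j) $ i = B $ i" using i dR by (simp add: K_def)
    qed (use formal_mapD(3)[OF Rq_formal[OF j1(2)]] in \<open>simp add: B_def\<close>)
    show "Const (fact j) \<cdot>\<^sub>v Rq (j - 1) j = Const (fact j) \<cdot>\<^sub>v Rq (j - 1) j" ..
    show "U1 j \<in> hom_polys (p + c) j (c + 0)" using U1_hom[OF j] by simp
    show "is_formal_map (p + c + 0) (c + 0) (Rq j)" using Rq_formal[OF j1(1)] by simp
    show "conjugated r p (nf_step p (c + 0) U1 j) (Rq (j - 1)) (Rq j)"
      using Rq_step[OF j] by (simp add: conjugated_def)
    have gM: "h1 j = B - M_pair p c 0 J (0\<^sub>m 0 0) (U1 j)"
      unfolding M_pair_dim_0[OF dU1] B_def by (rule first_fbar[OF j])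
    then show "h1 j = Const (fact j) \<cdot>\<^sub>v Rq (j - 1) j - M_pair p c 0 J (0\<^sub>m 0 0) (U1 j)" by (simp only: fb)
    have B0: "B \<in> hom_polys (p + c) j (c + 0)" using B by simp
    have Z: "0\<^sub>m 0 0 \<in> carrier_mat 0 (0::nat)" by simp
    note M0 = M_inv_P_I[OF J Z I1[OF j] K1[OF j] is_complement_M_0 B0]
    have first: "vec_first v c = v" if "dim_vec v = c" for v :: "mpoly vec"
      using that by (intro eq_vecI) auto
    let ?u = "M_inv p c 0 J (0\<^sub>m 0 0) (KerC1 j) {0\<^sub>v 0} (P_I p c 0 J (0\<^sub>m 0 0) j (ImC1 j) {0\<^sub>v 0} B)"
    have "U1 j = right_inv p J J (KerC1 j) (im_proj p J J j (ImC1 j) B)"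
      unfolding U_eq[of j] PI_def B_def
      by (rule M_inv_P_I(3)[OF J CQ I1[OF j] K1[OF j] I2[OF j] K2[OF j] fbar_y0[OF j]])
    also have "\<dots> = vec_first ?u c" unfolding M0(3) first[OF hom_polysD(1)[OF B]] ..
    also have "\<dots> = ?u" by (rule first) (use hom_polysD(1)[OF M0(1)] in simp)
    finally have u: "U1 j = ?u" .
    then show "U1 j = M_inv p c 0 J (0\<^sub>m 0 0) (KerC1 j) {0\<^sub>v 0}
        (P_I p c 0 J (0\<^sub>m 0 0) j (ImC1 j) {0\<^sub>v 0} (at_y0 p c (Const (fact j) \<cdot>\<^sub>v Rq (j - 1) j)))"
      unfolding fb at_y0_id[OF B] .
    have gj: "at_y0 p c (g j) \<in> hom_polys (p + c) j N"
    proof -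
      have "Const (fact j) \<cdot>\<^sub>v Ginf j \<in> hom_polys (p + N) j N"
        by (rule smult_hom_polys[OF formal_mapD(2)[OF Ginf_formal]])
      moreover have "Const (fact j) \<cdot>\<^sub>v Ginf j = g j"
      proof (rule eq_vecI)
        fix i assume "i < dim_vec (g j)"
        then show "(Const (fact j) \<cdot>\<^sub>v Ginf j) $ i = g j $ i"
          using j by (simp add: map_series_def mult.assoc[symmetric] Const_mult[symmetric])
      qed (use j in \<open>simp add: map_series_def\<close>)
      ultimately have "g j \<in> hom_polys (p + N) j N" by (simp only:)
      then show ?thesis by (rule at_y0_hom_polys)
    qed
    have "at_y0 p c (h1 j) = B - M_pair p c 0 J (0\<^sub>m 0 0) ?u"
      unfolding at_y0_id[OF vec_first_hom_polys[OF gj cN]] by (rule gM[unfolded u])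
    then show "at_y0 p c (h1 j) = at_y0 p c (Const (fact j) \<cdot>\<^sub>v Rq (j - 1) j) -
        P_I p c 0 J (0\<^sub>m 0 0) j (ImC1 j) {0\<^sub>v 0} (at_y0 p c (Const (fact j) \<cdot>\<^sub>v Rq (j - 1) j))"
      unfolding fb at_y0_id[OF B] M0(2) .
  qed
  then show ?thesis by blast
qed

end

subsection \<open>From the invariant manifold to its Taylor series\<close>

text \<open>Boxes bound only the first d coordinates. In a sequence of counterexamples the others
  are set to zero, which does not change f and makes the sequence converge to 0 in the product
  space.\<close>

lemma continuous_small_cbox0:
  assumes "continuous_on (cbox0 d \<delta>) f" "0 < \<delta>" "dep d f" "f (\<lambda>_. 0) = 0" "0 < \<rho>"
  shows "\<exists>\<epsilon>>0. \<forall>a\<in>cbox0 d \<epsilon>. \<bar>f a\<bar> < \<rho>"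
proof (rule ccontr)
  assume "\<not> ?thesis"
  then have "\<exists>a\<in>cbox0 d (inverse (real (Suc n))). \<not> \<bar>f a\<bar> < \<rho>" for n by simp
  then obtain a where a: "\<And>n. a n \<in> cbox0 d (inverse (real (Suc n)))" "\<And>n. \<not> \<bar>f (a n)\<bar> < \<rho>" by metis
  define b where "b n i = (if i < d then a n i else 0)" for n i
  have fb: "f (b n) = f (a n)" for n
    by (rule assms(3)[unfolded dep_def, rule_format]) (simp add: b_def)
  have "b \<longlonglongrightarrow> (\<lambda>_. 0)"
  proof (rule tendsto_coordinatewise)
    fix i
    have "\<bar>b n i\<bar> \<le> inverse (real (Suc n))" for n
      using a(1)[of n] by (auto simp: b_def cbox0_def less_imp_le)
    then show "(\<lambda>n. b n i) \<longlonglongrightarrow> 0"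
      by (intro Lim_null_comparison[OF _ LIMSEQ_inverse_real_of_nat]) simp
  qed
  moreover have 0: "(\<lambda>_. 0) \<in> cbox0 d \<delta>" using assms(2) by (simp add: cbox0_def)
  moreover have "eventually (\<lambda>n. b n \<in> cbox0 d \<delta>) sequentially"
    using topological_tendstoD[OF calculation(1) open_cbox0 0] .
  ultimately have "(\<lambda>n. f (b n)) \<longlonglongrightarrow> f (\<lambda>_. 0)"
    by (intro continuous_on_tendsto_compose[OF assms(1)])
  then have "eventually (\<lambda>n. \<bar>f (b n)\<bar> < \<rho>) sequentially"
    using assms(4,5) by (auto simp: tendsto_iff dist_real_def)
  then show False using a(2) by (simp add: fb)
qed

lemma finite_small:
  fixes P :: "nat \<Rightarrow> real \<Rightarrow> bool"
  assumes "\<And>s. s < n \<Longrightarrow> \<exists>\<epsilon>>0. P s \<epsilon>" "\<And>s \<epsilon> \<epsilon>'. P s \<epsilon> \<Longrightarrow> 0 < \<epsilon>' \<Longrightarrow> \<epsilon>' \<le> \<epsilon> \<Longrightarrow> P s \<epsilon>'"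
  shows "\<exists>\<epsilon>>0. \<forall>s<n. P s \<epsilon>"
  using assms(1)
proof (induction n)
  case 0
  show ?case by (intro exI[of _ 1]) simp
next
  case (Suc n)
  obtain e where e: "0 < e" "\<And>s. s < n \<Longrightarrow> P s e" using Suc by auto
  obtain e' where e': "0 < e'" "P n e'" using Suc.prems[of n] by auto
  have "P s (min e e')" if "s < Suc n" for s
  proof (cases "s = n")
    case True
    then show ?thesis using assms(2)[OF e'(2), of "min e e'"] e e' by simp
  next
    case False
    then show ?thesis using assms(2)[OF e(2), of s "min e e'"] that e e' by simp
  qed
  then show ?case using e e' by (intro exI[of _ "min e e'"]) simp
qed

lemma length_1_lists: "{is. length is = (1::nat) \<and> set is \<subseteq> {..<d}} = (\<lambda>i. [i]) ` {..<d::nat}"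
  by (auto simp: length_Suc_conv)

lemma taylor_1_params:
  assumes "\<And>l i. l < q \<Longrightarrow> i < c \<Longrightarrow> pdiff (p + c) (p + i) (\<lambda>z. w z $ l) (0\<^sub>v (p + c)) = 0"
  shows "taylor (p + c) q w 1 \<in> hom_polys p 1 q"
proof -
  define D where "D l i = pdiff (p + c) i (\<lambda>z. w z $ l) (0\<^sub>v (p + c))" for l i
  have e: "taylor (p + c) q w 1 $ l = (\<Sum>i<p. Const (D l i) * Var i)" if "l < q" for l
  proof -
    have "taylor (p + c) q w 1 $ l = (\<Sum>i<p + c. Const (D l i) * Var i)"
      unfolding taylor_def diff_form_def length_1_lists using that
      by (simp add: sum.reindex inj_on_def D_def)
    also have "\<dots> = (\<Sum>i<p. Const (D l i) * Var i)"
    proof (rule sum.mono_neutral_right)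
      show "\<forall>i\<in>{..<p + c} - {..<p}. Const (D l i) * Var i = 0"
      proof
        fix i assume "i \<in> {..<p + c} - {..<p}"
        then obtain k where "k < c" "i = p + k" by (metis DiffD1 DiffD2 add_less_cancel_left lessThan_iff le_iff_add not_less)
        then have "D l i = 0" using assms[OF that] by (simp add: D_def)
        then show "Const (D l i) * Var i = 0" by simp
      qed
    qed auto
    finally show ?thesis .
  qed
  have "homog 1 (\<Sum>i<p. Const (D l i) * Var i)" "in_vars p (\<Sum>i<p. Const (D l i) * Var i)" for l
    by (auto intro!: homog_sum in_vars_sum homog_smult in_vars_smult in_vars_Var homog_Var)
  then show ?thesis unfolding hom_polys_iff by (simp add: e del: One_nat_def) (simp add: taylor_def diff_form_def)
qed

text \<open>Near 0 a graph point and its image both lie where W is the graph and local invariance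
  applies. So the image lies on the graph over some x; the dual bases identify this x with
  \<open>Rf a\<close> and the height over it with \<open>Yf a\<close>.\<close>

lemma (in graph) invariance_on_box:
  assumes w_dim: "\<And>a. a \<in> cbox0 (p + c) \<delta> \<Longrightarrow> dim_vec (w (vec (p + c) a)) = q"
    and \<rho>1: "0 < \<rho>1"
    and W: "\<And>\<alpha> u. \<alpha> \<in> box0 p \<rho>1 \<Longrightarrow> u \<in> box0 N \<rho>1 \<Longrightarrow> (u, \<alpha>) \<in> W \<longleftrightarrow>
      (\<exists>x\<in>carrier_vec c. \<alpha> @\<^sub>v x \<in> box0 (p + c) \<delta> \<and> u = \<Phi>c *\<^sub>v x + \<Phi>su *\<^sub>v w (\<alpha> @\<^sub>v x))"
    and inv: "locally_invariant N p (\<lambda>u \<alpha>. C *\<^sub>v u + F u \<alpha>) W"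
  shows "\<exists>\<epsilon>>0. \<forall>a\<in>cbox0 (p + c) \<epsilon>. \<forall>l<q. Yf a l = wf (g2 a) l"
proof -
  obtain \<rho>2 where \<rho>2: "0 < \<rho>2" and inv': "\<And>\<alpha> u. \<alpha> \<in> box0 p \<rho>2 \<Longrightarrow> u \<in> box0 N \<rho>2 \<Longrightarrow> (u, \<alpha>) \<in> W \<Longrightarrow>
      C *\<^sub>v u + F u \<alpha> \<in> box0 N \<rho>2 \<Longrightarrow> (C *\<^sub>v u + F u \<alpha>, \<alpha>) \<in> W"
    using inv unfolding locally_invariant_def by blast
  define \<rho> where "\<rho> = min \<rho>1 \<rho>2"
  have \<rho>: "0 < \<rho>" "\<rho> \<le> \<rho>1" "\<rho> \<le> \<rho>2" using \<rho>1 \<rho>2 by (auto simp: \<rho>_def)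
  have sub: "z \<in> box0 d \<rho>1" "z \<in> box0 d \<rho>2" if "z \<in> box0 d \<rho>" for d z
    using that \<rho> by (auto simp: box0_def intro: less_le_trans)
  have zero: "enat 0 \<le> r" by (simp add: zero_enat_def[symmetric])
  have small: "\<exists>\<epsilon>>0. \<forall>s<N. \<forall>a\<in>cbox0 (p + c) \<epsilon>. \<bar>f a s\<bar> < \<rho>"
    if "\<And>s. s < N \<Longrightarrow> Ck (p + c) (cbox0 (p + c) \<delta>) 0 (\<lambda>a. f a s)" "\<And>s. dep (p + c) (\<lambda>a. f a s)"
      "\<And>s. s < N \<Longrightarrow> f (\<lambda>_. 0) s = 0" for f :: "(nat \<Rightarrow> real) \<Rightarrow> nat \<Rightarrow> real"
  proof (rule finite_small)
    fix s assume "s < N"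
    show "\<exists>\<epsilon>>0. \<forall>a\<in>cbox0 (p + c) \<epsilon>. \<bar>f a s\<bar> < \<rho>"
      by (rule continuous_small_cbox0[OF Ck_continuous[OF that(1)] \<delta> that(2) that(3) \<rho>(1)]) (rule \<open>s < N\<close>)+
  next
    show "\<forall>a\<in>cbox0 (p + c) e'. \<bar>f a s\<bar> < \<rho>" if "\<forall>a\<in>cbox0 (p + c) e. \<bar>f a s\<bar> < \<rho>" "e' \<le> e" for s e e'
      using that by (auto simp: cbox0_def intro: less_le_trans)
  qed
  \<comment> \<open>Continuity and the fixed origin keep u, and next its image, inside the box of
    radius \<rho>.\<close>
  obtain \<epsilon>1 where \<epsilon>1: "0 < \<epsilon>1" "\<And>s a. s < N \<Longrightarrow> a \<in> cbox0 (p + c) \<epsilon>1 \<Longrightarrow> \<bar>uf a s\<bar> < \<rho>"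
    using small[of uf, OF uf_Ck[OF zero] uf_dep uf_zero] by blast
  obtain \<epsilon>2 where \<epsilon>2: "0 < \<epsilon>2" "\<And>s a. s < N \<Longrightarrow> a \<in> cbox0 (p + c) \<epsilon>2 \<Longrightarrow> \<bar>Gf a s\<bar> < \<rho>"
    using small[of Gf, OF Gf_Ck[OF zero] Gf_dep Gf_zero] by blast
  define \<epsilon> where "\<epsilon> = min (min \<delta> \<rho>) (min \<epsilon>1 \<epsilon>2)"
  have \<epsilon>: "0 < \<epsilon>" "\<epsilon> \<le> \<delta>" "\<epsilon> \<le> \<rho>" "\<epsilon> \<le> \<epsilon>1" "\<epsilon> \<le> \<epsilon>2" using \<delta> \<rho> \<epsilon>1 \<epsilon>2 by (auto simp: \<epsilon>_def)
  have mono: "a \<in> cbox0 (p + c) e" if "a \<in> cbox0 (p + c) \<epsilon>" "\<epsilon> \<le> e" for a e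
    using that by (auto simp: cbox0_def intro: less_le_trans)
  have "Yf a l = wf (g2 a) l" if a: "a \<in> cbox0 (p + c) \<epsilon>" and l: "l < q" for a l
  proof -
    let ?\<alpha> = "vec p a" and ?x = "vec c (\<lambda>i. a (p + i))" and ?G = "vec N (Gf a)"
    have ax: "?\<alpha> @\<^sub>v ?x = vec (p + c) a" by (rule eq_vecI) auto
    have \<alpha>: "?\<alpha> \<in> box0 p \<rho>" using mono[OF a \<epsilon>(3)] by (simp add: box0_def cbox0_def)
    have u: "vec N (uf a) \<in> box0 N \<rho>" using \<epsilon>1(2)[OF _ mono[OF a \<epsilon>(4)]] by (simp add: box0_def)
    have G: "?G \<in> box0 N \<rho>" using \<epsilon>2(2)[OF _ mono[OF a \<epsilon>(5)]] by (simp add: box0_def)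
    have aD: "a \<in> cbox0 (p + c) \<delta>" by (rule mono[OF a \<epsilon>(2)])
    then have D: "?\<alpha> @\<^sub>v ?x \<in> box0 (p + c) \<delta>" unfolding ax by (simp add: box0_def cbox0_def)
    have "vec N (uf a) = \<Phi>c *\<^sub>v ?x + \<Phi>su *\<^sub>v w (?\<alpha> @\<^sub>v ?x)" unfolding ax by (rule u_vec[OF w_dim[OF aD], symmetric])
    with D have "(vec N (uf a), ?\<alpha>) \<in> W" unfolding W[OF sub(1)[OF \<alpha>] sub(1)[OF u]]
      by (intro bexI[of _ ?x]) auto
    from inv'[OF sub(2)[OF \<alpha>] sub(2)[OF u] this] have "(?G, ?\<alpha>) \<in> W" unfolding T_vec using sub(2)[OF G] by simp
    then obtain x where x: "x \<in> carrier_vec c" "?\<alpha> @\<^sub>v x \<in> box0 (p + c) \<delta>" "?G = \<Phi>c *\<^sub>v x + \<Phi>su *\<^sub>v w (?\<alpha> @\<^sub>v x)"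
      unfolding W[OF sub(1)[OF \<alpha>] sub(1)[OF G]] by blast
    define y where "y = w (?\<alpha> @\<^sub>v x)"
    have ax': "vec (p + c) (\<lambda>s. (?\<alpha> @\<^sub>v x) $ s) = ?\<alpha> @\<^sub>v x" using x(1) by (intro eq_vecI) auto
    have "(\<lambda>s. (?\<alpha> @\<^sub>v x) $ s) \<in> cbox0 (p + c) \<delta>" using x(2) by (simp add: box0_def cbox0_def)
    from w_dim[OF this] have y: "y \<in> carrier_vec q" unfolding ax' y_def by (rule carrier_vecI)
    have Px: "\<Phi>c *\<^sub>v x \<in> carrier_vec N" and Py: "\<Phi>su *\<^sub>v y \<in> carrier_vec N"
      by (rule mult_mat_vec_carrier[OF \<Phi>c x(1)], rule mult_mat_vec_carrier[OF \<Phi>su y])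
    have zm: "0\<^sub>m d q *\<^sub>v y = 0\<^sub>v d" "0\<^sub>m d c *\<^sub>v x = 0\<^sub>v d" for d
      using x(1) y by (auto intro!: eq_vecI simp: scalar_prod_def)
    have "\<Psi>c *\<^sub>v ?G = \<Psi>c *\<^sub>v (\<Phi>c *\<^sub>v x) + \<Psi>c *\<^sub>v (\<Phi>su *\<^sub>v y)"
      unfolding x(3) y_def[symmetric] by (rule mult_add_distrib_mat_vec[OF \<Psi>c Px Py])
    also have "\<dots> = x"
      using x(1) y by (simp add: assoc_mult_mat_vec[OF \<Psi>c \<Phi>c x(1), symmetric] assoc_mult_mat_vec[OF \<Psi>c \<Phi>su y, symmetric] cc cs zm)
    finally have xG: "\<Psi>c *\<^sub>v ?G = x" .
    have "\<Psi>su *\<^sub>v ?G = \<Psi>su *\<^sub>v (\<Phi>c *\<^sub>v x) + \<Psi>su *\<^sub>v (\<Phi>su *\<^sub>v y)"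
      unfolding x(3) y_def[symmetric] by (rule mult_add_distrib_mat_vec[OF \<Psi>su Px Py])
    also have "\<dots> = y"
      using x(1) y by (simp add: assoc_mult_mat_vec[OF \<Psi>su \<Phi>c x(1), symmetric] assoc_mult_mat_vec[OF \<Psi>su \<Phi>su y, symmetric] ss sc zm)
    finally have yG: "\<Psi>su *\<^sub>v ?G = y" .
    have "Rf a i = x $ i" if "i < c" for i
      using index_mult_mat_vec_sum[OF \<Psi>c, of ?G i] that by (simp add: xG Rf_def)
    then have "vec (p + c) (g2 a) = ?\<alpha> @\<^sub>v x"
      using x(1) by (intro eq_vecI) (auto simp: g2_def)
    then have "wf (g2 a) l = y $ l" by (simp add: wf_def y_def)
    moreover have "Yf a l = y $ l"
      using index_mult_mat_vec_sum[OF \<Psi>su, of ?G l] l by (simp add: yG Yf_def)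
    ultimately show ?thesis by simp
  qed
  with \<epsilon>(1) show ?thesis by blast
qed

text \<open>Makes N - c a true difference, so that N = c + q.\<close>

lemma cols_basis_dim_le:
  assumes "cols_basis N \<Phi> S" "\<Phi> \<in> carrier_mat N c"
  shows "c \<le> N"
proof -
  interpret vec_space "TYPE(real)" N .
  have sub: "set (cols \<Phi>) \<subseteq> carrier_vec N" using assms(2) cols_dim[of \<Phi>] by auto
  have li: "lin_indpt (set (cols \<Phi>))" using assms(1) by (simp add: cols_basis_def)
  have "card (set (cols \<Phi>)) \<le> dim" by (rule li_le_dim(2)[OF fin_dim sub[folded carrier_vs_is_self] li])
  moreover have "card (set (cols \<Phi>)) = c"
    using assms distinct_card[of "cols \<Phi>"] by (simp add: cols_basis_def)
  ultimately show ?thesis by (simp add: dim_is_n)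
qed

context coords
begin

text \<open>Supplies the three assumptions through which \<open>nf\<close> uses nonresonance, from
  annihilating lists for J and \<open>CQ\<close> with disjoint sets of products and
  eigenvalues.\<close>

lemma nonresonant_homological:
  assumes bc: "cols_basis N \<Phi>c (inv_subspace N C \<Lambda>)"
    and bs: "cols_basis N \<Phi>su (inv_subspace N C (spectrum (cmat C) - \<Lambda>))"
    and \<Lambda>: "finite \<Lambda>" "\<Lambda> \<subseteq> spectrum (cmat C)" and nr: "nonresonant C \<Lambda> p"
  shows "\<And>j h. 2 \<le> j \<Longrightarrow> h \<in> hom_polys (p + c) j q \<Longrightarrow> h \<in> M_im p J CQ j"
    and "\<And>j h. 2 \<le> j \<Longrightarrow> h \<in> hom_polys (p + c) j q \<Longrightarrow> M_op p J CQ h = 0\<^sub>v q \<Longrightarrow> h = 0\<^sub>v q"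
    and "\<And>h. h \<in> hom_polys p 1 q \<Longrightarrow> M_op p J CQ h = 0\<^sub>v q \<Longrightarrow> h = 0\<^sub>v q"
proof -
  let ?Y = "spectrum (cmat C) - \<Lambda>"
  define S where "S = \<Lambda> \<union> (if 0 < p then {1} else {})"
  have finY: "finite ?Y" using card_finite_spectrum(1)[of "cmat C" N] C by simp
  obtain xs where xs: "set xs \<subseteq> \<Lambda>" "\<And>b. (\<And>i. c \<le> i \<Longrightarrow> b i = 0) \<Longrightarrow> kills (mat_op c J) xs b"
    using restriction_annihilated[OF C \<Phi>c \<Psi>c J cc CJ bc \<Lambda>(1)] by blast
  obtain ys where ys: "set ys \<subseteq> ?Y" "\<And>b. (\<And>i. q \<le> i \<Longrightarrow> b i = 0) \<Longrightarrow> kills (mat_op q CQ) ys b"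
    using restriction_annihilated[OF C \<Phi>su \<Psi>su CQ ss CCQ bs finY] by blast
  have xsS: "set xs \<subseteq> S" and p1: "0 < p \<Longrightarrow> 1 \<in> S" using xs(1) by (auto simp: S_def)
  have hom: "homological c q J CQ (prods S j) ?Y ys" if "2 \<le> j" for j
    by (intro homological.intro J CQ ys nonresonant_prods[OF nr \<Lambda>(2,1) C that]) (simp_all add: S_def)
  have killed: "killed_by (comp_op p c J) (prods S j) (\<lambda>a. of_real (peval a (h $ i)))"
    if "h \<in> hom_polys (p + c) j q" "i < q" for h i j
    by (rule killed_by_poly[OF xsS xs(2) p1 hom_polysD(2,3)[OF that]])
  show "h \<in> M_im p J CQ j" if j: "2 \<le> j" and h: "h \<in> hom_polys (p + c) j q" for j h
  proof -
    have "\<exists>u\<in>hom_polys (p + c) j q. M_op p J CQ u = h"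
      by (rule homological.M_op_surj[OF hom[OF j] h killed[OF h]])
    then show ?thesis unfolding M_im_def using J CQ by auto
  qed
  show "h = 0\<^sub>v q" if j: "2 \<le> j" and h: "h \<in> hom_polys (p + c) j q" "M_op p J CQ h = 0\<^sub>v q" for j h
    by (rule homological.M_op_inj[OF hom[OF j] h killed[OF h(1)]])
  show "h = 0\<^sub>v q" if h: "h \<in> hom_polys p 1 q" "M_op p J CQ h = 0\<^sub>v q" for h
  \<comment> \<open>Without parameters there are no variables, and a linear form in them is
    zero.\<close>
  proof (cases "p = 0")
    case True
    show ?thesis
    proof (rule eq_vecI)
      fix i assume "i < dim_vec (0\<^sub>v q :: mpoly vec)"
      then have i: "i < q" by simp
      have "m \<notin> keys (h $ i)" for m
      proof
        assume m: "m \<in> keys (h $ i)"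
        with h(1) i True have "mon_degree m = 1 \<and> keys m \<subseteq> {..<0}" unfolding hom_polys_def by blast
        then show False by (auto simp: mon_degree_def)
      qed
      then have "keys (h $ i) = {}" by blast
      then show "h $ i = 0\<^sub>v q $ i" using i by simp
    qed (simp add: hom_polysD(1)[OF h(1)])
  next
    case False
    have "{1} \<inter> ?Y = {}"
    proof -
      \<comment> \<open>1 is a product of two parameter eigenvalues, so nonresonance at order 2
        excludes the eigenvalue 1 outside \<Lambda>.\<close>
      have "1 \<in> prods {1} 2" unfolding prods_def by (intro image_eqI[where x = "[1, 1]"]) auto
      with nonresonant_prods[OF nr \<Lambda>(2,1) C order_refl, of "{1}"] False show ?thesis by auto
    qed
    then have hom1: "homological c q J CQ {1} ?Y ys"
      by (intro homological.intro J CQ ys) simp_all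
    have k: "killed_by (comp_op p c J) {1} (\<lambda>a. of_real (peval a (h $ i)))" if i: "i < q" for i
    proof -
      \<comment> \<open>A form in the parameters alone is fixed by composition with J, so the single
        factor with number 1 annihilates it.\<close>
      have "peval (lin_pt p c J a) (h $ i) = peval a (h $ i)" for a
      proof (rule gsubst_cong)
        fix m v assume "m \<in> keys (h $ i)" "v \<in> keys m"
        with hom_polysD(3)[OF h(1) i] have "v < p" by (auto simp: in_vars_def)
        then show "lin_pt p c J a v = a v" by (simp add: lin_pt_def)
      qed
      then have "kills (comp_op p c J) [1] (\<lambda>a. of_real (peval a (h $ i)))"
        unfolding kills_single_iff by (simp add: comp_op_def)
      then show ?thesis unfolding killed_by_def by (intro exI[of _ "[1]"]) simp
    qed
    have "h \<in> hom_polys (p + c) 1 q" by (rule hom_polys_mono[OF h(1)]) simp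
    then show ?thesis by (rule homological.M_op_inj[OF hom1 _ h(2) k])
  qed
qed

end

theorem theorem2p3:
  fixes m n l N p c :: nat
    and C J CQ \<Phi>c \<Phi>su \<Psi>c \<Psi>su :: "real mat"
    and F :: "real vec \<Rightarrow> real vec \<Rightarrow> real vec"
    and \<Lambda> :: "complex set"
    and ImC1 KerC1 ImC2 KerC2 :: "nat \<Rightarrow> mpoly vec set"
  assumes "m > 0" and "n > 0" and "l > 0" and "N = (m + 1) * n * l"
    and "C \<in> carrier_mat N N"
    and "C_on (p + N) N (carrier_vec (p + N)) \<infinity> (joint p N F)"
    and "\<And>j. j < 2 \<Longrightarrow> diff_form (p + N) N (joint p N F) j = 0\<^sub>v N"
    and "finite \<Lambda>" and "\<Lambda> \<noteq> {}" and "\<Lambda> \<subseteq> spectrum (cmat C)"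
    and "c = (\<Sum>\<kappa>\<in>\<Lambda>. alg_mult C \<kappa>)"
    and "\<Phi>c \<in> carrier_mat N c" and "\<Phi>su \<in> carrier_mat N (N - c)"
    and "cols_basis N \<Phi>c (inv_subspace N C \<Lambda>)"
    and "cols_basis N \<Phi>su (inv_subspace N C (spectrum (cmat C) - \<Lambda>))"
    and "\<Psi>c \<in> carrier_mat c N" and "\<Psi>su \<in> carrier_mat (N - c) N"
    and "\<Psi>c * \<Phi>c = 1\<^sub>m c" and "\<Psi>su * \<Phi>su = 1\<^sub>m (N - c)"
    and "\<Psi>c * \<Phi>su = 0\<^sub>m c (N - c)" and "\<Psi>su * \<Phi>c = 0\<^sub>m (N - c) c"
    and "J \<in> carrier_mat c c" and "CQ \<in> carrier_mat (N - c) (N - c)"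
    and "C * \<Phi>c = \<Phi>c * J" and "C * \<Phi>su = \<Phi>su * CQ"
    and "nonresonant C \<Lambda> p"
    and "\<And>j. j \<ge> 2 \<Longrightarrow> is_complement (hom_polys (p + c) j c) (M_im p J J j) c (ImC1 j)"
    and "\<And>j. j \<ge> 2 \<Longrightarrow> is_complement (hom_polys (p + c) j c) (M_ker p J J j) c (KerC1 j)"
    and "\<And>j. j \<ge> 2 \<Longrightarrow>
           is_complement (hom_polys (p + c) j (N - c)) (M_im p J CQ j) (N - c) (ImC2 j)"
    and "\<And>j. j \<ge> 2 \<Longrightarrow>
           is_complement (hom_polys (p + c) j (N - c)) (M_ker p J CQ j) (N - c) (KerC2 j)"
  shows "
    let L = lin_part p c (N - c) J CQ;
        T = (\<lambda>u \<alpha>. C *\<^sub>v u + F u \<alpha>);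
        T' = map_series L (coord_terms p c N \<Phi>c \<Phi>su \<Psi>c \<Psi>su F)
    in \<exists>U fbar g P H.
      is_formal_map (p + c) c P \<and> P 1 = 0\<^sub>v c \<and>
      is_formal_map (p + c) (N - c) H \<and> H 1 = 0\<^sub>v (N - c) \<and>
      normal_form \<infinity> p c (N - c) J CQ ImC1 KerC1 ImC2 KerC2 T' U fbar g \<and>
      (\<forall>k. near_id p N (\<lambda>j. P j @\<^sub>v H j) k = nf_steps p N U k k) \<and>
      conjugated \<infinity> p (near_id p N (\<lambda>j. P j @\<^sub>v H j)) T' (map_series L g) \<and>
      (\<forall>j\<ge>2. vec_last (at_y0 p c (g j)) (N - c) = 0\<^sub>v (N - c)) \<and>
      (\<forall>r W w. 1 \<le> r \<and> tangent_manifold r N p c \<Phi>c \<Phi>su W w \<and> locally_invariant N p T W \<longrightarrow>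
         (let R = taylor (p + c) c (map_on_graph p c \<Phi>c \<Phi>su \<Psi>c T w);
              g1 = (\<lambda>j. vec_first (at_y0 p c (g j)) c)
          in graph_is_y0 r p c (taylor (p + c) (N - c) w) P H \<and>
             conjugated r p (near_id p c P) R (map_series (map_mat Const J *\<^sub>v x_vars p c) g1) \<and>
             (\<exists>U1 fbar1. normal_form r p c 0 J (0\<^sub>m 0 0) ImC1 KerC1 (\<lambda>_. {0\<^sub>v 0}) (\<lambda>_. {0\<^sub>v 0})
                R U1 fbar1 g1)))"
proof -
  define q where "q = N - c"
  have "c \<le> N" by (rule cols_basis_dim_le[OF assms(14,12)])
  then have N: "N = c + q" by (simp add: q_def)
  define L where "L = lin_part p c q J CQ"
  define T where "T = (\<lambda>u \<alpha>. C *\<^sub>v u + F u \<alpha>)"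
  define T' where "T' = map_series L (coord_terms p c N \<Phi>c \<Phi>su \<Psi>c \<Psi>su F)"
  note a = assms[folded q_def]
  interpret coords p c q N C J CQ \<Phi>c \<Phi>su \<Psi>c \<Psi>su
    by (rule coords.intro) (rule N a)+
  note hom = nonresonant_homological[OF a(14,15) a(8,10) a(26)]
  have T': "is_formal_map (p + N) N T'" unfolding T'_def L_def by (rule T'_formal)
  have T'1: "T' 1 = lin_part p c q J CQ" by (simp add: T'_def L_def map_series_def)
  interpret nf p c q N C J CQ \<Phi>c \<Phi>su \<Psi>c \<Psi>su T' ImC1 KerC1 ImC2 KerC2
    by unfold_locales (rule T' T'1 a hom; assumption)+
  \<comment> \<open>r, W and w are quantified inside the existential statement: U, g, P and H are
    fixed before any manifold is given, so the locales depending on the manifold are interpreted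
    within this block.\<close>
  have on_manifold: "let R = taylor (p + c) c (map_on_graph p c \<Phi>c \<Phi>su \<Psi>c T w);
              g1 = (\<lambda>j. vec_first (at_y0 p c (g j)) c)
          in graph_is_y0 r p c (taylor (p + c) q w) P H \<and>
             conjugated r p (near_id p c P) R (map_series (map_mat Const J *\<^sub>v x_vars p c) g1) \<and>
             (\<exists>U1 fbar1. normal_form r p c 0 J (0\<^sub>m 0 0) ImC1 KerC1 (\<lambda>_. {0\<^sub>v 0}) (\<lambda>_. {0\<^sub>v 0})
                R U1 fbar1 g1)"
    if r: "1 \<le> r" and tm: "tangent_manifold r N p c \<Phi>c \<Phi>su W w" and inv: "locally_invariant N p T W" for r W w
  proof -
    note tm' = tm[unfolded tangent_manifold_def, folded q_def]
    obtain \<delta> \<rho> where \<delta>: "0 < \<delta>" and w_C: "C_on (p + c) q (box0 (p + c) \<delta>) r w" and \<rho>: "0 < \<rho>"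
      and W: "\<forall>\<alpha>\<in>box0 p \<rho>. \<forall>u\<in>box0 N \<rho>. (u, \<alpha>) \<in> W \<longleftrightarrow>
          (\<exists>x\<in>carrier_vec c. \<alpha> @\<^sub>v x \<in> box0 (p + c) \<delta> \<and> u = \<Phi>c *\<^sub>v x + \<Phi>su *\<^sub>v w (\<alpha> @\<^sub>v x))"
      using conjunct2[OF conjunct2[OF tm']] by (elim exE conjE)
    have w0: "w (0\<^sub>v (p + c)) = 0\<^sub>v q" by (rule conjunct1[OF tm'])
    have w1: "pdiff (p + c) (p + i) (\<lambda>z. w z $ l) (0\<^sub>v (p + c)) = 0" if "l < q" "i < c" for l i
      using conjunct1[OF conjunct2[OF tm']] that by blast
    interpret gr: graph p c q N C J CQ \<Phi>c \<Phi>su \<Psi>c \<Psi>su F w \<delta> r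
    proof unfold_locales
      show "Ck (p + N) UNIV k (\<lambda>b. joint p N F (vec (p + N) b) $ i)" if "i < N" for k i
      proof -
        have "C_nat_on (p + N) (carrier_vec (p + N)) k (\<lambda>z. joint p N F z $ i)"
          using a(6) that by (simp add: C_on_def)
        from C_nat_on_Ck[OF this subset_refl] show ?thesis by simp
      qed
      show "joint p N F z \<in> carrier_vec N" if "z \<in> carrier_vec (p + N)" for z
        using a(6) that by (simp add: C_on_def)
      show "Ck (p + c) (cbox0 (p + c) \<delta>) k (\<lambda>a. w (vec (p + c) a) $ l)" if "enat k \<le> r" "l < q" for k l
      proof -
        have "C_nat_on (p + c) (box0 (p + c) \<delta>) k (\<lambda>z. w z $ l)" using w_C that by (simp add: C_on_def)
        from C_nat_on_Ck[OF this] show ?thesis by (simp add: box0_cbox0) (simp add: box0_def)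
      qed
    qed (rule a \<delta> r w0; assumption)+
    have w_dim: "dim_vec (w (vec (p + c) a)) = q" if "a \<in> cbox0 (p + c) \<delta>" for a
    proof -
      have "vec (p + c) a \<in> box0 (p + c) \<delta>" using that by (simp add: box0_def cbox0_def)
      then have "w (vec (p + c) a) \<in> carrier_vec q" using w_C by (simp add: C_on_def)
      then show ?thesis by (rule carrier_vecD)
    qed
    obtain \<epsilon> where \<epsilon>: "0 < \<epsilon>" "\<And>a l. a \<in> cbox0 (p + c) \<epsilon> \<Longrightarrow> l < q \<Longrightarrow> gr.Yf a l = gr.wf (gr.g2 a) l"
      using gr.invariance_on_box[where W = W, OF w_dim \<rho> bspec[OF bspec[OF W]] inv[unfolded T_def]] by blast
    note conj = gr.graph_invariance[OF w_dim \<epsilon>]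
    have R: "taylor (p + c) c (map_on_graph p c \<Phi>c \<Phi>su \<Psi>c T w) = gr.Rs" by (simp only: T_def)
    interpret nf_graph p c q N C J CQ \<Phi>c \<Phi>su \<Psi>c \<Psi>su T' ImC1 KerC1 ImC2 KerC2 gr.ws gr.Rs r
    proof unfold_locales
      show "is_formal_map (p + c) q gr.ws" by (rule gr.ws_formal)
      show "is_formal_map (p + c) c gr.Rs" by (rule gr.Rs_formal)
      show "1 \<le> r" by (rule r)
      show "gr.ws 1 \<in> hom_polys p 1 q" by (rule taylor_1_params[OF w1])
      show "agree_upto r (fcomp p T' (\<lambda>j. id_map p c j @\<^sub>v gr.ws j)) (fcomp p (\<lambda>j. id_map p c j @\<^sub>v gr.ws j) gr.Rs)"
        using conj unfolding gr.gw_def[abs_def] T'_def L_def .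
    qed
    show ?thesis
      unfolding R Let_def by (intro conjI graph_y0 reduced_conj reduced_normal_form)
  qed
  show ?thesis
    unfolding Let_def q_def[symmetric]
    unfolding L_def[symmetric] T'_def[symmetric] T_def[symmetric]
  proof (rule exI[of _ U], rule exI[of _ fbar], rule exI[of _ g], rule exI[of _ P], rule exI[of _ H], intro conjI allI impI)
    show "is_formal_map (p + c) c P" "is_formal_map (p + c) q H" by (rule P_formal, rule H_formal)
    show "P 1 = 0\<^sub>v c" "H 1 = 0\<^sub>v q" by (rule PH_low, simp)+
    show "normal_form \<infinity> p c q J CQ ImC1 KerC1 ImC2 KerC2 T' U fbar g" by (rule normal_form)
    show "near_id p N (\<lambda>j. P j @\<^sub>v H j) k = nf_steps p N U k k" for k by (rule Th_diag)
    show "conjugated \<infinity> p (near_id p N (\<lambda>j. P j @\<^sub>v H j)) T' (map_series L g)"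
      using Th_conj by (simp add: conjugated_def L_def)
    show "vec_last (at_y0 p c (g j)) q = 0\<^sub>v q" if "2 \<le> j" for j by (rule g2_y0[OF that])
  qed (use on_manifold[unfolded Let_def] in blast)+
qed

end
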